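(* Let $S$ be a compact surface and let $f:S\to S$ be a Morse-Smale diffeomorphism. Let $L(f)$ be the length of the longest path in the graph $G$ of periodic orbits of $f$ (defined in the context). Then the generalized entropy of $f$ satisfies $o(f)=[n^{L(f)}]$. In particular, the polynomial entropy satisfies $h_{pol}(f)=L(f)$.
   Context: Morse-Smale: a diffeomorphism $f$ is Morse-Smale if its non-wandering set $\Omega(f)$ is finite (hence consists of periodic points), all periodic points are hyperbolic, and every intersection between a stable manifold and an unstable manifold of periodic points is transverse. The graph $G$ and $L(f)$: write $\Omega(f)=\bigcup_{i=1}^k\theta(p_i)$, where $\theta(p_i)$ is the orbit of $p_i$ and distinct indices give distinct orbits. $G=(V,E)$ is the directed graph with vertices $V=\{\theta(p_1),\dots,\theta(p_k)\}$ and edges $E=\{(\theta(p_i),\theta(p_j)): i\ne j,\ W^u(\theta(p_i))\cap W^s(\theta(p_j))\neq\emptyset\}$. This graph has no cycles; $L(f)$ is the maximal number of edges of a directed path in $G$. Orders of growth: $\mathbb N=\{1,2,\dots\}$ and $\mathcal O$ is the set of non-decreasing sequences $a:\mathbb N\to[0,\infty)$. Write $a\approx b$ if there are $c_1,c_2\in(0,\infty)$ with $c_1a(n)\le b(n)\le c_2a(n)$ for all $n$; $\mathbb O=\mathcal O/_{\approx}$, and $[a(n)]$ is the class of $a$. Partial order: $[a(n)]\le[b(n)]$ if there is $C>0$ with $a(n)\le Cb(n)$ for all $n$. $\overline{\mathbb O}\supset\mathbb O$ is the Dedekind-MacNeille completion of $\mathbb O$. Generalized and polynomial entropy: for a continuous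 map $f$ of a compact metric space $(M,d)$, let $d^f_n(x,y)=\max_{0\le k\le n-1}d(f^k(x),f^k(y))$, $B(x,n,\varepsilon)=\{y: d^f_n(x,y)<\varepsilon\}$, and let $g_{f,\varepsilon}(n)$ be the minimal cardinality of a finite set $F\subset M$ with $M=\bigcup_{x\in F}B(x,n,\varepsilon)$. Then $o(f)=\sup\{[g_{f,\varepsilon}(n)]:\varepsilon>0\}\in\overline{\mathbb O}$ and $h_{pol}(f)=\lim_{\varepsilon\to0}\limsup_{n\to\infty}\frac{\log g_{f,\varepsilon}(n)}{\log n}$. *)

theory Defs
  imports "HOL-Analysis.Analysis" "Graph_Theory.Arc_Walk"
begin

section \<open>Surfaces and diffeomorphisms of class \<open>C\<^sup>1\<close>\<close>

definition C1_on :: "('a::real_normed_vector \<Rightarrow> 'b::real_normed_vector) \<Rightarrow> 'a set \<Rightarrow> bool" where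
  "C1_on g U \<longleftrightarrow> (\<exists>g' :: 'a \<Rightarrow> 'a \<Rightarrow>\<^sub>L 'b.
     (\<forall>x\<in>U. (g has_derivative blinfun_apply (g' x)) (at x)) \<and> continuous_on U g')"

text \<open>A chart is a pair of its domain and its coordinate map; the values of the coordinate map
  outside the domain are irrelevant.\<close>

type_synonym 'a chart = "'a set \<times> ('a \<Rightarrow> real^2)"

definition chart_on :: "'a::metric_space set \<Rightarrow> 'a chart \<Rightarrow> bool" where
  "chart_on S = (\<lambda>(U, \<phi>). openin (top_of_set S) U \<and> open (\<phi> ` U) \<and>
     homeomorphism U (\<phi> ` U) \<phi> (inv_into U \<phi>))"

definition local_rep :: "'a chart \<Rightarrow> 'a chart \<Rightarrow> ('a \<Rightarrow> 'a) \<Rightarrow> real^2 \<Rightarrow> real^2" where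
  "local_rep = (\<lambda>(U, \<phi>) (V, \<psi>) f. \<psi> \<circ> f \<circ> inv_into U \<phi>)"

text \<open>The domain of \<^term>\<open>local_rep (U, \<phi>) (V, \<psi>) f\<close> is
  \<^term>\<open>\<phi> ` (U \<inter> f -` V)\<close>; with \<^term>\<open>f = id\<close> it is a transition map.\<close>

definition C1_map :: "'a::metric_space set \<Rightarrow> 'a chart set \<Rightarrow> ('a \<Rightarrow> 'a) \<Rightarrow> bool" where
  "C1_map S A f \<longleftrightarrow> f ` S \<subseteq> S \<and> continuous_on S f \<and>
     (\<forall>(U, \<phi>)\<in>A. \<forall>(V, \<psi>)\<in>A. C1_on (local_rep (U, \<phi>) (V, \<psi>) f) (\<phi> ` (U \<inter> f -` V)))"

text \<open>Charts have open images in the plane, so the surface has no boundary.  The metric is an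
  arbitrary one inducing the topology.\<close>

definition compact_surface :: "'a::metric_space set \<Rightarrow> 'a chart set \<Rightarrow> bool" where
  "compact_surface S A \<longleftrightarrow> S \<noteq> {} \<and> compact S \<and>
     (\<forall>c\<in>A. chart_on S c) \<and> (\<Union>(U, \<phi>)\<in>A. U) = S \<and> C1_map S A id"

definition diffeo :: "'a::metric_space set \<Rightarrow> 'a chart set \<Rightarrow> ('a \<Rightarrow> 'a) \<Rightarrow> bool" where
  "diffeo S A f \<longleftrightarrow> bij_betw f S S \<and> C1_map S A f \<and> C1_map S A (inv_into S f)"


section \<open>Morse--Smale diffeomorphisms\<close>

definition nonwandering :: "'a::metric_space set \<Rightarrow> ('a \<Rightarrow> 'a) \<Rightarrow> 'a set" where
  "nonwandering S f = {x\<in>S. \<forall>U. openin (top_of_set S) U \<and> x \<in> U \<longrightarrow>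
     (\<exists>n\<ge>1. (f ^^ n) ` U \<inter> U \<noteq> {})}"

definition periodic_points :: "'a set \<Rightarrow> ('a \<Rightarrow> 'a) \<Rightarrow> 'a set" where
  "periodic_points S f = {p\<in>S. \<exists>n\<ge>1. (f ^^ n) p = p}"

definition period :: "('a \<Rightarrow> 'a) \<Rightarrow> 'a \<Rightarrow> nat" where
  "period f p = (LEAST n. n \<ge> 1 \<and> (f ^^ n) p = p)"

definition complex_eigenvalue :: "real^'n^'n \<Rightarrow> complex \<Rightarrow> bool" where
  "complex_eigenvalue M \<mu> \<longleftrightarrow> (\<exists>v. v \<noteq> 0 \<and> map_matrix complex_of_real M *v v = \<mu> *s v)"

definition hyperbolic :: "'a chart set \<Rightarrow> ('a \<Rightarrow> 'a) \<Rightarrow> 'a \<Rightarrow> bool" where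
  "hyperbolic A f p \<longleftrightarrow> (\<forall>(U, \<phi>)\<in>A. p \<in> U \<longrightarrow>
     (\<forall>\<mu>. complex_eigenvalue
             (jacobian (local_rep (U, \<phi>) (U, \<phi>) (f ^^ period f p)) (at (\<phi> p))) \<mu> \<longrightarrow>
           cmod \<mu> \<noteq> 1))"

definition stable_set :: "'a::metric_space set \<Rightarrow> ('a \<Rightarrow> 'a) \<Rightarrow> 'a \<Rightarrow> 'a set" where
  "stable_set S f p = {x\<in>S. (\<lambda>n. dist ((f ^^ n) x) ((f ^^ n) p)) \<longlonglongrightarrow> 0}"

definition unstable_set :: "'a::metric_space set \<Rightarrow> ('a \<Rightarrow> 'a) \<Rightarrow> 'a \<Rightarrow> 'a set" where
  "unstable_set S f p = stable_set S (inv_into S f) p"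

definition local_stable_set ::
    "'a::metric_space set \<Rightarrow> ('a \<Rightarrow> 'a) \<Rightarrow> real \<Rightarrow> 'a \<Rightarrow> 'a set" where
  "local_stable_set S f \<epsilon> p = {x\<in>S. \<forall>n. dist ((f ^^ n) x) ((f ^^ n) p) \<le> \<epsilon>}"

text \<open>
  For a hyperbolic periodic point \<open>p\<close> and small \<open>\<epsilon>\<close>, the local stable sets are embedded discs and
  the stable manifold of \<open>p\<close> is the increasing union over \<open>N\<close> of the preimages under \<open>f\<^sup>N\<close> of the
  local stable sets of \<open>f\<^sup>N p\<close>.  This is what makes it an injectively immersed submanifold: its
  intrinsic topology may be finer than the subspace topology.  A tangent vector at \<open>x\<close>, written in
  the chart \<open>(U, \<phi>)\<close>, is the velocity of a curve through \<open>x\<close> in the stable manifold that is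
  continuous in the intrinsic topology, i.e. that stays in one of these discs near time 0.
  With merely \<open>c t \<in> stable_set S f p\<close> this would go wrong along homoclinic curves that return
  to \<open>p\<close>.
\<close>

definition stable_tangent_space ::
    "'a::metric_space set \<Rightarrow> ('a \<Rightarrow> 'a) \<Rightarrow> 'a chart \<Rightarrow> 'a \<Rightarrow> 'a \<Rightarrow> (real^2) set" where
  "stable_tangent_space S f = (\<lambda>(U, \<phi>) p x. {v. \<exists>c :: real \<Rightarrow> 'a.
     c 0 = x \<and> (\<forall>t. c t \<in> U \<inter> stable_set S f p) \<and>
     ((\<phi> \<circ> c) has_vector_derivative v) (at 0) \<and>
     (\<forall>\<epsilon>>0. \<exists>N. \<forall>\<^sub>F t in nhds 0. (f ^^ N) (c t) \<in> local_stable_set S f \<epsilon> ((f ^^ N) p))})"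

definition transverse_at ::
    "'a::metric_space set \<Rightarrow> 'a chart set \<Rightarrow> ('a \<Rightarrow> 'a) \<Rightarrow> 'a \<Rightarrow> 'a \<Rightarrow> 'a \<Rightarrow> bool" where
  "transverse_at S A f p q x \<longleftrightarrow> (\<forall>(U, \<phi>)\<in>A. x \<in> U \<longrightarrow>
     {v + w | v w. v \<in> stable_tangent_space S f (U, \<phi>) p x \<and>
                   w \<in> stable_tangent_space S (inv_into S f) (U, \<phi>) q x} = UNIV)"

definition morse_smale :: "'a::metric_space set \<Rightarrow> 'a chart set \<Rightarrow> ('a \<Rightarrow> 'a) \<Rightarrow> bool" where
  "morse_smale S A f \<longleftrightarrow> diffeo S A f \<and> finite (nonwandering S f) \<and>
     (\<forall>p\<in>periodic_points S f. hyperbolic A f p) \<and>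
     (\<forall>p\<in>periodic_points S f. \<forall>q\<in>periodic_points S f.
        \<forall>x\<in>stable_set S f p \<inter> unstable_set S f q. transverse_at S A f p q x)"


section \<open>The graph of periodic orbits\<close>

definition orbit_of :: "('a \<Rightarrow> 'a) \<Rightarrow> 'a \<Rightarrow> 'a set" where
  "orbit_of f p = range (\<lambda>n. (f ^^ n) p)"

definition orbit_graph ::
    "'a::metric_space set \<Rightarrow> ('a \<Rightarrow> 'a) \<Rightarrow> ('a set, 'a set \<times> 'a set) pre_digraph" where
  "orbit_graph S f =
     (let V = orbit_of f ` nonwandering S f in
      \<lparr>verts = V,
       arcs = {(\<theta>, \<eta>). \<theta> \<in> V \<and> \<eta> \<in> V \<and> \<theta> \<noteq> \<eta> \<and>
                 (\<Union>p\<in>\<theta>. unstable_set S f p) \<inter> (\<Union>q\<in>\<eta>. stable_set S f q) \<noteq> {}},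
       tail = fst, head = snd\<rparr>)"

definition longest_path :: "'a::metric_space set \<Rightarrow> ('a \<Rightarrow> 'a) \<Rightarrow> nat" where
  "longest_path S f = Max {length \<pi> | \<pi> \<theta> \<eta>. pre_digraph.apath (orbit_graph S f) \<theta> \<pi> \<eta>}"


section \<open>Orders of growth\<close>

text \<open>Sequences are indexed by \<open>{1, 2, \<dots>}\<close>; the value at 0 is ignored everywhere.\<close>

definition growth_seqs :: "(nat \<Rightarrow> real) set" where
  "growth_seqs = {a. mono_on {1..} a \<and> (\<forall>n\<ge>1. 0 \<le> a n)}"

definition growth_equiv :: "(nat \<Rightarrow> real) \<Rightarrow> (nat \<Rightarrow> real) \<Rightarrow> bool" where
  "growth_equiv a b \<longleftrightarrow> a \<in> growth_seqs \<and> b \<in> growth_seqs \<and>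
     (\<exists>c\<^sub>1>0. \<exists>c\<^sub>2>0. \<forall>n\<ge>1. c\<^sub>1 * a n \<le> b n \<and> b n \<le> c\<^sub>2 * a n)"

definition growth_le :: "(nat \<Rightarrow> real) \<Rightarrow> (nat \<Rightarrow> real) \<Rightarrow> bool" where
  "growth_le a b \<longleftrightarrow> (\<exists>C>0. \<forall>n\<ge>1. a n \<le> C * b n)"

lemma growth_equiv_iff:
  "growth_equiv a b \<longleftrightarrow>
     a \<in> growth_seqs \<and> b \<in> growth_seqs \<and> growth_le a b \<and> growth_le b a"
proof -
  have "growth_le a b" if "c > 0" "\<forall>n\<ge>1. c * a n \<le> b n" for c
    unfolding growth_le_def using that
    by (intro exI[of _ "1 / c"]) (auto simp: field_simps)
  moreover have "\<exists>c>0. \<forall>n\<ge>1. c * a n \<le> b n" if "growth_le a b"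
  proof -
    from that obtain C where "C > 0" "\<forall>n\<ge>1. a n \<le> C * b n" by (auto simp: growth_le_def)
    then show ?thesis by (intro exI[of _ "1 / C"]) (auto simp: field_simps)
  qed
  ultimately show ?thesis
    unfolding growth_equiv_def growth_le_def[of b a] by meson
qed

lemma growth_le_refl: "growth_le a a"
  unfolding growth_le_def by (intro exI[of _ 1]) auto

lemma growth_le_trans:
  assumes "growth_le a b" "growth_le b c"
  shows "growth_le a c"
proof -
  obtain C D where CD: "C > 0" "D > 0" "\<forall>n\<ge>1. a n \<le> C * b n" "\<forall>n\<ge>1. b n \<le> D * c n"
    using assms by (auto simp: growth_le_def)
  have "a n \<le> (C * D) * c n" if "n \<ge> 1" for n
  proof -
    have "a n \<le> C * b n" using CD that by auto
    also have "\<dots> \<le> C * (D * c n)" using CD that by (intro mult_left_mono) auto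
    finally show ?thesis by (simp add: mult.assoc)
  qed
  then show ?thesis unfolding growth_le_def using CD by (intro exI[of _ "C * D"]) auto
qed

lemma zero_in_growth_seqs: "(\<lambda>_. 0) \<in> growth_seqs"
  by (auto simp: growth_seqs_def mono_on_def)

quotient_type growth = "nat \<Rightarrow> real" / partial: growth_equiv
  morphisms rep_growth growth_class
proof (rule part_equivpI)
  show "\<exists>x. growth_equiv x x"
    using zero_in_growth_seqs growth_le_refl growth_equiv_iff by blast
  show "symp growth_equiv"
    by (auto simp: symp_def growth_equiv_iff)
  show "transp growth_equiv"
    by (auto simp: transp_def growth_equiv_iff intro: growth_le_trans)
qed

lemma growth_class_eq_iff:
  assumes "a \<in> growth_seqs" "b \<in> growth_seqs"
  shows "growth_class a = growth_class b \<longleftrightarrow> growth_equiv a b"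
  using assms Quotient_rel[OF Quotient_growth, of a b]
  by (auto simp: growth_equiv_iff growth_le_refl)

instantiation growth :: order
begin

lift_definition less_eq_growth :: "growth \<Rightarrow> growth \<Rightarrow> bool" is growth_le
  by (auto simp: growth_equiv_iff intro: growth_le_trans)

definition less_growth :: "growth \<Rightarrow> growth \<Rightarrow> bool" where
  "less_growth x y \<longleftrightarrow> x \<le> y \<and> \<not> y \<le> x"

instance
proof
  fix x y z :: growth
  show "x < y \<longleftrightarrow> x \<le> y \<and> \<not> y \<le> x" by (rule less_growth_def)
  show "x \<le> x" by transfer (rule growth_le_refl)
  show "x \<le> y \<Longrightarrow> y \<le> z \<Longrightarrow> x \<le> z" by transfer (rule growth_le_trans)
  show "x \<le> y \<Longrightarrow> y \<le> x \<Longrightarrow> x = y" by transfer (auto simp: growth_equiv_iff)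
qed

end


section \<open>The Dedekind--MacNeille completion\<close>

definition upper_bounds :: "'a::order set \<Rightarrow> 'a set" where
  "upper_bounds A = {y. \<forall>x\<in>A. x \<le> y}"

definition lower_bounds :: "'a::order set \<Rightarrow> 'a set" where
  "lower_bounds A = {x. \<forall>y\<in>A. x \<le> y}"

lemma bounds_galois: "A \<subseteq> lower_bounds B \<longleftrightarrow> B \<subseteq> upper_bounds A"
  by (auto simp: lower_bounds_def upper_bounds_def)

lemma lower_upper_lower [simp]: "lower_bounds (upper_bounds (lower_bounds A)) = lower_bounds A"
  by (auto simp: lower_bounds_def upper_bounds_def)

lemma lower_upper_atMost [simp]: "lower_bounds (upper_bounds {..a}) = {..a}"
  by (auto simp: lower_bounds_def upper_bounds_def)

typedef (overloaded) 'a dm_completion = "{A :: 'a::order set. lower_bounds (upper_bounds A) = A}"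
  by (rule exI[of _ "lower_bounds {}"]) simp

setup_lifting type_definition_dm_completion

lift_definition dm_embed :: "'a::order \<Rightarrow> 'a dm_completion" is atMost
  by simp

lemma lower_upper_Inter:
  assumes "\<And>A. A \<in> \<A> \<Longrightarrow> lower_bounds (upper_bounds A) = A"
  shows "lower_bounds (upper_bounds (\<Inter>\<A>)) = \<Inter>\<A>"
proof
  show "lower_bounds (upper_bounds (\<Inter>\<A>)) \<subseteq> \<Inter>\<A>"
  proof (rule Inter_greatest)
    fix A assume A: "A \<in> \<A>"
    then have "lower_bounds (upper_bounds (\<Inter>\<A>)) \<subseteq> lower_bounds (upper_bounds A)"
      by (auto simp: lower_bounds_def upper_bounds_def)
    with assms[OF A] show "lower_bounds (upper_bounds (\<Inter>\<A>)) \<subseteq> A" by simp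
  qed
qed (auto simp: lower_bounds_def upper_bounds_def)

instantiation dm_completion :: (order) complete_lattice
begin

lift_definition less_eq_dm_completion :: "'a dm_completion \<Rightarrow> 'a dm_completion \<Rightarrow> bool" is "(\<subseteq>)" .

definition less_dm_completion :: "'a dm_completion \<Rightarrow> 'a dm_completion \<Rightarrow> bool" where
  "less_dm_completion X Y \<longleftrightarrow> X \<le> Y \<and> \<not> Y \<le> X"

lift_definition Inf_dm_completion :: "'a dm_completion set \<Rightarrow> 'a dm_completion" is Inter
  by (rule lower_upper_Inter) auto

lift_definition Sup_dm_completion :: "'a dm_completion set \<Rightarrow> 'a dm_completion"
  is "\<lambda>\<A>. lower_bounds (upper_bounds (\<Union>\<A>))"
  by simp

definition inf_dm_completion :: "'a dm_completion \<Rightarrow> 'a dm_completion \<Rightarrow> 'a dm_completion" where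
  "inf_dm_completion X Y = Inf {X, Y}"

definition sup_dm_completion :: "'a dm_completion \<Rightarrow> 'a dm_completion \<Rightarrow> 'a dm_completion" where
  "sup_dm_completion X Y = Sup {X, Y}"

definition top_dm_completion :: "'a dm_completion" where
  "top_dm_completion = Inf {}"

definition bot_dm_completion :: "'a dm_completion" where
  "bot_dm_completion = Sup {}"

instance
proof -
  have Inf_lower: "Inf \<X> \<le> X" if "X \<in> \<X>" for X :: "'a dm_completion" and \<X>
    using that by transfer auto
  have Inf_greatest: "Z \<le> Inf \<X>" if "\<And>X. X \<in> \<X> \<Longrightarrow> Z \<le> X" for Z :: "'a dm_completion" and \<X>
    using that by transfer blast
  have Sup_upper: "X \<le> Sup \<X>" if "X \<in> \<X>" for X :: "'a dm_completion" and \<X>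
    using that by transfer (auto simp: lower_bounds_def upper_bounds_def)
  have Sup_least: "Sup \<X> \<le> Z" if "\<And>X. X \<in> \<X> \<Longrightarrow> X \<le> Z" for Z :: "'a dm_completion" and \<X>
    using that
  proof transfer
    fix \<X> and Z :: "'a set"
    assume "\<forall>X\<in>\<X>. lower_bounds (upper_bounds X) = X"
      and Z: "lower_bounds (upper_bounds Z) = Z"
      and "\<And>X. lower_bounds (upper_bounds X) = X \<Longrightarrow> X \<in> \<X> \<Longrightarrow> X \<subseteq> Z"
    then have le: "\<And>X. X \<in> \<X> \<Longrightarrow> X \<subseteq> Z" by blast
    have "lower_bounds (upper_bounds (\<Union>\<X>)) \<subseteq> lower_bounds (upper_bounds Z)"
      using le by (fastforce simp: lower_bounds_def upper_bounds_def)
    then show "lower_bounds (upper_bounds (\<Union>\<X>)) \<subseteq> Z" using Z by simp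
  qed
  show "OFCLASS('a dm_completion, complete_lattice_class)"
  proof
    fix X Y Z :: "'a dm_completion" and \<X> :: "'a dm_completion set"
    show "X < Y \<longleftrightarrow> X \<le> Y \<and> \<not> Y \<le> X" by (rule less_dm_completion_def)
    show "X \<le> X" by transfer auto
    show "X \<le> Y \<Longrightarrow> Y \<le> Z \<Longrightarrow> X \<le> Z" by transfer auto
    show "X \<le> Y \<Longrightarrow> Y \<le> X \<Longrightarrow> X = Y" by transfer auto
    show "inf X Y \<le> X" "inf X Y \<le> Y"
      unfolding inf_dm_completion_def by (auto intro: Inf_lower)
    show "X \<le> Y \<Longrightarrow> X \<le> Z \<Longrightarrow> X \<le> inf Y Z"
      unfolding inf_dm_completion_def by (auto intro: Inf_greatest)
    show "X \<le> sup X Y" "Y \<le> sup X Y"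
      unfolding sup_dm_completion_def by (auto intro: Sup_upper)
    show "Y \<le> X \<Longrightarrow> Z \<le> X \<Longrightarrow> sup Y Z \<le> X"
      unfolding sup_dm_completion_def by (auto intro: Sup_least)
    show "X \<in> \<X> \<Longrightarrow> Inf \<X> \<le> X" by (rule Inf_lower)
    show "(\<And>X. X \<in> \<X> \<Longrightarrow> Z \<le> X) \<Longrightarrow> Z \<le> Inf \<X>" by (rule Inf_greatest)
    show "X \<in> \<X> \<Longrightarrow> X \<le> Sup \<X>" by (rule Sup_upper)
    show "(\<And>X. X \<in> \<X> \<Longrightarrow> X \<le> Z) \<Longrightarrow> Sup \<X> \<le> Z" by (rule Sup_least)
    show "Inf {} = (top :: 'a dm_completion)" by (simp add: top_dm_completion_def)
    show "Sup {} = (bot :: 'a dm_completion)" by (simp add: bot_dm_completion_def)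
  qed
qed

end

lemma dm_embed_le_iff: "dm_embed a \<le> dm_embed b \<longleftrightarrow> a \<le> b"
  by transfer auto

text \<open>Density in both directions, which characterises the completion up to isomorphism.\<close>

lemma dm_embed_Sup_dense: "X = Sup (dm_embed ` {a. dm_embed a \<le> X})"
proof transfer
  fix X :: "'a set" assume X: "lower_bounds (upper_bounds X) = X"
  have "\<Union> (atMost ` {a. {..a} \<subseteq> X}) = X"
  proof
    show "X \<subseteq> \<Union> (atMost ` {a. {..a} \<subseteq> X})"
    proof
      fix x assume "x \<in> X"
      then have "x \<in> lower_bounds (upper_bounds X)" using X by simp
      then have "{..x} \<subseteq> lower_bounds (upper_bounds X)"
        by (auto simp: lower_bounds_def intro: order_trans)
      then show "x \<in> \<Union> (atMost ` {a. {..a} \<subseteq> X})" using X by auto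
    qed
  qed auto
  then show "X = lower_bounds (upper_bounds (\<Union> (atMost ` {a. {..a} \<subseteq> X})))" using X by simp
qed

lemma dm_embed_Inf_dense: "X = Inf (dm_embed ` {a. X \<le> dm_embed a})"
proof transfer
  fix X :: "'a set" assume X: "lower_bounds (upper_bounds X) = X"
  have "\<Inter> (atMost ` {a. X \<subseteq> {..a}}) = lower_bounds (upper_bounds X)"
    by (auto simp: lower_bounds_def upper_bounds_def)
  then show "X = \<Inter> (atMost ` {a. X \<subseteq> {..a}})" using X by simp
qed


section \<open>Generalized and polynomial entropy\<close>

definition dyn_dist :: "('a::metric_space \<Rightarrow> 'a) \<Rightarrow> nat \<Rightarrow> 'a \<Rightarrow> 'a \<Rightarrow> real" where
  "dyn_dist f n x y = Max ((\<lambda>k. dist ((f ^^ k) x) ((f ^^ k) y)) ` {..<n})"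

definition dyn_ball :: "'a::metric_space set \<Rightarrow> ('a \<Rightarrow> 'a) \<Rightarrow> 'a \<Rightarrow> nat \<Rightarrow> real \<Rightarrow> 'a set" where
  "dyn_ball M f x n \<epsilon> = {y\<in>M. dyn_dist f n x y < \<epsilon>}"

definition cover_number :: "'a::metric_space set \<Rightarrow> ('a \<Rightarrow> 'a) \<Rightarrow> real \<Rightarrow> nat \<Rightarrow> nat" where
  "cover_number M f \<epsilon> n =
     (LEAST k. \<exists>F. F \<subseteq> M \<and> finite F \<and> card F = k \<and> M = (\<Union>x\<in>F. dyn_ball M f x n \<epsilon>))"

lemma dyn_ball_eq:
  assumes "n \<ge> 1"
  shows "dyn_ball M f x n \<epsilon> = {y\<in>M. \<forall>k<n. dist ((f ^^ k) x) ((f ^^ k) y) < \<epsilon>}"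
  using assms by (auto simp: dyn_ball_def dyn_dist_def lessThan_empty_iff)

text \<open>The covering numbers are attained by a finite cover and form a non-decreasing sequence.\<close>

context
  fixes M :: "'a::metric_space set" and f :: "'a \<Rightarrow> 'a"
  assumes M: "compact M" and f: "continuous_on M f" "f ` M \<subseteq> M"
begin

lemma funpow_continuous_on: "continuous_on M (f ^^ k) \<and> (f ^^ k) ` M \<subseteq> M"
proof (induction k)
  case (Suc k)
  have "continuous_on M (f \<circ> (f ^^ k))"
    using Suc f by (intro continuous_on_compose) (auto intro: continuous_on_subset)
  with Suc f show ?case by (auto simp: image_subset_iff)
qed auto

lemma openin_dyn_ball:
  assumes "n \<ge> 1"
  shows "openin (top_of_set M) (dyn_ball M f x n \<epsilon>)"
proof -
  have "openin (top_of_set M) (M \<inter> (f ^^ k) -` ball ((f ^^ k) x) \<epsilon>)" for k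
    using funpow_continuous_on by (intro continuous_openin_preimage_gen) auto
  then have "openin (top_of_set M) (\<Inter>k\<in>{..<n}. M \<inter> (f ^^ k) -` ball ((f ^^ k) x) \<epsilon>)"
    using assms by (intro openin_Inter) (auto simp: lessThan_empty_iff)
  moreover have "dyn_ball M f x n \<epsilon> = (\<Inter>k\<in>{..<n}. M \<inter> (f ^^ k) -` ball ((f ^^ k) x) \<epsilon>)"
  proof -
    have "0 \<in> {..<n}" using assms by auto
    then show ?thesis using assms by (simp add: dyn_ball_eq set_eq_iff) blast
  qed
  ultimately show ?thesis by simp
qed

lemma cover_number_attained:
  assumes "n \<ge> 1" "\<epsilon> > 0"
  shows "\<exists>F. F \<subseteq> M \<and> finite F \<and> card F = cover_number M f \<epsilon> n \<and>
    M = (\<Union>x\<in>F. dyn_ball M f x n \<epsilon>)"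
proof -
  have "\<forall>c\<in>(\<lambda>x. dyn_ball M f x n \<epsilon>) ` M. openin (top_of_set M) c"
    using openin_dyn_ball[OF assms(1)] by blast
  moreover have "M \<subseteq> \<Union>((\<lambda>x. dyn_ball M f x n \<epsilon>) ` M)"
    using assms by (auto simp: dyn_ball_eq)
  ultimately obtain \<D> where \<D>: "\<D> \<subseteq> (\<lambda>x. dyn_ball M f x n \<epsilon>) ` M" "finite \<D>" "M \<subseteq> \<Union>\<D>"
    using M unfolding compact_eq_openin_cover by meson
  then obtain F where F: "F \<subseteq> M" "finite F" "\<D> = (\<lambda>x. dyn_ball M f x n \<epsilon>) ` F"
    by (meson finite_subset_image)
  then have "M = (\<Union>x\<in>F. dyn_ball M f x n \<epsilon>)"
    using \<D> by (auto simp: dyn_ball_def)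
  then have "\<exists>k F. F \<subseteq> M \<and> finite F \<and> card F = k \<and> M = (\<Union>x\<in>F. dyn_ball M f x n \<epsilon>)"
    using F by blast
  then show ?thesis unfolding cover_number_def by (rule LeastI_ex)
qed

lemma cover_number_mono:
  assumes "1 \<le> m" "m \<le> n" "0 < \<epsilon>" "\<epsilon> \<le> \<delta>"
  shows "cover_number M f \<delta> m \<le> cover_number M f \<epsilon> n"
proof -
  obtain F where F: "F \<subseteq> M" "finite F" "card F = cover_number M f \<epsilon> n"
      "M = (\<Union>x\<in>F. dyn_ball M f x n \<epsilon>)"
    using cover_number_attained[of n \<epsilon>] assms by auto
  have "dyn_ball M f x n \<epsilon> \<subseteq> dyn_ball M f x m \<delta>" for x
  proof
    fix y assume y: "y \<in> dyn_ball M f x n \<epsilon>"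
    have "dist ((f ^^ k) x) ((f ^^ k) y) < \<delta>" if "k < m" for k
    proof -
      have "dist ((f ^^ k) x) ((f ^^ k) y) < \<epsilon>"
        using y that assms by (auto simp: dyn_ball_eq)
      then show ?thesis using assms by linarith
    qed
    then show "y \<in> dyn_ball M f x m \<delta>"
      using y assms by (auto simp: dyn_ball_eq)
  qed
  then have "M = (\<Union>x\<in>F. dyn_ball M f x m \<delta>)"
    using F(4) by (fastforce simp: dyn_ball_def)
  with F show ?thesis
    unfolding cover_number_def[of _ _ \<delta>] by (intro Least_le) auto
qed

lemma cover_number_in_growth_seqs:
  assumes "\<epsilon> > 0"
  shows "(\<lambda>n. real (cover_number M f \<epsilon> n)) \<in> growth_seqs"
  using assms cover_number_mono by (auto simp: growth_seqs_def mono_on_def)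

end

definition gen_entropy :: "'a::metric_space set \<Rightarrow> ('a \<Rightarrow> 'a) \<Rightarrow> growth dm_completion" where
  "gen_entropy M f =
     (SUP \<epsilon>\<in>{0<..}. dm_embed (growth_class (\<lambda>n. real (cover_number M f \<epsilon> n))))"

definition pol_entropy :: "'a::metric_space set \<Rightarrow> ('a \<Rightarrow> 'a) \<Rightarrow> ereal" where
  "pol_entropy M f =
     Lim (at_right 0) (\<lambda>\<epsilon>. limsup (\<lambda>n. ereal (ln (real (cover_number M f \<epsilon> n)) / ln (real n))))"

text \<open>The limit exists because the upper limit is antitone in \<open>\<epsilon>\<close>.\<close>

lemma tendsto_pol_entropy:
  assumes "compact M" "continuous_on M f" "f ` M \<subseteq> M"
  shows "((\<lambda>\<epsilon>. limsup (\<lambda>n. ereal (ln (real (cover_number M f \<epsilon> n)) / ln (real n)))) \<longlongrightarrow>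
    pol_entropy M f) (at_right 0)"
proof -
  define h where
    "h = (\<lambda>\<epsilon>. limsup (\<lambda>n. ereal (ln (real (cover_number M f \<epsilon> n)) / ln (real n))))"
  have anti: "h \<delta> \<le> h \<epsilon>" if "0 < \<epsilon>" "\<epsilon> \<le> \<delta>" for \<epsilon> \<delta>
    unfolding h_def
  proof (rule Limsup_mono)
    have "ln (real (cover_number M f \<delta> n)) / ln (real n)
        \<le> ln (real (cover_number M f \<epsilon> n)) / ln (real n)" if "n \<ge> 1" for n
    proof (rule divide_right_mono)
      have "cover_number M f \<delta> n \<le> cover_number M f \<epsilon> n"
        using cover_number_mono[OF assms] that \<open>0 < \<epsilon>\<close> \<open>\<epsilon> \<le> \<delta>\<close> by blast
      then show "ln (real (cover_number M f \<delta> n)) \<le> ln (real (cover_number M f \<epsilon> n))"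
        by (cases "cover_number M f \<delta> n = 0"; cases "cover_number M f \<epsilon> n = 0")
           (auto intro: ln_ge_zero)
    qed (use that in auto)
    then show "\<forall>\<^sub>F n in sequentially. ereal (ln (real (cover_number M f \<delta> n)) / ln (real n))
        \<le> ereal (ln (real (cover_number M f \<epsilon> n)) / ln (real n))"
      unfolding eventually_sequentially by (intro exI[of _ 1]) auto
  qed
  have "(h \<longlongrightarrow> (SUP \<epsilon>\<in>{0<..}. h \<epsilon>)) (at_right 0)"
  proof (rule order_tendstoI)
    fix a assume "a < (SUP \<epsilon>\<in>{0<..}. h \<epsilon>)"
    then obtain \<delta> where "\<delta> > 0" "a < h \<delta>" by (auto simp: less_SUP_iff)
    then show "\<forall>\<^sub>F \<epsilon> in at_right 0. a < h \<epsilon>"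
      unfolding eventually_at_right_field
      by (intro exI[of _ \<delta>]) (use \<open>a < h \<delta>\<close> \<open>\<delta> > 0\<close> anti in \<open>auto intro: less_le_trans[of a "h \<delta>"]\<close>)
  next
    fix a assume a: "(SUP \<epsilon>\<in>{0<..}. h \<epsilon>) < a"
    have "h \<epsilon> < a" if "\<epsilon> > 0" for \<epsilon>
      using a that by (meson SUP_upper greaterThan_iff le_less_trans)
    then show "\<forall>\<^sub>F \<epsilon> in at_right 0. h \<epsilon> < a"
      unfolding eventually_at_right_field by (intro exI[of _ 1]) auto
  qed
  then show ?thesis
    unfolding pol_entropy_def h_def[symmetric] by (metis tendsto_Lim trivial_limit_at_right_real)
qed

end

theory Submission
  imports Defs
begin

text \<open>
  Some power \<open>F = f\<^sup>P\<close> fixes the finite non-wandering set \<open>\<Omega>\<close> pointwise, and paths of orbits correspond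
  to chains of points of \<open>\<Omega>\<close> joined by heteroclinic orbits of \<open>F\<close>.  Transversality is only used in
  linearised form: velocities of curves in a stable set give solutions of the linearised equation that
  are bounded in forward time, so along a heteroclinic orbit every vector is a sum of one forward
  bounded and one backward bounded solution.  Hence \<open>\<xi> \<mapsto> (\<xi>\<^sub>i\<^sub>+\<^sub>1 - A\<^sub>i \<xi>\<^sub>i)\<^sub>i\<close> has an approximate right
  inverse on bounded sequences along concatenations of heteroclinic orbits, uniformly in the transition
  times, and a contraction argument shadows every such concatenation.  No invariant manifold theorem or
  inclination lemma is needed.

  Shadowing a cycle of connections would make a wandering point return, so there are no cycles.
  Shadowing a chain of length \<open>L\<close> with arbitrary transition times yields about \<open>n\<^sup>L\<close> separated orbits.
  Conversely, an orbit of length \<open>n\<close> spends a bounded time away from \<open>\<Omega>\<close>, its successive long sojourns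
  near points of \<open>\<Omega>\<close> follow a chain, and it is determined up to \<open>\<epsilon>\<close> by a bounded amount of data and the
  at most \<open>L\<close> times at which a sojourn ends and another follows.
\<close>

text \<open>Only a right inverse of the linearised orbit equation can be expected: along a
  connection from a source to a sink every homogeneous solution is bounded, so shadowing orbits are
  not unique. Distinct itineraries are therefore told apart by the positions of the shadowing
  orbits. The exponent counts connections, not sojourns: a chain with L connections has L + 1
  sojourns, but their durations add up to n minus a bounded time, which leaves L free times. A long
  orbit may pass from near q to near q' without following a single connection, since it can linger
  at fixed points in between. Compactness therefore yields only a chain of connections, and
  acyclicity makes the search for its links terminate. Working with F costs only constants: passing
  between f and F changes the time by the factor P and the scale by a modulus of continuity. That
  chains of points have the same maximal length as paths of orbits rests on f permuting the
  connections of F.\<close>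

section \<open>Hyperbolic linear maps\<close>

text \<open>\<open>P n\<close> is the n-th power of the map on its stable part and
  \<open>N n\<close> the n-th inverse power on its unstable part, each composed with the spectral
  projection. Giving these operators directly avoids invariant subspaces and also covers maps that
  are not invertible on the stable part.\<close>

definition hyperbolic_map :: "('v::banach \<Rightarrow>\<^sub>L 'v) \<Rightarrow> bool" where
  "hyperbolic_map M \<longleftrightarrow> (\<exists>P N C \<theta>. 0 \<le> \<theta> \<and> \<theta> < 1 \<and>
     (\<forall>n. norm (P n) \<le> C * \<theta> ^ n) \<and> (\<forall>n. norm (N n) \<le> C * \<theta> ^ n) \<and>
     P 0 + N 0 = id_blinfun \<and>
     (\<forall>n. M o\<^sub>L P n = P (Suc n) \<and> P n o\<^sub>L M = P (Suc n)) \<and>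
     (\<forall>n. M o\<^sub>L N (Suc n) = N n \<and> N (Suc n) o\<^sub>L M = N n))"

definition blinfun_power :: "('v::real_normed_vector \<Rightarrow>\<^sub>L 'v) \<Rightarrow> nat \<Rightarrow> ('v \<Rightarrow>\<^sub>L 'v)" where
  "blinfun_power M n = ((o\<^sub>L) M ^^ n) id_blinfun"

lemma blinfun_power_0 [simp]: "blinfun_power M 0 = id_blinfun"
  and blinfun_power_Suc [simp]: "blinfun_power M (Suc n) = M o\<^sub>L blinfun_power M n"
  by (simp_all add: blinfun_power_def)

lemma blinfun_compose_id [simp]: "M o\<^sub>L id_blinfun = M" "id_blinfun o\<^sub>L M = M"
  by (auto intro!: blinfun_eqI)

lemma blinfun_compose_assoc: "(A o\<^sub>L B) o\<^sub>L C = A o\<^sub>L (B o\<^sub>L C)"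
  by (auto intro!: blinfun_eqI)

lemma blinfun_power_commute: "blinfun_power M n o\<^sub>L M = M o\<^sub>L blinfun_power M n"
  by (induction n) (simp_all add: blinfun_compose_assoc)

text \<open>Keeping every m-th operator of both families gives witnesses for the power, with rate
  \<open>\<theta> ^ m\<close>. The eigenvalue condition concerns the period of each single point,
  while the dynamics is studied for a common multiple of all periods.\<close>

lemma hyperbolic_map_power:
  assumes M: "hyperbolic_map M" and m: "m \<ge> 1"
  shows "hyperbolic_map (blinfun_power M m)"
proof -
  obtain P N C \<theta> where \<theta>: "0 \<le> \<theta>" "\<theta> < 1"
    and bd: "\<forall>n. norm (P n) \<le> C * \<theta> ^ n" "\<forall>n. norm (N n) \<le> C * \<theta> ^ n"
    and id: "P 0 + N 0 = id_blinfun"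
    and MP: "\<forall>n. M o\<^sub>L P n = P (Suc n) \<and> P n o\<^sub>L M = P (Suc n)"
    and MN: "\<forall>n. M o\<^sub>L N (Suc n) = N n \<and> N (Suc n) o\<^sub>L M = N n"
    using M unfolding hyperbolic_map_def by blast
  have P: "blinfun_power M k o\<^sub>L P n = P (k + n) \<and> P n o\<^sub>L blinfun_power M k = P (k + n)" for k n
  proof (induction k arbitrary: n)
    case (Suc k)
    have "P n o\<^sub>L blinfun_power M (Suc k) = P (Suc n) o\<^sub>L blinfun_power M k"
      using MP by (simp add: blinfun_compose_assoc[symmetric])
    with Suc show ?case using MP by (simp add: blinfun_compose_assoc)
  qed auto
  have N: "blinfun_power M k o\<^sub>L N (k + n) = N n \<and> N (k + n) o\<^sub>L blinfun_power M k = N n" for k n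
  proof (induction k arbitrary: n)
    case (Suc k)
    have "N (Suc k + n) o\<^sub>L blinfun_power M (Suc k) = N (k + n) o\<^sub>L blinfun_power M k"
      using MN by (simp add: blinfun_compose_assoc[symmetric])
    moreover have "blinfun_power M (Suc k) o\<^sub>L N (Suc k + n) = N n"
      using Suc[of "Suc n"] MN by (simp add: blinfun_compose_assoc)
    ultimately show ?case using Suc by simp
  qed auto
  have "\<theta> ^ m < 1" using \<theta> m by (simp add: power_less_one_iff)
  show ?thesis unfolding hyperbolic_map_def
    apply (rule exI[of _ "\<lambda>n. P (m * n)"])
    apply (rule exI[of _ "\<lambda>n. N (m * n)"])
    apply (rule exI[of _ C])
    apply (rule exI[of _ "\<theta> ^ m"])
    using \<theta> \<open>\<theta> ^ m < 1\<close> bd id P[of m] N[of m]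
    by (auto simp: power_mult[symmetric])
qed

definition bdd_by :: "real \<Rightarrow> ('i \<Rightarrow> 'v::real_normed_vector) \<Rightarrow> bool" where
  "bdd_by c \<eta> \<longleftrightarrow> (\<forall>i. norm (\<eta> i) \<le> c)"

text \<open>The last part says in particular that bounded solutions are unique, so that \<open>G\<close> is the inverse
  of \<open>\<xi> \<mapsto> (\<xi>\<^sub>i\<^sub>+\<^sub>1 - M \<xi>\<^sub>i)\<^sub>i\<close> on bounded sequences.\<close>

lemma hyperbolic_map_green:
  fixes M :: "'v::banach \<Rightarrow>\<^sub>L 'v"
  assumes M: "hyperbolic_map M"
  obtains G :: "(int \<Rightarrow> 'v) \<Rightarrow> int \<Rightarrow> 'v" and C where "C > 0"
    and "\<forall>c \<eta>. bdd_by c \<eta> \<longrightarrow> bdd_by (C * c) (G \<eta>)"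
    and "\<forall>c \<eta> i. bdd_by c \<eta> \<longrightarrow> G \<eta> (i + 1) - M (G \<eta> i) = \<eta> i"
    and "\<forall>c d \<eta> \<eta>' i. bdd_by c \<eta> \<longrightarrow> bdd_by d \<eta>' \<longrightarrow> G (\<lambda>i. \<eta> i - \<eta>' i) i = G \<eta> i - G \<eta>' i"
    and "\<forall>b c (D :: int \<Rightarrow> 'v). bdd_by b D \<longrightarrow> bdd_by c (\<lambda>i. D (i + 1) - M (D i)) \<longrightarrow> bdd_by (C * c) D"
proof -
  obtain P N C \<theta> where \<theta>: "0 \<le> \<theta>" "\<theta> < 1"
    and bd: "\<And>n. norm (P n) \<le> C * \<theta> ^ n" "\<And>n. norm (N n) \<le> C * \<theta> ^ n"
    and id: "P 0 + N 0 = id_blinfun"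
    and MP: "\<And>n. M o\<^sub>L P n = P (Suc n)" "\<And>n. P n o\<^sub>L M = P (Suc n)"
    and MN: "\<And>n. M o\<^sub>L N (Suc n) = N n" "\<And>n. N (Suc n) o\<^sub>L M = N n"
    using M unfolding hyperbolic_map_def by blast
  have MP': "M (P n v) = P (Suc n) v" "P n (M v) = P (Suc n) v"
       "M (N (Suc n) v) = N n v" "N (Suc n) (M v) = N n v" for n v
    using MP[of n] MN[of n] by (metis blinfun_apply_blinfun_compose)+
  have C0: "C \<ge> 0" using order_trans[OF norm_ge_zero bd(1)[of 0]] by simp
  \<comment> \<open>Two geometric series with sum \<open>C * c / (1 - \<theta>)\<close> each; the
    extra 1 keeps the constant positive even if \<open>C = 0\<close>.\<close>
  define K where "K = 2 * C / (1 - \<theta>) + 1"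
  have K: "K > 0" using C0 \<theta> by (simp add: K_def add_nonneg_pos)
  have geo: "summable (\<lambda>n. C * c * \<theta> ^ n)" "(\<Sum>n. C * c * \<theta> ^ n) = C * c / (1 - \<theta>)" for c
    using \<theta> by (auto simp: suminf_mult suminf_geometric summable_geometric)
  have NS: "norm (N (Suc n)) \<le> C * \<theta> ^ n" for n
  proof -
    have "C * \<theta> ^ Suc n \<le> C * \<theta> ^ n" using C0 \<theta> by (intro mult_left_mono power_decreasing) auto
    with bd(2)[of "Suc n"] show ?thesis by linarith
  qed
  have est: "norm (Q n (x n)) \<le> C * c * \<theta> ^ n"
    if "\<And>n. norm (Q n) \<le> C * \<theta> ^ n" "\<And>n. norm (x n) \<le> c" for Q :: "nat \<Rightarrow> 'v \<Rightarrow>\<^sub>L 'v" and x c n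
  proof -
    have "norm (Q n (x n)) \<le> norm (Q n) * norm (x n)" by (rule norm_blinfun)
    also have "\<dots> \<le> (C * \<theta> ^ n) * c"
      using that C0 \<theta> by (intro mult_mono) (auto intro: mult_nonneg_nonneg)
    finally show ?thesis by (simp add: mult_ac)
  qed
  have summ: "summable (\<lambda>n. Q n (x n))" "norm (\<Sum>n. Q n (x n)) \<le> C * c / (1 - \<theta>)"
    if "\<And>n. norm (Q n) \<le> C * \<theta> ^ n" "\<And>n. norm (x n) \<le> c" for Q :: "nat \<Rightarrow> 'v \<Rightarrow>\<^sub>L 'v" and x c
  proof -
    note e = est[of Q x c, OF that]
    show "summable (\<lambda>n. Q n (x n))"
      using e by (intro summable_comparison_test'[OF geo(1)[of c]]) auto
    have sn: "summable (\<lambda>n. norm (Q n (x n)))"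
      using e by (intro summable_comparison_test'[OF geo(1)[of c]]) auto
    have "norm (\<Sum>n. Q n (x n)) \<le> (\<Sum>n. norm (Q n (x n)))" by (rule summable_norm[OF sn])
    also have "\<dots> \<le> (\<Sum>n. C * c * \<theta> ^ n)" using e sn geo(1) by (intro suminf_le) auto
    finally show "norm (\<Sum>n. Q n (x n)) \<le> C * c / (1 - \<theta>)" using geo(2) by simp
  qed
  define G where "G = (\<lambda>\<eta> i. (\<Sum>n. P n (\<eta> (i - 1 - int n))) - (\<Sum>n. N (Suc n) (\<eta> (i + int n))))"
  have sP: "summable (\<lambda>n. P n (\<eta> (i - 1 - int n)))"
       "norm (\<Sum>n. P n (\<eta> (i - 1 - int n))) \<le> C * c / (1 - \<theta>)"
       "summable (\<lambda>n. N (Suc n) (\<eta> (i + int n)))"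
       "norm (\<Sum>n. N (Suc n) (\<eta> (i + int n))) \<le> C * c / (1 - \<theta>)"
       if "bdd_by c \<eta>" for c \<eta> i
    using that summ[of P "\<lambda>n. \<eta> (i - 1 - int n)" c] summ[of "\<lambda>n. N (Suc n)" "\<lambda>n. \<eta> (i + int n)" c] bd(1) NS
    by (auto simp: bdd_by_def)
  have G_bd: "bdd_by (K * c) (G \<eta>)" if "bdd_by c \<eta>" for c \<eta>
    unfolding bdd_by_def
  proof
    fix i
    have c0: "c \<ge> 0" using that order_trans[OF norm_ge_zero] unfolding bdd_by_def by blast
    have "norm (G \<eta> i) \<le> C * c / (1 - \<theta>) + C * c / (1 - \<theta>)"
      unfolding G_def using sP[OF that, of i] norm_triangle_ineq4 by (smt (verit))
    also have "\<dots> \<le> K * c" using c0 \<theta> by (simp add: K_def algebra_simps)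
    finally show "norm (G \<eta> i) \<le> K * c" .
  qed
  \<comment> \<open>Both series telescope when the input is the defect of a bounded sequence, so
    \<open>G\<close> is also a left inverse. This is where uniqueness of bounded solutions comes
    from.\<close>
  have G_inv: "G (\<lambda>i. D (i + 1) - M (D i)) i = D i" if "bdd_by b D" for b D i
  proof -
    have lim: "(\<lambda>n. Q n (x n)) \<longlonglongrightarrow> 0"
      if "\<And>n. norm (Q n) \<le> C * \<theta> ^ n" "\<And>n. norm (x n) \<le> b" for Q :: "nat \<Rightarrow> 'v \<Rightarrow>\<^sub>L 'v" and x
      using summ(1)[OF that] by (rule summable_LIMSEQ_zero)
    have b: "norm (D i) \<le> b" for i using that by (simp add: bdd_by_def)
    let ?e = "\<lambda>i. D (i + 1) - M (D i)"
    have "(\<lambda>n. P n (D (i - int n)) - P (Suc n) (D (i - int (Suc n)))) sums (P 0 (D (i - int 0)) - 0)"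
      by (rule telescope_sums') (rule lim[OF bd(1)], rule b)
    moreover have "P n (D (i - int n)) - P (Suc n) (D (i - int (Suc n))) = P n (?e (i - 1 - int n))" for n
      by (simp add: blinfun.diff_right MP' algebra_simps)
    ultimately have 1: "(\<Sum>n. P n (?e (i - 1 - int n))) = P 0 (D i)"
      by (simp add: sums_iff)
    have "(\<lambda>n. N (Suc n) (D (i + int (Suc n))) - N n (D (i + int n))) sums (0 - N 0 (D (i + int 0)))"
      by (rule telescope_sums) (rule lim[OF bd(2)], rule b)
    moreover have "N (Suc n) (D (i + int (Suc n))) - N n (D (i + int n)) = N (Suc n) (?e (i + int n))" for n
      by (simp add: blinfun.diff_right MP' algebra_simps)
    ultimately have 2: "(\<Sum>n. N (Suc n) (?e (i + int n))) = - N 0 (D i)"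
      by (simp add: sums_iff)
    have "P 0 (D i) + N 0 (D i) = (P 0 + N 0) (D i)" by (simp add: blinfun.add_left)
    then show ?thesis unfolding G_def 1 2 by (simp add: id)
  qed
  have uniq: "bdd_by (K * c) D" if "bdd_by b D" "bdd_by c (\<lambda>i. D (i + 1) - M (D i))" for b c and D :: "int \<Rightarrow> 'v"
    using G_bd[OF that(2)] G_inv[OF that(1)] by (simp add: bdd_by_def)
  have add: "G (\<lambda>i. \<eta> i - \<eta>' i) i = G \<eta> i - G \<eta>' i" if "bdd_by c \<eta>" "bdd_by d \<eta>'" for c d \<eta> \<eta>' i
      unfolding G_def blinfun.diff_right
        suminf_diff[OF sP(1)[OF that(1), of i] sP(1)[OF that(2), of i], symmetric]
        suminf_diff[OF sP(3)[OF that(1), of i] sP(3)[OF that(2), of i], symmetric] by simp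
  have eq: "G \<eta> (i + 1) - M (G \<eta> i) = \<eta> i" if "bdd_by c \<eta>" for c \<eta> i
    proof -
      have 1: "(\<Sum>n. P n (\<eta> (i + 1 - 1 - int n))) = (\<Sum>n. P (Suc n) (\<eta> (i - 1 - int n))) + P 0 (\<eta> i)"
        using suminf_split_head[OF sP(1)[OF that, of "i + 1"]] by (simp add: algebra_simps)
      have 2: "M (\<Sum>n. P n (\<eta> (i - 1 - int n))) = (\<Sum>n. P (Suc n) (\<eta> (i - 1 - int n)))"
        using bounded_linear.suminf[OF blinfun.bounded_linear_right sP(1)[OF that, of i], of M]
        by (simp add: MP')
      have 3: "M (\<Sum>n. N (Suc n) (\<eta> (i + int n))) = (\<Sum>n. N n (\<eta> (i + int n)))"
        using bounded_linear.suminf[OF blinfun.bounded_linear_right sP(3)[OF that, of i], of M]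
        by (simp add: MP')
      have "summable (\<lambda>n. N n (\<eta> (i + int n)))"
        using summ(1)[of N "\<lambda>n. \<eta> (i + int n)" c] bd(2) that by (simp add: bdd_by_def)
      from suminf_split_head[OF this]
      have 4: "(\<Sum>n. N n (\<eta> (i + int n))) = (\<Sum>n. N (Suc n) (\<eta> (i + 1 + int n))) + N 0 (\<eta> i)"
        by (simp add: algebra_simps)
      have "P 0 (\<eta> i) + N 0 (\<eta> i) = (P 0 + N 0) (\<eta> i)" by (simp add: blinfun.add_left)
      then have 5: "P 0 (\<eta> i) + N 0 (\<eta> i) = \<eta> i" by (simp add: id)
      show ?thesis unfolding G_def blinfun.diff_right 1 2 3 4 using 5 by (simp add: algebra_simps)
    qed
  show ?thesis
    using that[of K G] K G_bd eq add uniq by blast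
qed

section \<open>Hyperbolicity of plane maps from the moduli of their eigenvalues\<close>

lemma linear_recurrence_bound:
  fixes \<sigma> :: "nat \<Rightarrow> real" and \<alpha> \<beta> :: complex
  assumes \<sigma>: "\<sigma> 0 = 0" "\<sigma> 1 = 1" "\<And>n. \<sigma> (Suc (Suc n)) = s * \<sigma> (Suc n) - d * \<sigma> n"
    and roots: "\<alpha> + \<beta> = of_real s" "\<alpha> * \<beta> = of_real d"
    and lt: "cmod \<alpha> \<le> \<rho>" "cmod \<beta> \<le> \<rho>" "\<rho> < \<theta>"
  shows "\<bar>\<sigma> n\<bar> \<le> 1 / (\<theta> - \<rho>) * \<theta> ^ n"
proof (induction n)
  case 0 show ?case using \<sigma> lt by simp
next
  case (Suc n)
  have \<rho>: "0 \<le> \<rho>" using lt(1) norm_ge_zero order_trans by blast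
  \<comment> \<open>Removing one root at a time works for double roots too, unlike the closed
    formula with denominator \<open>\<alpha> - \<beta>\<close>. The constant
    \<open>1 / (\<theta> - \<rho>)\<close> is the one that the induction reproduces.\<close>
  have diff: "complex_of_real (\<sigma> (Suc n)) - \<alpha> * of_real (\<sigma> n) = \<beta> ^ n" for n
  proof (induction n)
    case (Suc n)
    have "complex_of_real (\<sigma> (Suc (Suc n))) = (\<alpha> + \<beta>) * of_real (\<sigma> (Suc n)) - \<alpha> * \<beta> * of_real (\<sigma> n)"
      unfolding roots \<sigma>(3) by simp
    then have "complex_of_real (\<sigma> (Suc (Suc n))) - \<alpha> * of_real (\<sigma> (Suc n))
        = \<beta> * (complex_of_real (\<sigma> (Suc n)) - \<alpha> * of_real (\<sigma> n))"
      by (simp add: algebra_simps)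
    then show ?case using Suc by simp
  qed (simp add: \<sigma>[unfolded One_nat_def])
  have "\<bar>\<sigma> (Suc n)\<bar> = cmod (\<alpha> * of_real (\<sigma> n) + \<beta> ^ n)"
    by (metis diff add.commute diff_add_cancel norm_of_real)
  also have "\<dots> \<le> cmod \<alpha> * \<bar>\<sigma> n\<bar> + cmod \<beta> ^ n"
    by (metis norm_triangle_ineq norm_mult norm_power norm_of_real)
  also have "\<dots> \<le> \<rho> * (1 / (\<theta> - \<rho>) * \<theta> ^ n) + \<theta> ^ n"
    using lt \<rho> Suc by (intro add_mono mult_mono power_mono) auto
  also have "\<dots> = 1 / (\<theta> - \<rho>) * \<theta> ^ Suc n"
    using lt by (simp add: field_simps)
  finally show ?case .
qed

text \<open>By the quadratic relation all powers stay in the span of \<open>X\<close> and the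
  identity, with coefficients from a scalar linear recurrence, so a bound on its roots bounds the
  powers.\<close>

lemma blinfun_power_bound:
  fixes X :: "'v::banach \<Rightarrow>\<^sub>L 'v" and \<alpha> \<beta> :: complex
  assumes X: "\<And>v. X (X v) = s *\<^sub>R X v - d *\<^sub>R v"
    and roots: "\<alpha> + \<beta> = of_real s" "\<alpha> * \<beta> = of_real d"
    and lt: "cmod \<alpha> < 1" "cmod \<beta> < 1"
  obtains \<theta> C where "0 \<le> \<theta>" "\<theta> < 1" "\<forall>n. norm (blinfun_power X n) \<le> C * \<theta> ^ n"
proof -
  define \<rho> where "\<rho> = max (cmod \<alpha>) (cmod \<beta>)"
  define \<theta> where "\<theta> = (\<rho> + 1) / 2"
  have \<rho>: "0 \<le> \<rho>" "cmod \<alpha> \<le> \<rho>" "cmod \<beta> \<le> \<rho>" "\<rho> < \<theta>" "\<theta> < 1" "0 < \<theta>"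
    using lt by (auto simp: \<rho>_def \<theta>_def le_max_iff_disj add_nonneg_pos)
  define \<tau> where "\<tau> = rec_nat (0, 1 :: real) (\<lambda>_ (a, b). (b, s * b - d * a))"
  define \<sigma> where "\<sigma> = (\<lambda>n. fst (\<tau> n))"
  have \<tau>: "snd (\<tau> n) = \<sigma> (Suc n)" for n by (simp add: \<sigma>_def \<tau>_def split: prod.splits)
  have \<sigma>: "\<sigma> 0 = 0" "\<sigma> 1 = 1" "\<sigma> (Suc (Suc n)) = s * \<sigma> (Suc n) - d * \<sigma> n" for n
  proof -
    show "\<sigma> 0 = 0" "\<sigma> 1 = 1" by (simp_all add: \<sigma>_def \<tau>_def)
    have "\<sigma> (Suc (Suc n)) = snd (\<tau> (Suc n))" by (simp add: \<tau>)
    also have "\<dots> = s * snd (\<tau> n) - d * fst (\<tau> n)" by (simp add: \<tau>_def split: prod.splits)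
    finally show "\<sigma> (Suc (Suc n)) = s * \<sigma> (Suc n) - d * \<sigma> n" by (simp add: \<tau> \<sigma>_def)
  qed
  define K where "K = 1 / (\<theta> - \<rho>)"
  have K: "K > 0" using \<rho> by (simp add: K_def)
  have bd: "\<bar>\<sigma> n\<bar> \<le> K * \<theta> ^ n" for n
    unfolding K_def using linear_recurrence_bound[of \<sigma> s d \<alpha> \<beta> \<rho> \<theta> n] \<sigma> roots \<rho> by simp
  have pow: "blinfun_power X (Suc n) = \<sigma> (Suc n) *\<^sub>R X - (d * \<sigma> n) *\<^sub>R id_blinfun" for n
  proof (induction n)
    case (Suc n)
    show ?case
    proof (rule blinfun_eqI)
      fix v
      have "blinfun_power X (Suc (Suc n)) v = X (blinfun_power X (Suc n) v)" by simp
      also have "\<dots> = X (\<sigma> (Suc n) *\<^sub>R X v - (d * \<sigma> n) *\<^sub>R v)"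
        unfolding Suc by (simp add: blinfun.diff_left blinfun.scaleR_left)
      also have "\<dots> = \<sigma> (Suc (Suc n)) *\<^sub>R X v - (d * \<sigma> (Suc n)) *\<^sub>R v"
        by (simp add: \<sigma>(3) blinfun.diff_right blinfun.scaleR_right X algebra_simps)
      finally show "blinfun_power X (Suc (Suc n)) v = (\<sigma> (Suc (Suc n)) *\<^sub>R X - (d * \<sigma> (Suc n)) *\<^sub>R id_blinfun) v"
        by (simp add: blinfun.diff_left blinfun.scaleR_left)
    qed
  qed (use \<sigma> in simp)
  have id1: "norm (id_blinfun :: 'v \<Rightarrow>\<^sub>L 'v) \<le> 1"
    by (rule norm_blinfun_bound) auto
  define C where "C = K * norm X + \<bar>d\<bar> * K / \<theta> + 1"
  have "norm (blinfun_power X n) \<le> C * \<theta> ^ n" for n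
  proof (cases n)
    case 0
    have "C \<ge> 1" unfolding C_def using K \<rho> by simp
    with 0 id1 show ?thesis by simp
  next
    case (Suc m)
    have "norm (blinfun_power X n) \<le> norm (\<sigma> n *\<^sub>R X) + norm ((d * \<sigma> m) *\<^sub>R (id_blinfun :: 'v \<Rightarrow>\<^sub>L 'v))"
      unfolding Suc pow by (rule norm_triangle_ineq4)
    also have "\<dots> = \<bar>\<sigma> n\<bar> * norm X + \<bar>d\<bar> * \<bar>\<sigma> m\<bar> * norm (id_blinfun :: 'v \<Rightarrow>\<^sub>L 'v)"
      by (simp add: abs_mult)
    also have "\<dots> \<le> (K * \<theta> ^ n) * norm X + \<bar>d\<bar> * (K * \<theta> ^ m) * 1"
      using bd id1 K \<rho> by (intro add_mono mult_mono) auto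
    also have "\<dots> = (K * norm X + \<bar>d\<bar> * K / \<theta>) * \<theta> ^ n"
      using \<rho> by (simp add: Suc field_simps)
    also have "\<dots> \<le> C * \<theta> ^ n" using \<rho> by (simp add: C_def algebra_simps)
    finally show ?thesis .
  qed
  with \<rho> show ?thesis using that[of \<theta> C] by simp
qed

lemma hyperbolic_map_quadratic:
  fixes M :: "'v::banach \<Rightarrow>\<^sub>L 'v" and \<alpha> \<beta> :: complex
  assumes M: "\<And>v. M (M v) = s *\<^sub>R M v - d *\<^sub>R v"
    and roots: "\<alpha> + \<beta> = of_real s" "\<alpha> * \<beta> = of_real d"
    and neq: "cmod \<alpha> \<noteq> 1" "cmod \<beta> \<noteq> 1" and le: "cmod \<alpha> \<le> cmod \<beta>"
  shows "hyperbolic_map M"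
proof -
  consider "cmod \<beta> < 1" | "cmod \<alpha> > 1" | "cmod \<alpha> < 1" "cmod \<beta> > 1"
    using neq by linarith
  then show ?thesis
  proof cases
    case 1
    have lt: "cmod \<alpha> < 1" using 1 le by linarith
    obtain \<theta> C where C: "0 \<le> \<theta>" "\<theta> < 1" "\<forall>n. norm (blinfun_power M n) \<le> C * \<theta> ^ n"
      using blinfun_power_bound[OF M roots lt 1] .
    have "C \<ge> 0" using order_trans[OF norm_ge_zero C(3)[rule_format, of 0]] by simp
    show ?thesis unfolding hyperbolic_map_def
      apply (rule exI[of _ "blinfun_power M"])
      apply (rule exI[of _ "\<lambda>_. 0"])
      apply (rule exI[of _ C])
      apply (rule exI[of _ \<theta>])
      using C \<open>C \<ge> 0\<close> by (auto simp: blinfun_power_commute)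
  next
    case 2
    have nz: "\<alpha> \<noteq> 0" "\<beta> \<noteq> 0" using 2 le by auto
    then have d: "d \<noteq> 0" using roots by auto
    \<comment> \<open>The inverse of \<open>M\<close>, read off from the quadratic relation. The
      roots of its own relation are the reciprocals of \<alpha> and \<beta>, so its powers
      decay.\<close>
    define B where "B = (1 / d) *\<^sub>R (s *\<^sub>R id_blinfun - M)"
    have B: "B v = (1 / d) *\<^sub>R (s *\<^sub>R v - M v)" for v
      by (simp add: B_def blinfun.scaleR_left blinfun.diff_left)
    have MB: "M (B v) = v" for v
      by (simp add: B blinfun.scaleR_right blinfun.diff_right M d)
    have BM: "B (M v) = v" for v
      by (simp add: B M d)
    have BB: "B (B v) = (s / d) *\<^sub>R B v - (1 / d) *\<^sub>R v" for v
    proof -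
      have "B (B v) = (1 / d) *\<^sub>R (s *\<^sub>R B v - M (B v))" by (rule B)
      then show ?thesis by (simp add: MB algebra_simps)
    qed
    have r: "1 / \<alpha> + 1 / \<beta> = of_real (s / d)" "1 / \<alpha> * (1 / \<beta>) = of_real (1 / d)"
    proof -
      have "1 / \<alpha> + 1 / \<beta> = (\<alpha> + \<beta>) / (\<alpha> * \<beta>)" using nz by (simp add: field_simps)
      then show "1 / \<alpha> + 1 / \<beta> = of_real (s / d)" unfolding roots by simp
      have "1 / \<alpha> * (1 / \<beta>) = 1 / (\<alpha> * \<beta>)" by simp
      then show "1 / \<alpha> * (1 / \<beta>) = of_real (1 / d)" unfolding roots by simp
    qed
    have lt: "cmod (1 / \<alpha>) < 1" "cmod (1 / \<beta>) < 1"
      using 2 le nz by (auto simp: norm_divide divide_less_eq)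
    obtain \<theta> C where C: "0 \<le> \<theta>" "\<theta> < 1" "\<forall>n. norm (blinfun_power B n) \<le> C * \<theta> ^ n"
      using blinfun_power_bound[OF BB r lt] .
    have "C \<ge> 0" using order_trans[OF norm_ge_zero C(3)[rule_format, of 0]] by simp
    have 1: "M o\<^sub>L (B o\<^sub>L X) = X" "(X o\<^sub>L B) o\<^sub>L M = X" for X
      by (auto intro!: blinfun_eqI simp: MB BM)
    show ?thesis unfolding hyperbolic_map_def
      apply (rule exI[of _ "\<lambda>_. 0"])
      apply (rule exI[of _ "blinfun_power B"])
      apply (rule exI[of _ C])
      apply (rule exI[of _ \<theta>])
      using C \<open>C \<ge> 0\<close> by (auto simp: 1) (simp add: 1 flip: blinfun_power_commute)
  next
    case 3
    \<comment> \<open>The coefficients are real, so nonreal roots are conjugate and have equal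
      modulus; a saddle therefore has real roots.\<close>
    have im: "Im \<alpha> = - Im \<beta>" using arg_cong[OF roots(1), of Im] by simp
    have "Re \<alpha> * Im \<beta> + Im \<alpha> * Re \<beta> = 0" using arg_cong[OF roots(2), of Im] by simp
    then have "Im \<beta> * (Re \<alpha> - Re \<beta>) = 0" using im by (simp add: algebra_simps)
    moreover have "cmod \<alpha> = cmod \<beta>" if "Re \<alpha> = Re \<beta>"
      using that im by (simp add: cmod_def)
    ultimately have im0: "Im \<beta> = 0" "Im \<alpha> = 0" using 3 im by auto
    define l m where "l = Re \<alpha>" and "m = Re \<beta>"
    have lm: "s = l + m" "d = l * m"
      using arg_cong[OF roots(1), of Re] arg_cong[OF roots(2), of Re] im0 by (simp_all add: l_def m_def)
    have abs: "\<bar>l\<bar> < 1" "\<bar>m\<bar> > 1" using 3 im0 by (auto simp: l_def m_def cmod_def)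
    then have ne: "l - m \<noteq> 0" "m \<noteq> 0" "m - l \<noteq> 0" by auto
    \<comment> \<open>Spectral projection onto the eigenspace of \<open>l\<close> along that of
      \<open>m\<close>.\<close>
    define Q where "Q = (1 / (l - m)) *\<^sub>R (M - m *\<^sub>R id_blinfun)"
    have Q: "Q v = (1 / (l - m)) *\<^sub>R (M v - m *\<^sub>R v)" for v
      by (simp add: Q_def blinfun.scaleR_left blinfun.diff_left)
    have MQ: "M (Q v) = l *\<^sub>R Q v" and QM: "Q (M v) = l *\<^sub>R Q v" for v
      by (simp_all add: Q blinfun.scaleR_right blinfun.diff_right M lm algebra_simps)
    have Ml: "M v = m *\<^sub>R v + (l - m) *\<^sub>R Q v" for v
      using ne by (simp add: Q)
    have MQ2: "c *\<^sub>R (M v - l *\<^sub>R Q v) = (c * m) *\<^sub>R (v - Q v)" for v c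
      by (simp add: Ml algebra_simps)
    define \<theta> where "\<theta> = max \<bar>l\<bar> \<bar>1 / m\<bar>"
    define C where "C = max (norm Q) (norm (id_blinfun - Q))"
    have C: "C \<ge> 0" by (simp add: C_def le_max_iff_disj)
    have \<theta>: "0 \<le> \<theta>" "\<theta> < 1" using abs by (auto simp: \<theta>_def le_max_iff_disj)
    have b1: "norm (l ^ n *\<^sub>R Q) \<le> C * \<theta> ^ n" for n
    proof -
      have "norm (l ^ n *\<^sub>R Q) = norm Q * \<bar>l\<bar> ^ n" by (simp add: power_abs)
      also have "\<dots> \<le> C * \<theta> ^ n"
        using C by (intro mult_mono power_mono) (auto simp: C_def \<theta>_def)
      finally show ?thesis .
    qed
    have b2: "norm ((1 / m) ^ n *\<^sub>R (id_blinfun - Q)) \<le> C * \<theta> ^ n" for n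
    proof -
      have "norm ((1 / m) ^ n *\<^sub>R (id_blinfun - Q)) = norm (id_blinfun - Q) * \<bar>1 / m\<bar> ^ n"
        by (simp add: power_abs)
      also have "\<dots> \<le> C * \<theta> ^ n"
        using C by (intro mult_mono power_mono) (auto simp: C_def \<theta>_def)
      finally show ?thesis .
    qed
    show ?thesis unfolding hyperbolic_map_def
      apply (rule exI[of _ "\<lambda>n. l ^ n *\<^sub>R Q"])
      apply (rule exI[of _ "\<lambda>n. (1 / m) ^ n *\<^sub>R (id_blinfun - Q)"])
      apply (rule exI[of _ C])
      apply (rule exI[of _ \<theta>])
      by (intro conjI allI b1 b2 \<theta> blinfun_eqI)
        (simp_all add: blinfun.scaleR_left blinfun.scaleR_right blinfun.diff_left blinfun.diff_right
          blinfun.add_left MQ QM MQ2 ne mult.commute)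
  qed
qed

text \<open>A row turned by a right angle is annihilated by that row, and by the other one because
  the determinant vanishes. One such vector is nonzero unless the matrix is 0.\<close>

lemma singular_2x2_kernel:
  fixes X :: "'a::field^2^2"
  assumes "det X = 0"
  obtains v where "v \<noteq> 0" "X *v v = 0"
proof -
  have d: "X$1$1 * X$2$2 = X$1$2 * X$2$1" using assms by (simp add: det_2)
  have e: "X *v vector [- X$1$2, X$1$1] = 0" "X *v vector [- X$2$2, X$2$1] = 0"
    unfolding vec_eq_iff forall_2 matrix_vector_mult_def sum_2
    using d by (simp_all add: mult.commute)
  consider "X$1$1 \<noteq> 0 \<or> X$1$2 \<noteq> 0" | "X$2$1 \<noteq> 0 \<or> X$2$2 \<noteq> 0" | "X = 0"
    by (auto simp: vec_eq_iff forall_2)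
  then show ?thesis
  proof cases
    case 1
    show ?thesis
      by (rule that[of "vector [- X$1$2, X$1$1]"])
        (use 1 e in \<open>auto simp: vec_eq_iff forall_2\<close>)
  next
    case 2
    show ?thesis
      by (rule that[of "vector [- X$2$2, X$2$1]"])
        (use 2 e in \<open>auto simp: vec_eq_iff forall_2\<close>)
  next
    case 3
    show ?thesis
      by (rule that[of "axis 1 1"]) (use 3 in \<open>auto simp: axis_eq_0_iff\<close>)
  qed
qed

text \<open>Cayley-Hamilton in the plane supplies the quadratic relation. A root of the
  characteristic polynomial is turned into an eigenvalue by exhibiting an eigenvector, as
  \<open>complex_eigenvalue\<close> demands.\<close>

lemma hyperbolic_map_matrix:
  fixes M :: "(real^2) \<Rightarrow>\<^sub>L (real^2)"
  assumes ev: "\<And>\<mu>. complex_eigenvalue (matrix M) \<mu> \<Longrightarrow> cmod \<mu> \<noteq> 1"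
  shows "hyperbolic_map M"
proof -
  define W where "W = matrix M"
  have Mv: "M v = W *v v" for v
    unfolding W_def by (simp add: blinfun.bounded_linear_right bounded_linear.linear matrix_works)
  define s d where "s = W$1$1 + W$2$2" and "d = W$1$1 * W$2$2 - W$1$2 * W$2$1"
  have CH: "M (M v) = s *\<^sub>R M v - d *\<^sub>R v" for v
    by (simp add: Mv vec_eq_iff forall_2 matrix_vector_mult_def sum_2 s_def d_def algebra_simps)
  define z where "z = csqrt (of_real (s^2 - 4 * d))"
  have z2: "z * z = of_real (s^2 - 4 * d)" unfolding z_def by (simp flip: power2_eq_square)
  define \<alpha> \<beta> where "\<alpha> = (of_real s + z) / 2" and "\<beta> = (of_real s - z) / 2"
  have roots: "\<alpha> + \<beta> = of_real s" "\<alpha> * \<beta> = of_real d"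
    by (simp_all add: \<alpha>_def \<beta>_def field_simps z2 power2_eq_square)
  have ev1: "complex_eigenvalue W \<mu>" if "\<mu> * \<mu> - of_real s * \<mu> + of_real d = 0" for \<mu>
  proof -
    let ?X = "map_matrix complex_of_real W - mat \<mu>"
    have "det ?X = \<mu> * \<mu> - of_real s * \<mu> + of_real d"
      by (simp add: det_2 map_matrix_def mat_def s_def d_def algebra_simps)
    then have "det ?X = 0" using that by simp
    then obtain v where v: "v \<noteq> 0" "?X *v v = 0"
      using singular_2x2_kernel by blast
    have "mat \<mu> *v v = \<mu> *s v"
      by (simp add: vec_eq_iff forall_2 sum_2 matrix_vector_mult_def mat_def)
    with v show ?thesis unfolding complex_eigenvalue_def
      by (auto simp: matrix_vector_mult_diff_rdistrib)
  qed
  have "\<alpha> * \<alpha> - of_real s * \<alpha> + of_real d = 0" "\<beta> * \<beta> - of_real s * \<beta> + of_real d = 0"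
    unfolding roots[symmetric] by (simp_all add: algebra_simps)
  then have ne: "cmod \<alpha> \<noteq> 1" "cmod \<beta> \<noteq> 1" using ev1 ev W_def by blast+
  show ?thesis
  proof (cases "cmod \<alpha> \<le> cmod \<beta>")
    case True
    then show ?thesis using hyperbolic_map_quadratic[OF CH roots ne] by blast
  next
    case False
    then show ?thesis
      using hyperbolic_map_quadratic[OF CH, of \<beta> \<alpha>] roots ne by (simp add: add.commute mult.commute)
  qed
qed

section \<open>Approximate inverses along heteroclinic orbits\<close>

lemma bdd_by_nonneg: "bdd_by c \<eta> \<Longrightarrow> 0 \<le> c"
  using order_trans[OF norm_ge_zero] unfolding bdd_by_def by blast

lemma bdd_byD: "bdd_by c \<eta> \<Longrightarrow> norm (\<eta> i) \<le> c"
  by (simp add: bdd_by_def)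

text \<open>Additivity on differences is the part of linearity that the contraction estimate uses.
  \<delta> is prescribed first; the bound \<open>C\<close> that comes with it then sets the scales
  of the gluing.\<close>

definition approx_right_inverse ::
    "(int \<Rightarrow> 'v \<Rightarrow>\<^sub>L 'v::real_normed_vector) \<Rightarrow> real \<Rightarrow> real \<Rightarrow> ((int \<Rightarrow> 'v) \<Rightarrow> int \<Rightarrow> 'v) \<Rightarrow> bool" where
  "approx_right_inverse A \<delta> C R \<longleftrightarrow>
     (\<forall>c \<eta>. bdd_by c \<eta> \<longrightarrow> bdd_by (C * c) (R \<eta>)) \<and>
     (\<forall>c \<eta>. bdd_by c \<eta> \<longrightarrow> bdd_by (\<delta> * c) (\<lambda>i. R \<eta> (i + 1) - A i (R \<eta> i) - \<eta> i)) \<and>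
     (\<forall>c d \<eta> \<eta>' i. bdd_by c \<eta> \<longrightarrow> bdd_by d \<eta>' \<longrightarrow> R (\<lambda>i. \<eta> i - \<eta>' i) i = R \<eta> i - R \<eta>' i)"

text \<open>Linearised transversality: the values at time \<open>K\<close> of forward bounded and of
  backward bounded solutions together span the space. The bound \<open>c\<close> may depend on
  \<open>w\<close>; finite dimension makes it uniform later.\<close>

definition dichotomous_at :: "(int \<Rightarrow> 'v \<Rightarrow>\<^sub>L 'v::real_normed_vector) \<Rightarrow> int \<Rightarrow> bool" where
  "dichotomous_at A K \<longleftrightarrow> (\<forall>w. \<exists>\<zeta>s \<zeta>u c. \<zeta>s K + \<zeta>u K = w \<and>
     (\<forall>k\<ge>K. \<zeta>s (k + 1) = A k (\<zeta>s k)) \<and> (\<forall>k<K. \<zeta>u (k + 1) = A k (\<zeta>u k)) \<and>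
     (\<forall>k\<ge>K. norm (\<zeta>s k) \<le> c) \<and> (\<forall>k\<le>K. norm (\<zeta>u k) \<le> c))"

text \<open>Away from a compact time interval the Green operators of the two limits invert up to a small
  error.  On the interval one solves forward in time, and the resulting mismatch at its right end
  is split into a forward bounded and a backward bounded solution.\<close>

lemma approx_right_inverse_exists:
  fixes A :: "int \<Rightarrow> 'v::euclidean_space \<Rightarrow>\<^sub>L 'v"
  assumes hyp: "hyperbolic_map Ma" "hyperbolic_map Mb"
    and lim: "(\<lambda>k. A (int k)) \<longlonglongrightarrow> Mb" "(\<lambda>k. A (- int k)) \<longlonglongrightarrow> Ma"
    and dich: "\<And>K. dichotomous_at A K" and \<delta>: "\<delta> > 0"
  shows "\<exists>C>0. \<exists>R. approx_right_inverse A \<delta> C R"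
proof -
  obtain Ga :: "(int \<Rightarrow> 'v) \<Rightarrow> int \<Rightarrow> 'v" and Ca where Ca: "Ca > 0"
    and Ga: "\<forall>c \<eta>. bdd_by c \<eta> \<longrightarrow> bdd_by (Ca * c) (Ga \<eta>)"
      "\<forall>c \<eta> i. bdd_by c \<eta> \<longrightarrow> Ga \<eta> (i + 1) - Ma (Ga \<eta> i) = \<eta> i"
      "\<forall>c d \<eta> \<eta>' i. bdd_by c \<eta> \<longrightarrow> bdd_by d \<eta>' \<longrightarrow> Ga (\<lambda>i. \<eta> i - \<eta>' i) i = Ga \<eta> i - Ga \<eta>' i"
      "\<forall>b c (D :: int \<Rightarrow> 'v). bdd_by b D \<longrightarrow> bdd_by c (\<lambda>i. D (i + 1) - Ma (D i)) \<longrightarrow> bdd_by (Ca * c) D"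
    using hyperbolic_map_green[OF hyp(1)] .
  obtain Gb :: "(int \<Rightarrow> 'v) \<Rightarrow> int \<Rightarrow> 'v" and Cb where Cb: "Cb > 0"
    and Gb: "\<forall>c \<eta>. bdd_by c \<eta> \<longrightarrow> bdd_by (Cb * c) (Gb \<eta>)"
      "\<forall>c \<eta> i. bdd_by c \<eta> \<longrightarrow> Gb \<eta> (i + 1) - Mb (Gb \<eta> i) = \<eta> i"
      "\<forall>c d \<eta> \<eta>' i. bdd_by c \<eta> \<longrightarrow> bdd_by d \<eta>' \<longrightarrow> Gb (\<lambda>i. \<eta> i - \<eta>' i) i = Gb \<eta> i - Gb \<eta>' i"
      "\<forall>b c (D :: int \<Rightarrow> 'v). bdd_by b D \<longrightarrow> bdd_by c (\<lambda>i. D (i + 1) - Mb (D i)) \<longrightarrow> bdd_by (Cb * c) D"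
    using hyperbolic_map_green[OF hyp(2)] .
  obtain K1 where K1: "\<forall>k\<ge>K1. norm (A (int k) - Mb) < \<delta> / Cb"
    using LIMSEQ_D[OF lim(1), of "\<delta> / Cb"] \<delta> Cb by auto
  obtain K2 where K2: "\<forall>k\<ge>K2. norm (A (- int k) - Ma) < \<delta> / Ca"
    using LIMSEQ_D[OF lim(2), of "\<delta> / Ca"] \<delta> Ca by auto
  \<comment> \<open>Beyond time \<open>K\<close> on either side the coefficients are so close to
    their limits that the Green operators commit an error of at most \<delta>.\<close>
  define K where "K = int (max 1 (max K1 K2))"
  have K: "K \<ge> 1" and K': "K1 \<le> nat K" "K2 \<le> nat K" by (simp_all add: K_def)
  have Kb: "norm (A k - Mb) \<le> \<delta> / Cb" if "k \<ge> K" for k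
  proof -
    have "K1 \<le> nat k" using K' that by linarith
    then show ?thesis using K1[rule_format, of "nat k"] that K by simp
  qed
  have Ka: "norm (A k - Ma) \<le> \<delta> / Ca" if "k \<le> - K" for k
  proof -
    have "K2 \<le> nat (- k)" using K' that by linarith
    then show ?thesis using K2[rule_format, of "nat (- k)"] that K by simp
  qed
  \<comment> \<open>Inputs at times \<open>i \<ge> K\<close> go to the Green operator of the right
    limit, those at times \<open>i < - K\<close> to that of the left limit.\<close>
  define cb where "cb = (\<lambda>(\<eta> :: int \<Rightarrow> 'v) i. if i \<ge> K then \<eta> i else 0)"
  define ca where "ca = (\<lambda>(\<eta> :: int \<Rightarrow> 'v) i. if i < - K then \<eta> i else 0)"
  define xb where "xb = (\<lambda>\<eta>. Gb (cb \<eta>))"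
  define xa where "xa = (\<lambda>\<eta>. Ga (ca \<eta>))"
  have cbd: "bdd_by c (cb \<eta>)" "bdd_by c (ca \<eta>)" if "bdd_by c \<eta>" for c \<eta>
    using that bdd_by_nonneg[OF that] by (auto simp: bdd_by_def cb_def ca_def)
  have xbd: "norm (xb \<eta> i) \<le> Cb * c" "norm (xa \<eta> i) \<le> Ca * c" if "bdd_by c \<eta>" for c \<eta> i
    using Ga(1) Gb(1) cbd[OF that] unfolding xa_def xb_def by (blast intro: bdd_byD)+
  have xeq: "xb \<eta> (i + 1) - Mb (xb \<eta> i) = cb \<eta> i" "xa \<eta> (i + 1) - Ma (xa \<eta> i) = ca \<eta> i"
    if "bdd_by c \<eta>" for c \<eta> i
    using Ga(2) Gb(2) cbd[OF that] unfolding xa_def xb_def by blast+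
  have xadd: "xb (\<lambda>i. \<eta> i - \<eta>' i) i = xb \<eta> i - xb \<eta>' i" "xa (\<lambda>i. \<eta> i - \<eta>' i) i = xa \<eta> i - xa \<eta>' i"
    if "bdd_by c \<eta>" "bdd_by d \<eta>'" for c d \<eta> \<eta>' i
  proof -
    have "cb (\<lambda>i. \<eta> i - \<eta>' i) = (\<lambda>i. cb \<eta> i - cb \<eta>' i)" "ca (\<lambda>i. \<eta> i - \<eta>' i) = (\<lambda>i. ca \<eta> i - ca \<eta>' i)"
      by (auto simp: cb_def ca_def)
    then show "xb (\<lambda>i. \<eta> i - \<eta>' i) i = xb \<eta> i - xb \<eta>' i" "xa (\<lambda>i. \<eta> i - \<eta>' i) i = xa \<eta> i - xa \<eta>' i"
      using Gb(3)[rule_format, OF cbd(1)[OF that(1)] cbd(1)[OF that(2)]]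
        Ga(3)[rule_format, OF cbd(2)[OF that(1)] cbd(2)[OF that(2)]] unfolding xa_def xb_def by simp_all
  qed
  \<comment> \<open>\<open>y \<eta> n\<close> is the value at time \<open>- K + int n\<close>: the
    exact solution on the middle interval, started from the left part.\<close>
  define y where "y = (\<lambda>\<eta>. rec_nat (xa \<eta> (- K)) (\<lambda>n v. A (- K + int n) v + \<eta> (- K + int n)))"
  have y0: "y \<eta> 0 = xa \<eta> (- K)" and yS: "y \<eta> (Suc n) = A (- K + int n) (y \<eta> n) + \<eta> (- K + int n)" for \<eta> n
    by (simp_all add: y_def)
  have yadd: "y (\<lambda>i. \<eta> i - \<eta>' i) n = y \<eta> n - y \<eta>' n" if "bdd_by c \<eta>" "bdd_by d \<eta>'" for c d \<eta> \<eta>' n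
    by (induction n) (simp_all add: y0 yS xadd(2)[OF that] blinfun.diff_right)
  have "\<exists>Y>0. \<forall>n\<le>N. \<forall>c \<eta>. bdd_by c \<eta> \<longrightarrow> norm (y \<eta> n) \<le> Y * c" for N
  proof (induction N)
    case 0
    show ?case using xbd(2) Ca by (intro exI[of _ Ca]) (auto simp: y0)
  next
    case (Suc N)
    then obtain Y where Y: "Y > 0" "\<forall>n\<le>N. \<forall>c \<eta>. bdd_by c \<eta> \<longrightarrow> norm (y \<eta> n) \<le> Y * c" by blast
    let ?q = "norm (A (- K + int N))"
    have s: "norm (y \<eta> (Suc N)) \<le> (?q * Y + 1 + Y) * c" if "bdd_by c \<eta>" for c \<eta>
    proof -
      have "norm (y \<eta> (Suc N)) \<le> norm (A (- K + int N) (y \<eta> N)) + norm (\<eta> (- K + int N))"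
        unfolding yS by (rule norm_triangle_ineq)
      also have "\<dots> \<le> ?q * (Y * c) + c"
        using Y(2) that by (intro add_mono order_trans[OF norm_blinfun] mult_left_mono) (auto intro: bdd_byD)
      also have "\<dots> \<le> (?q * Y + 1 + Y) * c" using Y(1) bdd_by_nonneg[OF that] by (simp add: algebra_simps)
      finally show ?thesis .
    qed
    have m: "Y * c \<le> (?q * Y + 1 + Y) * c" if "bdd_by c \<eta>" for c and \<eta> :: "int \<Rightarrow> 'v"
      using Y(1) bdd_by_nonneg[OF that] by (intro mult_right_mono) (auto intro: add_nonneg_nonneg)
    show ?case
    proof (intro exI[of _ "?q * Y + 1 + Y"] conjI allI impI)
      show "0 < ?q * Y + 1 + Y" using Y(1) by (simp add: add_nonneg_pos)
      fix n :: nat and c and \<eta> :: "int \<Rightarrow> 'v" assume n: "n \<le> Suc N" and b: "bdd_by c \<eta>"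
      show "norm (y \<eta> n) \<le> (?q * Y + 1 + Y) * c"
      proof (cases "n = Suc N")
        case False
        then have "norm (y \<eta> n) \<le> Y * c" using Y(2) n b by auto
        with m[OF b] show ?thesis by linarith
      qed (use s[OF b] in simp)
    qed
  qed
  from this[of "nat (2 * K)"] obtain Y where Y: "Y > 0" "\<forall>n\<le>nat (2 * K). \<forall>c \<eta>. bdd_by c \<eta> \<longrightarrow> norm (y \<eta> n) \<le> Y * c" by blast
  define W where "W = (\<lambda>\<eta>. y \<eta> (nat (2 * K)) - xb \<eta> K)"
  have Wbd: "norm (W \<eta>) \<le> (Y + Cb) * c" if "bdd_by c \<eta>" for c \<eta>
    using Y(2)[rule_format, OF _ that, of "nat (2 * K)"] xbd(1)[OF that, of K]
      norm_triangle_ineq4[of "y \<eta> (nat (2 * K))" "xb \<eta> K"] by (simp add: W_def algebra_simps)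
  obtain zs zu cz where "\<forall>w. zs w K + zu w K = w \<and>
     (\<forall>k\<ge>K. zs w (k + 1) = A k (zs w k)) \<and> (\<forall>k<K. zu w (k + 1) = A k (zu w k)) \<and>
     (\<forall>k\<ge>K. norm (zs w k) \<le> cz w) \<and> (\<forall>k\<le>K. norm (zu w k) \<le> cz w)"
    using dich[of K] unfolding dichotomous_at_def choice_iff by (elim exE)
  then have z: "\<And>w. zs w K + zu w K = w" "\<And>w k. k \<ge> K \<Longrightarrow> zs w (k + 1) = A k (zs w k)"
      "\<And>w k. k < K \<Longrightarrow> zu w (k + 1) = A k (zu w k)"
      "\<And>w k. k \<ge> K \<Longrightarrow> norm (zs w k) \<le> cz w" "\<And>w k. k \<le> K \<Longrightarrow> norm (zu w k) \<le> cz w"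
    by simp_all
  \<comment> \<open>The solutions chosen for each \<open>w\<close> need not depend linearly on it.
    Using only those for basis vectors and combining them linearly makes the correction additive and
    its bound uniform.\<close>
  define Zs where "Zs = (\<lambda>\<eta> k. \<Sum>b\<in>Basis. (W \<eta> \<bullet> b) *\<^sub>R zs b k)"
  define Zu where "Zu = (\<lambda>\<eta> k. \<Sum>b\<in>Basis. (W \<eta> \<bullet> b) *\<^sub>R zu b k)"
  define L where "L = (\<lambda>\<eta> k. (if k \<ge> - K then y \<eta> (nat (k + K)) else xa \<eta> k) - Zu \<eta> k)"
  define R where "R = (\<lambda>\<eta> k. if k \<ge> K then xb \<eta> k + Zs \<eta> k else L \<eta> k)"
  have ZK: "Zs \<eta> K + Zu \<eta> K = W \<eta>" for \<eta>
    unfolding Zs_def Zu_def sum.distrib[symmetric] scaleR_add_right[symmetric] z(1)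
    by (rule euclidean_representation)
  \<comment> \<open>Subtracting the backward bounded part on the left and adding the forward bounded
    part on the right closes the mismatch \<open>W\<close> exactly at time \<open>K\<close>.\<close>
  have RK: "R \<eta> K = L \<eta> K" for \<eta>
    using ZK[of \<eta>] K by (simp add: R_def L_def W_def algebra_simps)
  have ZsS: "Zs \<eta> (k + 1) = A k (Zs \<eta> k)" if "k \<ge> K" for \<eta> k
    using that by (simp add: Zs_def z(2) blinfun.sum_right blinfun.scaleR_right)
  have ZuS: "Zu \<eta> (k + 1) = A k (Zu \<eta> k)" if "k < K" for \<eta> k
    using that by (simp add: Zu_def z(3) blinfun.sum_right blinfun.scaleR_right)
  define cZ where "cZ = (\<Sum>b\<in>Basis. \<bar>cz b\<bar>)"
  have cZ: "cZ \<ge> 0" by (simp add: cZ_def sum_nonneg)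
  have Zbd: "norm (\<Sum>b\<in>Basis. (W \<eta> \<bullet> b) *\<^sub>R h b) \<le> (Y + Cb) * cZ * c"
    if "bdd_by c \<eta>" "\<And>b. norm (h b) \<le> cz b" for c \<eta> and h :: "'v \<Rightarrow> 'v"
  proof -
    have "norm (\<Sum>b\<in>Basis. (W \<eta> \<bullet> b) *\<^sub>R h b) \<le> (\<Sum>b\<in>Basis. norm ((W \<eta> \<bullet> b) *\<^sub>R h b))"
      by (rule norm_sum)
    also have "\<dots> \<le> (\<Sum>b\<in>Basis. ((Y + Cb) * c) * \<bar>cz b\<bar>)"
    proof (rule sum_mono)
      fix b :: 'v assume b: "b \<in> Basis"
      have "\<bar>W \<eta> \<bullet> b\<bar> \<le> (Y + Cb) * c" using Basis_le_norm[OF b] Wbd[OF that(1)] by (rule order_trans)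
      moreover have "norm (h b) \<le> \<bar>cz b\<bar>" using that(2)[of b] by linarith
      ultimately show "norm ((W \<eta> \<bullet> b) *\<^sub>R h b) \<le> ((Y + Cb) * c) * \<bar>cz b\<bar>"
        unfolding norm_scaleR by (intro mult_mono) (auto intro: order_trans)
    qed
    also have "\<dots> = (Y + Cb) * cZ * c" unfolding sum_distrib_left[symmetric] cZ_def by simp
    finally show ?thesis .
  qed
  define C where "C = Ca + Cb + Y + (Y + Cb) * cZ"
  have C: "C > 0" using Ca Cb Y(1) cZ unfolding C_def by (simp add: add_pos_nonneg)
  have Rbd: "norm (R \<eta> k) \<le> C * c" if b: "bdd_by c \<eta>" for c \<eta> k
  proof -
    note c = bdd_by_nonneg[OF b]
    have p: "0 \<le> Ca * c" "0 \<le> Cb * c" "0 \<le> Y * c" using c Ca Cb Y(1) by auto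
    show ?thesis
    proof (cases "k \<ge> K")
      case True
      have "norm (R \<eta> k) \<le> norm (xb \<eta> k) + norm (Zs \<eta> k)"
        using True by (simp add: R_def norm_triangle_ineq)
      also have "\<dots> \<le> Cb * c + (Y + Cb) * cZ * c"
        unfolding Zs_def using True by (intro add_mono xbd[OF b] Zbd[OF b] z(4))
      finally show ?thesis using p by (simp add: C_def algebra_simps)
    next
      case False
      have "norm (R \<eta> k) \<le> norm (if k \<ge> - K then y \<eta> (nat (k + K)) else xa \<eta> k) + norm (Zu \<eta> k)"
        using False by (simp only: R_def L_def if_False norm_triangle_ineq4)
      also have "\<dots> \<le> (Ca * c + Y * c) + (Y + Cb) * cZ * c"
      proof (rule add_mono)
        have "nat (k + K) \<le> nat (2 * K)" using False by linarith
        then show "norm (if k \<ge> - K then y \<eta> (nat (k + K)) else xa \<eta> k) \<le> Ca * c + Y * c"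
          using Y(2)[rule_format, OF _ b, of "nat (k + K)"] xbd(2)[OF b, of k] p by auto
        show "norm (Zu \<eta> k) \<le> (Y + Cb) * cZ * c"
          unfolding Zu_def using False by (intro Zbd[OF b] z(5)) auto
      qed
      finally show ?thesis using p by (simp add: C_def algebra_simps)
    qed
  qed
  have Rerr: "norm (R \<eta> (i + 1) - A i (R \<eta> i) - \<eta> i) \<le> \<delta> * c" if b: "bdd_by c \<eta>" for c \<eta> i
  proof -
    note c = bdd_by_nonneg[OF b]
    consider "i \<ge> K" | "- K \<le> i" "i < K" | "i < - K" by linarith
    then show ?thesis
    proof cases
      case 1
      have "R \<eta> (i + 1) - A i (R \<eta> i) - \<eta> i = xb \<eta> (i + 1) - A i (xb \<eta> i) - \<eta> i"
        using 1 ZsS[OF 1, of \<eta>] by (simp add: R_def blinfun.add_right)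
      also have "\<dots> = - ((A i - Mb) (xb \<eta> i))"
        using xeq(1)[OF b, of i] 1 by (simp add: cb_def blinfun.diff_left algebra_simps)
      finally have "norm (R \<eta> (i + 1) - A i (R \<eta> i) - \<eta> i) \<le> norm (A i - Mb) * norm (xb \<eta> i)"
        by (simp add: norm_blinfun)
      also have "\<dots> \<le> (\<delta> / Cb) * (Cb * c)"
        using Kb[OF 1] xbd(1)[OF b, of i] \<delta> Cb by (intro mult_mono) auto
      finally show ?thesis using Cb by simp
    next
      case 2
      have 3: "R \<eta> (i + 1) = L \<eta> (i + 1)" using RK[of \<eta>] 2 by (cases "i + 1 = K") (auto simp: R_def)
      have "nat (i + 1 + K) = Suc (nat (i + K))" using 2 by linarith
      then have "L \<eta> (i + 1) = A i (y \<eta> (nat (i + K))) + \<eta> i - A i (Zu \<eta> i)"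
        using 2 by (simp add: L_def yS ZuS)
      then have "R \<eta> (i + 1) - A i (R \<eta> i) - \<eta> i = 0"
        unfolding 3 using 2 by (simp add: R_def L_def blinfun.diff_right)
      then show ?thesis using \<delta> c by simp
    next
      case 3
      have "(if i + 1 \<ge> - K then y \<eta> (nat (i + 1 + K)) else xa \<eta> (i + 1)) = xa \<eta> (i + 1)"
        using 3 y0 by (cases "i + 1 = - K") auto
      then have "L \<eta> (i + 1) = xa \<eta> (i + 1) - A i (Zu \<eta> i)"
        using 3 K by (simp add: L_def ZuS)
      then have "R \<eta> (i + 1) - A i (R \<eta> i) - \<eta> i = xa \<eta> (i + 1) - A i (xa \<eta> i) - \<eta> i"
        using 3 K by (simp add: R_def L_def blinfun.diff_right)
      also have "\<dots> = - ((A i - Ma) (xa \<eta> i))"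
        using xeq(2)[OF b, of i] 3 by (simp add: ca_def blinfun.diff_left algebra_simps)
      finally have "norm (R \<eta> (i + 1) - A i (R \<eta> i) - \<eta> i) \<le> norm (A i - Ma) * norm (xa \<eta> i)"
        by (simp add: norm_blinfun)
      also have "\<dots> \<le> (\<delta> / Ca) * (Ca * c)"
        using Ka[of i] 3 xbd(2)[OF b, of i] \<delta> Ca by (intro mult_mono) auto
      finally show ?thesis using Ca by simp
    qed
  qed
  have Radd: "R (\<lambda>i. \<eta> i - \<eta>' i) k = R \<eta> k - R \<eta>' k" if "bdd_by c \<eta>" "bdd_by d \<eta>'" for c d \<eta> \<eta>' k
  proof -
    have W: "W (\<lambda>i. \<eta> i - \<eta>' i) = W \<eta> - W \<eta>'" by (simp add: W_def yadd[OF that] xadd[OF that])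
    have "Zs (\<lambda>i. \<eta> i - \<eta>' i) k = Zs \<eta> k - Zs \<eta>' k" "Zu (\<lambda>i. \<eta> i - \<eta>' i) k = Zu \<eta> k - Zu \<eta>' k" 
      by (simp_all add: Zs_def Zu_def W inner_diff_left scaleR_diff_left sum_subtractf)
    then show ?thesis by (simp add: R_def L_def yadd[OF that] xadd[OF that])
  qed
  have "approx_right_inverse A \<delta> C R"
    unfolding approx_right_inverse_def
  proof (intro conjI allI impI)
    show "bdd_by (C * c) (R \<eta>)" if "bdd_by c \<eta>" for c \<eta>
      unfolding bdd_by_def using Rbd[OF that] by simp
    show "bdd_by (\<delta> * c) (\<lambda>i. R \<eta> (i + 1) - A i (R \<eta> i) - \<eta> i)" if "bdd_by c \<eta>" for c \<eta>
      unfolding bdd_by_def using Rerr[OF that] by simp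
  qed (rule Radd)
  with C show ?thesis by blast
qed

section \<open>Shadowing pseudo-orbits\<close>

text \<open>Slowly varying cut-offs at scale \<open>w\<close> around the time windows \<open>{i. J i = j}\<close> patch the approximate
  inverses of the pieces; each switch between windows costs \<open>C / w\<close>.\<close>

lemma approx_right_inverse_glue:
  fixes B :: "nat \<Rightarrow> int \<Rightarrow> 'v::real_normed_vector \<Rightarrow>\<^sub>L 'v" and t :: "nat \<Rightarrow> int" and J :: "int \<Rightarrow> nat"
  assumes R: "\<And>j. j < L \<Longrightarrow> approx_right_inverse (B j) \<delta> C (R j)" and C: "0 \<le> C" and w: "0 < w" and \<delta>': "0 \<le> \<delta>'"
    and J: "\<And>i. J i < L" and ne: "\<And>j. j < L \<Longrightarrow> \<exists>i. J i = j"
    and close: "\<And>i i'. \<bar>real_of_int i - real_of_int i'\<bar> < w \<Longrightarrow>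
        norm (B (J i') (i - t (J i')) - B (J i) (i - t (J i))) \<le> \<delta>'"
  shows "\<exists>S. approx_right_inverse (\<lambda>i. B (J i) (i - t (J i))) (L * (C / w + \<delta> + C * \<delta>')) (L * C) S"
proof -
  define W where "W = (\<lambda>j. real_of_int ` {i. J i = j})"
  \<comment> \<open>Tent functions that are 1 on the window and vanish from distance
    \<open>w\<close> on. Several may be nonzero at one time, whence the factor \<open>L\<close> in
    the bounds.\<close>
  define \<phi> where "\<phi> = (\<lambda>j i. max 0 (1 - infdist (real_of_int i) (W j) / w))"
  have \<phi>01: "0 \<le> \<phi> j i" "\<phi> j i \<le> 1" for j i
    using w infdist_nonneg[of "real_of_int i" "W j"] by (auto simp: \<phi>_def)
  have \<phi>1: "\<phi> (J i) i = 1" for i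
    by (simp add: \<phi>_def W_def)
  have \<phi>lip: "\<bar>\<phi> j (i + 1) - \<phi> j i\<bar> \<le> 1 / w" for j i
  proof -
    have "infdist (real_of_int (i + 1)) (W j) \<le> infdist (real_of_int i) (W j) + dist (real_of_int (i + 1)) (real_of_int i)"
      "infdist (real_of_int i) (W j) \<le> infdist (real_of_int (i + 1)) (W j) + dist (real_of_int i) (real_of_int (i + 1))"
      by (rule infdist_triangle)+
    then have "\<bar>infdist (real_of_int (i + 1)) (W j) - infdist (real_of_int i) (W j)\<bar> \<le> 1"
      by (simp add: dist_real_def)
    then have "\<bar>infdist (real_of_int (i + 1)) (W j) / w - infdist (real_of_int i) (W j) / w\<bar> \<le> 1 / w"
      using w by (simp add: diff_divide_distrib[symmetric] abs_divide divide_right_mono)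
    then show ?thesis unfolding \<phi>_def by linarith
  qed
  have \<phi>supp: "norm (B j (i - t j) - B (J i) (i - t (J i))) \<le> \<delta>'" if "j < L" "\<phi> j i \<noteq> 0" for j i
  proof -
    have "infdist (real_of_int i) (W j) < w"
    proof (rule ccontr)
      assume "\<not> infdist (real_of_int i) (W j) < w"
      then have "1 \<le> infdist (real_of_int i) (W j) / w" using w by (simp add: le_divide_eq)
      then show False using that(2) by (simp add: \<phi>_def)
    qed
    moreover have "W j \<noteq> {}" using ne[OF that(1)] by (auto simp: W_def)
    ultimately obtain x where "x \<in> W j" "dist (real_of_int i) x < w"
      by (auto simp: infdist_def cINF_less_iff bdd_below.I[of _ 0] split: if_splits)
    then obtain i' where "J i' = j" "\<bar>real_of_int i - real_of_int i'\<bar> < w"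
      by (auto simp: W_def dist_real_def)
    then show ?thesis using close by blast
  qed
  \<comment> \<open>Each piece receives the part of the input that lies in its own window, expressed
    in its own time.\<close>
  define sh where "sh = (\<lambda>j (\<eta> :: int \<Rightarrow> 'v) k. if J (k + t j) = j then \<eta> (k + t j) else 0)"
  have shb: "bdd_by c (sh j \<eta>)" if "bdd_by c \<eta>" for c j \<eta>
    using that bdd_by_nonneg[OF that] by (auto simp: bdd_by_def sh_def)
  have shd: "sh j (\<lambda>i. \<eta> i - \<eta>' i) = (\<lambda>i. sh j \<eta> i - sh j \<eta>' i)" for j \<eta> \<eta>'
    by (auto simp: sh_def)
  define S where "S = (\<lambda>\<eta> i. \<Sum>j<L. \<phi> j i *\<^sub>R R j (sh j \<eta>) (i - t j))"
  have R1: "norm (R j (sh j \<eta>) k) \<le> C * c" if "j < L" "bdd_by c \<eta>" for j c \<eta> k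
    using R[OF that(1)] shb[OF that(2)] unfolding approx_right_inverse_def by (blast intro: bdd_byD)
  have R2: "norm (R j (sh j \<eta>) (k + 1) - B j k (R j (sh j \<eta>) k) - sh j \<eta> k) \<le> \<delta> * c"
    if "j < L" "bdd_by c \<eta>" for j c \<eta> k
  proof -
    have "bdd_by (\<delta> * c) (\<lambda>i. R j (sh j \<eta>) (i + 1) - B j i (R j (sh j \<eta>) i) - sh j \<eta> i)"
      using R[OF that(1)] shb[OF that(2)] unfolding approx_right_inverse_def by blast
    from bdd_byD[OF this] show ?thesis .
  qed
  have "approx_right_inverse (\<lambda>i. B (J i) (i - t (J i))) (L * (C / w + \<delta> + C * \<delta>')) (L * C) S"
    unfolding approx_right_inverse_def
  proof (intro conjI allI impI)
    fix c and \<eta> :: "int \<Rightarrow> 'v" assume b: "bdd_by c \<eta>"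
    note c = bdd_by_nonneg[OF b]
    show "bdd_by (real L * C * c) (S \<eta>)"
      unfolding bdd_by_def
    proof
      fix i
      have "norm (S \<eta> i) \<le> (\<Sum>j<L. norm (\<phi> j i *\<^sub>R R j (sh j \<eta>) (i - t j)))"
        unfolding S_def by (rule norm_sum)
      also have "\<dots> \<le> (\<Sum>j<L. C * c)"
      proof (rule sum_mono)
        fix j assume "j \<in> {..<L}"
        then have "\<phi> j i * norm (R j (sh j \<eta>) (i - t j)) \<le> 1 * (C * c)"
          using \<phi>01 R1[OF _ b] by (intro mult_mono) auto
        then show "norm (\<phi> j i *\<^sub>R R j (sh j \<eta>) (i - t j)) \<le> C * c" using \<phi>01 by simp
      qed
      finally show "norm (S \<eta> i) \<le> real L * C * c" by simp
    qed
    show "bdd_by (real L * (C / w + \<delta> + C * \<delta>') * c)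
            (\<lambda>i. S \<eta> (i + 1) - blinfun_apply (B (J i) (i - t (J i))) (S \<eta> i) - \<eta> i)"
      unfolding bdd_by_def
    proof
      fix i
      let ?A = "B (J i) (i - t (J i))"
      let ?u = "\<lambda>j i. R j (sh j \<eta>) (i - t j)"
      \<comment> \<open>Three sources of error: the variation of the cut-off, the defect of the
        approximate inverse of the piece, and the difference between the linear map of piece
        \<open>j\<close> and the one in force at time \<open>i\<close>.\<close>
      let ?e = "\<lambda>j. (\<phi> j (i + 1) - \<phi> j i) *\<^sub>R ?u j (i + 1)
          + \<phi> j i *\<^sub>R (?u j (i + 1) - B j (i - t j) (?u j i) - sh j \<eta> (i - t j))
          + \<phi> j i *\<^sub>R ((B j (i - t j) - ?A) (?u j i))"
      have "(\<Sum>j<L. \<phi> j i *\<^sub>R sh j \<eta> (i - t j)) = (\<Sum>j<L. if j = J i then \<eta> i else 0)"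
        by (rule sum.cong) (auto simp: sh_def \<phi>1)
      then have \<eta>: "\<eta> i = (\<Sum>j<L. \<phi> j i *\<^sub>R sh j \<eta> (i - t j))" using J by simp
      have "S \<eta> (i + 1) - ?A (S \<eta> i) - \<eta> i =
         (\<Sum>j<L. \<phi> j (i + 1) *\<^sub>R ?u j (i + 1) - \<phi> j i *\<^sub>R ?A (?u j i) - \<phi> j i *\<^sub>R sh j \<eta> (i - t j))"
        unfolding S_def \<eta> by (simp add: blinfun.sum_right blinfun.scaleR_right sum_subtractf)
      also have "\<dots> = (\<Sum>j<L. ?e j)"
        by (rule sum.cong) (auto simp: blinfun.diff_left algebra_simps)
      finally have eq: "S \<eta> (i + 1) - ?A (S \<eta> i) - \<eta> i = (\<Sum>j<L. ?e j)" .
      have "norm (S \<eta> (i + 1) - ?A (S \<eta> i) - \<eta> i) \<le> (\<Sum>j<L. norm (?e j))"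
        unfolding eq by (rule norm_sum)
      also have "\<dots> \<le> (\<Sum>j<L. (C / w + \<delta> + C * \<delta>') * c)"
      proof (rule sum_mono)
        fix j assume "j \<in> {..<L}"
        then have j: "j < L" by simp
        have 1: "norm ((\<phi> j (i + 1) - \<phi> j i) *\<^sub>R ?u j (i + 1)) \<le> (1 / w) * (C * c)"
          unfolding norm_scaleR using \<phi>lip R1[OF j b] w by (intro mult_mono) auto
        have "norm (\<phi> j i *\<^sub>R (?u j (i + 1) - B j (i - t j) (?u j i) - sh j \<eta> (i - t j))) \<le> 1 * (\<delta> * c)"
          unfolding norm_scaleR using \<phi>01[of j i] R2[OF j b, of "i - t j"]
          by (intro mult_mono) (auto simp: algebra_simps)
        moreover have "norm (\<phi> j i *\<^sub>R ((B j (i - t j) - ?A) (?u j i))) \<le> \<delta>' * (C * c)"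
        proof (cases "\<phi> j i = 0")
          case False
          have "norm ((B j (i - t j) - ?A) (?u j i)) \<le> norm (B j (i - t j) - ?A) * norm (?u j i)"
            by (rule norm_blinfun)
          also have "\<dots> \<le> \<delta>' * (C * c)"
            using \<phi>supp[OF j False] R1[OF j b] \<delta>' by (intro mult_mono) auto
          finally have "\<bar>\<phi> j i\<bar> * norm ((B j (i - t j) - ?A) (?u j i)) \<le> 1 * (\<delta>' * (C * c))"
            using \<phi>01[of j i] by (intro mult_mono) auto
          then show ?thesis by simp
        qed (use \<delta>' C c in simp)
        ultimately have "norm (?e j) \<le> (1 / w) * (C * c) + 1 * (\<delta> * c) + \<delta>' * (C * c)"
          using 1 by (intro norm_triangle_le add_mono) auto
        then show "norm (?e j) \<le> (C / w + \<delta> + C * \<delta>') * c" by (simp add: algebra_simps)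
      qed
      finally show "norm (S \<eta> (i + 1) - ?A (S \<eta> i) - \<eta> i) \<le> real L * (C / w + \<delta> + C * \<delta>') * c"
        by simp
    qed
  next
    fix c d and \<eta> \<eta>' :: "int \<Rightarrow> 'v" and i assume b: "bdd_by c \<eta>" "bdd_by d \<eta>'"
    have "R j (sh j (\<lambda>i. \<eta> i - \<eta>' i)) k = R j (sh j \<eta>) k - R j (sh j \<eta>') k" if "j < L" for j k
      unfolding shd using R[OF that] shb[OF b(1), of j] shb[OF b(2), of j] unfolding approx_right_inverse_def by blast
    then show "S (\<lambda>i. \<eta> i - \<eta>' i) i = S \<eta> i - S \<eta>' i"
      by (simp add: S_def sum_subtractf[symmetric] scaleR_diff_right)
  qed
  then show ?thesis by blast
qed

text \<open>Solved for \<open>\<eta>\<close> with \<open>\<xi> = R \<eta>\<close>, the orbit equation becomes a fixed point equation for a contraction.\<close>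

lemma pseudo_orbit_shadowing:
  fixes A :: "int \<Rightarrow> 'v::banach \<Rightarrow>\<^sub>L 'v"
  assumes R: "approx_right_inverse A (1 / 4) C R" and C: "C > 0" and r: "r > 0"
    and lip: "\<And>i u v. norm (u - z i) \<le> r \<Longrightarrow> norm (v - z i) \<le> r \<Longrightarrow>
        norm (g i u - g i v - A i (u - v)) \<le> 1 / (4 * C) * norm (u - v)"
    and jump: "\<And>i. norm (g i (z i) - z (i + 1)) \<le> r / (2 * C)"
  shows "\<exists>\<xi>. bdd_by r \<xi> \<and> (\<forall>i. g i (z i + \<xi> i) = z (i + 1) + \<xi> (i + 1))"
proof -
  \<comment> \<open>\<open>R\<close> takes inputs bounded by \<rho> to displacements bounded by
    \<open>r\<close>, where the estimate on \<open>g\<close> applies.\<close>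
  define \<rho> where "\<rho> = r / C"
  have \<rho>: "\<rho> > 0" "C * \<rho> = r" using r C by (auto simp: \<rho>_def)
  define \<Phi> where "\<Phi> = (\<lambda>\<eta> i. \<eta> i - R \<eta> (i + 1) + g i (z i + R \<eta> i) - z (i + 1))"
  have Rb: "norm (R \<eta> i) \<le> C * c" if "bdd_by c \<eta>" for c \<eta> i
    using R that unfolding approx_right_inverse_def by (blast intro: bdd_byD)
  \<comment> \<open>One quarter comes from the error of \<open>R\<close> and one quarter from the
    nonlinearity; the remaining half of \<rho> absorbs the jumps.\<close>
  have contr: "norm (\<Phi> \<eta> i - \<Phi> \<eta>' i) \<le> 1 / 2 * c"
    if b: "bdd_by \<rho> \<eta>" "bdd_by \<rho> \<eta>'" and d: "bdd_by c (\<lambda>i. \<eta> i - \<eta>' i)" for c \<eta> \<eta>' i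
  proof -
    let ?d = "\<lambda>i. \<eta> i - \<eta>' i"
    have Rd: "R ?d i = R \<eta> i - R \<eta>' i" for i
      using R b unfolding approx_right_inverse_def by blast
    have 1: "norm (R ?d (i + 1) - A i (R ?d i) - ?d i) \<le> 1 / 4 * c"
    proof -
      have "bdd_by (1 / 4 * c) (\<lambda>i. R ?d (i + 1) - A i (R ?d i) - ?d i)"
        using R d unfolding approx_right_inverse_def by blast
      from bdd_byD[OF this] show ?thesis .
    qed
    have "norm (g i (z i + R \<eta> i) - g i (z i + R \<eta>' i) - A i ((z i + R \<eta> i) - (z i + R \<eta>' i)))
        \<le> 1 / (4 * C) * norm ((z i + R \<eta> i) - (z i + R \<eta>' i))"
      using Rb[OF b(1), of i] Rb[OF b(2), of i] \<rho> by (intro lip) auto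
    also have "\<dots> = 1 / (4 * C) * norm (R ?d i)" by (simp add: Rd)
    also have "\<dots> \<le> 1 / (4 * C) * (C * c)" using Rb[OF d, of i] C by (intro mult_left_mono) auto
    finally have 2: "norm (g i (z i + R \<eta> i) - g i (z i + R \<eta>' i) - A i (R ?d i)) \<le> 1 / 4 * c"
      using C by (simp add: Rd)
    have "\<Phi> \<eta> i - \<Phi> \<eta>' i = - (R ?d (i + 1) - A i (R ?d i) - ?d i)
        + (g i (z i + R \<eta> i) - g i (z i + R \<eta>' i) - A i (R ?d i))"
      by (simp add: \<Phi>_def Rd algebra_simps)
    then have "norm (\<Phi> \<eta> i - \<Phi> \<eta>' i) \<le> 1 / 4 * c + 1 / 4 * c"
      using 1 2 by (metis (no_types, lifting) norm_minus_cancel norm_triangle_mono)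
    then show ?thesis by simp
  qed
  have b0: "bdd_by 0 (\<lambda>_::int. 0::'v)" by (simp add: bdd_by_def)
  have R0: "R (\<lambda>_. 0) i = 0" for i using Rb[OF b0, of i] by simp
  have self: "bdd_by \<rho> (\<Phi> \<eta>)" if b: "bdd_by \<rho> \<eta>" for \<eta>
    unfolding bdd_by_def
  proof
    fix i
    have "norm (\<Phi> (\<lambda>_. 0) i) \<le> \<rho> / 2"
      using jump[of i] by (simp add: \<Phi>_def R0 \<rho>_def)
    moreover have "norm (\<Phi> \<eta> i - \<Phi> (\<lambda>_. 0) i) \<le> 1 / 2 * \<rho>"
      using b \<rho> by (intro contr) (auto simp: bdd_by_def)
    ultimately show "norm (\<Phi> \<eta> i) \<le> \<rho>"
      using norm_triangle_ineq2[of "\<Phi> \<eta> i" "\<Phi> (\<lambda>_. 0) i"] by linarith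
  qed
  \<comment> \<open>Picard iteration on sequences, with estimates uniform in \<open>i\<close> and
    limits taken separately at each \<open>i\<close>.\<close>
  define \<eta> where "\<eta> = (\<lambda>n. (\<Phi> ^^ n) (\<lambda>_. 0))"
  have \<eta>S: "\<eta> (Suc n) = \<Phi> (\<eta> n)" for n by (simp add: \<eta>_def)
  have \<eta>b: "bdd_by \<rho> (\<eta> n)" for n
    by (induction n) (use \<rho> self in \<open>auto simp: \<eta>S \<eta>_def bdd_by_def\<close>)
  have step: "norm (\<eta> (Suc n) i - \<eta> n i) \<le> \<rho> * (1 / 2) ^ n" for n i
  proof (induction n arbitrary: i)
    case 0
    show ?case using bdd_byD[OF \<eta>b[of 1], of i] by (simp add: \<eta>_def)
  next
    case (Suc n)
    then have "bdd_by (\<rho> * (1 / 2) ^ n) (\<lambda>i. \<eta> (Suc n) i - \<eta> n i)" by (simp add: bdd_by_def)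
    from contr[OF \<eta>b \<eta>b this, of i] show ?case by (simp add: \<eta>S)
  qed
  have cau: "norm (\<eta> (n + k) i - \<eta> n i) \<le> 2 * \<rho> * (1 / 2) ^ n - 2 * \<rho> * (1 / 2) ^ (n + k)" for n k i
  proof (induction k)
    case (Suc k)
    have "norm (\<eta> (n + Suc k) i - \<eta> n i) \<le> norm (\<eta> (Suc (n + k)) i - \<eta> (n + k) i) + norm (\<eta> (n + k) i - \<eta> n i)"
      using norm_triangle_ineq[of "\<eta> (Suc (n + k)) i - \<eta> (n + k) i" "\<eta> (n + k) i - \<eta> n i"] by simp
    with Suc step[of "n + k" i] show ?case by simp
  qed simp
  define h where "h = (\<lambda>i. lim (\<lambda>n. \<eta> n i))"
  have lim: "(\<lambda>n. \<eta> n i) \<longlonglongrightarrow> h i" for i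
  proof -
    have "summable (\<lambda>n. \<eta> (Suc n) i - \<eta> n i)"
      by (rule summable_comparison_test'[of "\<lambda>n. \<rho> * (1 / 2) ^ n"])
        (use step in \<open>auto intro!: summable_mult summable_geometric\<close>)
    then have "(\<lambda>n. \<Sum>k<n. \<eta> (Suc k) i - \<eta> k i) \<longlonglongrightarrow> (\<Sum>n. \<eta> (Suc n) i - \<eta> n i)"
      by (rule summable_LIMSEQ)
    then have "(\<lambda>n. \<eta> n i - \<eta> 0 i) \<longlonglongrightarrow> (\<Sum>n. \<eta> (Suc n) i - \<eta> n i)"
      using sum_lessThan_telescope[of "\<lambda>n. \<eta> n i"] by simp
    from tendsto_add[OF this tendsto_const[of "\<eta> 0 i"]] have "convergent (\<lambda>n. \<eta> n i)"
      by (auto simp: convergent_def)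
    then show ?thesis unfolding h_def convergent_LIMSEQ_iff .
  qed
  have tail: "norm (h i - \<eta> n i) \<le> 2 * \<rho> * (1 / 2) ^ n" for n i
  proof (rule LIMSEQ_le_const2)
    have "(\<lambda>k. \<eta> (k + n) i) \<longlonglongrightarrow> h i" using lim by (rule LIMSEQ_ignore_initial_segment)
    then show "(\<lambda>k. norm (\<eta> (k + n) i - \<eta> n i)) \<longlonglongrightarrow> norm (h i - \<eta> n i)"
      by (intro tendsto_intros)
    have "norm (\<eta> (k + n) i - \<eta> n i) \<le> 2 * \<rho> * (1 / 2) ^ n" for k
    proof -
      have "0 \<le> 2 * \<rho> * (1 / 2) ^ (n + k)" using \<rho> by simp
      with cau[of n k i] show ?thesis by (simp add: add.commute)
    qed
    then show "\<exists>N. \<forall>k\<ge>N. norm (\<eta> (k + n) i - \<eta> n i) \<le> 2 * \<rho> * (1 / 2) ^ n" by blast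
  qed
  have hb: "bdd_by \<rho> h"
    unfolding bdd_by_def
    using LIMSEQ_le_const2[OF tendsto_norm[OF lim]] bdd_byD[OF \<eta>b] by blast
  have fixed: "\<Phi> h i = h i" for i
  proof -
    have "norm (\<Phi> h i - h i) \<le> 2 * \<rho> * (1 / 2) ^ n" for n
    proof -
      have "norm (\<Phi> h i - \<Phi> (\<eta> n) i) \<le> 1 / 2 * (2 * \<rho> * (1 / 2) ^ n)"
        using tail by (intro contr hb \<eta>b) (simp add: bdd_by_def)
      moreover have "norm (\<eta> (Suc n) i - h i) \<le> 2 * \<rho> * (1 / 2) ^ Suc n"
        using tail[of i "Suc n"] by (simp add: norm_minus_commute)
      ultimately show ?thesis
        using norm_triangle_ineq[of "\<Phi> h i - \<Phi> (\<eta> n) i" "\<eta> (Suc n) i - h i"] by (simp add: \<eta>S)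
    qed
    moreover have "(\<lambda>n. 2 * \<rho> * (1 / 2) ^ n) \<longlonglongrightarrow> 0"
      by (intro tendsto_mult_right_zero LIMSEQ_realpow_zero) auto
    ultimately have "norm (\<Phi> h i - h i) \<le> 0" by (intro LIMSEQ_le_const) auto
    then show ?thesis by simp
  qed
  show ?thesis
  proof (intro exI[of _ "R h"] conjI allI)
    show "bdd_by r (R h)" unfolding bdd_by_def using Rb[OF hb] \<rho> by simp
    show "g i (z i + R h i) = z (i + 1) + R h (i + 1)" for i
      using fixed[of i] by (simp add: \<Phi>_def algebra_simps)
  qed
qed

section \<open>Transition times and concatenated heteroclinic orbits\<close>

definition separated :: "nat \<Rightarrow> (nat \<Rightarrow> int) \<Rightarrow> int \<Rightarrow> bool" where
  "separated L t T \<longleftrightarrow> (\<forall>j. Suc j < L \<longrightarrow> t j + T \<le> t (Suc j))"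

text \<open>Piece \<open>j\<close> is centred at time \<open>t j\<close>. Following the nearest
  centre puts each switch midway, where for well separated centres both pieces are close to their
  common limit. Ties may be resolved either way.\<close>

definition nearest :: "nat \<Rightarrow> (nat \<Rightarrow> int) \<Rightarrow> (int \<Rightarrow> nat) \<Rightarrow> bool" where
  "nearest L t J \<longleftrightarrow> (\<forall>i. J i < L \<and> (\<forall>j<L. \<bar>i - t (J i)\<bar> \<le> \<bar>i - t j\<bar>))"

lemma nearest_exists: "L > 0 \<Longrightarrow> \<exists>J. nearest L t J"
proof -
  assume "L > 0"
  then have "\<exists>m. m < L \<and> (\<forall>j<L. \<bar>i - t m\<bar> \<le> \<bar>i - t j\<bar>)" for i
    using ex_min_if_finite[of "(\<lambda>j. \<bar>i - t j\<bar>) ` {..<L}"] by (fastforce simp: not_less)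
  then show ?thesis unfolding nearest_def by metis
qed

lemma separated_less:
  assumes "separated L t T" "T \<ge> 0" "j < j'" "j' < L"
  shows "t j + T \<le> t j'"
  using assms(3,4)
proof (induction j')
  case (Suc j')
  have "t j' + T \<le> t (Suc j')" using assms(1) Suc.prems by (simp add: separated_def)
  then show ?case using Suc assms(2) by (cases "j = j'") auto
qed simp

lemma nearest_centre:
  assumes "separated L t T" "T > 0" "nearest L t J" "j < L"
  shows "J (t j) = j"
proof -
  have "\<bar>t j - t (J (t j))\<bar> \<le> \<bar>t j - t j\<bar>" "J (t j) < L"
    using assms(3,4) unfolding nearest_def by blast+
  then have "t (J (t j)) = t j" by simp
  with separated_less[OF assms(1), of j "J (t j)"] separated_less[OF assms(1), of "J (t j)" j] assms \<open>J (t j) < L\<close>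
  show ?thesis by (metis less_add_same_cancel1 less_imp_le linorder_not_less nat_neq_iff)
qed

text \<open>The midpoint of the two centres lies between \<open>p\<close> and \<open>q\<close> and
  is at least \<open>T / 2 \<ge> N + l\<close> away from each centre. A further centre in between
  would be nearer to \<open>p\<close>.\<close>

lemma nearest_switch:
  assumes sep: "separated L t T" and near: "nearest L t J"
    and T: "2 * N + 2 * l \<le> T" "0 < N" "0 \<le> l"
    and pq: "J p < J q" "\<bar>p - q\<bar> \<le> l"
  shows "J q = Suc (J p)" "p \<le> q" "t (J p) + N \<le> p" "q \<le> t (J q) - N"
proof -
  have L: "J q < L" "J p < L" using near by (auto simp: nearest_def)
  have lt: "t (J p) + T \<le> t (J q)" using separated_less[OF sep _ pq(1) L(1)] T by linarith
  have n: "\<bar>p - t (J p)\<bar> \<le> \<bar>p - t (J q)\<bar>" "\<bar>q - t (J q)\<bar> \<le> \<bar>q - t (J p)\<bar>"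
    using near L by (auto simp: nearest_def)
  have m: "2 * p \<le> t (J p) + t (J q)" "t (J p) + t (J q) \<le> 2 * q" using n lt T by linarith+
  then show "p \<le> q" by linarith
  show "t (J p) + N \<le> p" "q \<le> t (J q) - N" using m lt pq(2) T by linarith+
  show "J q = Suc (J p)"
  proof (rule ccontr)
    assume "J q \<noteq> Suc (J p)"
    with pq(1) have "Suc (J p) < J q" by simp
    from separated_less[OF sep _ this L(1)] T have 1: "t (Suc (J p)) + T \<le> t (J q)" by linarith
    have 2: "t (J p) + T \<le> t (Suc (J p))"
      using sep \<open>Suc (J p) < J q\<close> L(1) by (simp add: separated_def)
    have "\<bar>p - t (J p)\<bar> \<le> \<bar>p - t (Suc (J p))\<bar>"
      using near less_trans[OF \<open>Suc (J p) < J q\<close> L(1)] unfolding nearest_def by blast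
    with 1 2 m pq(2) T show False by linarith
  qed
qed

text \<open>\<open>a\<close> and \<open>b\<close> pair a limit point with the limit derivative
  there. The last clause is strict differentiability along the orbit with a radius uniform in
  time.\<close>

definition hetero_data :: "(int \<Rightarrow> 'v::euclidean_space) \<Rightarrow> (int \<Rightarrow> 'v \<Rightarrow> 'v) \<Rightarrow> (int \<Rightarrow> 'v \<Rightarrow>\<^sub>L 'v) \<Rightarrow>
    'v \<times> ('v \<Rightarrow>\<^sub>L 'v) \<Rightarrow> 'v \<times> ('v \<Rightarrow>\<^sub>L 'v) \<Rightarrow> bool" where
  "hetero_data z g A a b \<longleftrightarrow> hyperbolic_map (snd a) \<and> hyperbolic_map (snd b) \<and>
     (\<lambda>k. z (- int k)) \<longlonglongrightarrow> fst a \<and> (\<lambda>k. z (int k)) \<longlonglongrightarrow> fst b \<and>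
     (\<lambda>k. A (- int k)) \<longlonglongrightarrow> snd a \<and> (\<lambda>k. A (int k)) \<longlonglongrightarrow> snd b \<and>
     (\<forall>K. dichotomous_at A K) \<and> (\<forall>i. g i (z i) = z (i + 1)) \<and>
     (\<forall>\<delta>>0. \<exists>r>0. \<forall>i u v. norm (u - z i) \<le> r \<longrightarrow> norm (v - z i) \<le> r \<longrightarrow>
        norm (g i u - g i v - A i (u - v)) \<le> \<delta> * norm (u - v))"

lemma approx_right_inverse_mono:
  assumes "approx_right_inverse A \<delta> C R" "\<delta> \<le> \<delta>'" "C \<le> C'"
  shows "approx_right_inverse A \<delta>' C' R"
proof -
  have "bdd_by (C' * c) h" if "bdd_by (C * c) h" "C \<le> C'" "0 \<le> c" for c C C' and h :: "int \<Rightarrow> 'a"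
    using that mult_right_mono[OF that(2,3)] by (auto simp: bdd_by_def intro: order_trans)
  with assms show ?thesis unfolding approx_right_inverse_def by (meson bdd_by_nonneg)
qed

lemma uniform_nat_bound:
  fixes P :: "nat \<Rightarrow> nat \<Rightarrow> bool"
  assumes "\<And>j. j < L \<Longrightarrow> eventually (P j) sequentially"
  shows "eventually (\<lambda>N. \<forall>k\<ge>N. \<forall>j<L. P j k) sequentially"
proof -
  have "eventually (\<lambda>k. \<forall>j\<in>{..<L}. P j k) sequentially"
    using assms by (intro eventually_ball_finite) auto
  then show ?thesis by (auto simp: eventually_sequentially intro: order_trans)
qed

text \<open>The time \<open>T\<close> does not depend on the transition times \<open>t\<close>; this uniformity is what makes
  the number of itineraries grow like \<open>n\<^sup>L\<close>.\<close>

theorem hetero_chain_shadowing: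
  fixes z :: "nat \<Rightarrow> int \<Rightarrow> 'v::euclidean_space"
  assumes L: "L > 0" and data: "\<And>j. j < L \<Longrightarrow> hetero_data (z j) (g j) (A j) (a j) (a (Suc j))" and r0: "r0 > 0"
  shows "\<exists>T>0. \<forall>t J. separated L t T \<longrightarrow> nearest L t J \<longrightarrow>
    (\<forall>i. J i = J (i + 1) \<or> (J (i + 1) = Suc (J i) \<and> t (J i) + N0 \<le> i \<and> i + 1 \<le> t (J (i + 1)) - N0)) \<and>
    (\<exists>\<xi>. bdd_by r0 \<xi> \<and> (\<forall>i. g (J i) (i - t (J i)) (z (J i) (i - t (J i)) + \<xi> i)
        = z (J (i + 1)) (i + 1 - t (J (i + 1))) + \<xi> (i + 1)))"
proof -
  \<comment> \<open>Each of the three gluing errors is set to \<open>1 / (12 * L)\<close>; over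
    \<open>L\<close> pieces they sum to the 1/4 that the contraction allows.\<close>
  have "\<exists>C R. C > 0 \<and> approx_right_inverse (A j) (1 / (12 * L)) C R" if "j < L" for j
    using approx_right_inverse_exists[of "snd (a j)" "snd (a (Suc j))" "A j" "1 / (12 * L)"] data[OF that] L
    unfolding hetero_data_def by fastforce
  then obtain Cj R where Cj: "\<And>j. j < L \<Longrightarrow> Cj j > 0 \<and> approx_right_inverse (A j) (1 / (12 * L)) (Cj j) (R j)"
    by metis
  define C where "C = (\<Sum>j<L. Cj j)"
  have Cle: "Cj j \<le> C" if "j < L" for j
    unfolding C_def using that Cj by (intro member_le_sum) (auto intro: less_imp_le)
  have C: "C > 0" using Cle[OF L] Cj[OF L] by linarith
  have R: "approx_right_inverse (A j) (1 / (12 * L)) C (R j)" if "j < L" for j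
    using Cj[OF that] Cle[OF that] by (auto intro: approx_right_inverse_mono)
  define w where "w = 12 * L * C"
  define \<delta>' where "\<delta>' = 1 / (12 * L * C)"
  have w: "w > 0" and \<delta>': "\<delta>' > 0" using L C by (auto simp: w_def \<delta>'_def)
  have sum14: "L * (C / w + 1 / (12 * L) + C * \<delta>') = 1 / 4"
    using L C by (simp add: w_def \<delta>'_def field_simps)
  define C' where "C' = L * C"
  have C': "C' > 0" using L C by (simp add: C'_def)
  have "\<exists>r>0. \<forall>i u v. norm (u - z j i) \<le> r \<longrightarrow> norm (v - z j i) \<le> r \<longrightarrow>
        norm (g j i u - g j i v - A j i (u - v)) \<le> 1 / (4 * C') * norm (u - v)" if "j < L" for j
  proof -
    have "\<forall>\<delta>>0. \<exists>r>0. \<forall>i u v. norm (u - z j i) \<le> r \<longrightarrow> norm (v - z j i) \<le> r \<longrightarrow>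
        norm (g j i u - g j i v - A j i (u - v)) \<le> \<delta> * norm (u - v)"
      using data[OF that] unfolding hetero_data_def by simp
    from spec[OF this, of "1 / (4 * C')"] show ?thesis using C' by simp
  qed
  then obtain rj where rj: "\<And>j. j < L \<Longrightarrow> rj j > 0 \<and> (\<forall>i u v. norm (u - z j i) \<le> rj j \<longrightarrow> norm (v - z j i) \<le> rj j \<longrightarrow>
        norm (g j i u - g j i v - A j i (u - v)) \<le> 1 / (4 * C') * norm (u - v))"
    by metis
  define r where "r = Min (insert r0 (rj ` {..<L}))"
  have r: "r > 0" "r \<le> r0" using r0 rj by (auto simp: r_def)
  have rle: "r \<le> rj j" if "j < L" for j using that by (auto simp: r_def)
  define \<sigma> where "\<sigma> = r / (2 * C')"
  have \<sigma>: "\<sigma> > 0" using r C' by (simp add: \<sigma>_def)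
  have small: "eventually (\<lambda>k. norm (x k - x') < e) sequentially"
    if "x \<longlonglongrightarrow> x'" "e > 0" for x :: "nat \<Rightarrow> 'b::real_normed_vector" and x' e
    using tendstoD[OF that] by (simp add: dist_norm)
  define P where "P = (\<lambda>j k. norm (z j (- int k) - fst (a j)) < \<sigma> / 2 \<and> norm (z j (int k) - fst (a (Suc j))) < \<sigma> / 2 \<and>
      norm (A j (- int k) - snd (a j)) < \<delta>' / 2 \<and> norm (A j (int k) - snd (a (Suc j))) < \<delta>' / 2)"
  have "eventually (P j) sequentially" if "j < L" for j
    using data[OF that] \<sigma> \<delta>' unfolding hetero_data_def P_def by (intro eventually_conj small) auto
  from uniform_nat_bound[of L P, OF this]
  obtain N1 where N1: "\<And>k j. k \<ge> N1 \<Longrightarrow> j < L \<Longrightarrow> P j k"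
    unfolding eventually_sequentially by blast
  \<comment> \<open>Beyond \<open>N\<close> the pieces are near their limits, in position and in
    derivative. Including \<open>N0\<close> lets the application push all switches out to times
    where its charts no longer change.\<close>
  define N where "N = max (max 1 N0) (int N1)"
  have N: "N > 0" "N0 \<le> N" "int N1 \<le> N" by (auto simp: N_def)
  have right: "norm (z j k - fst (a (Suc j))) < \<sigma> / 2 \<and> norm (A j k - snd (a (Suc j))) < \<delta>' / 2"
    if "j < L" "k \<ge> N" for j k
    using N1[of "nat k" j] that N by (auto simp: P_def)
  have left: "norm (z j k - fst (a j)) < \<sigma> / 2 \<and> norm (A j k - snd (a j)) < \<delta>' / 2"
    if "j < L" "k \<le> - N" for j k
    using N1[of "nat (- k)" j] that N by (auto simp: P_def)
  define l where "l = max 1 \<lceil>w\<rceil>"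
  have l: "l \<ge> 1" "w \<le> l" by (auto simp: l_def) linarith
  \<comment> \<open>The gap required by \<open>nearest_switch\<close>, with \<open>l\<close>
    covering both single steps and the width \<open>w\<close> of the cut-offs.\<close>
  define T where "T = 2 * N + 2 * l"
  have T: "T > 0" using N l by (simp add: T_def)
  show ?thesis
  proof (intro exI[of _ T] conjI allI impI T)
    fix t J
    assume sep: "separated L t T" and near: "nearest L t J"
    have JL: "J i < L" for i using near by (simp add: nearest_def)
    have sw: "J q = Suc (J p)" "p \<le> q" "t (J p) + N \<le> p" "q \<le> t (J q) - N"
      if "J p < J q" "\<bar>p - q\<bar> \<le> l" for p q
      using nearest_switch[OF sep near _ N(1) _ that] T_def l by auto
    {
      fix i
      have "J (i + 1) = Suc (J i) \<and> t (J i) + N0 \<le> i \<and> i + 1 \<le> t (J (i + 1)) - N0" if "J i \<noteq> J (i + 1)"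
      proof (cases "J i < J (i + 1)")
        case True
        from sw[OF this] l N show ?thesis by auto
      next
        case False
        with that have "J (i + 1) < J i" by simp
        from sw(2)[OF this] l show ?thesis by auto
      qed
      then show "J i = J (i + 1) \<or> (J (i + 1) = Suc (J i) \<and> t (J i) + N0 \<le> i \<and> i + 1 \<le> t (J (i + 1)) - N0)"
        by blast
    } note switch = this
    let ?A = "\<lambda>i. A (J i) (i - t (J i))"
    have "\<exists>S. approx_right_inverse ?A (L * (C / w + 1 / (12 * L) + C * \<delta>')) (L * C) S"
    proof (rule approx_right_inverse_glue[where R = R])
      show "\<exists>i. J i = j" if "j < L" for j using nearest_centre[OF sep T near that] by blast
      fix i i' :: int assume "\<bar>real_of_int i - real_of_int i'\<bar> < w"
      with l(2) have "\<bar>real_of_int (i - i')\<bar> \<le> real_of_int l" by simp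
      then have ii: "\<bar>i - i'\<bar> \<le> l" by linarith
      consider "J i = J i'" | "J i < J i'" | "J i' < J i" by linarith
      then show "norm (A (J i') (i - t (J i')) - A (J i) (i - t (J i))) \<le> \<delta>'"
      proof cases
        case 1 then show ?thesis using \<delta>' by simp
      next
        case 2
        note s = sw[OF 2 ii]
        have "norm (A (J i) (i - t (J i)) - snd (a (Suc (J i)))) < \<delta>' / 2" using right[OF JL, of "i - t (J i)" i] s by auto
        moreover have "norm (A (J i') (i - t (J i')) - snd (a (J i'))) < \<delta>' / 2" using left[OF JL, of "i - t (J i')" i'] s by auto
        ultimately show ?thesis unfolding s(1)
          using norm_triangle_ineq4[of "A (Suc (J i)) (i - t (Suc (J i))) - snd (a (Suc (J i)))" "A (J i) (i - t (J i)) - snd (a (Suc (J i)))"]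
          by simp
      next
        case 3
        have ii': "\<bar>i' - i\<bar> \<le> l" using ii by linarith
        note s = sw[OF 3 ii']
        have "norm (A (J i') (i - t (J i')) - snd (a (Suc (J i')))) < \<delta>' / 2" using right[OF JL, of "i - t (J i')" i'] s by auto
        moreover have "norm (A (J i) (i - t (J i)) - snd (a (J i))) < \<delta>' / 2" using left[OF JL, of "i - t (J i)" i] s by auto
        ultimately show ?thesis unfolding s(1)
          using norm_triangle_ineq4[of "A (J i') (i - t (J i')) - snd (a (Suc (J i')))" "A (Suc (J i')) (i - t (Suc (J i'))) - snd (a (Suc (J i')))"]
          by simp
      qed
    qed (use R C w \<delta>' JL in auto)
    then obtain S where S: "approx_right_inverse ?A (1 / 4) C' S" unfolding sum14 C'_def by blast
    have "\<exists>\<xi>. bdd_by r \<xi> \<and> (\<forall>i. g (J i) (i - t (J i)) (z (J i) (i - t (J i)) + \<xi> i)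
        = z (J (i + 1)) (i + 1 - t (J (i + 1))) + \<xi> (i + 1))"
    proof (rule pseudo_orbit_shadowing[OF S C' r(1)])
      show "norm (g (J i) (i - t (J i)) u - g (J i) (i - t (J i)) v - ?A i (u - v)) \<le> 1 / (4 * C') * norm (u - v)"
        if "norm (u - z (J i) (i - t (J i))) \<le> r" "norm (v - z (J i) (i - t (J i))) \<le> r" for i u v
        using rj[OF JL, of i] rle[OF JL, of i] that by (meson order_trans)
      show "norm (g (J i) (i - t (J i)) (z (J i) (i - t (J i))) - z (J (i + 1)) (i + 1 - t (J (i + 1)))) \<le> r / (2 * C')" for i
      proof -
        have g: "g (J i) (i - t (J i)) (z (J i) (i - t (J i))) = z (J i) (i + 1 - t (J i))"
          using data[OF JL, of i] unfolding hetero_data_def by (simp add: algebra_simps)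
        show ?thesis
        proof (cases "J i = J (i + 1)")
          case True
          then show ?thesis unfolding g using r C' by simp
        next
          case False
          then have lt: "J i < J (i + 1)" using switch[of i] by auto
          have "\<bar>i - (i + 1)\<bar> \<le> l" using l by simp
          note s = sw[OF lt this]
          have "norm (z (J i) (i + 1 - t (J i)) - fst (a (Suc (J i)))) < \<sigma> / 2" using right[OF JL, of "i + 1 - t (J i)" i] s by auto
          moreover have "norm (z (J (i + 1)) (i + 1 - t (J (i + 1))) - fst (a (J (i + 1)))) < \<sigma> / 2"
            using left[OF JL, of "i + 1 - t (J (i + 1))" "i + 1"] s by auto
          ultimately show ?thesis unfolding g \<sigma>_def[symmetric] s(1)
            using norm_triangle_ineq4[of "z (J i) (i + 1 - t (J i)) - fst (a (Suc (J i)))" "z (Suc (J i)) (i + 1 - t (Suc (J i))) - fst (a (Suc (J i)))"]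
            by simp
        qed
      qed
    qed
    then show "\<exists>\<xi>. bdd_by r0 \<xi> \<and> (\<forall>i. g (J i) (i - t (J i)) (z (J i) (i - t (J i)) + \<xi> i)
        = z (J (i + 1)) (i + 1 - t (J (i + 1))) + \<xi> (i + 1))"
      using r(2) unfolding bdd_by_def by (meson order_trans)
  qed
qed

section \<open>Strict differentiability and charts\<close>

text \<open>Peano's strict derivative. It is the two-point estimate of the contraction argument, it
  follows from \<open>C1_on\<close>, and it composes without tracking domains of definition.\<close>

definition strict_deriv_at :: "('v::real_normed_vector \<Rightarrow> 'w::real_normed_vector) \<Rightarrow> 'v \<Rightarrow> ('v \<Rightarrow>\<^sub>L 'w) \<Rightarrow> bool" where
  "strict_deriv_at g z A \<longleftrightarrow> (\<forall>\<delta>>0. \<exists>r>0. \<forall>u v. norm (u - z) \<le> r \<longrightarrow> norm (v - z) \<le> r \<longrightarrow>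
     norm (g u - g v - A (u - v)) \<le> \<delta> * norm (u - v))"

lemma strict_deriv_atD:
  assumes "strict_deriv_at g z A" "\<delta> > 0"
  obtains r where "r > 0" "\<forall>u v. norm (u - z) \<le> r \<longrightarrow> norm (v - z) \<le> r \<longrightarrow>
     norm (g u - g v - A (u - v)) \<le> \<delta> * norm (u - v)"
  using assms unfolding strict_deriv_at_def by blast

lemma strict_deriv_has_derivative:
  assumes "strict_deriv_at g z A"
  shows "(g has_derivative A) (at z)"
  unfolding has_derivative_at_alt
proof (intro conjI allI impI)
  show "bounded_linear A" by (rule blinfun.bounded_linear_right)
  fix e :: real assume "e > 0"
  note pos = this
  obtain r where r0: "r > 0" and r1: "\<forall>u v. norm (u - z) \<le> r \<longrightarrow> norm (v - z) \<le> r \<longrightarrow>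
     norm (g u - g v - A (u - v)) \<le> e * norm (u - v)"
    using strict_deriv_atD[OF assms pos] .
  note r = r0 r1[rule_format]
  show "\<exists>d>0. \<forall>y. norm (y - z) < d \<longrightarrow> norm (g y - g z - A (y - z)) \<le> e * norm (y - z)"
    using r by (intro exI[of _ r]) auto
qed

lemma C1_on_strict_deriv:
  fixes g :: "'v::real_normed_vector \<Rightarrow> 'w::real_normed_vector"
  assumes "C1_on g U" "open U" "z \<in> U"
  shows "\<exists>A. strict_deriv_at g z A"
proof -
  obtain g' where g': "\<And>x. x \<in> U \<Longrightarrow> (g has_derivative blinfun_apply (g' x)) (at x)" "continuous_on U g'"
    using assms(1) unfolding C1_on_def by blast
  have "strict_deriv_at g z (g' z)"
    unfolding strict_deriv_at_def
  proof (intro allI impI)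
    fix \<delta> :: real assume \<delta>: "\<delta> > 0"
    have "continuous (at z) g'" using g'(2) assms(2,3) by (simp add: continuous_on_eq_continuous_at)
    then obtain d where d: "d > 0" "\<And>w. dist w z < d \<Longrightarrow> dist (g' w) (g' z) < \<delta>"
      using \<delta> unfolding continuous_at_eps_delta by blast
    obtain e where e: "e > 0" "cball z e \<subseteq> U" using assms(2,3) open_contains_cball by blast
    define r where "r = min (d / 2) e"
    have r: "r > 0" "r < d" "cball z r \<subseteq> U" using d e by (auto simp: r_def)
    show "\<exists>r>0. \<forall>u v. norm (u - z) \<le> r \<longrightarrow> norm (v - z) \<le> r \<longrightarrow>
        norm (g u - g v - g' z (u - v)) \<le> \<delta> * norm (u - v)"
    proof (intro exI[of _ r] conjI allI impI r)
      fix u v assume uv: "norm (u - z) \<le> r" "norm (v - z) \<le> r"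
      have "norm ((g u - g' z u) - (g v - g' z v)) \<le> \<delta> * norm (u - v)"
      proof (rule differentiable_bound[of "cball z r"])
        show "convex (cball z r)" by simp
        show "u \<in> cball z r" "v \<in> cball z r" using uv by (auto simp: dist_norm norm_minus_commute)
        fix x assume x: "x \<in> cball z r"
        then have xU: "x \<in> U" using r by blast
        show "((\<lambda>x. g x - g' z x) has_derivative (\<lambda>h. g' x h - g' z h)) (at x within cball z r)"
          by (intro has_derivative_diff has_derivative_at_withinI[OF g'(1)[OF xU]]
              bounded_linear_imp_has_derivative blinfun.bounded_linear_right)
        have "norm (g' x - g' z) \<le> \<delta>"
          using d(2)[of x] x r by (auto simp: dist_norm norm_minus_commute)
        then show "onorm (\<lambda>h. g' x h - g' z h) \<le> \<delta>"
          by (simp add: norm_blinfun.rep_eq minus_blinfun.rep_eq)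
      qed
      then show "norm (g u - g v - g' z (u - v)) \<le> \<delta> * norm (u - v)"
        by (simp add: blinfun.diff_right algebra_simps)
    qed
  qed
  then show ?thesis by blast
qed

text \<open>Continuity of strict derivatives: for a small step from \<open>y\<close>, the estimate
  around \<open>z\<close> and the derivative at \<open>y\<close> describe the same increment of
  \<open>g\<close>. It gives the convergence of derivatives along an orbit.\<close>

lemma strict_deriv_near:
  fixes A :: "'v::real_normed_vector \<Rightarrow>\<^sub>L 'w::real_normed_vector"
  assumes "\<And>u v. norm (u - z) \<le> r \<Longrightarrow> norm (v - z) \<le> r \<Longrightarrow> norm (g u - g v - A (u - v)) \<le> \<delta> * norm (u - v)"
    and "norm (y - z) < r" "strict_deriv_at g y B" "\<delta> \<ge> 0"
  shows "norm (B - A) \<le> \<delta>"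
proof (rule field_le_epsilon)
  fix e :: real assume e: "e > 0"
  obtain s where s0: "s > 0" and s1: "\<forall>u v. norm (u - y) \<le> s \<longrightarrow> norm (v - y) \<le> s \<longrightarrow>
     norm (g u - g v - B (u - v)) \<le> e * norm (u - v)"
    using strict_deriv_atD[OF assms(3) e] .
  note s = s0 s1[rule_format]
  define m where "m = min s (r - norm (y - z))"
  have m: "m > 0" using s assms(2) by (simp add: m_def)
  show "norm (B - A) \<le> \<delta> + e"
  proof (rule norm_blinfun_bound)
    show "0 \<le> \<delta> + e" using assms(4) e by simp
    fix h :: 'v
    show "norm ((B - A) h) \<le> (\<delta> + e) * norm h"
    proof (cases "h = 0")
      case False
      define k where "k = (m / norm h) *\<^sub>R h"
      have k: "norm k = m" using False m by (simp add: k_def)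
      have "norm (y + k - z) \<le> norm (y - z) + norm k"
        using norm_triangle_ineq[of "y - z" k] by (simp add: algebra_simps)
      then have k1: "norm (y + k - z) \<le> r" using k by (simp add: m_def)
      have "norm (g (y + k) - g y - A (y + k - y)) \<le> \<delta> * norm (y + k - y)"
        using k1 assms(2) by (intro assms(1)) auto
      moreover have "norm (g (y + k) - g y - B (y + k - y)) \<le> e * norm (y + k - y)"
        using k s(1) by (intro s(2)) (auto simp: m_def)
      moreover have "(B - A) k = (g (y + k) - g y - A (y + k - y)) - (g (y + k) - g y - B (y + k - y))"
        by (simp add: blinfun.diff_left)
      ultimately have "norm ((B - A) k) \<le> (\<delta> + e) * norm k"
        using norm_triangle_ineq4[of "g (y + k) - g y - A (y + k - y)" "g (y + k) - g y - B (y + k - y)"]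
        by (simp add: distrib_right)
      then have "(m / norm h) * norm ((B - A) h) \<le> (m / norm h) * ((\<delta> + e) * norm h)"
        using m False by (simp add: k_def blinfun.scaleR_right mult_ac)
      moreover have "0 < m / norm h" using m False by simp
      ultimately show ?thesis by (simp only: mult_le_cancel_left_pos)
    qed simp
  qed
qed

lemma strict_deriv_cong:
  assumes "strict_deriv_at g z A" "s > 0" "\<And>u. norm (u - z) \<le> s \<Longrightarrow> g u = h u"
  shows "strict_deriv_at h z A"
  unfolding strict_deriv_at_def
proof (intro allI impI)
  fix \<delta> :: real assume "\<delta> > 0"
  note pos = this
  obtain r where r0: "r > 0" and r1: "\<forall>u v. norm (u - z) \<le> r \<longrightarrow> norm (v - z) \<le> r \<longrightarrow>
     norm (g u - g v - A (u - v)) \<le> \<delta> * norm (u - v)"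
    using strict_deriv_atD[OF assms(1) pos] .
  show "\<exists>r>0. \<forall>u v. norm (u - z) \<le> r \<longrightarrow> norm (v - z) \<le> r \<longrightarrow>
        norm (h u - h v - A (u - v)) \<le> \<delta> * norm (u - v)"
    by (intro exI[of _ "min r s"]) (use r0 r1 assms(2) in \<open>simp flip: assms(3)\<close>)
qed

lemma strict_deriv_compose:
  assumes g: "strict_deriv_at g z A" and h: "strict_deriv_at h (g z) B"
  shows "strict_deriv_at (h \<circ> g) z (B o\<^sub>L A)"
  unfolding strict_deriv_at_def
proof (intro allI impI)
  fix \<delta> :: real assume \<delta>: "\<delta> > 0"
  define K where "K = norm A + 1"
  have K: "K > 0" by (simp add: K_def add_nonneg_pos)
  define e where "e = min 1 (\<delta> / (2 * (norm B + 1)))"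
  have nB: "norm B + 1 > 0" by (simp add: add_nonneg_pos)
  have e: "e > 0" "e \<le> 1" "norm B * e \<le> \<delta> / 2"
  proof -
    show "e > 0" "e \<le> 1" using \<delta> nB by (auto simp: e_def)
    have "norm B * e \<le> (norm B + 1) * (\<delta> / (2 * (norm B + 1)))"
      using \<open>e > 0\<close> by (intro mult_mono) (auto simp: e_def)
    also have "\<dots> = \<delta> / 2" using nB by (simp add: field_simps)
    finally show "norm B * e \<le> \<delta> / 2" .
  qed
  obtain r where r0: "r > 0" and r1: "\<forall>u v. norm (u - z) \<le> r \<longrightarrow> norm (v - z) \<le> r \<longrightarrow>
     norm (g u - g v - A (u - v)) \<le> e * norm (u - v)"
    using strict_deriv_atD[OF g e(1)] .
  note r = r0 r1[rule_format]
  have "\<delta> / (2 * K) > 0" using \<delta> K by simp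
  note pos = this
  obtain s where s0: "s > 0" and s1: "\<forall>u v. norm (u - g z) \<le> s \<longrightarrow> norm (v - g z) \<le> s \<longrightarrow>
     norm (h u - h v - B (u - v)) \<le> \<delta> / (2 * K) * norm (u - v)"
    using strict_deriv_atD[OF h pos] .
  note s = s0 s1[rule_format]
  have lip: "norm (g u - g v) \<le> K * norm (u - v)" if "norm (u - z) \<le> r" "norm (v - z) \<le> r" for u v
  proof -
    have "norm (g u - g v) \<le> norm (g u - g v - A (u - v)) + norm (A (u - v))"
      using norm_triangle_ineq[of "g u - g v - A (u - v)" "A (u - v)"] by simp
    also have "\<dots> \<le> 1 * norm (u - v) + norm A * norm (u - v)"
      using order_trans[OF r(2)[OF that] mult_right_mono[OF e(2)]] by (intro add_mono norm_blinfun) auto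
    finally show ?thesis by (simp add: K_def algebra_simps)
  qed
  define q where "q = min r (s / K)"
  have q: "q > 0" "q \<le> r" "K * q \<le> s" using r s K by (auto simp: q_def min_def field_simps)
  show "\<exists>r>0. \<forall>u v. norm (u - z) \<le> r \<longrightarrow> norm (v - z) \<le> r \<longrightarrow>
        norm ((h \<circ> g) u - (h \<circ> g) v - (B o\<^sub>L A) (u - v)) \<le> \<delta> * norm (u - v)"
  proof (intro exI[of _ q] conjI allI impI q)
    fix u v assume uv: "norm (u - z) \<le> q" "norm (v - z) \<le> q"
    have gs: "norm (g x - g z) \<le> s" if "norm (x - z) \<le> q" for x
    proof -
      have "norm (g x - g z) \<le> K * norm (x - z)" using that q r by (intro lip) auto
      also have "\<dots> \<le> K * q" using that K by (intro mult_left_mono) auto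
      finally show ?thesis using q by simp
    qed
    have "norm (h (g u) - h (g v) - B (g u - g v)) \<le> \<delta> / (2 * K) * norm (g u - g v)"
      using uv by (intro s(2) gs)
    also have "\<dots> \<le> \<delta> / (2 * K) * (K * norm (u - v))"
      using uv q \<delta> K by (intro mult_left_mono lip) auto
    finally have 1: "norm (h (g u) - h (g v) - B (g u - g v)) \<le> \<delta> / 2 * norm (u - v)" using K by simp
    have "norm (B (g u - g v - A (u - v))) \<le> norm B * (e * norm (u - v))"
      using uv q by (intro order_trans[OF norm_blinfun] mult_left_mono r(2)) auto
    also have "\<dots> \<le> \<delta> / 2 * norm (u - v)" using mult_right_mono[OF e(3), of "norm (u - v)"] by (simp add: mult.assoc)
    finally have 2: "norm (B (g u - g v - A (u - v))) \<le> \<delta> / 2 * norm (u - v)" .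
    have eq: "(h \<circ> g) u - (h \<circ> g) v - (B o\<^sub>L A) (u - v) = (h (g u) - h (g v) - B (g u - g v)) + B (g u - g v - A (u - v))"
      by (simp add: blinfun.diff_right)
    show "norm ((h \<circ> g) u - (h \<circ> g) v - (B o\<^sub>L A) (u - v)) \<le> \<delta> * norm (u - v)"
      unfolding eq using norm_triangle_mono[OF 1 2] by simp
  qed
qed

lemma strict_deriv_unique:
  "strict_deriv_at g z A \<Longrightarrow> strict_deriv_at g z B \<Longrightarrow> A = B"
  by (metis strict_deriv_has_derivative has_derivative_unique blinfun_apply_inject)

text \<open>The supremum \<beta> of the norms is finite and satisfies
  \<open>\<beta> \<le> max (C * e) (\<beta> / 2)\<close>, which forces
  \<open>\<beta> \<le> C * e\<close>. The maximum in the hypothesis admits an absolute error where a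
  half-line of times is cut off and a relative one elsewhere.\<close>

lemma hyperbolic_map_rigid:
  fixes M :: "'v::banach \<Rightarrow>\<^sub>L 'v"
  assumes "hyperbolic_map M"
  obtains C where "C > 0" "\<forall>b e (D :: int \<Rightarrow> 'v). bdd_by b D \<longrightarrow> e \<ge> 0 \<longrightarrow>
     (\<forall>i. norm (D (i + 1) - M (D i)) \<le> max e (1 / (2 * C) * norm (D i))) \<longrightarrow> bdd_by (C * e) D"
proof -
  obtain G :: "(int \<Rightarrow> 'v) \<Rightarrow> int \<Rightarrow> 'v" and C where C: "C > 0"
      "\<forall>c \<eta>. bdd_by c \<eta> \<longrightarrow> bdd_by (C * c) (G \<eta>)"
      "\<forall>c \<eta> i. bdd_by c \<eta> \<longrightarrow> G \<eta> (i + 1) - M (G \<eta> i) = \<eta> i"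
      "\<forall>c d \<eta> \<eta>' i. bdd_by c \<eta> \<longrightarrow> bdd_by d \<eta>' \<longrightarrow> G (\<lambda>i. \<eta> i - \<eta>' i) i = G \<eta> i - G \<eta>' i"
      "\<forall>b c (D :: int \<Rightarrow> 'v). bdd_by b D \<longrightarrow> bdd_by c (\<lambda>i. D (i + 1) - M (D i)) \<longrightarrow> bdd_by (C * c) D"
    using hyperbolic_map_green[OF assms] .
  show ?thesis
  proof (rule that[OF C(1)], intro allI impI)
    fix b e :: real and D :: "int \<Rightarrow> 'v"
    assume b: "bdd_by b D" and e: "e \<ge> 0" and d: "\<forall>i. norm (D (i + 1) - M (D i)) \<le> max e (1 / (2 * C) * norm (D i))"
    define \<beta> where "\<beta> = (SUP i. norm (D i))"
    have bb: "bdd_above (range (\<lambda>i. norm (D i)))" using b by (auto simp: bdd_by_def intro: bdd_aboveI)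
    have \<beta>: "norm (D i) \<le> \<beta>" for i unfolding \<beta>_def by (rule cSUP_upper[OF UNIV_I bb])
    have \<beta>0: "0 \<le> \<beta>" using \<beta> norm_ge_zero order_trans by blast
    have "bdd_by (max e (1 / (2 * C) * \<beta>)) (\<lambda>i. D (i + 1) - M (D i))"
      unfolding bdd_by_def
    proof
      fix i
      have "1 / (2 * C) * norm (D i) \<le> 1 / (2 * C) * \<beta>" using \<beta> C(1) by (intro mult_left_mono) auto
      then show "norm (D (i + 1) - M (D i)) \<le> max e (1 / (2 * C) * \<beta>)"
        using d[rule_format, of i] by linarith
    qed
    then have "bdd_by (C * max e (1 / (2 * C) * \<beta>)) D" using C(5) b by blast
    then have "\<beta> \<le> C * max e (1 / (2 * C) * \<beta>)"
      unfolding \<beta>_def by (intro cSUP_least) (auto intro: bdd_byD)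
    also have "\<dots> = max (C * e) (\<beta> / 2)" using C(1) by (simp add: max_mult_distrib_left)
    finally have "\<beta> \<le> C * e" using e C(1) \<beta>0 by (auto simp: max_def split: if_splits)
    then show "bdd_by (C * e) D" using \<beta> unfolding bdd_by_def by (meson order_trans)
  qed
qed

lemma vector_derivative_norm_le:
  assumes f: "(f has_vector_derivative a) (at 0)" and h: "(h has_vector_derivative b) (at 0)"
    and le: "\<forall>\<^sub>F t in nhds (0 :: real). norm (f t - f 0) \<le> K * norm (h t - h 0)" and K: "K \<ge> 0"
  shows "norm a \<le> K * norm b"
proof (rule field_le_epsilon)
  fix e0 :: real assume e0: "e0 > 0"
  define e where "e = e0 / (K + 1)"
  have e: "e > 0" "(K + 1) * e = e0" using e0 K by (auto simp: e_def)
  obtain d1 where d1: "d1 > 0" "\<forall>t. norm (t - 0) < d1 \<longrightarrow> norm (f t - f 0 - (t - 0) *\<^sub>R a) \<le> e * norm (t - 0)"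
    using f e(1) unfolding has_vector_derivative_def has_derivative_at_alt by blast
  obtain d2 where d2: "d2 > 0" "\<forall>t. norm (t - 0) < d2 \<longrightarrow> norm (h t - h 0 - (t - 0) *\<^sub>R b) \<le> e * norm (t - 0)"
    using h e(1) unfolding has_vector_derivative_def has_derivative_at_alt by blast
  obtain d3 where d3: "d3 > 0" "\<forall>t. dist t 0 < d3 \<longrightarrow> norm (f t - f 0) \<le> K * norm (h t - h 0)"
    using le unfolding eventually_nhds_metric by blast
  define t where "t = min d1 (min d2 d3) / 2"
  have t: "t > 0" "t < d1" "t < d2" "t < d3" using d1 d2 d3 by (auto simp: t_def)
  have "norm (f t - f 0 - t *\<^sub>R a) \<le> e * t" using d1(2)[rule_format, of t] t by simp
  moreover have "norm (h t - h 0 - t *\<^sub>R b) \<le> e * t" using d2(2)[rule_format, of t] t by simp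
  moreover have "norm (f t - f 0) \<le> K * norm (h t - h 0)" using d3(2)[rule_format, of t] t by simp
  moreover have "norm (t *\<^sub>R a) \<le> norm (f t - f 0) + norm (f t - f 0 - t *\<^sub>R a)"
    using norm_triangle_ineq4[of "f t - f 0" "f t - f 0 - t *\<^sub>R a"] by simp
  moreover have "norm (h t - h 0) \<le> norm (h t - h 0 - t *\<^sub>R b) + norm (t *\<^sub>R b)"
    using norm_triangle_ineq[of "h t - h 0 - t *\<^sub>R b" "t *\<^sub>R b"] by simp
  ultimately have "t * norm a \<le> K * (e * t + t * norm b) + e * t"
    using K t(1) mult_left_mono[of "norm (h t - h 0)" "e * t + t * norm b" K] by simp
  also have "\<dots> = t * (K * norm b + (K + 1) * e)" by (simp add: algebra_simps)
  finally show "norm a \<le> K * norm b + e0" using t(1) e(2) by simp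
qed

text \<open>Orbits that stay near a hyperbolic fixed point during a half-infinite time interval separate
  at a rate controlled by their separation at the finite end; dividing by \<open>t\<close> bounds the tangent vectors.\<close>

lemma tangent_orbit_bounded:
  fixes M :: "'v::banach \<Rightarrow>\<^sub>L 'v"
  assumes M: "hyperbolic_map M" and strict: "strict_deriv_at g z M"
  obtains r where "r > 0" "\<forall>(y :: real \<Rightarrow> int \<Rightarrow> 'v) \<zeta> I k0. (I = {k0..} \<or> I = {..k0}) \<longrightarrow>
    (\<forall>\<^sub>F t in nhds 0. \<forall>k\<in>I. norm (y t k - z) \<le> r) \<longrightarrow>
    (\<forall>\<^sub>F t in nhds 0. \<forall>k. k \<in> I \<longrightarrow> k + 1 \<in> I \<longrightarrow> y t (k + 1) = g (y t k)) \<longrightarrow>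
    (\<forall>k\<in>I. ((\<lambda>t. y t k) has_vector_derivative \<zeta> k) (at 0)) \<longrightarrow>
    (\<exists>K. \<forall>k\<in>I. norm (\<zeta> k) \<le> K)"
proof -
  obtain C where C: "C > 0" and rigid: "\<forall>b e (D :: int \<Rightarrow> 'v). bdd_by b D \<longrightarrow> e \<ge> 0 \<longrightarrow>
     (\<forall>i. norm (D (i + 1) - M (D i)) \<le> max e (1 / (2 * C) * norm (D i))) \<longrightarrow> bdd_by (C * e) D"
    using hyperbolic_map_rigid[OF M] .
  have "1 / (2 * C) > 0" using C by simp
  obtain r where r: "r > 0" and est: "\<forall>u v. norm (u - z) \<le> r \<longrightarrow> norm (v - z) \<le> r \<longrightarrow>
     norm (g u - g v - M (u - v)) \<le> 1 / (2 * C) * norm (u - v)"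
    using strict_deriv_atD[OF strict \<open>1 / (2 * C) > 0\<close>] .
  show ?thesis
  proof (rule that[OF r], intro allI impI)
    fix y :: "real \<Rightarrow> int \<Rightarrow> 'v" and \<zeta> I k0
    assume I: "I = {k0..} \<or> I = {..k0}"
      and close: "\<forall>\<^sub>F t in nhds 0. \<forall>k\<in>I. norm (y t k - z) \<le> r"
      and step: "\<forall>\<^sub>F t in nhds 0. \<forall>k. k \<in> I \<longrightarrow> k + 1 \<in> I \<longrightarrow> y t (k + 1) = g (y t k)"
      and der: "\<forall>k\<in>I. ((\<lambda>t. y t k) has_vector_derivative \<zeta> k) (at 0)"
    let ?P = "\<lambda>t. (\<forall>k\<in>I. norm (y t k - z) \<le> r) \<and> (\<forall>k. k \<in> I \<longrightarrow> k + 1 \<in> I \<longrightarrow> y t (k + 1) = g (y t k))"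
    have ev: "\<forall>\<^sub>F t in nhds 0. ?P t" using close step by (rule eventually_conj)
    then have P0: "?P 0" by (rule eventually_nhds_x_imp_x)
    define K where "K = C * (1 + norm M)"
    have K: "K \<ge> 0" using C by (simp add: K_def)
    have k0: "k0 \<in> I" using I by auto
    have main: "norm (y t k - y 0 k) \<le> K * norm (y t k0 - y 0 k0)" if P: "?P t" and k: "k \<in> I" for t k
    proof -
      \<comment> \<open>Extended by zero beyond the half-line, the difference solves the equation up
        to a relative error, except at the single step across the end \<open>k0\<close>. There the
        defect is \<open>D k0\<close> or its image under \<open>M\<close>, up to sign, and
        \<open>e\<close> bounds both.\<close>
      define D where "D = (\<lambda>i. if i \<in> I then y t i - y 0 i else 0)"
      define e where "e = (1 + norm M) * norm (D k0)"
      have e: "e \<ge> 0" by (simp add: e_def)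
      have D0: "norm (D k0) \<le> e" "norm (M (D k0)) \<le> e"
      proof -
        show "norm (D k0) \<le> e" by (simp add: e_def algebra_simps)
        show "norm (M (D k0)) \<le> e" using norm_blinfun[of M "D k0"] by (simp add: e_def algebra_simps add_increasing)
      qed
      have "bdd_by (2 * r) D"
        unfolding bdd_by_def
      proof
        fix i
        show "norm (D i) \<le> 2 * r"
        proof (cases "i \<in> I")
          case True
          then have "norm (y t i - z) \<le> r" "norm (y 0 i - z) \<le> r" using P P0 by auto
          then show ?thesis using True norm_triangle_ineq4[of "y t i - z" "y 0 i - z"] by (simp add: D_def)
        qed (use r in \<open>simp add: D_def\<close>)
      qed
      moreover have "norm (D (i + 1) - M (D i)) \<le> max e (1 / (2 * C) * norm (D i))" for i
      proof -
        consider "i \<in> I" "i + 1 \<in> I" | "i \<in> I" "i + 1 \<notin> I" "i = k0" | "i \<notin> I" "i + 1 \<in> I" "i + 1 = k0"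
          | "i \<notin> I" "i + 1 \<notin> I" using I by force
        then show ?thesis
        proof cases
          case 1
          have "norm (g (y t i) - g (y 0 i) - M (y t i - y 0 i)) \<le> 1 / (2 * C) * norm (y t i - y 0 i)"
            using est P P0 1 by blast
          then have "norm (D (i + 1) - M (D i)) \<le> 1 / (2 * C) * norm (D i)"
            using 1 P P0 by (simp add: D_def)
          then show ?thesis by linarith
        next
          case 2
          then have "norm (D (i + 1) - M (D i)) = norm (M (D k0))" by (simp add: D_def)
          then show ?thesis using D0 by linarith
        next
          case 3
          then have "norm (D (i + 1) - M (D i)) = norm (D k0)" by (simp add: D_def)
          then show ?thesis using D0 by linarith
        next
          case 4
          then show ?thesis using e by (simp add: D_def)
        qed
      qed
      ultimately have "bdd_by (C * e) D" using rigid e by blast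
      from bdd_byD[OF this, of k] show ?thesis
        using k k0 by (simp add: D_def e_def K_def mult.assoc)
    qed
    show "\<exists>K. \<forall>k\<in>I. norm (\<zeta> k) \<le> K"
    proof (intro exI[of _ "K * norm (\<zeta> k0)"] ballI)
      fix k assume k: "k \<in> I"
      show "norm (\<zeta> k) \<le> K * norm (\<zeta> k0)"
        by (rule vector_derivative_norm_le[OF der[rule_format, OF k] der[rule_format, OF k0] eventually_mono[OF ev] K])
          (rule main[OF _ k])
    qed
  qed
qed

section \<open>Charts and maps that are strictly differentiable in charts\<close>

lemma chart_inverse:
  assumes "chart_on S c" "y \<in> fst c"
  shows "inv_into (fst c) (snd c) (snd c y) = y"
  using assms by (auto simp: chart_on_def split_beta homeomorphism_def)

lemma local_rep_apply:
  assumes "chart_on S c" "y \<in> fst c"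
  shows "local_rep c c' h (snd c y) = snd c' (h y)"
  using chart_inverse[OF assms] by (simp add: local_rep_def split_beta)

lemma chart_inj:
  assumes "chart_on S c" "x \<in> fst c" "y \<in> fst c" "snd c x = snd c y"
  shows "x = y"
  using chart_inverse[OF assms(1)] assms by metis

lemma chart_subset: "chart_on S c \<Longrightarrow> fst c \<subseteq> S"
  by (auto simp: chart_on_def split_beta dest: openin_imp_subset)

lemma chart_openin: "chart_on S c \<Longrightarrow> openin (top_of_set S) (fst c)"
  by (auto simp: chart_on_def split_beta)

lemma chart_image_open:
  assumes c: "chart_on S c" and W: "openin (top_of_set S) W"
  shows "open (snd c ` (fst c \<inter> W))"
proof -
  have h: "homeomorphism (fst c) (snd c ` fst c) (snd c) (inv_into (fst c) (snd c))" "open (snd c ` fst c)"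
    using c by (auto simp: chart_on_def split_beta)
  have "openin (top_of_set (fst c)) (fst c \<inter> W)"
    using W chart_subset[OF c] by (metis inf.absorb_iff2 inf_commute openin_subtopology_Int2 subtopology_subtopology)
  from homeomorphism_imp_open_map[OF h(1) this] show ?thesis
    using h(2) openin_open_eq by blast
qed

lemma chart_near:
  assumes c: "chart_on S c" and W: "openin (top_of_set S) W" and x: "x \<in> fst c" "x \<in> W"
  shows "\<exists>r>0. \<forall>u. norm (u - snd c x) \<le> r \<longrightarrow> (\<exists>y. y \<in> fst c \<and> y \<in> W \<and> u = snd c y)"
proof -
  obtain r where "r > 0" "cball (snd c x) r \<subseteq> snd c ` (fst c \<inter> W)"
    using chart_image_open[OF c W] x open_contains_cball by blast
  then show ?thesis by (intro exI[of _ r]) (auto simp: dist_norm norm_minus_commute subset_iff image_iff)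
qed

text \<open>The curves behind the tangent spaces are not assumed continuous. Differentiability at 0
  in coordinates gives continuity there, and the chart turns it into staying in
  \<open>W\<close>.\<close>

lemma curve_in_open:
  assumes c: "chart_on S c" and k: "\<And>t. k t \<in> fst c" "((snd c \<circ> k) has_vector_derivative v) (at (0::real))"
    and W: "openin (top_of_set S) W" "k 0 \<in> W"
  shows "\<forall>\<^sub>F t in nhds 0. k t \<in> W"
proof -
  obtain r where r: "r > 0" "\<forall>u. norm (u - snd c (k 0)) \<le> r \<longrightarrow> (\<exists>y. y \<in> fst c \<and> y \<in> W \<and> u = snd c y)"
    using chart_near[OF c W(1) k(1) W(2)] by blast
  have "isCont (snd c \<circ> k) 0" using has_vector_derivative_continuous[OF k(2)] .
  then obtain d where d: "d > 0" "\<And>t. dist t 0 < d \<Longrightarrow> dist ((snd c \<circ> k) t) ((snd c \<circ> k) 0) < r"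
    using r(1) unfolding continuous_at_eps_delta by blast
  have "k t \<in> W" if "dist t 0 < d" for t
  proof -
    have "norm (snd c (k t) - snd c (k 0)) \<le> r" using d(2)[OF that] by (simp add: dist_norm)
    then obtain y where "y \<in> fst c" "y \<in> W" "snd c (k t) = snd c y" using r(2) by blast
    then show ?thesis using chart_inj[OF c k(1)] by metis
  qed
  then show ?thesis using d(1) unfolding eventually_nhds_metric by blast
qed

text \<open>Pointwise strict derivatives take the place of \<open>C1_map\<close>: this property
  passes directly to compositions, hence to all iterates in both directions of time.\<close>

definition smooth_on :: "'a::metric_space set \<Rightarrow> 'a chart set \<Rightarrow> ('a \<Rightarrow> 'a) \<Rightarrow> bool" where
  "smooth_on S A h \<longleftrightarrow> h ` S \<subseteq> S \<and> continuous_on S h \<and>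
     (\<forall>x\<in>S. \<forall>c\<in>A. \<forall>c'\<in>A. x \<in> fst c \<longrightarrow> h x \<in> fst c' \<longrightarrow>
        (\<exists>D. strict_deriv_at (local_rep c c' h) (snd c x) D))"

definition dmap :: "'a chart \<Rightarrow> 'a chart \<Rightarrow> ('a \<Rightarrow> 'a) \<Rightarrow> 'a \<Rightarrow> ((real^2) \<Rightarrow>\<^sub>L (real^2))" where
  "dmap c c' h x = (SOME D. strict_deriv_at (local_rep c c' h) (snd c x) D)"

lemma smooth_on_strict_deriv:
  assumes "smooth_on S A h" "c \<in> A" "c' \<in> A" "x \<in> S" "x \<in> fst c" "h x \<in> fst c'"
  shows "strict_deriv_at (local_rep c c' h) (snd c x) (dmap c c' h x)"
proof -
  have "\<exists>D. strict_deriv_at (local_rep c c' h) (snd c x) D"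
    using assms unfolding smooth_on_def by blast
  then show ?thesis unfolding dmap_def by (rule someI_ex)
qed

lemma smooth_on_preimage:
  assumes "smooth_on S A h" "openin (top_of_set S) W"
  shows "openin (top_of_set S) {y\<in>S. h y \<in> W}"
proof -
  have "openin (top_of_set S) (S \<inter> h -` W)"
    using assms unfolding smooth_on_def by (intro continuous_openin_preimage[of _ _ S]) auto
  moreover have "{y\<in>S. h y \<in> W} = S \<inter> h -` W" by auto
  ultimately show ?thesis by simp
qed

text \<open>\<open>local_rep\<close> is meaningful only on its domain, so the composition of
  representatives is first identified with the representative of the composition on a neighbourhood
  of the point.\<close>

lemma local_rep_compose:
  assumes c: "chart_on S c" "chart_on S c'" and g: "smooth_on S A g"
    and x: "x \<in> S" "x \<in> fst c" "g x \<in> fst c'"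
    and D: "strict_deriv_at (local_rep c c' g) (snd c x) D"
    and E: "strict_deriv_at (local_rep c' c'' f) (snd c' (g x)) E"
  shows "strict_deriv_at (local_rep c c'' (f \<circ> g)) (snd c x) (E o\<^sub>L D)"
proof -
  let ?W = "{y\<in>S. g y \<in> fst c'}"
  obtain r where r: "r > 0" "\<forall>u. norm (u - snd c x) \<le> r \<longrightarrow> (\<exists>y. y \<in> fst c \<and> y \<in> ?W \<and> u = snd c y)"
    using chart_near[OF c(1) smooth_on_preimage[OF g chart_openin[OF c(2)]] x(2)] x by blast
  have "strict_deriv_at (local_rep c' c'' f \<circ> local_rep c c' g) (snd c x) (E o\<^sub>L D)"
    by (rule strict_deriv_compose[OF D]) (simp add: local_rep_apply[OF c(1) x(2)] E)
  then show ?thesis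
  proof (rule strict_deriv_cong[OF _ r(1)])
    fix u assume "norm (u - snd c x) \<le> r"
    then obtain y where "y \<in> fst c" "g y \<in> fst c'" "u = snd c y" using r(2) by blast
    then show "(local_rep c' c'' f \<circ> local_rep c c' g) u = local_rep c c'' (f \<circ> g) u"
      by (simp add: local_rep_apply[OF c(1)] local_rep_apply[OF c(2)])
  qed
qed

lemma smooth_on_compose:
  assumes A: "\<And>c. c \<in> A \<Longrightarrow> chart_on S c" "\<And>x. x \<in> S \<Longrightarrow> \<exists>c\<in>A. x \<in> fst c"
    and f: "smooth_on S A f" and g: "smooth_on S A g"
  shows "smooth_on S A (f \<circ> g)"
  unfolding smooth_on_def
proof (intro conjI ballI impI)
  show "(f \<circ> g) ` S \<subseteq> S" using f g unfolding smooth_on_def by auto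
  show "continuous_on S (f \<circ> g)"
    using f g unfolding smooth_on_def by (blast intro: continuous_on_compose continuous_on_subset)
  fix x c c'' assume *: "x \<in> S" "c \<in> A" "c'' \<in> A" "x \<in> fst c" "(f \<circ> g) x \<in> fst c''"
  have gx: "g x \<in> S" using g *(1) unfolding smooth_on_def by auto
  then obtain c' where c': "c' \<in> A" "g x \<in> fst c'" using A(2) by blast
  show "\<exists>D. strict_deriv_at (local_rep c c'' (f \<circ> g)) (snd c x) D"
    using local_rep_compose[OF A(1)[OF *(2)] A(1)[OF c'(1)] g *(1,4) c'(2)
        smooth_on_strict_deriv[OF g *(2) c'(1) *(1,4) c'(2)]
        smooth_on_strict_deriv[OF f c'(1) *(3) gx c'(2)]] *(5) by auto
qed

lemma C1_map_smooth_on: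
  assumes A: "\<And>c. c \<in> A \<Longrightarrow> chart_on S c" and h: "C1_map S A h"
  shows "smooth_on S A h"
  unfolding smooth_on_def
proof (intro conjI ballI impI)
  show hS: "h ` S \<subseteq> S" and cont: "continuous_on S h" using h by (auto simp: C1_map_def)
  fix x c c' assume *: "x \<in> S" "c \<in> A" "c' \<in> A" "x \<in> fst c" "h x \<in> fst c'"
  have C1: "C1_on (local_rep c c' h) (snd c ` (fst c \<inter> h -` fst c'))"
    using h *(2,3) unfolding C1_map_def by (auto simp: split_beta)
  have "openin (top_of_set S) (S \<inter> h -` fst c')"
    using hS cont chart_openin[OF A[OF *(3)]] by (intro continuous_openin_preimage[of _ _ S]) auto
  from chart_image_open[OF A[OF *(2)] this] have "open (snd c ` (fst c \<inter> h -` fst c'))"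
    using chart_subset[OF A[OF *(2)]] by (simp add: Int_absorb2 Int_assoc[symmetric])
  from C1_on_strict_deriv[OF C1 this] show "\<exists>D. strict_deriv_at (local_rep c c' h) (snd c x) D"
    using *(4,5) by blast
qed

section \<open>Iterated orbits on a surface\<close>

text \<open>One radius for each tail and finitely many radii in between have a positive
  minimum.\<close>

lemma uniform_radius:
  fixes Q :: "int \<Rightarrow> real \<Rightarrow> bool"
  assumes each: "\<And>k. \<exists>r>0. Q k r" and anti: "\<And>k r s. Q k r \<Longrightarrow> 0 < s \<Longrightarrow> s \<le> r \<Longrightarrow> Q k s"
    and right: "\<exists>N. \<exists>r>0. \<forall>k\<ge>N. Q k r" and left: "\<exists>N. \<exists>r>0. \<forall>k\<le>N. Q k r"
  shows "\<exists>r>0. \<forall>k. Q k r"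
proof -
  obtain N1 r1 where 1: "r1 > 0" "\<forall>k\<ge>N1. Q k r1" using right by blast
  obtain N2 r2 where 2: "r2 > 0" "\<forall>k\<le>N2. Q k r2" using left by blast
  have "\<forall>k. \<exists>r. r > 0 \<and> Q k r" using each by blast
  from choice[OF this] obtain r where r: "\<And>k. r k > 0 \<and> Q k (r k)" by blast
  define s where "s = Min (insert r1 (insert r2 (r ` {N2..N1})))"
  have fin: "finite (insert r1 (insert r2 (r ` {N2..N1})))" by simp
  have s1: "s > 0" unfolding s_def using Min_in[OF fin] 1(1) 2(1) r by (auto simp: Min_gr_iff)
  have s2: "s \<le> r1" "s \<le> r2" unfolding s_def by (rule Min_le[OF fin], simp)+
  have s3: "s \<le> r k" if "N2 \<le> k" "k \<le> N1" for k unfolding s_def by (rule Min_le[OF fin]) (use that in simp)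
  note s = s1 s2 s3
  have "Q k s" for k
  proof -
    consider "k \<ge> N1" | "k \<le> N2" | "N2 \<le> k" "k \<le> N1" by linarith
    then show ?thesis
    proof cases
      case 1 then show ?thesis using anti[of k r1 s] \<open>\<forall>k\<ge>N1. Q k r1\<close> s by simp
    next
      case 2 then show ?thesis using anti[of k r2 s] \<open>\<forall>k\<le>N2. Q k r2\<close> s by simp
    next
      case 3 then show ?thesis using anti[of k "r k" s] r[of k] s by simp
    qed
  qed
  with s(1) show ?thesis by blast
qed

lemma int_tails:
  assumes "eventually P (sequentially :: nat filter)"
  shows "(\<forall>n. P n \<longrightarrow> Q (int n)) \<Longrightarrow> \<exists>N. \<forall>k\<ge>N. Q k" and "(\<forall>n. P n \<longrightarrow> Q (- int n)) \<Longrightarrow> \<exists>N. \<forall>k\<le>N. Q k"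
proof -
  obtain N where N: "\<forall>n\<ge>N. P n" using assms unfolding eventually_sequentially by blast
  show "\<exists>N. \<forall>k\<ge>N. Q k" if "\<forall>n. P n \<longrightarrow> Q (int n)"
  proof (intro exI[of _ "int N"] allI impI)
    fix k assume "k \<ge> int N"
    then have "nat k \<ge> N" "int (nat k) = k" by linarith+
    then show "Q k" using N that by metis
  qed
  show "\<exists>N. \<forall>k\<le>N. Q k" if "\<forall>n. P n \<longrightarrow> Q (- int n)"
  proof (intro exI[of _ "- int N"] allI impI)
    fix k assume "k \<le> - int N"
    then have "nat (- k) \<ge> N" "- int (nat (- k)) = k" by linarith+
    then show "Q k" using N that by metis
  qed
qed

text \<open>Far out on either side the maps coincide with one fixed map, whose estimate at the limit
  point covers all nearby orbit points at once. Only finitely many times remain in between.\<close>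

lemma uniform_strict_deriv:
  fixes z :: "int \<Rightarrow> 'v::real_normed_vector" and A :: "int \<Rightarrow> 'v \<Rightarrow>\<^sub>L 'v"
  assumes each: "\<And>k. strict_deriv_at (g k) (z k) (A k)"
    and right: "\<exists>N. \<forall>k\<ge>N. g k = gb" "strict_deriv_at gb zb Mb" "(\<lambda>n. z (int n)) \<longlonglongrightarrow> zb"
    and left: "\<exists>N. \<forall>k\<le>N. g k = ga" "strict_deriv_at ga za Ma" "(\<lambda>n. z (- int n)) \<longlonglongrightarrow> za"
  shows "(\<lambda>n. A (int n)) \<longlonglongrightarrow> Mb" "(\<lambda>n. A (- int n)) \<longlonglongrightarrow> Ma"
    "\<delta> > 0 \<Longrightarrow> \<exists>r>0. \<forall>k u v. norm (u - z k) \<le> r \<longrightarrow> norm (v - z k) \<le> r \<longrightarrow>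
        norm (g k u - g k v - A k (u - v)) \<le> \<delta> * norm (u - v)"
proof -
  \<comment> \<open>Balls of radius \<open>r / 2\<close> about late orbit points lie in the ball
    about the limit; replacing \<open>M\<close> by \<open>A (s n)\<close> costs a second
    \<delta>.\<close>
  have tail: "\<forall>\<^sub>F n in sequentially. norm (A (s n) - M) \<le> \<delta> \<and> (\<forall>u v. norm (u - z (s n)) \<le> r / 2 \<longrightarrow> norm (v - z (s n)) \<le> r / 2 \<longrightarrow>
        norm (g (s n) u - g (s n) v - A (s n) (u - v)) \<le> 2 * \<delta> * norm (u - v))"
    if "\<forall>\<^sub>F n in sequentially. g (s n) = h" "(\<lambda>n. z (s n)) \<longlonglongrightarrow> z'" "\<delta> > 0" "r > 0"
      and r: "\<And>u v. norm (u - z') \<le> r \<Longrightarrow> norm (v - z') \<le> r \<Longrightarrow>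
        norm (h u - h v - M (u - v)) \<le> \<delta> * norm (u - v)"
    for s :: "nat \<Rightarrow> int" and h :: "'v \<Rightarrow> 'v" and z' and M :: "'v \<Rightarrow>\<^sub>L 'v" and \<delta> r
  proof -
    have "\<forall>\<^sub>F n in sequentially. norm (z (s n) - z') < r / 2"
      using tendstoD[OF that(2), of "r / 2"] that(4) by (simp add: dist_norm)
    with that(1) show ?thesis
    proof eventually_elim
      case (elim n)
      have near: "norm (A (s n) - M) \<le> \<delta>"
        using strict_deriv_near[of z' r h M \<delta> "z (s n)" "A (s n)"] r elim each[of "s n"] that(3,4) by simp
      have "norm (g (s n) u - g (s n) v - A (s n) (u - v)) \<le> 2 * \<delta> * norm (u - v)"
        if "norm (u - z (s n)) \<le> r / 2" "norm (v - z (s n)) \<le> r / 2" for u v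
      proof -
        have "norm (w - z') \<le> r" if "norm (w - z (s n)) \<le> r / 2" for w
          using that elim(2) norm_triangle_ineq[of "w - z (s n)" "z (s n) - z'"] by simp
        then have "norm (h u - h v - M (u - v)) \<le> \<delta> * norm (u - v)" using that by (intro r) auto
        moreover have "norm ((A (s n) - M) (u - v)) \<le> \<delta> * norm (u - v)"
          using near by (meson norm_blinfun mult_right_mono norm_ge_zero order_trans)
        moreover have eq: "h u - h v - A (s n) (u - v) = (h u - h v - M (u - v)) - (A (s n) - M) (u - v)"
          by (simp add: blinfun.diff_left)
        ultimately show ?thesis unfolding elim(1) eq
          using norm_triangle_ineq4[of "h u - h v - M (u - v)" "(A (s n) - M) (u - v)"] by linarith
      qed
      with near show ?case by blast
    qed
  qed
  have evb: "\<forall>\<^sub>F n in sequentially. g (int n) = gb" and eva: "\<forall>\<^sub>F n in sequentially. g (- int n) = ga"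
  proof -
    obtain N where N: "\<forall>k\<ge>N. g k = gb" using right(1) by blast
    show "\<forall>\<^sub>F n in sequentially. g (int n) = gb"
      unfolding eventually_sequentially by (rule exI[of _ "nat N"]) (use N in auto)
    obtain N where N: "\<forall>k\<le>N. g k = ga" using left(1) by blast
    show "\<forall>\<^sub>F n in sequentially. g (- int n) = ga"
      unfolding eventually_sequentially by (rule exI[of _ "nat (- N)"]) (use N in auto)
  qed
  show "(\<lambda>n. A (int n)) \<longlonglongrightarrow> Mb"
  proof (rule tendstoI)
    fix e :: real assume e: "e > 0"
    then have e2: "e / 2 > 0" by simp
    obtain r where r: "r > 0" "\<forall>u v. norm (u - zb) \<le> r \<longrightarrow> norm (v - zb) \<le> r \<longrightarrow>
      norm (gb u - gb v - Mb (u - v)) \<le> e / 2 * norm (u - v)" using strict_deriv_atD[OF right(2) e2] .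
    note T = tail[OF evb right(3) e2 r(1) r(2)[rule_format], simplified]
    show "\<forall>\<^sub>F n in sequentially. dist (A (int n)) Mb < e"
      using T by eventually_elim (use e in \<open>auto simp: dist_norm\<close>)
  qed
  show "(\<lambda>n. A (- int n)) \<longlonglongrightarrow> Ma"
  proof (rule tendstoI)
    fix e :: real assume e: "e > 0"
    then have e2: "e / 2 > 0" by simp
    obtain r where r: "r > 0" "\<forall>u v. norm (u - za) \<le> r \<longrightarrow> norm (v - za) \<le> r \<longrightarrow>
      norm (ga u - ga v - Ma (u - v)) \<le> e / 2 * norm (u - v)" using strict_deriv_atD[OF left(2) e2] .
    note T = tail[OF eva left(3) e2 r(1) r(2)[rule_format], simplified]
    show "\<forall>\<^sub>F n in sequentially. dist (A (- int n)) Ma < e"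
      using T by eventually_elim (use e in \<open>auto simp: dist_norm\<close>)
  qed
  assume \<delta>: "\<delta> > 0"
  then have \<delta>2: "\<delta> / 2 > 0" by simp
  define Q where "Q = (\<lambda>k r. \<forall>u v. norm (u - z k) \<le> r \<longrightarrow> norm (v - z k) \<le> r \<longrightarrow>
        norm (g k u - g k v - A k (u - v)) \<le> \<delta> * norm (u - v))"
  have "\<exists>r>0. \<forall>k. Q k r"
  proof (rule uniform_radius)
    show "\<exists>r>0. Q k r" for k using each[of k] \<delta> unfolding strict_deriv_at_def Q_def by blast
    show "Q k r \<Longrightarrow> 0 < s \<Longrightarrow> s \<le> r \<Longrightarrow> Q k s" for k r s
      unfolding Q_def by (meson order_trans)
    obtain r where r: "r > 0" "\<forall>u v. norm (u - zb) \<le> r \<longrightarrow> norm (v - zb) \<le> r \<longrightarrow>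
      norm (gb u - gb v - Mb (u - v)) \<le> \<delta> / 2 * norm (u - v)" using strict_deriv_atD[OF right(2) \<delta>2] .
    have "\<exists>N. \<forall>k\<ge>N. Q k (r / 2)"
      using tail[OF evb right(3) \<delta>2 r(1) r(2)[rule_format]]
      by (rule int_tails(1)) (auto simp: Q_def)
    then show "\<exists>N. \<exists>r>0. \<forall>k\<ge>N. Q k r" using r(1) by (meson half_gt_zero)
    obtain r where r: "r > 0" "\<forall>u v. norm (u - za) \<le> r \<longrightarrow> norm (v - za) \<le> r \<longrightarrow>
      norm (ga u - ga v - Ma (u - v)) \<le> \<delta> / 2 * norm (u - v)" using strict_deriv_atD[OF left(2) \<delta>2] .
    have "\<exists>N. \<forall>k\<le>N. Q k (r / 2)"
      using tail[OF eva left(3) \<delta>2 r(1) r(2)[rule_format]]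
      by (rule int_tails(2)) (auto simp: Q_def)
    then show "\<exists>N. \<exists>r>0. \<forall>k\<le>N. Q k r" using r(1) by (meson half_gt_zero)
  qed
  then show "\<exists>r>0. \<forall>k u v. norm (u - z k) \<le> r \<longrightarrow> norm (v - z k) \<le> r \<longrightarrow>
        norm (g k u - g k v - A k (u - v)) \<le> \<delta> * norm (u - v)" unfolding Q_def .
qed

text \<open>The inverse is a parameter of its own because the locale is used both for
  \<open>f\<close> and for the power of \<open>f\<close> that fixes the periodic points.\<close>

locale surface_dyn =
  fixes S :: "'a::metric_space set" and A :: "'a chart set" and F Fi :: "'a \<Rightarrow> 'a"
  assumes compact_S: "compact S"
    and atlas: "\<And>c. c \<in> A \<Longrightarrow> chart_on S c" and cover: "\<And>x. x \<in> S \<Longrightarrow> \<exists>c\<in>A. x \<in> fst c"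
    and smooth_id: "smooth_on S A id" and smooth_F: "smooth_on S A F" and smooth_Fi: "smooth_on S A Fi"
    and Fi_F: "\<And>x. x \<in> S \<Longrightarrow> Fi (F x) = x" and F_Fi: "\<And>x. x \<in> S \<Longrightarrow> F (Fi x) = x"
begin

definition orb :: "'a \<Rightarrow> int \<Rightarrow> 'a" where
  "orb x k = (if k \<ge> 0 then (F ^^ nat k) x else (Fi ^^ nat (- k)) x)"

lemma F_in: "x \<in> S \<Longrightarrow> F x \<in> S" and Fi_in: "x \<in> S \<Longrightarrow> Fi x \<in> S"
  using smooth_F smooth_Fi unfolding smooth_on_def by auto

lemma orb_0 [simp]: "orb x 0 = x"
  by (simp add: orb_def)

lemma orb_nat: "orb x (int n) = (F ^^ n) x"
  by (simp add: orb_def)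

lemma orb_neg: "orb x (- int n) = (Fi ^^ n) x"
  by (cases n) (simp_all add: orb_def nat_add_distrib del: funpow.simps)

lemma smooth_funpow:
  assumes "smooth_on S A h"
  shows "smooth_on S A (h ^^ n)"
proof (induction n)
  case (Suc n)
  show ?case unfolding funpow.simps by (rule smooth_on_compose[OF atlas cover assms Suc])
qed (use smooth_id in \<open>simp add: id_def\<close>)

lemma smooth_orb: "smooth_on S A (\<lambda>x. orb x k)"
  using smooth_funpow[OF smooth_F, of "nat k"] smooth_funpow[OF smooth_Fi, of "nat (- k)"]
  by (cases "k \<ge> 0") (simp_all add: orb_def)

lemma orb_in: "x \<in> S \<Longrightarrow> orb x k \<in> S"
  using smooth_orb[of k] unfolding smooth_on_def by auto

lemma F_orb: assumes "x \<in> S" shows "F (orb x k) = orb x (k + 1)"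
proof (cases "k \<ge> 0")
  case True
  then have "nat (k + 1) = Suc (nat k)" by linarith
  then show ?thesis using True by (simp add: orb_def)
next
  case False
  define n where "n = nat (- (k + 1))"
  have k: "k = - int (Suc n)" "k + 1 = - int n" using False by (auto simp: n_def)
  have "F (orb x k) = F (Fi ((Fi ^^ n) x))" unfolding k(1) orb_neg by simp
  also have "\<dots> = orb x (k + 1)" unfolding k(2) orb_neg
    using F_Fi[OF orb_in[OF assms, of "- int n"]] unfolding orb_neg .
  finally show ?thesis .
qed

lemma Fi_orb: "x \<in> S \<Longrightarrow> Fi (orb x k) = orb x (k - 1)"
  using F_orb[of x "k - 1"] Fi_F[OF orb_in, of x "k - 1"] by simp

lemma orb_unique:
  assumes y: "\<And>i. y i \<in> S" "\<And>i. F (y i) = y (i + 1)"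
  shows "y i = orb (y 0) i"
proof (induction i rule: int_induct[where k = 0])
  case (step1 i)
  have "y (i + 1) = F (y i)" by (rule y(2)[symmetric])
  then show ?case using F_orb[OF y(1)[of 0], of i] step1 by simp
next
  case (step2 i)
  have "F (y (i - 1)) = y i" using y(2)[of "i - 1"] by simp
  then have "y (i - 1) = Fi (y i)" using Fi_F[OF y(1)] by metis
  then show ?case using Fi_orb[OF y(1)[of 0], of i] step2 by simp
qed simp

lemma orb_add: "x \<in> S \<Longrightarrow> orb (orb x k) l = orb x (k + l)"
  using orb_unique[of "\<lambda>l. orb x (k + l)" l] F_orb orb_in by (simp add: add.assoc)

text \<open>The velocity at time \<open>k\<close> is defined through the derivative of the whole
  iterate from \<open>K\<close> to \<open>k\<close>, forward or backward. The recursion then follows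
  at every \<open>k\<close> from uniqueness of derivatives, without inverting
  \<open>dmap\<close>.\<close>

lemma curve_tangents:
  assumes x: "x \<in> S" and D: "\<And>k. D k \<in> A \<and> orb x k \<in> fst (D k)"
    and c: "c 0 = orb x K" "\<And>t. c t \<in> fst (D K)" "((snd (D K) \<circ> c) has_vector_derivative v) (at (0::real))"
  obtains \<zeta> where "\<zeta> K = v" "\<forall>k. \<zeta> (k + 1) = dmap (D k) (D (k + 1)) F (orb x k) (\<zeta> k)"
    "\<forall>k. ((\<lambda>t. snd (D k) (orb (c t) (k - K))) has_vector_derivative \<zeta> k) (at 0)"
proof -
  note At = atlas[OF conjunct1[OF D]]
  have cS: "c t \<in> S" for t using c(2) chart_subset[OF At] by blast
  have oc: "orb (c 0) (k - K) = orb x k" for k using orb_add[OF x] c(1) by simp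
  define \<zeta> where "\<zeta> = (\<lambda>k. dmap (D K) (D k) (\<lambda>y. orb y (k - K)) (c 0) v)"
  have der: "((\<lambda>t. snd (D k) (orb (c t) (k - K))) has_vector_derivative \<zeta> k) (at 0)" for k
  proof -
    have "strict_deriv_at (local_rep (D K) (D k) (\<lambda>y. orb y (k - K))) (snd (D K) (c 0))
        (dmap (D K) (D k) (\<lambda>y. orb y (k - K)) (c 0))"
      using D by (intro smooth_on_strict_deriv[OF smooth_orb]) (auto simp: cS c(2) oc)
    from strict_deriv_has_derivative[OF this]
    have "(local_rep (D K) (D k) (\<lambda>y. orb y (k - K)) has_derivative
        dmap (D K) (D k) (\<lambda>y. orb y (k - K)) (c 0)) (at ((snd (D K) \<circ> c) 0))" by simp
    from has_derivative_compose[OF c(3)[unfolded has_vector_derivative_def] this]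
    show ?thesis
      unfolding has_vector_derivative_def \<zeta>_def
      by (simp add: local_rep_apply[OF At c(2)] blinfun.scaleR_right)
  qed
  have uniq: "a = b" if "(f has_vector_derivative a) (at 0)" "(f has_vector_derivative b) (at 0)"
    for f :: "real \<Rightarrow> real^2" and a b
    using that by (rule vector_derivative_unique_at)
  have "\<zeta> K = v"
    using uniq[OF der[of K]] c(3) by (simp add: o_def)
  moreover have "\<zeta> (k + 1) = dmap (D k) (D (k + 1)) F (orb x k) (\<zeta> k)" for k
  proof (rule uniq[OF der])
    let ?y = "\<lambda>t. orb (c t) (k - K)"
    have "strict_deriv_at (local_rep (D k) (D (k + 1)) F) (snd (D k) (orb x k)) (dmap (D k) (D (k + 1)) F (orb x k))"
      using D by (intro smooth_on_strict_deriv[OF smooth_F]) (auto simp: F_orb x orb_in)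
    from strict_deriv_has_derivative[OF this]
    have "(local_rep (D k) (D (k + 1)) F has_derivative dmap (D k) (D (k + 1)) F (orb x k)) (at (snd (D k) (?y 0)))"
      by (simp add: oc)
    from has_derivative_compose[OF der[of k, unfolded has_vector_derivative_def] this]
    have 1: "((\<lambda>t. local_rep (D k) (D (k + 1)) F (snd (D k) (?y t))) has_vector_derivative
        dmap (D k) (D (k + 1)) F (orb x k) (\<zeta> k)) (at 0)"
      unfolding has_vector_derivative_def by (simp add: blinfun.scaleR_right)
    have "\<forall>\<^sub>F t in nhds 0. c t \<in> {y\<in>S. orb y (k - K) \<in> fst (D k)}"
      by (rule curve_in_open[OF At c(2,3) smooth_on_preimage[OF smooth_orb chart_openin[OF At]]])
        (use D oc cS in auto)
    then have "\<forall>\<^sub>F t in nhds 0. local_rep (D k) (D (k + 1)) F (snd (D k) (?y t)) = snd (D (k + 1)) (orb (c t) (k + 1 - K))"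
    proof eventually_elim
      case (elim t)
      then have "local_rep (D k) (D (k + 1)) F (snd (D k) (?y t)) = snd (D (k + 1)) (F (?y t))"
        by (intro local_rep_apply[OF At]) auto
      also have "F (?y t) = orb (c t) (k + 1 - K)" using F_orb[OF cS, of t "k - K"] by (simp add: algebra_simps)
      finally show ?case .
    qed
    then show "((\<lambda>t. snd (D (k + 1)) (orb (c t) (k + 1 - K))) has_vector_derivative
        dmap (D k) (D (k + 1)) F (orb x k) (\<zeta> k)) (at 0)"
      using 1 has_derivative_transform_eventually unfolding has_vector_derivative_def
      by (smt (verit) UNIV_I eventually_at_filter eventually_mono eventually_nhds_x_imp_x)
  qed
  ultimately show ?thesis using that der by blast
qed

text \<open>The threshold \<open>N\<close> is uniform for \<open>t\<close> near 0: the curve is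
  continuous in the intrinsic topology of the stable manifold, as in
  \<open>stable_tangent_space\<close>.\<close>

definition fwd_curve :: "(real \<Rightarrow> 'a) \<Rightarrow> 'a \<Rightarrow> bool" where
  "fwd_curve c q \<longleftrightarrow> (\<forall>\<epsilon>>0. \<exists>N. \<forall>\<^sub>F t in nhds 0. \<forall>n\<ge>N. dist (orb (c t) n) q \<le> \<epsilon>)"

definition bwd_curve :: "(real \<Rightarrow> 'a) \<Rightarrow> 'a \<Rightarrow> bool" where
  "bwd_curve c p \<longleftrightarrow> (\<forall>\<epsilon>>0. \<exists>N. \<forall>\<^sub>F t in nhds 0. \<forall>n\<le>N. dist (orb (c t) n) p \<le> \<epsilon>)"

text \<open>The tangent spaces are replaced by curves that realise the vectors. \<open>p\<close> is
  the limit in the past and \<open>q\<close> the limit in the future.\<close>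

definition transversal_at :: "'a \<Rightarrow> 'a \<Rightarrow> 'a \<Rightarrow> bool" where
  "transversal_at p q y \<longleftrightarrow> (\<forall>c\<in>A. y \<in> fst c \<longrightarrow> (\<forall>w. \<exists>cs cu vs vu. w = vs + vu \<and>
     cs 0 = y \<and> (\<forall>t. cs t \<in> fst c) \<and> ((snd c \<circ> cs) has_vector_derivative vs) (at 0) \<and> fwd_curve cs q \<and>
     cu 0 = y \<and> (\<forall>t. cu t \<in> fst c) \<and> ((snd c \<circ> cu) has_vector_derivative vu) (at 0) \<and> bwd_curve cu p))"

definition hyperbolic_fixed :: "'a \<Rightarrow> bool" where
  "hyperbolic_fixed q \<longleftrightarrow> q \<in> S \<and> F q = q \<and> (\<forall>c\<in>A. q \<in> fst c \<longrightarrow> hyperbolic_map (dmap c c F q))"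

section \<open>Heteroclinic orbits in coordinates\<close>

lemma chart_ball:
  assumes c: "c \<in> A" "q \<in> fst c" and r: "r > 0"
  shows "\<exists>\<epsilon>>0. \<forall>y\<in>S. dist y q \<le> \<epsilon> \<longrightarrow> y \<in> fst c \<and> norm (snd c y - snd c q) \<le> r"
proof -
  note ch = atlas[OF c(1)]
  have h: "homeomorphism (fst c) (snd c ` fst c) (snd c) (inv_into (fst c) (snd c))"
    using ch by (auto simp: chart_on_def split_beta)
  have "openin (top_of_set (fst c)) (fst c \<inter> snd c -` ball (snd c q) r)"
    using homeomorphism_cont1[OF h] by (intro continuous_openin_preimage_gen) auto
  then have "openin (top_of_set S) (fst c \<inter> snd c -` ball (snd c q) r)"
    using chart_openin[OF ch] openin_trans by blast
  then obtain e where e: "e > 0" "\<forall>y\<in>S. dist y q < e \<longrightarrow> y \<in> fst c \<inter> snd c -` ball (snd c q) r"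
    using c(2) r unfolding openin_euclidean_subtopology_iff by (metis IntI centre_in_ball vimageI)
  show ?thesis
    by (rule exI[of _ "e / 2"]) (use e in \<open>auto simp: dist_norm norm_minus_commute less_imp_le\<close>)
qed

lemma chart_tendsto:
  assumes "c \<in> A" "q \<in> fst c" "y \<longlonglongrightarrow> q" "\<And>n. y n \<in> S"
  shows "(\<lambda>n. snd c (y n)) \<longlonglongrightarrow> snd c q"
proof (rule tendstoI)
  fix e :: real assume e: "e > 0"
  then have e2: "e / 2 > 0" by simp
  from chart_ball[OF assms(1,2) e2] obtain \<epsilon> where \<epsilon>: "\<epsilon> > 0"
    "\<forall>y\<in>S. dist y q \<le> \<epsilon> \<longrightarrow> y \<in> fst c \<and> norm (snd c y - snd c q) \<le> e / 2" by blast
  from tendstoD[OF assms(3) \<epsilon>(1)] show "\<forall>\<^sub>F n in sequentially. dist (snd c (y n)) (snd c q) < e"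
  proof eventually_elim
    case (elim n)
    then have "norm (snd c (y n) - snd c q) \<le> e / 2" using \<epsilon>(2) assms(4) by simp
    then show ?case using e by (simp add: dist_norm)
  qed
qed

text \<open>The charts are eventually constant on both sides, so that the coordinate maps eventually
  coincide with one map near its hyperbolic fixed point.\<close>

definition orbit_charts :: "'a \<Rightarrow> 'a chart \<Rightarrow> 'a chart \<Rightarrow> int \<Rightarrow> (int \<Rightarrow> 'a chart) \<Rightarrow> bool" where
  "orbit_charts x a b N D \<longleftrightarrow> x \<in> S \<and> (\<forall>k. D k \<in> A \<and> orb x k \<in> fst (D k)) \<and>
     (\<forall>k\<ge>N. D k = b) \<and> (\<forall>k\<le>-N. D k = a)"

lemma orbit_charts_exist:
  assumes x: "x \<in> S" and a: "a \<in> A" "p \<in> fst a" and b: "b \<in> A" "q \<in> fst b"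
    and lim: "(\<lambda>n. orb x (int n)) \<longlonglongrightarrow> q" "(\<lambda>n. orb x (- int n)) \<longlonglongrightarrow> p"
  shows "\<exists>N>0. \<exists>D. orbit_charts x a b N D"
proof -
  have ev: "\<forall>\<^sub>F n in sequentially. y n \<in> fst c" if c: "c \<in> A" "q \<in> fst c" "y \<longlonglongrightarrow> q" "\<And>n. y n \<in> S" for c q and y :: "nat \<Rightarrow> 'a"
  proof -
    obtain \<epsilon> where "\<epsilon> > 0" "\<forall>y\<in>S. dist y q \<le> \<epsilon> \<longrightarrow> y \<in> fst c"
      using chart_ball[OF c(1,2), of 1] by auto
    then show ?thesis using tendstoD[OF c(3), of \<epsilon>] c(4) by (auto elim!: eventually_mono)
  qed
  obtain N1 where N1: "\<forall>k\<ge>N1. orb x k \<in> fst b"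
    using int_tails(1)[OF ev[OF b lim(1) orb_in[OF x]], of "\<lambda>k. orb x k \<in> fst b"] by auto
  obtain N2 where N2: "\<forall>k\<le>N2. orb x k \<in> fst a"
    using int_tails(2)[OF ev[OF a lim(2) orb_in[OF x]], of "\<lambda>k. orb x k \<in> fst a"] by auto
  define N where "N = max 1 (max N1 (- N2))"
  define D where "D = (\<lambda>k. if k \<ge> N then b else if k \<le> - N then a else (SOME c. c \<in> A \<and> orb x k \<in> fst c))"
  have some: "(SOME c. c \<in> A \<and> orb x k \<in> fst c) \<in> A \<and> orb x k \<in> fst (SOME c. c \<in> A \<and> orb x k \<in> fst c)" for k
    by (rule someI_ex) (use cover[OF orb_in[OF x]] in blast)
  have "orbit_charts x a b N D"
    using x a b N1 N2 some unfolding orbit_charts_def D_def by (auto simp: N_def)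
  moreover have "N > 0" by (simp add: N_def)
  ultimately show ?thesis by blast
qed

text \<open>\<open>I\<close> stands for either kind of half-line, so that stable curves at the
  future limit and unstable curves at the past limit are treated by one argument in the chart of the
  fixed point.\<close>

lemma tangent_bounded_near_fixed:
  assumes x: "x \<in> S" and D: "\<And>k. D k \<in> A \<and> orb x k \<in> fst (D k)" and q: "hyperbolic_fixed q" "b \<in> A" "q \<in> fst b"
    and c: "\<And>t. c t \<in> S"
    and der: "\<forall>k. ((\<lambda>t. snd (D k) (orb (c t) (k - K))) has_vector_derivative \<zeta> k) (at (0::real))"
    and I: "\<And>k0 :: int. I k0 = {k0..} \<or> I k0 = {..k0}"
    and near: "\<And>\<epsilon>. \<epsilon> > 0 \<Longrightarrow> \<exists>k0. (\<forall>k\<in>I k0. D k = b) \<and> (\<forall>\<^sub>F t in nhds 0. \<forall>k\<in>I k0. dist (orb (c t) (k - K)) q \<le> \<epsilon>)"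
  shows "\<exists>k0 B. \<forall>k\<in>I k0. norm (\<zeta> k) \<le> B"
proof -
  have Fq: "q \<in> S" "F q = q" and hyp: "hyperbolic_map (dmap b b F q)"
    using q unfolding hyperbolic_fixed_def by auto
  have strict: "strict_deriv_at (local_rep b b F) (snd b q) (dmap b b F q)"
    using q Fq by (intro smooth_on_strict_deriv[OF smooth_F]) auto
  let ?y = "\<lambda>t k. snd b (orb (c t) (k - K))"
  obtain r where r: "r > 0" and tob: "\<forall>(y :: real \<Rightarrow> int \<Rightarrow> real^2) \<zeta> I k0. (I = {k0..} \<or> I = {..k0}) \<longrightarrow>
    (\<forall>\<^sub>F t in nhds 0. \<forall>k\<in>I. norm (y t k - snd b q) \<le> r) \<longrightarrow>
    (\<forall>\<^sub>F t in nhds 0. \<forall>k. k \<in> I \<longrightarrow> k + 1 \<in> I \<longrightarrow> y t (k + 1) = local_rep b b F (y t k)) \<longrightarrow>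
    (\<forall>k\<in>I. ((\<lambda>t. y t k) has_vector_derivative \<zeta> k) (at 0)) \<longrightarrow>
    (\<exists>K. \<forall>k\<in>I. norm (\<zeta> k) \<le> K)"
    using tangent_orbit_bounded[OF hyp strict] .
  obtain \<epsilon> where \<epsilon>: "\<epsilon> > 0" "\<forall>y\<in>S. dist y q \<le> \<epsilon> \<longrightarrow> y \<in> fst b \<and> norm (snd b y - snd b q) \<le> r"
    using chart_ball[OF q(2,3) r] by blast
  obtain k0 where k0: "\<forall>k\<in>I k0. D k = b" "\<forall>\<^sub>F t in nhds 0. \<forall>k\<in>I k0. dist (orb (c t) (k - K)) q \<le> \<epsilon>"
    using near[OF \<epsilon>(1)] by blast
  have 1: "\<forall>\<^sub>F t in nhds 0. \<forall>k\<in>I k0. orb (c t) (k - K) \<in> fst b \<and> norm (?y t k - snd b q) \<le> r"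
    using k0(2) by eventually_elim (use \<epsilon>(2) orb_in[OF c] in auto)
  have "\<forall>\<^sub>F t in nhds 0. \<forall>k\<in>I k0. norm (?y t k - snd b q) \<le> r"
    using 1 by eventually_elim auto
  moreover have "\<forall>\<^sub>F t in nhds 0. \<forall>k. k \<in> I k0 \<longrightarrow> k + 1 \<in> I k0 \<longrightarrow> ?y t (k + 1) = local_rep b b F (?y t k)"
    using 1
  proof eventually_elim
    case (elim t)
    show ?case
    proof (intro allI impI)
      fix k assume k: "k \<in> I k0" "k + 1 \<in> I k0"
      have "local_rep b b F (?y t k) = snd b (F (orb (c t) (k - K)))"
        using elim k by (intro local_rep_apply[OF atlas[OF q(2)]]) auto
      then show "?y t (k + 1) = local_rep b b F (?y t k)"
        using F_orb[OF c, of t "k - K"] by (simp add: algebra_simps)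
    qed
  qed
  moreover have "\<forall>k\<in>I k0. ((\<lambda>t. ?y t k) has_vector_derivative \<zeta> k) (at 0)"
    using der k0(1) by metis
  ultimately have "\<exists>B. \<forall>k\<in>I k0. norm (\<zeta> k) \<le> B"
    using tob[THEN spec[of _ ?y], THEN spec[of _ \<zeta>], THEN spec[of _ "I k0"], THEN spec[of _ k0]] I[of k0] by blast
  then show ?thesis by blast
qed

text \<open>The two curves given by transversality are transported along the orbit. Hyperbolicity of
  the limit point bounds their velocities on a tail, and finitely many times remain up to
  \<open>K\<close>.\<close>

lemma dichotomous_orbit:
  assumes D: "orbit_charts x a b N D" and p: "hyperbolic_fixed p" "a \<in> A" "p \<in> fst a"
    and q: "hyperbolic_fixed q" "b \<in> A" "q \<in> fst b" and tr: "transversal_at p q (orb x K)"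
  shows "dichotomous_at (\<lambda>k. dmap (D k) (D (k + 1)) F (orb x k)) K"
  unfolding dichotomous_at_def
proof
  fix w :: "real^2"
  have x: "x \<in> S" and D': "\<And>k. D k \<in> A \<and> orb x k \<in> fst (D k)" and Db: "\<And>k. k \<ge> N \<Longrightarrow> D k = b" and Da: "\<And>k. k \<le> - N \<Longrightarrow> D k = a"
    using D unfolding orbit_charts_def by auto
  obtain cs cu vs vu where w: "w = vs + vu"
     and cs: "cs 0 = orb x K" "\<forall>t. cs t \<in> fst (D K)" "((snd (D K) \<circ> cs) has_vector_derivative vs) (at 0)" "fwd_curve cs q"
     and cu: "cu 0 = orb x K" "\<forall>t. cu t \<in> fst (D K)" "((snd (D K) \<circ> cu) has_vector_derivative vu) (at 0)" "bwd_curve cu p"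
    using tr D'[of K] unfolding transversal_at_def by blast
  have inS: "cs t \<in> S" "cu t \<in> S" for t
    using cs(2) cu(2) chart_subset[OF atlas[OF conjunct1[OF D']]] by blast+
  obtain \<zeta>s where \<zeta>s: "\<zeta>s K = vs" "\<forall>k. \<zeta>s (k + 1) = dmap (D k) (D (k + 1)) F (orb x k) (\<zeta>s k)"
    "\<forall>k. ((\<lambda>t. snd (D k) (orb (cs t) (k - K))) has_vector_derivative \<zeta>s k) (at 0)"
    using curve_tangents[OF x D' cs(1) spec[OF cs(2)] cs(3)] .
  obtain \<zeta>u where \<zeta>u: "\<zeta>u K = vu" "\<forall>k. \<zeta>u (k + 1) = dmap (D k) (D (k + 1)) F (orb x k) (\<zeta>u k)"
    "\<forall>k. ((\<lambda>t. snd (D k) (orb (cu t) (k - K))) has_vector_derivative \<zeta>u k) (at 0)"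
    using curve_tangents[OF x D' cu(1) spec[OF cu(2)] cu(3)] .
  have "\<exists>k0 B. \<forall>k\<in>{k0..}. norm (\<zeta>s k) \<le> B"
  proof (rule tangent_bounded_near_fixed[OF x D' q inS(1) \<zeta>s(3)])
    fix \<epsilon> :: real assume "\<epsilon> > 0"
    then obtain m where m: "\<forall>\<^sub>F t in nhds 0. \<forall>n\<ge>m. dist (orb (cs t) n) q \<le> \<epsilon>"
      using cs(4) unfolding fwd_curve_def by blast
    show "\<exists>k0. (\<forall>k\<in>{k0..}. D k = b) \<and> (\<forall>\<^sub>F t in nhds 0. \<forall>k\<in>{k0..}. dist (orb (cs t) (k - K)) q \<le> \<epsilon>)"
      by (rule exI[of _ "max N (m + K)"]) (use Db in \<open>auto intro!: eventually_mono[OF m]\<close>)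
  qed simp
  then obtain k1 B1 where B1: "\<forall>k\<ge>k1. norm (\<zeta>s k) \<le> B1" by auto
  have "\<exists>k0 B. \<forall>k\<in>{..k0}. norm (\<zeta>u k) \<le> B"
  proof (rule tangent_bounded_near_fixed[OF x D' p inS(2) \<zeta>u(3)])
    fix \<epsilon> :: real assume "\<epsilon> > 0"
    then obtain m where m: "\<forall>\<^sub>F t in nhds 0. \<forall>n\<le>m. dist (orb (cu t) n) p \<le> \<epsilon>"
      using cu(4) unfolding bwd_curve_def by blast
    show "\<exists>k0. (\<forall>k\<in>{..k0}. D k = a) \<and> (\<forall>\<^sub>F t in nhds 0. \<forall>k\<in>{..k0}. dist (orb (cu t) (k - K)) p \<le> \<epsilon>)"
      by (rule exI[of _ "min (- N) (m + K)"]) (use Da in \<open>auto intro!: eventually_mono[OF m]\<close>)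
  qed simp
  then obtain k2 B2 where B2: "\<forall>k\<le>k2. norm (\<zeta>u k) \<le> B2" by auto
  define B where "B = \<bar>B1\<bar> + \<bar>B2\<bar> + (\<Sum>k\<in>{K..k1}. norm (\<zeta>s k)) + (\<Sum>k\<in>{k2..K}. norm (\<zeta>u k))"
  have nn: "0 \<le> (\<Sum>k\<in>{K..k1}. norm (\<zeta>s k))" "0 \<le> (\<Sum>k\<in>{k2..K}. norm (\<zeta>u k))"
    by (simp_all add: sum_nonneg)
  have "norm (\<zeta>s k) \<le> B" if "k \<ge> K" for k
  proof (cases "k \<ge> k1")
    case True
    then have "norm (\<zeta>s k) \<le> B1" using B1 by simp
    then show ?thesis using nn unfolding B_def by linarith
  next
    case False
    then have "norm (\<zeta>s k) \<le> (\<Sum>k\<in>{K..k1}. norm (\<zeta>s k))"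
      using that by (intro member_le_sum) auto
    then show ?thesis using nn unfolding B_def by linarith
  qed
  moreover have "norm (\<zeta>u k) \<le> B" if "k \<le> K" for k
  proof (cases "k \<le> k2")
    case True
    then have "norm (\<zeta>u k) \<le> B2" using B2 by simp
    then show ?thesis using nn unfolding B_def by linarith
  next
    case False
    then have "norm (\<zeta>u k) \<le> (\<Sum>k\<in>{k2..K}. norm (\<zeta>u k))"
      using that by (intro member_le_sum) auto
    then show ?thesis using nn unfolding B_def by linarith
  qed
  ultimately show "\<exists>\<zeta>s \<zeta>u B. \<zeta>s K + \<zeta>u K = w \<and>
     (\<forall>k\<ge>K. \<zeta>s (k + 1) = dmap (D k) (D (k + 1)) F (orb x k) (\<zeta>s k)) \<and>
     (\<forall>k<K. \<zeta>u (k + 1) = dmap (D k) (D (k + 1)) F (orb x k) (\<zeta>u k)) \<and>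
     (\<forall>k\<ge>K. norm (\<zeta>s k) \<le> B) \<and> (\<forall>k\<le>K. norm (\<zeta>u k) \<le> B)"
    using \<zeta>s(1,2) \<zeta>u(1,2) w by blast
qed

lemma orbit_hetero_data:
  assumes D: "orbit_charts x a b N D" and p: "hyperbolic_fixed p" "a \<in> A" "p \<in> fst a"
    and q: "hyperbolic_fixed q" "b \<in> A" "q \<in> fst b" and tr: "\<And>K. transversal_at p q (orb x K)"
    and lim: "(\<lambda>n. orb x (int n)) \<longlonglongrightarrow> q" "(\<lambda>n. orb x (- int n)) \<longlonglongrightarrow> p"
  shows "hetero_data (\<lambda>k. snd (D k) (orb x k)) (\<lambda>k. local_rep (D k) (D (k + 1)) F)
    (\<lambda>k. dmap (D k) (D (k + 1)) F (orb x k)) (snd a p, dmap a a F p) (snd b q, dmap b b F q)"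
proof -
  have x: "x \<in> S" and D': "\<And>k. D k \<in> A \<and> orb x k \<in> fst (D k)" and Db: "\<And>k. k \<ge> N \<Longrightarrow> D k = b" and Da: "\<And>k. k \<le> - N \<Longrightarrow> D k = a"
    using D unfolding orbit_charts_def by auto
  have p': "p \<in> S" "F p = p" and q': "q \<in> S" "F q = q" and hyp: "hyperbolic_map (dmap a a F p)" "hyperbolic_map (dmap b b F q)"
    using p q unfolding hyperbolic_fixed_def by auto
  have each: "strict_deriv_at (local_rep (D k) (D (k + 1)) F) (snd (D k) (orb x k)) (dmap (D k) (D (k + 1)) F (orb x k))" for k
    using D' by (intro smooth_on_strict_deriv[OF smooth_F]) (auto simp: F_orb x orb_in)
  have sq: "strict_deriv_at (local_rep b b F) (snd b q) (dmap b b F q)"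
    using q q' by (intro smooth_on_strict_deriv[OF smooth_F]) auto
  have sp: "strict_deriv_at (local_rep a a F) (snd a p) (dmap a a F p)"
    using p p' by (intro smooth_on_strict_deriv[OF smooth_F]) auto
  have zb: "(\<lambda>n. snd (D (int n)) (orb x (int n))) \<longlonglongrightarrow> snd b q"
  proof (rule Lim_transform_eventually[OF chart_tendsto[OF q(2,3) lim(1) orb_in[OF x]]])
    show "\<forall>\<^sub>F n in sequentially. snd b (orb x (int n)) = snd (D (int n)) (orb x (int n))"
      unfolding eventually_sequentially by (rule exI[of _ "nat N"]) (use Db in auto)
  qed
  have za: "(\<lambda>n. snd (D (- int n)) (orb x (- int n))) \<longlonglongrightarrow> snd a p"
  proof (rule Lim_transform_eventually[OF chart_tendsto[OF p(2,3) lim(2) orb_in[OF x]]])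
    show "\<forall>\<^sub>F n in sequentially. snd a (orb x (- int n)) = snd (D (- int n)) (orb x (- int n))"
      unfolding eventually_sequentially by (rule exI[of _ "nat N"]) (use Da in auto)
  qed
  have gb: "\<exists>N. \<forall>k\<ge>N. local_rep (D k) (D (k + 1)) F = local_rep b b F"
    by (rule exI[of _ N]) (use Db in auto)
  have ga: "\<exists>N. \<forall>k\<le>N. local_rep (D k) (D (k + 1)) F = local_rep a a F"
    by (rule exI[of _ "- N - 1"]) (use Da in auto)
  note U = uniform_strict_deriv[of "\<lambda>k. local_rep (D k) (D (k + 1)) F" "\<lambda>k. snd (D k) (orb x k)"
      "\<lambda>k. dmap (D k) (D (k + 1)) F (orb x k)", OF each gb sq zb ga sp za]
  have orbit: "local_rep (D k) (D (k + 1)) F (snd (D k) (orb x k)) = snd (D (k + 1)) (orb x (k + 1))" for k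
    using local_rep_apply[OF atlas[OF conjunct1[OF D']] conjunct2[OF D'], of k "D (k + 1)" F] F_orb[OF x, of k] by simp
  show ?thesis
    unfolding hetero_data_def fst_conv snd_conv
    using hyp zb za U(1,2) dichotomous_orbit[OF D p q tr] orbit U(3) by blast
qed

text \<open>Shadowing produces only coordinates. Within this radius they come from points of the
  surface whose images lie in the domain of the next chart.\<close>

lemma orbit_chart_radius:
  assumes D: "orbit_charts x a b N D" and p: "p \<in> S" "F p = p" "p \<in> fst a" "a \<in> A"
    and q: "q \<in> S" "F q = q" "q \<in> fst b" "b \<in> A"
    and lim: "(\<lambda>n. orb x (int n)) \<longlonglongrightarrow> q" "(\<lambda>n. orb x (- int n)) \<longlonglongrightarrow> p" and \<epsilon>: "\<epsilon> > 0"
  shows "\<exists>r>0. \<forall>k u. norm (u - snd (D k) (orb x k)) \<le> r \<longrightarrow>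
    (\<exists>y. y \<in> fst (D k) \<and> F y \<in> fst (D (k + 1)) \<and> dist y (orb x k) < \<epsilon> \<and> u = snd (D k) y)"
proof -
  have x: "x \<in> S" and D': "\<And>k. D k \<in> A \<and> orb x k \<in> fst (D k)" and Db: "\<And>k. k \<ge> N \<Longrightarrow> D k = b" and Da: "\<And>k. k \<le> - N \<Longrightarrow> D k = a"
    using D unfolding orbit_charts_def by auto
  define Q where "Q = (\<lambda>k r. \<forall>u. norm (u - snd (D k) (orb x k)) \<le> r \<longrightarrow>
    (\<exists>y. y \<in> fst (D k) \<and> F y \<in> fst (D (k + 1)) \<and> dist y (orb x k) < \<epsilon> \<and> u = snd (D k) y))"
  have open_ball: "openin (top_of_set S) (S \<inter> ball q e)" for q e by (simp add: openin_open_Int)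
  have near: "\<exists>r>0. \<forall>u. norm (u - snd c q) \<le> r \<longrightarrow> (\<exists>y. y \<in> fst c \<and> y \<in> S \<and> F y \<in> fst c' \<and> dist y q < e \<and> u = snd c y)"
    if "c \<in> A" "c' \<in> A" "q \<in> fst c" "F q \<in> fst c'" "q \<in> S" "e > 0" for c c' q e
  proof -
    have "openin (top_of_set S) ({y\<in>S. F y \<in> fst c'} \<inter> (S \<inter> ball q e))"
      using smooth_on_preimage[OF smooth_F chart_openin[OF atlas[OF that(2)]]] open_ball by (rule openin_Int)
    from chart_near[OF atlas[OF that(1)] this that(3)] that
    show ?thesis by (auto simp: dist_commute)
  qed
  have tail: "\<exists>r>0. \<forall>\<^sub>F n in sequentially. Q (s n) r"
    if c: "c \<in> A" "q \<in> S" "F q = q" "q \<in> fst c" and lim: "(\<lambda>n. orb x (s n)) \<longlonglongrightarrow> q"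
      and Dc: "\<forall>\<^sub>F n in sequentially. D (s n) = c \<and> D (s n + 1) = c" for c q and s :: "nat \<Rightarrow> int"
  proof -
    have e2: "\<epsilon> / 2 > 0" using \<epsilon> by simp
    obtain r where r: "r > 0" "\<forall>u. norm (u - snd c q) \<le> r \<longrightarrow> (\<exists>y. y \<in> fst c \<and> y \<in> S \<and> F y \<in> fst c \<and> dist y q < \<epsilon> / 2 \<and> u = snd c y)"
      using near[of c c q "\<epsilon> / 2"] c e2 by auto
    have "\<forall>\<^sub>F n in sequentially. dist (snd c (orb x (s n))) (snd c q) < r / 2"
      using r(1) by (intro tendstoD[OF chart_tendsto[OF c(1,4) lim orb_in[OF x]]]) simp
    moreover have "\<forall>\<^sub>F n in sequentially. dist (orb x (s n)) q < \<epsilon> / 2" using tendstoD[OF lim e2] .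
    ultimately have "\<forall>\<^sub>F n in sequentially. Q (s n) (r / 2)"
      using Dc
    proof eventually_elim
      case (elim n)
      show ?case unfolding Q_def
      proof (intro allI impI)
        fix u assume "norm (u - snd (D (s n)) (orb x (s n))) \<le> r / 2"
        then have "norm (u - snd c q) \<le> r"
          using elim norm_triangle_ineq[of "u - snd c (orb x (s n))" "snd c (orb x (s n)) - snd c q"]
          by (simp add: dist_norm)
        then obtain y where y: "y \<in> fst c" "F y \<in> fst c" "dist y q < \<epsilon> / 2" "u = snd c y" using r(2) by blast
        moreover have "dist y (orb x (s n)) < \<epsilon>"
          using y(3) elim(2) dist_triangle2[of y "orb x (s n)" q] by linarith
        ultimately show "\<exists>y. y \<in> fst (D (s n)) \<and> F y \<in> fst (D (s n + 1)) \<and> dist y (orb x (s n)) < \<epsilon> \<and> u = snd (D (s n)) y"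
          using elim(3) by auto
      qed
    qed
    then show ?thesis using r(1) by (meson half_gt_zero)
  qed
  have "\<exists>r>0. \<forall>k. Q k r"
  proof (rule uniform_radius)
    show "\<exists>r>0. Q k r" for k
    proof -
      have "F (orb x k) \<in> fst (D (k + 1))" using D' F_orb[OF x] by simp
      from near[OF conjunct1[OF D'] conjunct1[OF D'] conjunct2[OF D'] this orb_in[OF x] \<epsilon>]
      show ?thesis unfolding Q_def by blast
    qed
    show "Q k r \<Longrightarrow> 0 < s \<Longrightarrow> s \<le> r \<Longrightarrow> Q k s" for k r s unfolding Q_def by (meson order_trans)
    have "\<forall>\<^sub>F n in sequentially. D (int n) = b \<and> D (int n + 1) = b"
      unfolding eventually_sequentially by (rule exI[of _ "nat N"]) (use Db in auto)
    from tail[OF q(4,1,2,3) lim(1) this] obtain r where r: "r > 0" "\<forall>\<^sub>F n in sequentially. Q (int n) r" by blast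
    show "\<exists>N. \<exists>r>0. \<forall>k\<ge>N. Q k r" using int_tails(1)[OF r(2), of "\<lambda>k. Q k r"] r(1) by blast
    have "\<forall>\<^sub>F n in sequentially. D (- int n) = a \<and> D (- int n + 1) = a"
      unfolding eventually_sequentially by (rule exI[of _ "nat (N + 1)"]) (use Da in auto)
    from tail[OF p(4,1,2,3) lim(2) this] obtain r where r: "r > 0" "\<forall>\<^sub>F n in sequentially. Q (- int n) r" by blast
    show "\<exists>N. \<exists>r>0. \<forall>k\<le>N. Q k r" using int_tails(2)[OF r(2), of "\<lambda>k. Q k r"] r(1) by blast
  qed
  then show ?thesis unfolding Q_def .
qed

text \<open>Shadowing in coordinates, translated back to the surface. Consecutive pieces share the
  chart at their common fixed point, so that coordinates can be compared across a switch.\<close>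

theorem chain_shadowing:
  assumes L: "L > 0" and q: "\<And>j. j \<le> L \<Longrightarrow> hyperbolic_fixed (q j)" and x: "\<And>j. j < L \<Longrightarrow> x j \<in> S"
    and lim: "\<And>j. j < L \<Longrightarrow> (\<lambda>n. orb (x j) (int n)) \<longlonglongrightarrow> q (Suc j)" "\<And>j. j < L \<Longrightarrow> (\<lambda>n. orb (x j) (- int n)) \<longlonglongrightarrow> q j"
    and tr: "\<And>j K. j < L \<Longrightarrow> transversal_at (q j) (q (Suc j)) (orb (x j) K)" and \<epsilon>: "\<epsilon> > 0"
  shows "\<exists>T>0. \<forall>t J. separated L t T \<longrightarrow> nearest L t J \<longrightarrow>
    (\<exists>y\<in>S. \<forall>i. dist (orb y i) (orb (x (J i)) (i - t (J i))) < \<epsilon>)"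
proof -
  have qS: "q j \<in> S" "F (q j) = q j" if "j \<le> L" for j using q[OF that] by (auto simp: hyperbolic_fixed_def)
  have "\<forall>j. \<exists>c. j \<le> L \<longrightarrow> c \<in> A \<and> q j \<in> fst c" using cover qS(1) by blast
  from choice[OF this] obtain c where c: "\<And>j. j \<le> L \<Longrightarrow> c j \<in> A \<and> q j \<in> fst (c j)" by blast
  have "\<forall>j. \<exists>ND. j < L \<longrightarrow> fst ND > 0 \<and> orbit_charts (x j) (c j) (c (Suc j)) (fst ND) (snd ND)"
  proof
    fix j
    show "\<exists>ND. j < L \<longrightarrow> fst ND > 0 \<and> orbit_charts (x j) (c j) (c (Suc j)) (fst ND) (snd ND)"
    proof (cases "j < L")
      case True
      then have "\<exists>N>0. \<exists>D. orbit_charts (x j) (c j) (c (Suc j)) N D"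
        using c[of j] c[of "Suc j"] by (intro orbit_charts_exist[OF x _ _ _ _ lim]) auto
      then show ?thesis by auto
    qed auto
  qed
  from choice[OF this] obtain ND where ND: "\<And>j. j < L \<Longrightarrow> fst (ND j) > 0 \<and> orbit_charts (x j) (c j) (c (Suc j)) (fst (ND j)) (snd (ND j))"
    by blast
  define N where "N = (\<lambda>j. fst (ND j))"
  define D where "D = (\<lambda>j. snd (ND j))"
  have OC: "orbit_charts (x j) (c j) (c (Suc j)) (N j) (D j)" and Npos: "N j > 0" if "j < L" for j
    using ND[OF that] by (simp_all add: N_def D_def)
  have DA: "D j k \<in> A" "orb (x j) k \<in> fst (D j k)" if "j < L" for j k
    using OC[OF that] unfolding orbit_charts_def by auto
  \<comment> \<open>At distance \<open>N0\<close> from its centre every piece uses the chart of its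
    limit point; handed to the coordinate shadowing, this bound places all switches there.\<close>
  define N0 where "N0 = Max (N ` {..<L})"
  have N0: "N j \<le> N0" if "j < L" for j unfolding N0_def using that by (intro Max_ge) auto
  have "\<forall>j. \<exists>r. j < L \<longrightarrow> r > 0 \<and> (\<forall>k u. norm (u - snd (D j k) (orb (x j) k)) \<le> r \<longrightarrow>
    (\<exists>y. y \<in> fst (D j k) \<and> F y \<in> fst (D j (k + 1)) \<and> dist y (orb (x j) k) < \<epsilon> \<and> u = snd (D j k) y))"
  proof
    fix j
    show "\<exists>r. j < L \<longrightarrow> r > 0 \<and> (\<forall>k u. norm (u - snd (D j k) (orb (x j) k)) \<le> r \<longrightarrow>
    (\<exists>y. y \<in> fst (D j k) \<and> F y \<in> fst (D j (k + 1)) \<and> dist y (orb (x j) k) < \<epsilon> \<and> u = snd (D j k) y))"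
    proof (cases "j < L")
      case True
      then show ?thesis
        using orbit_chart_radius[OF OC[OF True], of "q j" "q (Suc j)" \<epsilon>] qS c[of j] c[of "Suc j"] lim[OF True] \<epsilon> by auto
    qed auto
  qed
  from choice[OF this] obtain rj where rj: "\<And>j. j < L \<Longrightarrow> rj j > 0 \<and> (\<forall>k u. norm (u - snd (D j k) (orb (x j) k)) \<le> rj j \<longrightarrow>
    (\<exists>y. y \<in> fst (D j k) \<and> F y \<in> fst (D j (k + 1)) \<and> dist y (orb (x j) k) < \<epsilon> \<and> u = snd (D j k) y))" by blast
  define r where "r = Min (rj ` {..<L})"
  have r: "r > 0" unfolding r_def using rj L by (subst Min_gr_iff) auto
  have rle: "r \<le> rj j" if "j < L" for j unfolding r_def using that by (intro Min_le) auto
  define z where "z = (\<lambda>j k. snd (D j k) (orb (x j) k))"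
  define g where "g = (\<lambda>j k. local_rep (D j k) (D j (k + 1)) F)"
  have data: "hetero_data (z j) (g j) (\<lambda>k. dmap (D j k) (D j (k + 1)) F (orb (x j) k))
      (snd (c j) (q j), dmap (c j) (c j) F (q j)) (snd (c (Suc j)) (q (Suc j)), dmap (c (Suc j)) (c (Suc j)) F (q (Suc j)))"
    if "j < L" for j
    unfolding z_def g_def using that c[of j] c[of "Suc j"] q
    by (intro orbit_hetero_data[OF OC[OF that]] tr lim) auto
  obtain T where T: "T > 0" and sh: "\<forall>t J. separated L t T \<longrightarrow> nearest L t J \<longrightarrow>
    (\<forall>i. J i = J (i + 1) \<or> (J (i + 1) = Suc (J i) \<and> t (J i) + N0 \<le> i \<and> i + 1 \<le> t (J (i + 1)) - N0)) \<and>
    (\<exists>\<xi>. bdd_by r \<xi> \<and> (\<forall>i. g (J i) (i - t (J i)) (z (J i) (i - t (J i)) + \<xi> i)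
        = z (J (i + 1)) (i + 1 - t (J (i + 1))) + \<xi> (i + 1)))"
    using hetero_chain_shadowing[of L z g "\<lambda>j k. dmap (D j k) (D j (k + 1)) F (orb (x j) k)"
        "\<lambda>j. (snd (c j) (q j), dmap (c j) (c j) F (q j))" r N0, OF L data r] by blast
  show ?thesis
  proof (intro exI[of _ T] conjI allI impI T)
    fix t J assume sep: "separated L t T" and near: "nearest L t J"
    have JL: "J i < L" for i using near by (simp add: nearest_def)
    from sh sep near obtain \<xi> where sw: "\<And>i. J i = J (i + 1) \<or> (J (i + 1) = Suc (J i) \<and> t (J i) + N0 \<le> i \<and> i + 1 \<le> t (J (i + 1)) - N0)"
      and \<xi>: "bdd_by r \<xi>" "\<And>i. g (J i) (i - t (J i)) (z (J i) (i - t (J i)) + \<xi> i) = z (J (i + 1)) (i + 1 - t (J (i + 1))) + \<xi> (i + 1)"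
      by blast
    have "\<exists>y. y \<in> fst (D (J i) (i - t (J i))) \<and> F y \<in> fst (D (J i) (i - t (J i) + 1)) \<and>
        dist y (orb (x (J i)) (i - t (J i))) < \<epsilon> \<and> z (J i) (i - t (J i)) + \<xi> i = snd (D (J i) (i - t (J i))) y" for i
    proof -
      have "norm (z (J i) (i - t (J i)) + \<xi> i - snd (D (J i) (i - t (J i))) (orb (x (J i)) (i - t (J i)))) \<le> rj (J i)"
        using bdd_byD[OF \<xi>(1), of i] rle[OF JL, of i] by (simp add: z_def)
      then show ?thesis using rj[OF JL[of i]] by blast
    qed
    then have "\<forall>i. \<exists>y. y \<in> fst (D (J i) (i - t (J i))) \<and> F y \<in> fst (D (J i) (i - t (J i) + 1)) \<and>
        dist y (orb (x (J i)) (i - t (J i))) < \<epsilon> \<and> z (J i) (i - t (J i)) + \<xi> i = snd (D (J i) (i - t (J i))) y" by blast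
    from choice[OF this] obtain y where y: "\<And>i. y i \<in> fst (D (J i) (i - t (J i)))" "\<And>i. F (y i) \<in> fst (D (J i) (i - t (J i) + 1))"
        "\<And>i. dist (y i) (orb (x (J i)) (i - t (J i))) < \<epsilon>" "\<And>i. z (J i) (i - t (J i)) + \<xi> i = snd (D (J i) (i - t (J i))) (y i)"
      by blast
    have chart_eq: "D (J i) (i - t (J i) + 1) = D (J (i + 1)) (i + 1 - t (J (i + 1)))" for i
    proof (cases "J i = J (i + 1)")
      case True
      then show ?thesis by (simp add: algebra_simps)
    next
      case False
      with sw have s: "J (i + 1) = Suc (J i)" "t (J i) + N0 \<le> i" "i + 1 \<le> t (J (i + 1)) - N0" by blast+
      have "D (J i) (i - t (J i) + 1) = c (Suc (J i))"
        using OC[OF JL[of i]] s(2) N0[OF JL[of i]] unfolding orbit_charts_def by auto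
      moreover have "D (J (i + 1)) (i + 1 - t (J (i + 1))) = c (J (i + 1))"
        using OC[OF JL[of "i + 1"]] s(3) N0[OF JL[of "i + 1"]] unfolding orbit_charts_def by auto
      ultimately show ?thesis using s(1) by simp
    qed
    have yS: "y i \<in> S" for i using y(1) chart_subset[OF atlas[OF DA(1)[OF JL]]] by blast
    have Fy: "F (y i) = y (i + 1)" for i
    proof (rule chart_inj[OF atlas[OF DA(1)[OF JL[of "i + 1"]]]])
      show "F (y i) \<in> fst (D (J (i + 1)) (i + 1 - t (J (i + 1))))" using y(2)[of i] unfolding chart_eq .
      show "y (i + 1) \<in> fst (D (J (i + 1)) (i + 1 - t (J (i + 1))))" by (rule y(1))
      have "snd (D (J i) (i - t (J i) + 1)) (F (y i)) = g (J i) (i - t (J i)) (snd (D (J i) (i - t (J i))) (y i))"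
        unfolding g_def by (rule local_rep_apply[OF atlas[OF DA(1)[OF JL]] y(1), symmetric])
      also have "\<dots> = z (J (i + 1)) (i + 1 - t (J (i + 1))) + \<xi> (i + 1)"
        unfolding y(4)[of i, symmetric] by (rule \<xi>(2))
      also have "\<dots> = snd (D (J (i + 1)) (i + 1 - t (J (i + 1)))) (y (i + 1))" by (rule y(4))
      finally show "snd (D (J (i + 1)) (i + 1 - t (J (i + 1)))) (F (y i)) = snd (D (J (i + 1)) (i + 1 - t (J (i + 1)))) (y (i + 1))"
        unfolding chart_eq .
    qed
    show "\<exists>y\<in>S. \<forall>i. dist (orb y i) (orb (x (J i)) (i - t (J i))) < \<epsilon>"
    proof (intro bexI[of _ "y 0"] allI yS)
      fix i
      show "dist (orb (y 0) i) (orb (x (J i)) (i - t (J i))) < \<epsilon>"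
        using y(3)[of i] unfolding orb_unique[of y i, OF yS Fy] .
    qed
  qed
qed

end

section \<open>Heteroclinic connections\<close>

text \<open>Meant for \<open>Q\<close> the non-wandering set of \<open>f\<close> and
  \<open>F\<close> a power of \<open>f\<close> that fixes it pointwise.\<close>

locale ms_dyn = surface_dyn S A F Fi for S :: "'a::metric_space set" and A F Fi +
  fixes Q :: "'a set"
  assumes finite_Q: "finite Q" and hyp_Q: "\<And>q. q \<in> Q \<Longrightarrow> hyperbolic_fixed q"
    and wandering: "\<And>x. x \<in> S \<Longrightarrow> x \<notin> Q \<Longrightarrow> \<exists>U. openin (top_of_set S) U \<and> x \<in> U \<and> (\<forall>n\<ge>1. (F ^^ n) ` U \<inter> U = {})"
    and transversal: "\<And>p q x. p \<in> Q \<Longrightarrow> q \<in> Q \<Longrightarrow> x \<in> S \<Longrightarrow> (\<lambda>n. orb x (int n)) \<longlonglongrightarrow> q \<Longrightarrow>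
        (\<lambda>n. orb x (- int n)) \<longlonglongrightarrow> p \<Longrightarrow> transversal_at p q x"
begin

lemma Q_S: "q \<in> Q \<Longrightarrow> q \<in> S" and F_Q: "q \<in> Q \<Longrightarrow> F q = q"
  using hyp_Q unfolding hyperbolic_fixed_def by auto

lemma Fi_Q: "q \<in> Q \<Longrightarrow> Fi q = q"
  using Fi_F[OF Q_S] F_Q by metis

lemma orb_Q: "q \<in> Q \<Longrightarrow> orb q k = q"
  using orb_unique[of "\<lambda>_. q" k] Q_S F_Q by simp

lemma orb_notin_Q: "x \<in> S \<Longrightarrow> x \<notin> Q \<Longrightarrow> orb x k \<notin> Q"
  using orb_add[of x k "- k"] orb_Q[of "orb x k" "- k"] by auto

lemma orb_cont: "continuous_on S (\<lambda>x. orb x k)"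
  using smooth_orb unfolding smooth_on_def by blast

lemma orb_tendsto:
  assumes "y \<longlonglongrightarrow> z" "\<And>n. y n \<in> S" "z \<in> S"
  shows "(\<lambda>n. orb (y n) k) \<longlonglongrightarrow> orb z k"
  using continuous_on_tendsto_compose[OF orb_cont assms(1,3)] assms(2) by simp

text \<open>Homoclinic connections, with \<open>p = q\<close>, are included here;
  \<open>het_acyclic\<close> excludes them.\<close>

definition het :: "('a \<times> 'a) set" where
  "het = {(p, q). p \<in> Q \<and> q \<in> Q \<and> (\<exists>x\<in>S - Q. (\<lambda>n. orb x (int n)) \<longlonglongrightarrow> q \<and> (\<lambda>n. orb x (- int n)) \<longlonglongrightarrow> p)}"

lemma transversal_orb:
  assumes "p \<in> Q" "q \<in> Q" "x \<in> S" "(\<lambda>n. orb x (int n)) \<longlonglongrightarrow> q" "(\<lambda>n. orb x (- int n)) \<longlonglongrightarrow> p"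
  shows "transversal_at p q (orb x K)"
proof (rule transversal[OF assms(1,2) orb_in[OF assms(3)]])
  have "(\<lambda>n. orb (orb x (int n)) K) \<longlonglongrightarrow> orb q K" "(\<lambda>n. orb (orb x (- int n)) K) \<longlonglongrightarrow> orb p K"
    by (rule orb_tendsto; use assms orb_in Q_S in auto)+
  then show "(\<lambda>n. orb (orb x K) (int n)) \<longlonglongrightarrow> q" "(\<lambda>n. orb (orb x K) (- int n)) \<longlonglongrightarrow> p"
    using assms by (simp_all add: orb_add orb_Q add.commute)
qed

section \<open>Wandering neighbourhoods and limits of orbits\<close>

definition wandering_nbhd :: "'a set \<Rightarrow> bool" where
  "wandering_nbhd U \<longleftrightarrow> openin (top_of_set S) U \<and> (\<forall>n\<ge>1. (F ^^ n) ` U \<inter> U = {})"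

text \<open>A second visit would be a return of the wandering set to itself. The bound on the time
  spent away from \<open>Q\<close> rests on this.\<close>

lemma wandering_once:
  assumes "wandering_nbhd U" "x \<in> S" "orb x i \<in> U" "orb x j \<in> U"
  shows "i = j"
proof -
  have "\<not> i < j" if "orb x i \<in> U" "orb x j \<in> U" for i j
  proof
    assume "i < j"
    then have "orb x j = (F ^^ nat (j - i)) (orb x i)" "nat (j - i) \<ge> 1"
      using orb_add[OF assms(2), of i "j - i"] by (auto simp: orb_def[of "orb x i"])
    then have "orb x j \<in> (F ^^ nat (j - i)) ` U" using that by simp
    then show False using assms(1) that \<open>nat (j - i) \<ge> 1\<close> unfolding wandering_nbhd_def by blast
  qed
  then show ?thesis using assms(3,4) by (meson linorder_neqE_linordered_idom)
qed

lemma wandering_cover: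
  assumes "r > 0" "e > 0"
  obtains \<U> where "finite \<U>" "\<forall>U\<in>\<U>. wandering_nbhd U \<and> (\<forall>y\<in>U. \<forall>y'\<in>U. dist y y' < e)"
    "\<forall>y\<in>S. (\<forall>q\<in>Q. dist y q \<ge> r) \<longrightarrow> y \<in> \<Union>\<U>"
proof -
  define K where "K = S - (\<Union>q\<in>Q. ball q r)"
  have K: "compact K" unfolding K_def by (intro compact_diff compact_S) auto
  have "\<exists>V. open V \<and> x \<in> V \<and> wandering_nbhd (S \<inter> V) \<and> (\<forall>y\<in>V. \<forall>y'\<in>V. dist y y' < e)" if "x \<in> K" for x
  proof -
    have x: "x \<in> S" "x \<notin> Q" using that assms by (auto simp: K_def)
    obtain U where U: "openin (top_of_set S) U" "x \<in> U" "\<forall>n\<ge>1. (F ^^ n) ` U \<inter> U = {}"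
      using wandering[OF x] by blast
    obtain V where V: "open V" "U = S \<inter> V" using U(1) unfolding openin_open by blast
    let ?V = "V \<inter> ball x (e / 2)"
    have "openin (top_of_set S) (S \<inter> ?V)" using V(1) by (intro openin_open_Int open_Int) auto
    moreover have "\<forall>n\<ge>1. (F ^^ n) ` (S \<inter> ?V) \<inter> (S \<inter> ?V) = {}" using U(3) V(2) by blast
    moreover have "dist y y' < e" if "y \<in> ?V" "y' \<in> ?V" for y y'
      using that dist_triangle_half_r[of x y e y'] by auto
    ultimately show ?thesis
      using U(2) V assms(2) unfolding wandering_nbhd_def by (intro exI[of _ ?V]) auto
  qed
  then obtain V where V: "\<And>x. x \<in> K \<Longrightarrow> open (V x) \<and> x \<in> V x \<and> wandering_nbhd (S \<inter> V x) \<and> (\<forall>y\<in>V x. \<forall>y'\<in>V x. dist y y' < e)"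
    by metis
  have "K \<subseteq> \<Union> (V ` K)" using V by blast
  from compactE_image[OF K _ this] obtain K' where K': "K' \<subseteq> K" "finite K'" "K \<subseteq> \<Union> (V ` K')"
    using V by metis
  show ?thesis
  proof (rule that[of "(\<lambda>x. S \<inter> V x) ` K'"])
    show "finite ((\<lambda>x. S \<inter> V x) ` K')" using K' by simp
    show "\<forall>U\<in>(\<lambda>x. S \<inter> V x) ` K'. wandering_nbhd U \<and> (\<forall>y\<in>U. \<forall>y'\<in>U. dist y y' < e)"
      using V K'(1) by blast
    show "\<forall>y\<in>S. (\<forall>q\<in>Q. dist y q \<ge> r) \<longrightarrow> y \<in> \<Union> ((\<lambda>x. S \<inter> V x) ` K')"
    proof (intro ballI impI)
      fix y assume y: "y \<in> S" "\<forall>q\<in>Q. dist y q \<ge> r"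
      then have "y \<in> K" by (auto simp: K_def dist_commute not_less)
      then show "y \<in> \<Union> ((\<lambda>x. S \<inter> V x) ` K')" using K'(3) y(1) by blast
    qed
  qed
qed

text \<open>The balls around different points are disjoint and no single step, forward or backward,
  jumps from one to another. Hence an orbit that leaves a ball is outside all of them at that
  moment.\<close>

definition isolating :: "real \<Rightarrow> bool" where
  "isolating r \<longleftrightarrow> r > 0 \<and> (\<forall>p\<in>Q. \<forall>q\<in>Q. p \<noteq> q \<longrightarrow> dist p q > 2 * r \<and>
     (\<forall>y\<in>S. dist y p < r \<longrightarrow> dist (F y) q \<ge> r \<and> dist (Fi y) q \<ge> r))"

lemma isolating_mono: "isolating r \<Longrightarrow> 0 < s \<Longrightarrow> s \<le> r \<Longrightarrow> isolating s"
  unfolding isolating_def by (smt (verit))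

lemma isolating_exists: "\<exists>r. isolating r"
proof -
  have "\<exists>r>0. \<forall>s. 0 < s \<and> s \<le> r \<longrightarrow> dist p q > 2 * s \<and> (\<forall>y\<in>S. dist y p < s \<longrightarrow> dist (F y) q \<ge> s \<and> dist (Fi y) q \<ge> s)"
    if pq: "p \<in> Q" "q \<in> Q" "p \<noteq> q" for p q
  proof -
    define d where "d = dist p q"
    have d: "d > 0" using pq by (simp add: d_def)
    have cont: "\<exists>e>0. \<forall>y\<in>S. dist y p < e \<longrightarrow> dist (h y) p < d / 2"
      if "continuous_on S h" "h p = p" for h
      using that Q_S[OF pq(1)] d unfolding continuous_on_iff by (metis half_gt_zero)
    have "continuous_on S F" "continuous_on S Fi" using smooth_F smooth_Fi unfolding smooth_on_def by auto
    from cont[OF this(1) F_Q[OF pq(1)]] cont[OF this(2) Fi_Q[OF pq(1)]]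
    obtain e1 e2 where e: "e1 > 0" "\<forall>y\<in>S. dist y p < e1 \<longrightarrow> dist (F y) p < d / 2"
      "e2 > 0" "\<forall>y\<in>S. dist y p < e2 \<longrightarrow> dist (Fi y) p < d / 2" by blast
    show ?thesis
    proof (intro exI[of _ "min (d / 3) (min e1 e2)"] conjI allI impI ballI)
      show "min (d / 3) (min e1 e2) > 0" using d e by simp
      fix s assume s: "0 < s \<and> s \<le> min (d / 3) (min e1 e2)"
      then show "dist p q > 2 * s" using d unfolding d_def by linarith
      fix y assume y: "y \<in> S" "dist y p < s"
      have "dist (F y) p < d / 2" "dist (Fi y) p < d / 2" using e y s by auto
      moreover have "d \<le> dist (F y) p + dist (F y) q" "d \<le> dist (Fi y) p + dist (Fi y) q"
        unfolding d_def by (metis dist_commute dist_triangle)+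
      ultimately show "dist (F y) q \<ge> s" "dist (Fi y) q \<ge> s" using s d by linarith+
    qed
  qed
  then have "\<forall>pq. \<exists>r. fst pq \<in> Q \<longrightarrow> snd pq \<in> Q \<longrightarrow> fst pq \<noteq> snd pq \<longrightarrow> r > 0 \<and> (\<forall>s. 0 < s \<and> s \<le> r \<longrightarrow> dist (fst pq) (snd pq) > 2 * s \<and>
      (\<forall>y\<in>S. dist y (fst pq) < s \<longrightarrow> dist (F y) (snd pq) \<ge> s \<and> dist (Fi y) (snd pq) \<ge> s))" by blast
  from choice[OF this] obtain r' where r': "\<And>pq. fst pq \<in> Q \<longrightarrow> snd pq \<in> Q \<longrightarrow> fst pq \<noteq> snd pq \<longrightarrow> r' pq > 0 \<and> (\<forall>s. 0 < s \<and> s \<le> r' pq \<longrightarrow> dist (fst pq) (snd pq) > 2 * s \<and>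
      (\<forall>y\<in>S. dist y (fst pq) < s \<longrightarrow> dist (F y) (snd pq) \<ge> s \<and> dist (Fi y) (snd pq) \<ge> s))" by blast
  define r where "r = (\<lambda>p q. r' (p, q))"
  have r: "\<And>p q. p \<in> Q \<Longrightarrow> q \<in> Q \<Longrightarrow> p \<noteq> q \<Longrightarrow> r p q > 0 \<and> (\<forall>s. 0 < s \<and> s \<le> r p q \<longrightarrow> dist p q > 2 * s \<and>
      (\<forall>y\<in>S. dist y p < s \<longrightarrow> dist (F y) q \<ge> s \<and> dist (Fi y) q \<ge> s))"
    using r' unfolding r_def by (metis fst_conv snd_conv)
  define X where "X = insert 1 ((\<lambda>(p, q). r p q) ` {(p, q) \<in> Q \<times> Q. p \<noteq> q})"
  have fin: "finite X" unfolding X_def using finite_Q by (auto intro: finite_subset[of _ "Q \<times> Q"])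
  have "Min X > 0" using fin r by (subst Min_gr_iff) (auto simp: X_def)
  moreover have "Min X \<le> r p q" if "p \<in> Q" "q \<in> Q" "p \<noteq> q" for p q
    using that by (intro Min_le[OF fin]) (auto simp: X_def image_iff)
  ultimately have "isolating (Min X)" unfolding isolating_def using r by blast
  then show ?thesis by blast
qed

text \<open>Finitely many wandering sets cover the complement of the balls, and an orbit visits each
  at most once.\<close>

lemma orbit_near_Q:
  assumes "x \<in> S" "r > 0"
  shows "finite {i. \<forall>q\<in>Q. dist (orb x i) q \<ge> r}"
proof -
  obtain \<U> where \<U>: "finite \<U>" "\<forall>U\<in>\<U>. wandering_nbhd U \<and> (\<forall>y\<in>U. \<forall>y'\<in>U. dist y y' < 1)"
    "\<forall>y\<in>S. (\<forall>q\<in>Q. dist y q \<ge> r) \<longrightarrow> y \<in> \<Union>\<U>"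
    using wandering_cover[OF assms(2) zero_less_one] .
  have "finite {i. orb x i \<in> U}" if "U \<in> \<U>" for U
  proof (cases "{i. orb x i \<in> U} = {}")
    case False
    then obtain j where "orb x j \<in> U" by blast
    then have "{i. orb x i \<in> U} \<subseteq> {j}" using wandering_once[of U x] \<U>(2) that assms(1) by blast
    then show ?thesis by (rule finite_subset) simp
  qed simp
  then have "finite (\<Union>U\<in>\<U>. {i. orb x i \<in> U})" using \<U>(1) by blast
  moreover have "{i. \<forall>q\<in>Q. dist (orb x i) q \<ge> r} \<subseteq> (\<Union>U\<in>\<U>. {i. orb x i \<in> U})"
  proof
    fix i assume "i \<in> {i. \<forall>q\<in>Q. dist (orb x i) q \<ge> r}"
    then have "orb x i \<in> \<Union>\<U>" using \<U>(3) orb_in[OF assms(1), of i] by simp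
    then show "i \<in> (\<Union>U\<in>\<U>. {i. orb x i \<in> U})" by simp
  qed
  ultimately show ?thesis by (rule finite_subset[rotated])
qed

text \<open>Eventually the orbit lies in the balls and cannot change balls, so it stays in one;
  smaller radii select the same point. The sequence \<open>s\<close> covers both directions of
  time.\<close>

lemma limit_exists:
  assumes x: "x \<in> S" and s: "(s = (\<lambda>n. int n) \<or> s = (\<lambda>n. - int n))"
  shows "\<exists>q\<in>Q. (\<lambda>n. orb x (s n)) \<longlonglongrightarrow> q"
proof -
  obtain r0 where r0: "isolating r0" using isolating_exists by blast
  have inj: "inj s" using s by (auto simp: inj_def)
  have ev: "\<exists>q\<in>Q. \<forall>\<^sub>F n in sequentially. dist (orb x (s n)) q < r" if r: "0 < r" "r \<le> r0" for r
  proof -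
    have iso: "isolating r" using isolating_mono[OF r0 r] .
    have "finite (s -` {i. \<forall>q\<in>Q. dist (orb x i) q \<ge> r})"
      using orbit_near_Q[OF x r(1)] inj by (rule finite_vimageI)
    then obtain N where N: "\<And>n. n \<ge> N \<Longrightarrow> \<exists>q\<in>Q. dist (orb x (s n)) q < r"
      unfolding finite_nat_set_iff_bounded_le by (auto simp: not_le) (meson not_less_eq_eq not_less)
    obtain q where q: "q \<in> Q" "dist (orb x (s N)) q < r" using N[of N] by auto
    have "dist (orb x (s n)) q < r" if "n \<ge> N" for n
      using that
    proof (induction n rule: dec_induct)
      case (step n)
      have "orb x (s (Suc n)) = F (orb x (s n)) \<or> orb x (s (Suc n)) = Fi (orb x (s n))"
      proof -
        have "s (Suc n) = s n + 1 \<or> s (Suc n) = s n - 1" using s by auto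
        then show ?thesis using F_orb[OF x, of "s n"] Fi_orb[OF x, of "s n"] by metis
      qed
      moreover obtain p where "p \<in> Q" "dist (orb x (s (Suc n))) p < r" using N[of "Suc n"] step by auto
      ultimately show ?case using iso q(1) step(3) orb_in[OF x] unfolding isolating_def by (metis not_le)
    qed (rule q)
    then show ?thesis using q(1) unfolding eventually_sequentially by blast
  qed
  have "r0 > 0" using r0 by (simp add: isolating_def)
  then obtain q where q: "q \<in> Q" "\<forall>\<^sub>F n in sequentially. dist (orb x (s n)) q < r0" using ev[of r0] by auto
  have "(\<lambda>n. orb x (s n)) \<longlonglongrightarrow> q"
  proof (rule tendstoI)
    fix e :: real assume e: "e > 0"
    have "0 < min e r0" using e \<open>r0 > 0\<close> by simp
    then obtain p where p: "p \<in> Q" "\<forall>\<^sub>F n in sequentially. dist (orb x (s n)) p < min e r0"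
      using ev[of "min e r0"] by auto
    have "\<exists>n. dist (orb x (s n)) p < r0 \<and> dist (orb x (s n)) q < r0"
      using eventually_conj[OF p(2) q(2)] by (metis (no_types, lifting) eventually_happens min_less_iff_conj sequentially_bot)
    then have "dist p q < 2 * r0" by (metis dist_commute dist_triangle_lt add_strict_mono mult_2)
    then have "p = q" using r0 p(1) q(1) unfolding isolating_def by (meson less_asym)
    with p(2) show "\<forall>\<^sub>F n in sequentially. dist (orb x (s n)) q < e" by (auto elim: eventually_mono)
  qed
  with q(1) show ?thesis by blast
qed

section \<open>Chains of connections and the absence of cycles\<close>

lemma het_chain:
  assumes "(p, q) \<in> het ^^ m"
  obtains f x where "f 0 = p" "f m = q" "\<forall>j<m. f j \<in> Q \<and> f (Suc j) \<in> Q \<and> x j \<in> S \<and> x j \<notin> Q \<and>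
    (\<lambda>n. orb (x j) (int n)) \<longlonglongrightarrow> f (Suc j) \<and> (\<lambda>n. orb (x j) (- int n)) \<longlonglongrightarrow> f j"
proof -
  obtain f where f: "f 0 = p" "f m = q" "\<forall>i<m. (f i, f (Suc i)) \<in> het"
    using assms unfolding relpow_fun_conv by blast
  then have "\<forall>j. \<exists>x. j < m \<longrightarrow> f j \<in> Q \<and> f (Suc j) \<in> Q \<and> x \<in> S \<and> x \<notin> Q \<and>
    (\<lambda>n. orb x (int n)) \<longlonglongrightarrow> f (Suc j) \<and> (\<lambda>n. orb x (- int n)) \<longlonglongrightarrow> f j"
    unfolding het_def by blast
  from choice[OF this] f(1,2) that show ?thesis by blast
qed

lemma het_shadowing:
  assumes m: "m > 0" and f: "\<forall>j<m. f j \<in> Q \<and> f (Suc j) \<in> Q \<and> x j \<in> S \<and> x j \<notin> Q \<and>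
    (\<lambda>n. orb (x j) (int n)) \<longlonglongrightarrow> f (Suc j) \<and> (\<lambda>n. orb (x j) (- int n)) \<longlonglongrightarrow> f j" and \<epsilon>: "\<epsilon> > 0"
  shows "\<exists>T>0. \<forall>t J. separated m t T \<longrightarrow> nearest m t J \<longrightarrow>
    (\<exists>y\<in>S. \<forall>i. dist (orb y i) (orb (x (J i)) (i - t (J i))) < \<epsilon>)"
proof (rule chain_shadowing[OF m _ _ _ _ _ \<epsilon>, where q = f])
  show "hyperbolic_fixed (f j)" if "j \<le> m" for j
    using that f hyp_Q m by (cases j) auto
qed (use f transversal_orb in auto)

lemma het_acyclic: "acyclic het"
proof (rule acyclicI, rule allI, rule notI)
  fix p assume "(p, p) \<in> het\<^sup>+"
  then obtain m where m: "m > 0" "(p, p) \<in> het ^^ m" unfolding trancl_power by blast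
  obtain f x where f: "f 0 = p" "f m = p" "\<forall>j<m. f j \<in> Q \<and> f (Suc j) \<in> Q \<and> x j \<in> S \<and> x j \<notin> Q \<and>
    (\<lambda>n. orb (x j) (int n)) \<longlonglongrightarrow> f (Suc j) \<and> (\<lambda>n. orb (x j) (- int n)) \<longlonglongrightarrow> f j"
    using het_chain[OF m(2)] .
  \<comment> \<open>The cycle is extended by its first connection once more, so that the shadowing
    orbit passes near \<open>x 0\<close> at time \<open>t 0\<close> and again at time
    \<open>t m\<close>.\<close>
  define f' where "f' = (\<lambda>j. if j = Suc m then f 1 else f j)"
  define x' where "x' = (\<lambda>j. if j = m then x 0 else x j)"
  have f': "\<forall>j<Suc m. f' j \<in> Q \<and> f' (Suc j) \<in> Q \<and> x' j \<in> S \<and> x' j \<notin> Q \<and>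
    (\<lambda>n. orb (x' j) (int n)) \<longlonglongrightarrow> f' (Suc j) \<and> (\<lambda>n. orb (x' j) (- int n)) \<longlonglongrightarrow> f' j"
    using f m(1) by (auto simp: f'_def x'_def less_Suc_eq)
  obtain U where U: "openin (top_of_set S) U" "x 0 \<in> U" "\<forall>n\<ge>1. (F ^^ n) ` U \<inter> U = {}"
    using wandering[of "x 0"] f(3) m(1) by blast
  then obtain \<epsilon> where \<epsilon>: "\<epsilon> > 0" "\<forall>y\<in>S. dist y (x 0) < \<epsilon> \<longrightarrow> y \<in> U"
    unfolding openin_euclidean_subtopology_iff by blast
  obtain T where T: "T > 0" "\<forall>t J. separated (Suc m) t T \<longrightarrow> nearest (Suc m) t J \<longrightarrow>
    (\<exists>y\<in>S. \<forall>i. dist (orb y i) (orb (x' (J i)) (i - t (J i))) < \<epsilon>)"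
    using het_shadowing[OF _ f' \<epsilon>(1)] by auto
  define t where "t = (\<lambda>j. int j * T)"
  have sep: "separated (Suc m) t T" by (simp add: separated_def t_def algebra_simps)
  obtain J where J: "nearest (Suc m) t J" using nearest_exists[of "Suc m" t] by auto
  obtain y where y: "y \<in> S" "\<And>i. dist (orb y i) (orb (x' (J i)) (i - t (J i))) < \<epsilon>"
    using T(2) sep J by blast
  have "J (t 0) = 0" "J (t m) = m" using nearest_centre[OF sep T(1) J] by auto
  then have "dist (orb y (t 0)) (x 0) < \<epsilon>" "dist (orb y (t m)) (x 0) < \<epsilon>"
    using y(2)[of "t 0"] y(2)[of "t m"] m(1) by (auto simp: x'_def)
  then have "orb y (t 0) \<in> U" "orb y (t m) \<in> U" using \<epsilon>(2) orb_in[OF y(1)] by auto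
  then have "t 0 = t m"
    using wandering_once[of U y] U y(1) unfolding wandering_nbhd_def by blast
  then show False using T(1) m(1) by (simp add: t_def)
qed

text \<open>Only \<open>r\<close> will shrink; \<open>r0\<close> stays fixed, so that the
  intermediate points outside the large balls cannot accumulate at \<open>Q\<close>.\<close>

definition transit :: "real \<Rightarrow> real \<Rightarrow> 'a \<Rightarrow> 'a \<Rightarrow> bool" where
  "transit r0 r q q' \<longleftrightarrow> (\<exists>x\<in>S. \<exists>i l :: nat. 0 < i \<and> i < l \<and> dist x q < r \<and> dist (orb x (int l)) q' < r \<and>
     (\<forall>p\<in>Q. dist (orb x (int i)) p \<ge> r0))"

text \<open>By isolation the first step out of the ball of \<open>q\<close> cannot land in another
  ball.\<close>

lemma first_exit:
  assumes iso: "isolating r0" and x: "x \<in> S" "q \<in> Q" "dist x q < r0" and l: "dist (orb x (int l)) q \<ge> r0"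
  obtains i where "0 < i" "i \<le> l" "\<forall>k<i. dist (orb x (int k)) q < r0" "\<forall>p\<in>Q. dist (orb x (int i)) p \<ge> r0"
proof -
  define P where "P = (\<lambda>i. dist (orb x (int i)) q \<ge> r0)"
  define i where "i = (LEAST i. P i)"
  have i: "dist (orb x (int i)) q \<ge> r0" "i \<le> l"
    using LeastI[of P l] Least_le[of P l] l by (simp_all add: i_def P_def)
  have before: "\<forall>k<i. dist (orb x (int k)) q < r0"
    using not_less_Least[of _ P] unfolding i_def P_def not_le by blast
  have "i \<noteq> 0" using i(1) x(3) by (metis not_le of_nat_0 orb_0)
  then obtain k where k: "i = Suc k" using not0_implies_Suc by blast
  have "dist (orb x (int i)) p \<ge> r0" if "p \<in> Q" for p
  proof (cases "p = q")
    case False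
    have "orb x (int i) = F (orb x (int k))" using F_orb[OF x(1), of "int k"] k by (simp add: add.commute)
    then show ?thesis
      using iso that False x(2) orb_in[OF x(1), of "int k"] before k unfolding isolating_def by (metis lessI)
  qed (use i in simp)
  with i before \<open>i \<noteq> 0\<close> that show ?thesis by blast
qed

lemma orb_add_nat: "x \<in> S \<Longrightarrow> orb (orb x (int a)) (int b) = orb x (int (a + b))"
  using orb_add[of x "int a" "int b"] by simp

text \<open>Orbit segments that start ever closer to \<open>q\<close> and end ever closer to \<open>q'\<close> leave a neighbourhood
  of \<open>q\<close> at points accumulating at some \<open>z\<close> on the unstable set of \<open>q\<close>.\<close>

lemma transit_step:
  assumes iso: "isolating r0" and q: "q \<in> Q" "q' \<in> Q" and tr: "\<And>r. r > 0 \<Longrightarrow> transit r0 r q q'"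
  shows "\<exists>q1. (q, q1) \<in> het \<and> (q1 = q' \<or> (\<forall>r>0. transit r0 r q1 q'))"
proof -
  have r0: "r0 > 0" using iso by (simp add: isolating_def)
  \<comment> \<open>Radii tending to 0, capped by \<open>r0\<close> so that every segment starts in
    the large ball of \<open>q\<close>.\<close>
  define e where "e = (\<lambda>n. min r0 (1 / real (Suc n)))"
  have e: "e n > 0" "e n \<le> r0" for n using r0 by (simp_all add: e_def)
  have "e \<longlonglongrightarrow> min r0 0" unfolding e_def by (intro tendsto_min tendsto_const LIMSEQ_Suc[OF lim_1_over_n])
  then have e0: "e \<longlonglongrightarrow> 0" using r0 by simp
  have "\<exists>x i l. x \<in> S \<and> dist x q < e n \<and> dist (orb x (int l)) q' < e n \<and> 0 < i \<and> i < l \<and>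
      (\<forall>k<i. dist (orb x (int k)) q < r0) \<and> (\<forall>p\<in>Q. dist (orb x (int i)) p \<ge> r0)" for n
  proof -
    obtain x i l where x: "x \<in> S" "0 < i" "i < l" "dist x q < e n" "dist (orb x (int l)) q' < e n"
      "\<forall>p\<in>Q. dist (orb x (int i)) p \<ge> r0" using tr[OF e(1)[of n]] unfolding transit_def by blast
    have "dist x q < r0" "dist (orb x (int i)) q \<ge> r0" using x(4,6) q(1) e(2)[of n] by auto
    then obtain i' where "0 < i'" "i' \<le> i" "\<forall>k<i'. dist (orb x (int k)) q < r0" "\<forall>p\<in>Q. dist (orb x (int i')) p \<ge> r0"
      using first_exit[OF iso x(1) q(1)] by metis
    with x show ?thesis by (meson le_less_trans)
  qed
  then have "\<forall>n. \<exists>xil. fst xil \<in> S \<and> dist (fst xil) q < e n \<and> dist (orb (fst xil) (int (snd (snd xil)))) q' < e n \<and>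
      0 < fst (snd xil) \<and> fst (snd xil) < snd (snd xil) \<and>
      (\<forall>k<fst (snd xil). dist (orb (fst xil) (int k)) q < r0) \<and> (\<forall>p\<in>Q. dist (orb (fst xil) (int (fst (snd xil)))) p \<ge> r0)"
    by (metis fst_conv snd_conv)
  from choice[OF this] obtain xil where xil: "\<And>n. fst (xil n) \<in> S \<and> dist (fst (xil n)) q < e n \<and>
      dist (orb (fst (xil n)) (int (snd (snd (xil n))))) q' < e n \<and> 0 < fst (snd (xil n)) \<and> fst (snd (xil n)) < snd (snd (xil n)) \<and>
      (\<forall>k<fst (snd (xil n)). dist (orb (fst (xil n)) (int k)) q < r0) \<and>
      (\<forall>p\<in>Q. dist (orb (fst (xil n)) (int (fst (snd (xil n))))) p \<ge> r0)" by blast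
  define x i l where "x = (\<lambda>n. fst (xil n))" and "i = (\<lambda>n. fst (snd (xil n)))" and "l = (\<lambda>n. snd (snd (xil n)))"
  have xS: "x n \<in> S" and xq: "dist (x n) q < e n" and xl: "dist (orb (x n) (int (l n))) q' < e n" and i: "0 < i n" "i n < l n"
    and xk: "\<And>k. k < i n \<Longrightarrow> dist (orb (x n) (int k)) q < r0" and xi: "\<And>p. p \<in> Q \<Longrightarrow> dist (orb (x n) (int (i n))) p \<ge> r0" for n
    using xil[of n] by (simp_all add: x_def i_def l_def)
  define w where "w = (\<lambda>n. orb (x n) (int (i n)))"
  have wS: "w n \<in> S" for n by (simp add: w_def orb_in xS)
  obtain z \<sigma> where z: "z \<in> S" "strict_mono \<sigma>" "(w \<circ> \<sigma>) \<longlonglongrightarrow> z"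
    using compact_S wS unfolding compact_def by metis
  define v where "v = w \<circ> \<sigma>"
  have v: "v \<longlonglongrightarrow> z" "\<And>n. v n \<in> S" using z wS by (auto simp: v_def)
  have zQ: "z \<notin> Q"
  proof
    assume "z \<in> Q"
    from tendstoD[OF v(1) r0] obtain n where "dist (v n) z < r0" by (auto simp: eventually_sequentially)
    then show False using xi[OF \<open>z \<in> Q\<close>, of "\<sigma> n"] by (simp add: v_def w_def)
  qed
  have xlim: "(\<lambda>n. x (\<sigma> n)) \<longlonglongrightarrow> q"
  proof (rule metric_tendsto_imp_tendsto[OF LIMSEQ_subseq_LIMSEQ[OF e0 z(2)]])
    show "\<forall>\<^sub>F n in sequentially. dist (x (\<sigma> n)) q \<le> dist ((e \<circ> \<sigma>) n) 0"
      using xq e(1) by (intro always_eventually allI) (simp add: less_imp_le)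
  qed
  \<comment> \<open>The starting points converge to the fixed point \<open>q\<close>, so any fixed
    number of steps stays in the large ball and the exit times tend to infinity.\<close>
  have ilarge: "\<forall>\<^sub>F n in sequentially. k \<le> i (\<sigma> n)" for k
  proof -
    have "\<forall>\<^sub>F n in sequentially. \<forall>j\<in>{..<k}. dist (orb (x (\<sigma> n)) (int j)) q < r0"
    proof (intro eventually_ball_finite ballI)
      fix j
      show "\<forall>\<^sub>F n in sequentially. dist (orb (x (\<sigma> n)) (int j)) q < r0"
        using tendstoD[OF orb_tendsto[OF xlim xS Q_S[OF q(1)], of "int j"] r0] by (simp add: orb_Q q(1))
    qed simp
    then show ?thesis
    proof eventually_elim
      case (elim n)
      show ?case
      proof (rule ccontr)
        assume "\<not> k \<le> i (\<sigma> n)"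
        then have "dist (orb (x (\<sigma> n)) (int (i (\<sigma> n)))) q < r0" using elim by simp
        then show False using xi[OF q(1), of "\<sigma> n"] by simp
      qed
    qed
  qed
  \<comment> \<open>The past of \<open>z\<close> is a limit of segments inside the ball of
    \<open>q\<close>, so its backward limit, a point of \<open>Q\<close>, can only be
    \<open>q\<close>.\<close>
  have backward: "dist (orb z (- int k)) q \<le> r0" if "k > 0" for k
  proof (rule tendsto_upperbound[of _ _ sequentially])
    show "(\<lambda>n. dist (orb (v n) (- int k)) q) \<longlonglongrightarrow> dist (orb z (- int k)) q"
      by (intro tendsto_dist tendsto_const orb_tendsto v z)
    show "\<forall>\<^sub>F n in sequentially. dist (orb (v n) (- int k)) q \<le> r0"
      using ilarge[of k]
    proof eventually_elim
      case (elim n)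
      have "orb (v n) (- int k) = orb (x (\<sigma> n)) (int (i (\<sigma> n) - k))"
        using elim by (simp add: v_def w_def orb_add[OF xS] of_nat_diff)
      then show ?case using xk[of "i (\<sigma> n) - k" "\<sigma> n"] elim that by simp
    qed
  qed simp
  obtain p where p: "p \<in> Q" "(\<lambda>n. orb z (- int n)) \<longlonglongrightarrow> p" using limit_exists[OF z(1), of "\<lambda>n. - int n"] by auto
  have "dist p q \<le> r0"
  proof (rule tendsto_upperbound[of _ _ sequentially])
    show "(\<lambda>n. dist (orb z (- int n)) q) \<longlonglongrightarrow> dist p q" by (intro tendsto_dist tendsto_const p)
    show "\<forall>\<^sub>F n in sequentially. dist (orb z (- int n)) q \<le> r0"
      unfolding eventually_sequentially by (rule exI[of _ 1]) (use backward in auto)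
  qed simp
  then have pq: "p = q" using iso p(1) q(1) r0 unfolding isolating_def by (smt (verit))
  obtain q1 where q1: "q1 \<in> Q" "(\<lambda>n. orb z (int n)) \<longlonglongrightarrow> q1" using limit_exists[OF z(1), of "\<lambda>n. int n"] by auto
  have h: "(q, q1) \<in> het" unfolding het_def using q q1 p pq z(1) zQ by blast
  \<comment> \<open>The segments follow \<open>z\<close> until they are near \<open>q1\<close>; from
    there to their end they form the next transit.\<close>
  have "transit r0 r q1 q'" if ne: "q1 \<noteq> q'" and r: "r > 0" for r
  proof -
    define s where "s = min r r0"
    have s: "s > 0" "s \<le> r" "s \<le> r0" using r r0 by (auto simp: s_def)
    obtain t where t: "dist (orb z (int t)) q1 < s" using tendstoD[OF q1(2) s(1)] by (auto simp: eventually_sequentially)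
    have A: "\<forall>\<^sub>F n in sequentially. dist (orb (v n) (int t)) q1 < s"
      using order_tendstoD(2)[OF tendsto_dist[OF orb_tendsto[OF v z(1)] tendsto_const] t] .
    have E: "\<forall>\<^sub>F n in sequentially. e (\<sigma> n) < s"
      using order_tendstoD(2)[OF LIMSEQ_subseq_LIMSEQ[OF e0 z(2)] s(1)] by (simp add: o_def)
    have "\<forall>\<^sub>F n in sequentially. \<forall>j\<in>{..t}. e (\<sigma> n) < dist (orb (v n) (int j)) q'"
    proof (intro eventually_ball_finite ballI)
      fix j
      have "orb z (int j) \<noteq> q'" using orb_notin_Q[OF z(1) zQ, of "int j"] q(2) by auto
      then have pos: "dist (orb z (int j)) q' > 0" by simp
      have "(\<lambda>n. dist (orb (v n) (int j)) q' - e (\<sigma> n)) \<longlonglongrightarrow> dist (orb z (int j)) q' - 0"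
        using LIMSEQ_subseq_LIMSEQ[OF e0 z(2)]
        by (intro tendsto_diff tendsto_dist orb_tendsto v z tendsto_const) (simp add: o_def)
      from order_tendstoD(1)[OF this, of 0] pos
      show "\<forall>\<^sub>F n in sequentially. e (\<sigma> n) < dist (orb (v n) (int j)) q'" by simp
    qed simp
    from eventually_happens[OF eventually_conj[OF A eventually_conj[OF E this]]]
    obtain n where n: "dist (orb (v n) (int t)) q1 < s" "e (\<sigma> n) < s" "\<forall>j\<le>t. e (\<sigma> n) < dist (orb (v n) (int j)) q'" by auto
    let ?x = "x (\<sigma> n)" and ?i = "i (\<sigma> n)" and ?l = "l (\<sigma> n)"
    have vx: "v n = orb ?x (int ?i)" by (simp add: v_def w_def)
    \<comment> \<open>Up to time \<open>t\<close> the orbit of \<open>z\<close> avoids the point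
      \<open>q'\<close>, hence nearby segments keep a distance from it and reach their end near
      \<open>q'\<close> only later.\<close>
    have "?i + t < ?l"
    proof (rule ccontr)
      assume "\<not> ?i + t < ?l"
      then have "?l - ?i \<le> t" "?i + (?l - ?i) = ?l" using i(2)[of "\<sigma> n"] by auto
      then have "e (\<sigma> n) < dist (orb ?x (int ?l)) q'"
        using n(3) orb_add_nat[OF xS, of "\<sigma> n" ?i "?l - ?i"] unfolding vx by metis
      then show False using xl[of "\<sigma> n"] by simp
    qed
    define y where "y = orb (v n) (int t)"
    define m where "m = ?l - (?i + t)"
    have yS: "y \<in> S" by (simp add: y_def orb_in v)
    have ym: "orb y (int m) = orb ?x (int ?l)"
      unfolding y_def vx orb_add_nat[OF xS] using \<open>?i + t < ?l\<close> by (simp add: m_def)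
    have last: "dist (orb y (int m)) q' < s" using xl[of "\<sigma> n"] n(2) unfolding ym by simp
    have start: "dist y q1 < s" using n(1) by (simp add: y_def)
    have "dist q1 q' \<le> dist (orb y (int m)) q1 + dist (orb y (int m)) q'" by (metis dist_commute dist_triangle)
    moreover have "2 * r0 < dist q1 q'" using iso ne q1(1) q(2) unfolding isolating_def by blast
    ultimately have "dist (orb y (int m)) q1 \<ge> r0" using last s by linarith
    then obtain k where k: "0 < k" "k \<le> m" "\<forall>p\<in>Q. dist (orb y (int k)) p \<ge> r0"
      using first_exit[OF iso yS q1(1)] start s by (metis less_le_trans)
    have "k \<noteq> m" using k(3) q(2) last s by auto
    then show ?thesis
      unfolding transit_def using yS k start last s by (intro bexI[of _ y] exI[of _ k] exI[of _ m]) auto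
  qed
  with h show ?thesis by blast
qed

lemma wf_het_converse: "wf (het\<inverse>)"
proof (rule finite_acyclic_wf_converse[OF _ het_acyclic])
  show "finite het" by (rule finite_subset[of _ "Q \<times> Q"]) (auto simp: het_def finite_Q)
qed

text \<open>Repeating \<open>transit_step\<close> moves along connections, and acyclicity on a
  finite set makes this well-founded.\<close>

lemma transit_het:
  assumes iso: "isolating r0" and q': "q' \<in> Q"
  shows "q \<in> Q \<Longrightarrow> \<forall>r>0. transit r0 r q q' \<Longrightarrow> (q, q') \<in> het\<^sup>+"
proof (induction q rule: wf_induct_rule[OF wf_het_converse])
  case (1 q)
  obtain q1 where q1: "(q, q1) \<in> het" "q1 = q' \<or> (\<forall>r>0. transit r0 r q1 q')"
    using transit_step[OF iso 1(2) q'] 1(3) by blast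
  have "q1 \<in> Q" using q1(1) by (auto simp: het_def)
  with q1 1(1)[of q1] show ?case by (auto intro: trancl_into_trancl2)
qed

lemma transit_mono: "transit r0 r q q' \<Longrightarrow> r \<le> s \<Longrightarrow> transit r0 s q q'"
  unfolding transit_def by (meson less_le_trans)

text \<open>A pair that admits transits at every radius lies in the transitive closure. Every other
  pair fails at some radius, and there are finitely many pairs.\<close>

lemma transit_radius:
  assumes iso: "isolating r0"
  obtains r1 where "r1 > 0" "r1 \<le> r0" "\<forall>q\<in>Q. \<forall>q'\<in>Q. transit r0 r1 q q' \<longrightarrow> (q, q') \<in> het\<^sup>+"
proof -
  have "\<forall>pq. \<exists>r>0. pq \<in> Q \<times> Q \<longrightarrow> transit r0 r (fst pq) (snd pq) \<longrightarrow> pq \<in> het\<^sup>+"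
    using transit_het[OF iso] by (metis mem_Times_iff prod.collapse zero_less_one)
  then obtain r where r: "\<And>pq. r pq > 0 \<and> (pq \<in> Q \<times> Q \<longrightarrow> transit r0 (r pq) (fst pq) (snd pq) \<longrightarrow> pq \<in> het\<^sup>+)"
    by metis
  define r1 where "r1 = Min (insert r0 (r ` (Q \<times> Q)))"
  have fin: "finite (insert r0 (r ` (Q \<times> Q)))" using finite_Q by simp
  have "r0 > 0" using iso by (simp add: isolating_def)
  then have "r1 > 0" unfolding r1_def using r by (subst Min_gr_iff[OF fin]) auto
  moreover have "r1 \<le> r0" unfolding r1_def by (rule Min_le[OF fin]) simp
  moreover have "(q, q') \<in> het\<^sup>+" if "q \<in> Q" "q' \<in> Q" "transit r0 r1 q q'" for q q'
  proof -
    have "r1 \<le> r (q, q')" unfolding r1_def by (rule Min_le[OF fin]) (use that in simp)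
    then show ?thesis using r[of "(q, q')"] transit_mono[OF that(3)] that by simp
  qed
  ultimately show ?thesis using that by blast
qed

end

section \<open>The upper bound\<close>

text \<open>\<open>expand v\<close> consists of the words that arise from \<open>v\<close> by repeating its left letters; right
  letters occur exactly once.\<close>

fun expand :: "('q + 'u) list \<Rightarrow> ('q + 'u) list set" where
  "expand [] = {[]}"
| "expand (Inl q # v) = {replicate a (Inl q) @ w | a w. a \<ge> 1 \<and> w \<in> expand v}"
| "expand (Inr u # v) = (\<lambda>w. Inr u # w) ` expand v"

lemma expand_no_left: "filter isl v = [] \<Longrightarrow> expand v = {v}"
proof (induction v)
  case (Cons x v) then show ?case by (cases x) auto
qed simp

text \<open>The exponent is one less than the number of left letters because the total length
  determines the last multiplicity once the others are chosen. \<open>N\<close> bounds every choice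
  and stays fixed while \<open>n\<close> decreases in the induction.\<close>

lemma expand_count:
  assumes "N \<ge> 1" "n \<le> N"
  shows "finite {w \<in> expand v. length w = n} \<and>
    card {w \<in> expand v. length w = n} \<le> N ^ (length (filter isl v) - 1)"
  using assms(2)
proof (induction v arbitrary: n rule: expand.induct)
  case 1
  have "{w \<in> expand ([] :: ('a + 'b) list). length w = n} \<subseteq> {[]}" by auto
  from card_mono[OF _ this] finite_subset[OF this] show ?case by simp
next
  case (3 u v)
  have "{w \<in> expand (Inr u # v). length w = n} \<subseteq> (\<lambda>w. Inr u # w) ` {w \<in> expand v. length w = n - 1}" (is "?A \<subseteq> ?f ` ?B")
    by auto
  moreover have B: "finite ?B \<and> card ?B \<le> N ^ (length (filter isl v) - 1)" using 3 by simp
  ultimately have "finite ?A" "card ?A \<le> card ?B"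
    using finite_subset surj_card_le by blast+
  with B show ?case by simp
next
  case (2 q v)
  show ?case
  proof (cases "filter isl v = []")
    case True
    have "{w \<in> expand (Inl q # v). length w = n} \<subseteq> {replicate (n - length v) (Inl q) @ v}"
      by (auto simp: expand_no_left[OF True])
    from card_mono[OF _ this] finite_subset[OF this] True show ?thesis by simp
  next
    case False
    let ?B = "\<lambda>a. {w \<in> expand v. length w = n - a}"
    have "{w \<in> expand (Inl q # v). length w = n} \<subseteq> (\<Union>a\<in>{1..n}. (\<lambda>w. replicate a (Inl q) @ w) ` ?B a)" (is "?A \<subseteq> ?U")
    proof
      fix u assume "u \<in> ?A"
      then obtain a w where u: "u = replicate a (Inl q) @ w" "a \<ge> 1" "w \<in> expand v" "length u = n" by auto
      then have "a \<in> {1..n}" "w \<in> ?B a" by auto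
      with u(1) show "u \<in> ?U" by blast
    qed
    have B: "finite (?B a) \<and> card (?B a) \<le> N ^ (length (filter isl v) - 1)" for a
      using 2 by simp
    then have "finite ?U" by blast
    then have A: "finite ?A" "card ?A \<le> card ?U"
      using finite_subset[OF \<open>?A \<subseteq> ?U\<close>] card_mono[OF _ \<open>?A \<subseteq> ?U\<close>] by blast+
    have "card ?U \<le> (\<Sum>a\<in>{1..n}. card ((\<lambda>w. replicate a (Inl q) @ w) ` ?B a))"
      by (rule card_UN_le) simp
    also have "\<dots> \<le> (\<Sum>a\<in>{1..n}. N ^ (length (filter isl v) - 1))"
      using B by (intro sum_mono) (meson card_image_le order_trans)
    also have "\<dots> = n * N ^ (length (filter isl v) - 1)" by simp
    also have "\<dots> \<le> N * N ^ (length (filter isl v) - 1)" using 2(2) by simp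
    also have "\<dots> = N ^ length (filter isl v)" using False by (cases "filter isl v") auto
    finally show ?thesis using A by simp
  qed
qed

text \<open>Each pair in the transitive closure contributes at least one step, so the length of the
  list is bounded by that of a path in \<open>r\<close>.\<close>

lemma successively_trancl_length:
  assumes "qs \<noteq> []" "successively (\<lambda>a b. (a, b) \<in> r\<^sup>+) qs"
  shows "\<exists>n b. length qs \<le> Suc n \<and> (hd qs, b) \<in> r ^^ n"
  using assms
proof (induction qs)
  case (Cons a qs)
  show ?case
  proof (cases "qs = []")
    case True then show ?thesis by (auto intro!: exI[of _ 0])
  next
    case False
    with Cons obtain n b where n: "length qs \<le> Suc n" "(hd qs, b) \<in> r ^^ n" by (auto simp: successively_Cons)
    have "(a, hd qs) \<in> r\<^sup>+" using Cons.prems False by (simp add: successively_Cons)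
    then obtain m where "m > 0" "(a, hd qs) \<in> r ^^ m" unfolding trancl_power by blast
    then have "(a, b) \<in> r ^^ (m + n)" using n(2) by (auto simp: relpow_add)
    with n(1) \<open>m > 0\<close> show ?thesis by (intro exI[of _ "m + n"] exI[of _ b]) auto
  qed
qed simp

context ms_dyn
begin

definition cell :: "real \<Rightarrow> 'a + 'a set \<Rightarrow> 'a set" where
  "cell r0 c = (case c of Inl q \<Rightarrow> ball q r0 | Inr U \<Rightarrow> U)"

text \<open>A left letter stands for a sojourn near a fixed point, counted from a first to a last visit to the
  small ball of radius \<open>r1\<close> during which the orbit stays in the large ball of radius \<open>r0\<close>.\<close>

lemma orbit_coding:
  assumes iso: "isolating r0" and r1: "r1 > 0" "r1 \<le> r0"
    and trans: "\<forall>q\<in>Q. \<forall>q'\<in>Q. transit r0 r1 q q' \<longrightarrow> (q, q') \<in> het\<^sup>+"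
    and \<U>: "\<forall>U\<in>\<U>. wandering_nbhd U" "\<forall>y\<in>S. (\<forall>q\<in>Q. dist y q \<ge> r1) \<longrightarrow> y \<in> \<Union>\<U>"
    and x: "x \<in> S"
  shows "\<exists>v w. w \<in> expand v \<and> length w = n \<and> (\<forall>k<n. orb x (int k) \<in> cell r0 (w ! k)) \<and>
    set v \<subseteq> Inl ` Q \<union> Inr ` \<U> \<and> distinct (filter (\<lambda>c. \<not> isl c) v) \<and>
    (\<forall>U. Inr U \<in> set v \<longrightarrow> (\<exists>k<n. orb x (int k) \<in> U)) \<and>
    successively (\<lambda>a b. (projl a, projl b) \<in> het\<^sup>+) (filter isl v) \<and>
    (filter isl v \<noteq> [] \<longrightarrow> (\<exists>l<n. dist (orb x (int l)) (projl (hd (filter isl v))) < r1))"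
  using x
proof (induction n arbitrary: x rule: less_induct)
  \<comment> \<open>The last clause of the claim says that the first sojourn in the code of the
    remaining segment is really visited; this links a new sojourn to it.\<close>
  case (less n)
  show ?case
  proof (cases "n = 0")
    case True
    then show ?thesis by (intro exI[of _ "[]"]) simp
  next
    case n0: False
    have shift: "orb (orb x (int a)) (int k) = orb x (int (a + k))" for a k using orb_add_nat[OF less.prems] .
    show ?thesis
    proof (cases "\<exists>q\<in>Q. dist x q < r1")
      case True
      then obtain q where q: "q \<in> Q" "dist x q < r1" by blast
      \<comment> \<open>Visits to the small ball before the orbit has left the large ball; the
        sojourn lasts until the latest of them.\<close>
      define X where "X = {k. k < n \<and> dist (orb x (int k)) q < r1 \<and> (\<forall>i\<le>k. dist (orb x (int i)) q < r0)}"
      have X: "finite X" "0 \<in> X" using q r1 n0 by (auto simp: X_def)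
      define m where "m = Max X"
      have m: "m \<in> X" "\<And>k. k \<in> X \<Longrightarrow> k \<le> m" using Max_in[OF X(1)] Max_ge[OF X(1)] X(2) unfolding m_def by blast+
      define y where "y = orb x (int (Suc m))"
      have yS: "y \<in> S" by (simp only: y_def orb_in less.prems)
      have mn: "m < n" "n - Suc m < n" using m(1) n0 by (auto simp: X_def)
      from less.IH[OF mn(2) yS] obtain v w where vw: "w \<in> expand v" "length w = n - Suc m"
        "\<forall>k<n - Suc m. orb y (int k) \<in> cell r0 (w ! k)" "set v \<subseteq> Inl ` Q \<union> Inr ` \<U>" "distinct (filter (\<lambda>c. \<not> isl c) v)"
        "\<forall>U. Inr U \<in> set v \<longrightarrow> (\<exists>k<n - Suc m. orb y (int k) \<in> U)"
        "successively (\<lambda>a b. (projl a, projl b) \<in> het\<^sup>+) (filter isl v)"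
        "filter isl v \<noteq> [] \<longrightarrow> (\<exists>l<n - Suc m. dist (orb y (int l)) (projl (hd (filter isl v))) < r1)" by blast
      have yk: "orb y (int k) = orb x (int (Suc m + k))" for k unfolding y_def shift ..
      have link: "(q, projl (hd (filter isl v))) \<in> het\<^sup>+" if ne: "filter isl v \<noteq> []"
      proof -
        obtain l where l: "l < n - Suc m" "dist (orb y (int l)) (projl (hd (filter isl v))) < r1" using vw(8) ne by blast
        define q' where "q' = projl (hd (filter isl v))"
        have "hd (filter isl v) \<in> set v" "isl (hd (filter isl v))" using hd_in_set[OF ne] by auto
        then have q': "q' \<in> Q" using vw(4) by (auto simp: q'_def)
        define z where "z = orb x (int m)"
        have zS: "z \<in> S" by (simp add: z_def orb_in less.prems)
        have zk: "orb z (int k) = orb x (int (m + k))" for k unfolding z_def shift ..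
        have zq: "dist z q < r1" using m(1) by (simp add: X_def z_def)
        have lq': "dist (orb z (int (Suc l))) q' < r1" using l(2) unfolding yk zk q'_def by simp
        \<comment> \<open>Without an exit from the large ball, the next sojourn would be near the
          same point and its visit to the small ball a later element of \<open>X\<close>.\<close>
        have "\<exists>i\<le>Suc l. dist (orb z (int i)) q \<ge> r0"
        proof (rule ccontr)
          assume no: "\<not> ?thesis"
          have "q' = q"
          proof (rule ccontr)
            assume "q' \<noteq> q"
            then have "2 * r0 < dist q' q" using iso q q' unfolding isolating_def by blast
            moreover have "dist (orb z (int (Suc l))) q < r0" using no by (meson not_le order_refl)
            ultimately show False using lq' r1 dist_triangle3[of q' q "orb z (int (Suc l))"] by simp
          qed
          have "dist (orb x (int i)) q < r0" if "i \<le> m + Suc l" for i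
          proof (cases "i \<le> m")
            case False
            then have "i - m \<le> Suc l" "m + (i - m) = i" using that by auto
            then show ?thesis using no zk[of "i - m"] by (metis not_le)
          qed (use m(1) in \<open>auto simp: X_def\<close>)
          moreover have "m + Suc l < n" using l(1) by simp
          moreover have "dist (orb x (int (m + Suc l))) q < r1" using lq' \<open>q' = q\<close> zk by metis
          ultimately have "m + Suc l \<in> X" by (simp add: X_def)
          then show False using m(2) by fastforce
        qed
        then obtain j where j: "j \<le> Suc l" "dist (orb z (int j)) q \<ge> r0" by blast
        have "dist z q < r0" using zq r1 by simp
        then obtain i where i: "0 < i" "i \<le> j" "\<forall>p\<in>Q. dist (orb z (int i)) p \<ge> r0"
          using first_exit[OF iso zS q(1) _ j(2)] by metis
        have "i \<noteq> Suc l" using i(3) q' lq' r1 by auto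
        then have "transit r0 r1 q q'" unfolding transit_def using zS zq lq' i j
          by (intro bexI[of _ z] exI[of _ i] exI[of _ "Suc l"]) auto
        then show ?thesis using trans q(1) q' unfolding q'_def by blast
      qed
      show ?thesis
      proof (rule exI[of _ "Inl q # v"], rule exI[of _ "replicate (Suc m) (Inl q) @ w"], intro conjI)
        show "replicate (Suc m) (Inl q) @ w \<in> expand (Inl q # v)"
          unfolding expand.simps mem_Collect_eq
          by (rule exI[of _ "Suc m"], rule exI[of _ w]) (use vw(1) in auto)
        show "length (replicate (Suc m) (Inl q) @ w) = n" using vw(2) mn by simp
        show "\<forall>k<n. orb x (int k) \<in> cell r0 ((replicate (Suc m) (Inl q) @ w) ! k)"
        proof (intro allI impI)
          fix k assume k: "k < n"
          show "orb x (int k) \<in> cell r0 ((replicate (Suc m) (Inl q) @ w) ! k)"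
          proof (cases "k < Suc m")
            case True
            then have "dist (orb x (int k)) q < r0" using m(1) by (auto simp: X_def)
            then show ?thesis using True by (simp add: nth_append cell_def dist_commute del: replicate.simps)
          next
            case False
            then have "k - Suc m < n - Suc m" "Suc m + (k - Suc m) = k" using k by auto
            then have "orb x (int k) \<in> cell r0 (w ! (k - Suc m))" using vw(3) yk by metis
            then show ?thesis using False by (simp add: nth_append del: replicate.simps)
          qed
        qed
        show "set (Inl q # v) \<subseteq> Inl ` Q \<union> Inr ` \<U>" using vw(4) q(1) by auto
        show "distinct (filter (\<lambda>c. \<not> isl c) (Inl q # v))" using vw(5) by simp
        show "\<forall>U. Inr U \<in> set (Inl q # v) \<longrightarrow> (\<exists>k<n. orb x (int k) \<in> U)"
        proof (intro allI impI)
          fix U assume "Inr U \<in> set (Inl q # v)"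
          then obtain k where "k < n - Suc m" "orb x (int (Suc m + k)) \<in> U" using vw(6) yk by auto
          then show "\<exists>k<n. orb x (int k) \<in> U" by (intro exI[of _ "Suc m + k"]) auto
        qed
        show "successively (\<lambda>a b. (projl a, projl b) \<in> het\<^sup>+) (filter isl (Inl q # v))"
          using vw(7) link by (cases "filter isl v = []") (auto simp: successively_Cons)
        show "filter isl (Inl q # v) \<noteq> [] \<longrightarrow> (\<exists>l<n. dist (orb x (int l)) (projl (hd (filter isl (Inl q # v)))) < r1)"
          using q(2) n0 by (intro impI exI[of _ 0]) auto
      qed
    next
      case False
      then obtain U where U: "U \<in> \<U>" "x \<in> U" using \<U>(2) less.prems by force
      define y where "y = orb x (int 1)"
      have yS: "y \<in> S" by (simp only: y_def orb_in less.prems)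
      have "n - 1 < n" using n0 by simp
      from less.IH[OF this yS] obtain v w where vw: "w \<in> expand v" "length w = n - 1"
        "\<forall>k<n - 1. orb y (int k) \<in> cell r0 (w ! k)" "set v \<subseteq> Inl ` Q \<union> Inr ` \<U>" "distinct (filter (\<lambda>c. \<not> isl c) v)"
        "\<forall>U. Inr U \<in> set v \<longrightarrow> (\<exists>k<n - 1. orb y (int k) \<in> U)"
        "successively (\<lambda>a b. (projl a, projl b) \<in> het\<^sup>+) (filter isl v)"
        "filter isl v \<noteq> [] \<longrightarrow> (\<exists>l<n - 1. dist (orb y (int l)) (projl (hd (filter isl v))) < r1)" by blast
      have yk: "orb y (int k) = orb x (int (Suc k))" for k unfolding y_def shift by simp
      show ?thesis
      proof (rule exI[of _ "Inr U # v"], rule exI[of _ "Inr U # w"], intro conjI)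
        show "Inr U # w \<in> expand (Inr U # v)" using vw(1) by simp
        show "length (Inr U # w) = n" using vw(2) n0 by simp
        show "\<forall>k<n. orb x (int k) \<in> cell r0 ((Inr U # w) ! k)"
        proof (intro allI impI)
          fix k assume "k < n"
          then show "orb x (int k) \<in> cell r0 ((Inr U # w) ! k)"
            using vw(3) U(2) yk by (cases k) (auto simp: cell_def)
        qed
        show "set (Inr U # v) \<subseteq> Inl ` Q \<union> Inr ` \<U>" using vw(4) U(1) by auto
        \<comment> \<open>A right letter of \<open>v\<close> is visited at a later time by the
          induction hypothesis, which is impossible for the wandering set that contains
          \<open>x\<close>.\<close>
        have "Inr U \<notin> set v"
        proof
          assume "Inr U \<in> set v"
          then obtain k where "orb x (int (Suc k)) \<in> U" using vw(6) yk by auto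
          moreover have "orb x (int 0) \<in> U" using U(2) by simp
          ultimately have "int (Suc k) = int 0"
            using wandering_once[OF _ less.prems] \<U>(1) U(1) by blast
          then show False by simp
        qed
        then show "distinct (filter (\<lambda>c. \<not> isl c) (Inr U # v))" using vw(5) by simp
        show "\<forall>U'. Inr U' \<in> set (Inr U # v) \<longrightarrow> (\<exists>k<n. orb x (int k) \<in> U')"
        proof (intro allI impI)
          fix U' assume "Inr U' \<in> set (Inr U # v)"
          then consider "U' = U" | k where "k < n - 1" "orb x (int (Suc k)) \<in> U'" using vw(6) yk by auto
          then show "\<exists>k<n. orb x (int k) \<in> U'"
          proof cases
            case 1 then show ?thesis using U(2) n0 by (intro exI[of _ 0]) auto
          next
            case 2 then show ?thesis by (intro exI[of _ "Suc k"]) auto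
          qed
        qed
        show "successively (\<lambda>a b. (projl a, projl b) \<in> het\<^sup>+) (filter isl (Inr U # v))" using vw(7) by simp
        show "filter isl (Inr U # v) \<noteq> [] \<longrightarrow> (\<exists>l<n. dist (orb x (int l)) (projl (hd (filter isl (Inr U # v)))) < r1)"
        proof
          assume "filter isl (Inr U # v) \<noteq> []"
          then obtain l where "l < n - 1" "dist (orb x (int (Suc l))) (projl (hd (filter isl v))) < r1" using vw(8) yk by auto
          then show "\<exists>l<n. dist (orb x (int l)) (projl (hd (filter isl (Inr U # v)))) < r1"
            by (intro exI[of _ "Suc l"]) auto
        qed
      qed
    qed
  qed
qed

text \<open>The number of words \<open>v\<close> does not depend on \<open>n\<close>, and each
  expands to at most \<open>n ^ L\<close> codes of length \<open>n\<close>. Orbits with the same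
  code stay \<epsilon>-close, so one centre per code suffices.\<close>

theorem cover_number_upper:
  assumes L: "\<And>n p q. (p, q) \<in> het ^^ n \<Longrightarrow> n \<le> L" and \<epsilon>: "\<epsilon> > 0"
  shows "\<exists>K>0. \<forall>n\<ge>1. real (cover_number S F \<epsilon> n) \<le> K * real n ^ L"
proof -
  obtain r where r: "isolating r" using isolating_exists by blast
  define r0 where "r0 = min r (\<epsilon> / 2)"
  have r0: "isolating r0" "r0 \<le> \<epsilon> / 2"
    using isolating_mono[OF r, of r0] r \<epsilon> by (auto simp: r0_def isolating_def[of r])
  obtain r1 where r1: "r1 > 0" "r1 \<le> r0" "\<forall>q\<in>Q. \<forall>q'\<in>Q. transit r0 r1 q q' \<longrightarrow> (q, q') \<in> het\<^sup>+"
    using transit_radius[OF r0(1)] .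
  obtain \<U> where \<U>: "finite \<U>" "\<forall>U\<in>\<U>. wandering_nbhd U \<and> (\<forall>y\<in>U. \<forall>y'\<in>U. dist y y' < \<epsilon>)"
    "\<forall>y\<in>S. (\<forall>q\<in>Q. dist y q \<ge> r1) \<longrightarrow> y \<in> \<Union>\<U>"
    using wandering_cover[OF r1(1) \<epsilon>] .
  define X where "X = Inl ` Q \<union> Inr ` \<U>"
  have X: "finite X" using finite_Q \<U>(1) by (simp add: X_def)
  \<comment> \<open>At most one occurrence of each wandering set, and at most \<open>Suc L\<close>
    sojourns since consecutive ones are joined by connections.\<close>
  define M where "M = card \<U> + Suc L"
  define V where "V = {v. set v \<subseteq> X \<and> length v \<le> M}"
  have V: "finite V" unfolding V_def using X by (rule finite_lists_length_le)
  define W where "W = (\<lambda>n. \<Union>v\<in>{v\<in>V. length (filter isl v) \<le> Suc L}. {w \<in> expand v. length w = n})"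
  have W: "finite (W n)" "card (W n) \<le> card V * n ^ L" if "n \<ge> 1" for n
  proof -
    have e: "finite {w \<in> expand v. length w = n} \<and> card {w \<in> expand v. length w = n} \<le> n ^ L"
      if "length (filter isl v) \<le> Suc L" for v :: "('a + 'a set) list"
    proof -
      have "n ^ (length (filter isl v) - 1) \<le> n ^ L" using that \<open>n \<ge> 1\<close> by (intro power_increasing) auto
      then show ?thesis using expand_count[OF \<open>n \<ge> 1\<close> order_refl, of v] by linarith
    qed
    show "finite (W n)" unfolding W_def using V e by auto
    have "card (W n) \<le> (\<Sum>v\<in>{v\<in>V. length (filter isl v) \<le> Suc L}. card {w \<in> expand v. length w = n})"
      unfolding W_def using V by (intro card_UN_le) simp
    also have "\<dots> \<le> (\<Sum>v\<in>{v\<in>V. length (filter isl v) \<le> Suc L}. n ^ L)"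
      using e by (intro sum_mono) auto
    also have "\<dots> \<le> card V * n ^ L" using V by (simp add: card_mono)
    finally show "card (W n) \<le> card V * n ^ L" .
  qed
  have code: "\<exists>w\<in>W n. \<forall>k<n. orb x (int k) \<in> cell r0 (w ! k)" if x: "x \<in> S" for x n
  proof -
    obtain v w where vw: "w \<in> expand v" "length w = n" "\<forall>k<n. orb x (int k) \<in> cell r0 (w ! k)"
      "set v \<subseteq> Inl ` Q \<union> Inr ` \<U>" "distinct (filter (\<lambda>c. \<not> isl c) v)"
      "successively (\<lambda>a b. (projl a, projl b) \<in> het\<^sup>+) (filter isl v)"
      using orbit_coding[OF r0(1) r1(1,2,3) _ \<U>(3) x, of n] \<U>(2) by blast
    have len: "length (filter isl v) \<le> Suc L"
    proof (cases "filter isl v = []")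
      case False
      have "successively (\<lambda>a b. (a, b) \<in> het\<^sup>+) (map projl (filter isl v))"
        using vw(6) by (simp add: successively_map)
      then obtain m b where "length (filter isl v) \<le> Suc m" "(hd (map projl (filter isl v)), b) \<in> het ^^ m"
        using successively_trancl_length[of "map projl (filter isl v)" het] False by auto
      then show ?thesis using L by fastforce
    qed simp
    have "set (filter (\<lambda>c. \<not> isl c) v) \<subseteq> Inr ` \<U>" using vw(4) by auto
    then have "length (filter (\<lambda>c. \<not> isl c) v) \<le> card (Inr ` \<U> :: ('a + 'a set) set)"
      using distinct_card[OF vw(5)] card_mono[of "Inr ` \<U>"] \<U>(1) by (metis finite_imageI)
    also have "\<dots> \<le> card \<U>" using \<U>(1) by (rule card_image_le)
    finally have "length v \<le> M"
      using sum_length_filter_compl[of isl v] len by (simp add: M_def)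
    then have "v \<in> V" using vw(4) by (simp add: V_def X_def)
    with vw len show ?thesis unfolding W_def by blast
  qed
  have "real (cover_number S F \<epsilon> n) \<le> (real (card V) + 1) * real n ^ L" if n: "n \<ge> 1" for n
  proof -
    have "\<forall>x. \<exists>w. x \<in> S \<longrightarrow> w \<in> W n \<and> (\<forall>k<n. orb x (int k) \<in> cell r0 (w ! k))" using code by blast
    from choice[OF this] obtain c where c: "\<And>x. x \<in> S \<Longrightarrow> c x \<in> W n \<and> (\<forall>k<n. orb x (int k) \<in> cell r0 (c x ! k))" by blast
    define rep where "rep = (\<lambda>w. SOME x. x \<in> S \<and> c x = w)"
    have rep: "rep (c x) \<in> S \<and> c (rep (c x)) = c x" if "x \<in> S" for x
      unfolding rep_def by (rule someI_ex) (use that in blast)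
    define E where "E = rep ` c ` S"
    have cW: "c ` S \<subseteq> W n" using c by blast
    have fin: "finite (c ` S)" using cW W(1)[OF n] by (rule finite_subset)
    have "card E \<le> card (c ` S)" unfolding E_def using fin by (rule card_image_le)
    also have "\<dots> \<le> card (W n)" using W(1)[OF n] cW by (rule card_mono)
    finally have cE: "card E \<le> card V * n ^ L" using W(2)[OF n] by linarith
    have ES: "E \<subseteq> S" using rep by (auto simp: E_def)
    have diam: "dist a b < \<epsilon>" if "a \<in> cell r0 u" "b \<in> cell r0 u" "u \<in> X" for a b u
    proof -
      from that(3) consider q where "u = Inl q" | U where "u = Inr U" "U \<in> \<U>" by (auto simp: X_def)
      then show ?thesis
      proof cases
        case 1
        then have "dist q a < \<epsilon> / 2" "dist q b < \<epsilon> / 2" using that(1,2) r0(2) by (auto simp: cell_def)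
        then show ?thesis by (rule dist_triangle_half_r)
      next
        case 2
        then show ?thesis using that(1,2) \<U>(2) by (auto simp: cell_def)
      qed
    qed
    have letters: "w ! k \<in> X" if "w \<in> W n" "k < n" for w k
    proof -
      have "set w \<subseteq> set v" if "w \<in> expand v" for v w :: "('a + 'a set) list"
        using that by (induction v arbitrary: w rule: expand.induct) (auto split: if_splits, blast+)
      with that show ?thesis unfolding W_def V_def by fastforce
    qed
    have "S = (\<Union>x\<in>E. dyn_ball S F x n \<epsilon>)"
    proof
      show "(\<Union>x\<in>E. dyn_ball S F x n \<epsilon>) \<subseteq> S" by (auto simp: dyn_ball_def)
      show "S \<subseteq> (\<Union>x\<in>E. dyn_ball S F x n \<epsilon>)"
      proof
        fix y assume y: "y \<in> S"
        have "dist ((F ^^ k) (rep (c y))) ((F ^^ k) y) < \<epsilon>" if "k < n" for k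
          using diam[of "orb (rep (c y)) (int k)" "c y ! k" "orb y (int k)"] c[OF y] c[of "rep (c y)"] rep[OF y] that
            letters[of "c y" k] by (simp add: orb_nat)
        then have "y \<in> dyn_ball S F (rep (c y)) n \<epsilon>" using n y by (simp add: dyn_ball_eq)
        then show "y \<in> (\<Union>x\<in>E. dyn_ball S F x n \<epsilon>)" using y by (auto simp: E_def)
      qed
    qed
    moreover have "finite E" unfolding E_def using fin by simp
    ultimately have "cover_number S F \<epsilon> n \<le> card E"
      unfolding cover_number_def using ES by (intro Least_le) blast
    with cE have "cover_number S F \<epsilon> n \<le> card V * n ^ L" by linarith
    then have "real (cover_number S F \<epsilon> n) \<le> real (card V * n ^ L)" by (simp only: of_nat_le_iff)
    then show ?thesis by (simp add: algebra_simps add_increasing)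
  qed
  then show ?thesis by (intro exI[of _ "real (card V) + 1"]) auto
qed

section \<open>The lower bound\<close>

text \<open>Pseudo-orbits along the chain with different transition times are shadowed by separated orbits:
  at the first transition time where they differ, one orbit is at some \<open>x j\<close> and the other still
  near the past orbit of \<open>x j\<close>.\<close>

theorem cover_number_lower:
  assumes chain: "(p, q) \<in> het ^^ L" and L: "L > 0"
  shows "\<exists>\<epsilon>>0. \<exists>K>0. \<forall>n\<ge>1. K * real n ^ L \<le> real (cover_number S F \<epsilon> n)"
proof -
  obtain f x where f: "\<forall>j<L. f j \<in> Q \<and> f (Suc j) \<in> Q \<and> x j \<in> S \<and> x j \<notin> Q \<and>
    (\<lambda>n. orb (x j) (int n)) \<longlonglongrightarrow> f (Suc j) \<and> (\<lambda>n. orb (x j) (- int n)) \<longlonglongrightarrow> f j"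
    using het_chain[OF chain] by metis
  \<comment> \<open>\<open>x j\<close> is kept away from its own past and from its past limit
    \<open>f j\<close>; the separation argument compares it with one or the other.\<close>
  have "\<exists>e>0. (\<forall>i<0. dist (orb (x j) i) (x j) \<ge> e) \<and> dist (f j) (x j) \<ge> e" if j: "j < L" for j
  proof -
    have xj: "x j \<in> S" "x j \<notin> Q" "f j \<in> Q" using f j by auto
    obtain U where U: "openin (top_of_set S) U" "x j \<in> U" "\<forall>n\<ge>1. (F ^^ n) ` U \<inter> U = {}"
      using wandering[OF xj(1,2)] by blast
    then obtain e where e: "e > 0" "\<forall>y\<in>S. dist y (x j) < e \<longrightarrow> y \<in> U"
      unfolding openin_euclidean_subtopology_iff by blast
    have "dist (orb (x j) i) (x j) \<ge> e" if "i < 0" for i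
    proof (rule ccontr)
      assume "\<not> ?thesis"
      then have "orb (x j) i \<in> U" using e(2) orb_in[OF xj(1)] by auto
      moreover have "orb (x j) 0 \<in> U" using U(2) by simp
      ultimately have "i = 0" using wandering_once[of U "x j" i 0] U xj(1) unfolding wandering_nbhd_def by blast
      then show False using that by simp
    qed
    moreover have "dist (f j) (x j) > 0" using xj by auto
    ultimately show ?thesis using e(1) by (intro exI[of _ "min e (dist (f j) (x j))"]) (auto simp: min_le_iff_disj)
  qed
  then have "\<forall>j. \<exists>e. j < L \<longrightarrow> e > 0 \<and> (\<forall>i<0. dist (orb (x j) i) (x j) \<ge> e) \<and> dist (f j) (x j) \<ge> e" by blast
  from choice[OF this] obtain ej where ej: "\<And>j. j < L \<Longrightarrow> ej j > 0 \<and> (\<forall>i<0. dist (orb (x j) i) (x j) \<ge> ej j) \<and> dist (f j) (x j) \<ge> ej j"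
    by blast
  \<comment> \<open>A quarter leaves room for up to three errors of size \<delta> while the two
    orbits remain \<delta> apart.\<close>
  define \<delta> where "\<delta> = Min (ej ` {..<L}) / 4"
  have "Min (ej ` {..<L}) > 0" using ej L by (subst Min_gr_iff) auto
  then have \<delta>: "\<delta> > 0" by (simp add: \<delta>_def)
  have \<delta>le: "4 * \<delta> \<le> ej j" if "j < L" for j unfolding \<delta>_def using that by simp
  have neg: "dist (orb (x j) i) (x j) \<ge> 4 * \<delta>" if "j < L" "i < 0" for i j
    using ej[OF that(1)] \<delta>le[OF that(1)] that(2) by (meson order_trans)
  have lim4: "dist (f j) (x j) \<ge> 4 * \<delta>" if "j < L" for j
    using ej[OF that] \<delta>le[OF that] by linarith
  obtain T where T: "T > 0" and shadow: "\<forall>t J. separated L t T \<longrightarrow> nearest L t J \<longrightarrow>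
    (\<exists>y\<in>S. \<forall>i. dist (orb y i) (orb (x (J i)) (i - t (J i))) < \<delta>)"
    using het_shadowing[OF L f \<delta>] by blast
  have "\<forall>\<^sub>F k in sequentially. dist (orb (x j) (int k)) (f (Suc j)) < \<delta>" if "j < L" for j
    using f that \<delta> by (intro tendstoD) auto
  from uniform_nat_bound[of L "\<lambda>j k. dist (orb (x j) (int k)) (f (Suc j)) < \<delta>", OF this]
  obtain N1 where N1: "\<forall>k\<ge>N1. \<forall>j<L. dist (orb (x j) (int k)) (f (Suc j)) < \<delta>"
    unfolding eventually_sequentially by blast
  define T' where "T' = max (nat T) N1"
  have key: "B ^ L \<le> cover_number S F (\<delta> / 2) n" if B: "B \<ge> T'" "2 * L * B \<le> n" "n \<ge> 1" for B n
  proof -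
    have BT: "int B \<ge> T" "B \<ge> N1" "B > 0" using B(1) T by (auto simp: T'_def)
    \<comment> \<open>One offset below \<open>B\<close> for each piece. Blocks of length
      \<open>2 * B\<close> keep the transition times at least \<open>B\<close> apart and all below
      \<open>n\<close>.\<close>
    define H where "H = PiE {..<L} (\<lambda>_. {..<B})"
    define t where "t = (\<lambda>(h :: nat \<Rightarrow> nat) j. int (2 * j * B + h j))"
    have hB: "h j < B" if "h \<in> H" "j < L" for h j using that by (auto simp: H_def PiE_def)
    have gap: "separated L (t h) (int B)" if "h \<in> H" for h
      unfolding separated_def
    proof (intro allI impI)
      fix j assume "Suc j < L"
      then have "h j < B" using hB[OF that] by simp
      then show "t h j + int B \<le> t h (Suc j)" by (simp add: t_def algebra_simps)
    qed
    have sep: "separated L (t h) T" if "h \<in> H" for h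
      using gap[OF that] BT(1) unfolding separated_def by force
    have "\<forall>h. \<exists>J. nearest L (t h) J" using nearest_exists[OF L] by blast
    from choice[OF this] obtain J where J: "\<And>h. nearest L (t h) (J h)" by blast
    have "\<forall>h. \<exists>y. h \<in> H \<longrightarrow> y \<in> S \<and> (\<forall>i. dist (orb y i) (orb (x (J h i)) (i - t h (J h i))) < \<delta>)"
      using shadow sep J by blast
    from choice[OF this] obtain y where y: "\<And>h. h \<in> H \<Longrightarrow> y h \<in> S"
      "\<And>h i. h \<in> H \<Longrightarrow> dist (orb (y h) i) (orb (x (J h i)) (i - t h (J h i))) < \<delta>" by blast
    have far: "\<exists>s<n. dist (orb (y h) (int s)) (orb (y h') (int s)) \<ge> \<delta>"
      if h: "h \<in> H" "h' \<in> H" and i: "i < L" "h i < h' i" "\<And>j. j < i \<Longrightarrow> h j = h' j" for h h' i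
    proof -
      define s where "s = 2 * i * B + h i"
      have s: "int s = t h i" by (simp add: s_def t_def)
      have "s < 2 * i * B + 2 * B" using hB[OF h(1) i(1)] by (simp add: s_def)
      also have "\<dots> = 2 * B * Suc i" by simp
      also have "\<dots> \<le> 2 * B * L" using i(1) by (intro mult_le_mono2) simp
      also have "\<dots> \<le> n" using B(2) by (simp add: mult_ac)
      finally have sn: "s < n" .
      have "J h (int s) = i" unfolding s using nearest_centre[OF gap[OF h(1)] _ J i(1)] BT(3) by simp
      then have n1: "dist (orb (y h) (int s)) (x i) < \<delta>"
        using y(2)[OF h(1), of "int s"] by (simp add: s)
      define j where "j = J h' (int s)"
      have jL: "j < L" and jn: "\<And>k. k < L \<Longrightarrow> \<bar>int s - t h' j\<bar> \<le> \<bar>int s - t h' k\<bar>"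
        using J[of h'] unfolding nearest_def j_def by blast+
      have n2: "dist (orb (y h') (int s)) (orb (x j) (int s - t h' j)) < \<delta>"
        using y(2)[OF h(2), of "int s"] by (simp add: j_def)
      have less: "t h' k + int B \<le> t h' k'" if "k < k'" "k' < L" for k k'
        using separated_less[OF gap[OF h(2)] _ that] by simp
      have si: "int s < t h' i" using i(2) by (simp add: s_def t_def)
      have "j \<le> i"
      proof (rule ccontr)
        assume "\<not> j \<le> i"
        then have "t h' i + int B \<le> t h' j" using less jL by simp
        then show False using jn[OF i(1)] si BT(3) by linarith
      qed
      \<comment> \<open>While the orbit of \<open>h\<close> is at \<open>x i\<close>, that of
        \<open>h'\<close> is still in the past of \<open>x i\<close>, or at the end of the preceding
        piece and hence near \<open>f i\<close>. A yet earlier piece is impossible, because centre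
        \<open>Suc j\<close> has been reached and is nearer.\<close>
      then consider "j = i" | "Suc j = i" | "Suc j < i" by linarith
      then have "dist (orb (y h) (int s)) (orb (y h') (int s)) \<ge> \<delta>"
      proof cases
        case 1
        have "dist (orb (x i) (int s - t h' i)) (x i) \<ge> 4 * \<delta>" using si by (intro neg i(1)) simp
        then show ?thesis
          using dist_triangle3[of "orb (x i) (int s - t h' i)" "x i" "orb (y h') (int s)"]
            dist_triangle3[of "orb (y h') (int s)" "x i" "orb (y h) (int s)"] n1 n2[unfolded 1] \<delta> by linarith
      next
        case 2
        have "t h' j = t h j" using i(3)[of j] 2 by (simp add: t_def)
        moreover have "t h j + int B \<le> t h i"
          using separated_less[OF gap[OF h(1)] _ _ i(1), of j] 2 by simp
        ultimately have "int s - t h' j \<ge> int N1" using BT(2) s by linarith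
        then have "dist (orb (x j) (int s - t h' j)) (f (Suc j)) < \<delta>"
          using N1[rule_format, of "nat (int s - t h' j)" j] jL by auto
        then have 3: "dist (orb (x j) (int s - t h' j)) (f i) < \<delta>" using 2 by simp
        have "dist (f i) (x i) \<le> dist (orb (x j) (int s - t h' j)) (f i) + (dist (orb (y h') (int s)) (orb (x j) (int s - t h' j)) +
            (dist (orb (y h) (int s)) (orb (y h') (int s)) + dist (orb (y h) (int s)) (x i)))"
          using dist_triangle3[of "f i" "x i" "orb (x j) (int s - t h' j)"]
            dist_triangle3[of "orb (x j) (int s - t h' j)" "x i" "orb (y h') (int s)"]
            dist_triangle3[of "orb (y h') (int s)" "x i" "orb (y h) (int s)"] by linarith
        then show ?thesis
          using lim4[OF i(1)] 3 n1 n2 by linarith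
      next
        case 3
        have a: "t h' j + int B \<le> t h' (Suc j)" using less 3 i(1) by simp
        have "t h' (Suc j) = t h (Suc j)" using i(3)[OF 3] by (simp add: t_def)
        moreover have "t h (Suc j) + int B \<le> t h i"
          using separated_less[OF gap[OF h(1)] _ 3 i(1)] by simp
        ultimately have "t h' (Suc j) \<le> int s" using s by linarith
        with a jn[of "Suc j"] 3 i(1) BT(3) show ?thesis by linarith
      qed
      with sn show ?thesis by blast
    qed
    have far': "\<exists>s<n. dist (orb (y h) (int s)) (orb (y h') (int s)) \<ge> \<delta>" if h: "h \<in> H" "h' \<in> H" "h \<noteq> h'" for h h'
    proof -
      define i where "i = (LEAST i. h i \<noteq> h' i)"
      have "\<exists>i. h i \<noteq> h' i" using h(3) by blast
      from LeastI_ex[OF this] have ne: "h i \<noteq> h' i" by (simp add: i_def)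
      have eq: "h j = h' j" if "j < i" for j using not_less_Least[of j "\<lambda>i. h i \<noteq> h' i"] that by (auto simp: i_def)
      have iL: "i < L"
      proof (rule ccontr)
        assume "\<not> i < L"
        then have "h i = undefined" "h' i = undefined" using h(1,2) by (auto simp: H_def PiE_def extensional_def)
        then show False using ne by simp
      qed
      consider "h i < h' i" | "h' i < h i" using ne by linarith
      then show ?thesis
      proof cases
        case 1 then show ?thesis using far[OF h(1,2) iL _ eq] by blast
      next
        case 2
        then obtain s where "s < n" "dist (orb (y h') (int s)) (orb (y h) (int s)) \<ge> \<delta>"
          using far[OF h(2,1) iL _ eq[symmetric]] by blast
        then show ?thesis by (auto simp: dist_commute)
      qed
    qed
    have "continuous_on S F" "F ` S \<subseteq> S" using smooth_F unfolding smooth_on_def by auto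
    from cover_number_attained[OF compact_S this B(3), of "\<delta> / 2"] \<delta>
    obtain E where E: "E \<subseteq> S" "finite E" "card E = cover_number S F (\<delta> / 2) n" "S = (\<Union>x\<in>E. dyn_ball S F x n (\<delta> / 2))"
      by auto
    have "\<forall>h. \<exists>c. h \<in> H \<longrightarrow> c \<in> E \<and> y h \<in> dyn_ball S F c n (\<delta> / 2)" using y(1) E(4) by blast
    from choice[OF this] obtain c where c: "\<And>h. h \<in> H \<Longrightarrow> c h \<in> E \<and> y h \<in> dyn_ball S F (c h) n (\<delta> / 2)" by blast
    have "inj_on c H"
    proof (rule inj_onI, rule ccontr)
      fix h h' assume h: "h \<in> H" "h' \<in> H" "c h = c h'" "h \<noteq> h'"
      from far'[OF h(1,2,4)] obtain s where s: "s < n" "dist (orb (y h) (int s)) (orb (y h') (int s)) \<ge> \<delta>" by blast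
      have "dist ((F ^^ s) (c h)) ((F ^^ s) (y h)) < \<delta> / 2" "dist ((F ^^ s) (c h)) ((F ^^ s) (y h')) < \<delta> / 2"
        using c[OF h(1)] c[OF h(2)] h(3) s(1) B(3) by (auto simp: dyn_ball_eq)
      then have "dist ((F ^^ s) (y h)) ((F ^^ s) (y h')) < \<delta>" by (rule dist_triangle_half_r)
      then show False using s(2) by (simp add: orb_nat)
    qed
    then have "card H \<le> card E" by (rule card_inj_on_le) (use c E(2) in auto)
    moreover have "card H = B ^ L" by (simp add: H_def card_PiE)
    ultimately show ?thesis using E(3) by simp
  qed
  have one: "1 \<le> cover_number S F (\<delta> / 2) n" if "n \<ge> 1" for n
  proof -
    have "continuous_on S F" "F ` S \<subseteq> S" using smooth_F unfolding smooth_on_def by auto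
    from cover_number_attained[OF compact_S this that, of "\<delta> / 2"] \<delta>
    obtain E where E: "E \<subseteq> S" "finite E" "card E = cover_number S F (\<delta> / 2) n" "S = (\<Union>x\<in>E. dyn_ball S F x n (\<delta> / 2))"
      by auto
    have "S \<noteq> {}" using f L by auto
    then have "E \<noteq> {}" using E(4) by auto
    then show ?thesis using E(2,3) by (metis One_nat_def Suc_leI card_gt_0_iff)
  qed
  \<comment> \<open>For large \<open>n\<close> the choice \<open>B = n div (2 * L)\<close> loses
    only a constant factor; for small \<open>n\<close> the bound follows from the covering number
    being at least 1.\<close>
  define n0 where "n0 = 4 * L * (T' + 1)"
  have n0: "n0 > 0" using L by (simp add: n0_def)
  define K where "K = min ((1 / (4 * real L)) ^ L) ((1 / real n0) ^ L)"
  have K: "K > 0" using L n0 by (simp add: K_def)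
  have "K * real n ^ L \<le> real (cover_number S F (\<delta> / 2) n)" if n: "n \<ge> 1" for n
  proof (cases "n \<ge> n0")
    case True
    define B where "B = n div (2 * L)"
    have "2 * L * T' \<le> n" "4 * L \<le> n" using True by (auto simp: n0_def algebra_simps)
    then have "T' \<le> B" unfolding B_def using L by (simp add: less_eq_div_iff_mult_less_eq mult.commute)
    moreover have "2 * L * B \<le> n" by (simp add: B_def)
    ultimately have 1: "B ^ L \<le> cover_number S F (\<delta> / 2) n" using key n by blast
    have "n < 2 * L * (B + 1)"
      unfolding B_def using L dividend_less_times_div[of "2 * L" n] by (simp add: algebra_simps)
    then have "n \<le> 4 * L * B" using \<open>4 * L \<le> n\<close> by (simp add: algebra_simps)
    then have "real n \<le> real (4 * L * B)" by (simp only: of_nat_le_iff)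
    then have "1 / (4 * real L) * real n \<le> real B" using L by (simp add: field_simps)
    then have "(1 / (4 * real L) * real n) ^ L \<le> real B ^ L" by (intro power_mono) auto
    moreover have "K * real n ^ L \<le> (1 / (4 * real L) * real n) ^ L"
      unfolding power_mult_distrib by (intro mult_right_mono) (auto simp: K_def)
    moreover have "real B ^ L \<le> real (cover_number S F (\<delta> / 2) n)" using 1 by (simp flip: of_nat_power)
    ultimately show ?thesis by linarith
  next
    case False
    have "K * real n ^ L \<le> (1 / real n0 * real n) ^ L"
      unfolding power_mult_distrib by (intro mult_right_mono) (auto simp: K_def)
    also have "\<dots> \<le> 1" using False n0 by (intro power_le_one) auto
    finally show ?thesis using one[OF n] by linarith
  qed
  with \<delta> K show ?thesis by (intro exI[of _ "\<delta> / 2"]) auto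
qed

end

section \<open>Passing to a power that fixes the periodic points\<close>

lemma funpow_fixed_mult: "(h ^^ m) p = p \<Longrightarrow> (h ^^ (m * k)) p = p"
  by (induction k) (simp_all add: funpow_add)

lemma funpow_div_mod: "(h ^^ n) x = (h ^^ (n mod P)) ((h ^^ (P * (n div P))) x)"
  unfolding comp_apply[of "h ^^ _" "h ^^ _", symmetric] funpow_add[symmetric] by simp

text \<open>Between multiples of \<open>P\<close> there are only the finitely many iterates
  \<open>h ^^ r\<close> with \<open>r < P\<close>, each continuous at \<open>q\<close>.\<close>

lemma tendsto_fixed_stable_set:
  fixes h :: "'a::metric_space \<Rightarrow> 'a"
  assumes h: "continuous_on S h" "h ` S \<subseteq> S" and P: "P \<ge> 1" "(h ^^ P) q = q" "q \<in> S" and x: "x \<in> S"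
    and lim: "(\<lambda>n. ((h ^^ P) ^^ n) x) \<longlonglongrightarrow> q"
  shows "x \<in> stable_set S h q"
proof -
  have hk: "continuous_on S (h ^^ k)" "(h ^^ k) y \<in> S" if "y \<in> S" for k y
  proof -
    have "continuous_on S (h ^^ k) \<and> (h ^^ k) ` S \<subseteq> S"
    proof (induction k)
      case (Suc k)
      then have "continuous_on S (h \<circ> (h ^^ k))"
        using h by (intro continuous_on_compose) (auto intro: continuous_on_subset)
      with Suc h show ?case by (auto simp: image_subset_iff)
    qed simp
    then show "continuous_on S (h ^^ k)" "(h ^^ k) y \<in> S" using that by auto
  qed
  have lim': "(\<lambda>n. (h ^^ (P * n)) x) \<longlonglongrightarrow> q" using lim by (simp add: funpow_mult mult.commute)
  have "(\<lambda>n. dist ((h ^^ n) x) ((h ^^ n) q)) \<longlonglongrightarrow> 0"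
  proof (rule metric_LIMSEQ_I)
    fix e :: real assume e: "e > 0"
    have "\<forall>\<^sub>F n in sequentially. dist ((h ^^ r) ((h ^^ (P * n)) x)) ((h ^^ r) q) < e" for r
      by (rule tendstoD[OF continuous_on_tendsto_compose[OF hk(1)[OF x] lim' P(3)] e]) (simp add: hk x)
    from uniform_nat_bound[of P "\<lambda>r n. dist ((h ^^ r) ((h ^^ (P * n)) x)) ((h ^^ r) q) < e", OF this]
    obtain N where N: "\<forall>n\<ge>N. \<forall>r<P. dist ((h ^^ r) ((h ^^ (P * n)) x)) ((h ^^ r) q) < e"
      unfolding eventually_sequentially by blast
    show "\<exists>no. \<forall>n\<ge>no. dist (dist ((h ^^ n) x) ((h ^^ n) q)) 0 < e"
    proof (intro exI[of _ "P * N"] allI impI)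
      fix n assume n: "n \<ge> P * N"
      then have "n div P \<ge> N" using P(1) by (simp add: less_eq_div_iff_mult_less_eq mult.commute)
      moreover have "n mod P < P" using P(1) by simp
      moreover have "(h ^^ (P * (n div P))) q = q" using funpow_fixed_mult[OF P(2)] .
      ultimately have "dist ((h ^^ n) x) ((h ^^ n) q) < e"
        unfolding funpow_div_mod[of n h _ P] using N by simp
      then show "dist (dist ((h ^^ n) x) ((h ^^ n) q)) 0 < e" by simp
    qed
  qed
  then show ?thesis using x unfolding stable_set_def by simp
qed

lemma stable_set_tendsto:
  assumes P: "P \<ge> 1" "(h ^^ P) q = q" and x: "x \<in> stable_set S h q"
  shows "(\<lambda>n. ((h ^^ P) ^^ n) x) \<longlonglongrightarrow> q"
proof -
  have "(\<lambda>n. dist ((h ^^ n) x) ((h ^^ n) q)) \<longlonglongrightarrow> 0" using x by (simp add: stable_set_def)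
  moreover have "strict_mono (\<lambda>n. P * n)" using P(1) by (simp add: strict_mono_def)
  ultimately have "((\<lambda>n. dist ((h ^^ n) x) ((h ^^ n) q)) \<circ> (\<lambda>n. P * n)) \<longlonglongrightarrow> 0"
    by (rule LIMSEQ_subseq_LIMSEQ)
  then have "(\<lambda>n. dist ((h ^^ (P * n)) x) ((h ^^ (P * n)) q)) \<longlonglongrightarrow> 0" by (simp add: o_def)
  then have "(\<lambda>n. dist ((h ^^ (P * n)) x) q) \<longlonglongrightarrow> 0" by (simp add: funpow_fixed_mult[OF P(2)])
  then show ?thesis by (subst tendsto_dist_iff) (simp add: funpow_mult mult.commute)
qed

text \<open>Membership in a local stable set bounds all later times at once. Since
  \<open>N \<le> P * m\<close> for \<open>m \<ge> N\<close>, the same \<open>N\<close> serves for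
  the power.\<close>

lemma local_stable_curve:
  assumes P: "P \<ge> 1" "(h ^^ P) q = q"
    and c: "\<forall>\<epsilon>>0. \<exists>N. \<forall>\<^sub>F t in nhds 0. (h ^^ N) (c t) \<in> local_stable_set S h \<epsilon> ((h ^^ N) q)" and \<epsilon>: "\<epsilon> > 0"
  shows "\<exists>N. \<forall>\<^sub>F t in nhds (0::real). \<forall>m\<ge>N. dist (((h ^^ P) ^^ m) (c t)) q \<le> \<epsilon>"
proof -
  obtain N where N: "\<forall>\<^sub>F t in nhds 0. (h ^^ N) (c t) \<in> local_stable_set S h \<epsilon> ((h ^^ N) q)" using c \<epsilon> by blast
  have "\<forall>\<^sub>F t in nhds 0. \<forall>m\<ge>N. dist (((h ^^ P) ^^ m) (c t)) q \<le> \<epsilon>"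
    using N
  proof eventually_elim
    case (elim t)
    show ?case
    proof (intro allI impI)
      fix m assume m: "m \<ge> N"
      have "N \<le> P * m" using m mult_le_mono1[OF P(1), of m] by linarith
      then have split: "P * m = (P * m - N) + N" by simp
      have "dist ((h ^^ (P * m - N)) ((h ^^ N) (c t))) ((h ^^ (P * m - N)) ((h ^^ N) q)) \<le> \<epsilon>"
        using elim unfolding local_stable_set_def by blast
      then have "dist ((h ^^ (P * m)) (c t)) ((h ^^ (P * m)) q) \<le> \<epsilon>"
        by (subst (1 2) split) (simp add: funpow_add)
      then show "dist (((h ^^ P) ^^ m) (c t)) q \<le> \<epsilon>"
        by (simp add: funpow_mult mult.commute funpow_fixed_mult[OF P(2)])
    qed
  qed
  then show ?thesis by blast
qed

section \<open>The data of a Morse-Smale diffeomorphism\<close>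

locale morse_smale_surface =
  fixes S :: "'a::metric_space set" and A :: "'a chart set" and f :: "'a \<Rightarrow> 'a"
  assumes surface: "compact_surface S A" and ms: "morse_smale S A f"
begin

abbreviation g :: "'a \<Rightarrow> 'a" where "g \<equiv> inv_into S f"

abbreviation \<Omega> :: "'a set" where "\<Omega> \<equiv> nonwandering S f"

lemma charts: "c \<in> A \<Longrightarrow> chart_on S c"
  using surface unfolding compact_surface_def by blast

lemma charts_cover: "x \<in> S \<Longrightarrow> \<exists>c\<in>A. x \<in> fst c"
proof -
  assume "x \<in> S"
  then obtain U \<phi> where "(U, \<phi>) \<in> A" "x \<in> U" using surface unfolding compact_surface_def by blast
  then show ?thesis by (intro bexI[of _ "(U, \<phi>)"]) auto
qed

lemma bij_f: "bij_betw f S S"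
  using ms unfolding morse_smale_def diffeo_def by blast

end

sublocale morse_smale_surface \<subseteq> base: surface_dyn S A f g
proof
  show "compact S" using surface by (simp add: compact_surface_def)
  show "chart_on S c" if "c \<in> A" for c using charts[OF that] .
  show "\<exists>c\<in>A. x \<in> fst c" if "x \<in> S" for x using charts_cover[OF that] .
  show "smooth_on S A id" "smooth_on S A f" "smooth_on S A g"
    using surface ms unfolding compact_surface_def morse_smale_def diffeo_def
    by (blast intro: C1_map_smooth_on charts)+
  show "g (f x) = x" "f (g x) = x" if "x \<in> S" for x
    using bij_f that by (auto simp: bij_betw_def intro: inv_into_f_f f_inv_into_f)
qed

context morse_smale_surface
begin

lemma f_iter_in: "x \<in> S \<Longrightarrow> (f ^^ n) x \<in> S"
  using base.orb_in[of x "int n"] by (simp add: base.orb_nat)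

lemma g_f_iter: "x \<in> S \<Longrightarrow> (g ^^ n) ((f ^^ n) x) = x"
  using base.orb_add[of x "int n" "- int n"] by (simp add: base.orb_nat base.orb_neg)

lemma f_g_iter: "x \<in> S \<Longrightarrow> (f ^^ n) ((g ^^ n) x) = x"
  using base.orb_add[of x "- int n" "int n"] by (simp add: base.orb_nat base.orb_neg)

lemma cont_f: "continuous_on S f" "f ` S \<subseteq> S" and cont_g: "continuous_on S g" "g ` S \<subseteq> S"
  using base.smooth_F base.smooth_Fi unfolding smooth_on_def by auto

lemma finite_\<Omega>: "finite \<Omega>" and \<Omega>_S: "x \<in> \<Omega> \<Longrightarrow> x \<in> S"
  using ms by (auto simp: morse_smale_def nonwandering_def)

lemma f_\<Omega>: assumes "x \<in> \<Omega>" shows "f x \<in> \<Omega>"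
proof -
  have "\<exists>n\<ge>1. (f ^^ n) ` U \<inter> U \<noteq> {}" if U: "openin (top_of_set S) U" "f x \<in> U" for U
  proof -
    have "openin (top_of_set S) {y\<in>S. f y \<in> U}" by (rule smooth_on_preimage[OF base.smooth_F U(1)])
    moreover have "x \<in> {y\<in>S. f y \<in> U}" using \<Omega>_S[OF assms] U(2) by simp
    ultimately obtain n where n: "n \<ge> 1" "(f ^^ n) ` {y\<in>S. f y \<in> U} \<inter> {y\<in>S. f y \<in> U} \<noteq> {}"
      using assms unfolding nonwandering_def by blast
    then obtain y where "f y \<in> U" "f ((f ^^ n) y) \<in> U" by auto
    then have "(f ^^ n) (f y) \<in> (f ^^ n) ` U \<inter> U" by (simp add: funpow_swap1)
    then show ?thesis using n(1) by blast
  qed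
  then show ?thesis using base.F_in[OF \<Omega>_S[OF assms]] unfolding nonwandering_def by blast
qed

text \<open>An orbit in a finite forward invariant set repeats, and invertibility of
  \<open>f\<close> moves the repetition back to its start.\<close>

lemma \<Omega>_periodic: assumes x: "x \<in> \<Omega>" shows "\<exists>n\<ge>1. (f ^^ n) x = x"
proof -
  have "(f ^^ n) x \<in> \<Omega>" for n by (induction n) (use x f_\<Omega> in auto)
  then have "finite (range (\<lambda>n. (f ^^ n) x))" using finite_\<Omega> by (meson finite_subset image_subsetI)
  then have "\<not> inj (\<lambda>n. (f ^^ n) x)" using finite_imageD infinite_UNIV_nat by blast
  then obtain i j where "i < j" "(f ^^ i) x = (f ^^ j) x"
    unfolding inj_def by (metis linorder_neqE_nat)
  then have "(f ^^ i) ((f ^^ (j - i)) x) = (f ^^ i) x"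
    by (metis add_diff_inverse_nat comp_apply funpow_add not_less_iff_gr_or_eq)
  then have "(f ^^ (j - i)) x = x" using g_f_iter f_iter_in \<Omega>_S[OF x] by metis
  with \<open>i < j\<close> show ?thesis by (intro exI[of _ "j - i"]) auto
qed

lemma period: assumes "x \<in> \<Omega>" shows "period f x \<ge> 1" "(f ^^ period f x) x = x"
  using LeastI_ex[OF \<Omega>_periodic[OF assms]] unfolding period_def by auto

lemma \<Omega>_periodic_points: "\<Omega> = periodic_points S f"
proof
  show "\<Omega> \<subseteq> periodic_points S f" using \<Omega>_periodic \<Omega>_S unfolding periodic_points_def by blast
  show "periodic_points S f \<subseteq> \<Omega>"
  proof
    fix p assume "p \<in> periodic_points S f"
    then obtain n where n: "p \<in> S" "n \<ge> 1" "(f ^^ n) p = p" unfolding periodic_points_def by blast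
    have "\<exists>n\<ge>1. (f ^^ n) ` U \<inter> U \<noteq> {}" if "p \<in> U" for U
    proof -
      have "p \<in> (f ^^ n) ` U" using imageI[OF that, of "f ^^ n"] n(3) by simp
      then show ?thesis using that n(2) by blast
    qed
    then show "p \<in> \<Omega>" using n(1) by (simp add: nonwandering_def)
  qed
qed

text \<open>The product serves as a common multiple of the periods, for which divisibility is
  immediate.\<close>

definition P :: nat where "P = (\<Prod>p\<in>\<Omega>. period f p)"

lemma P_pos: "P \<ge> 1"
proof -
  have "0 < P" unfolding P_def by (rule prod_pos) (use period(1) in force)
  then show ?thesis by simp
qed

lemma P_period: assumes "x \<in> \<Omega>" obtains m where "m \<ge> 1" "P = period f x * m"
proof -
  obtain m where "P = period f x * m" using finite_\<Omega> assms unfolding P_def by (metis dvdE dvd_prodI)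
  moreover have "m \<ge> 1" using P_pos \<open>P = _\<close> by (cases m) auto
  ultimately show ?thesis using that by blast
qed

lemma f_P: "x \<in> \<Omega> \<Longrightarrow> (f ^^ P) x = x"
  using P_period funpow_fixed_mult[OF period(2)] by metis

lemma g_P: "x \<in> \<Omega> \<Longrightarrow> (g ^^ P) x = x"
  using g_f_iter[of x P] f_P \<Omega>_S by metis

end

sublocale morse_smale_surface \<subseteq> pow: surface_dyn S A "f ^^ P" "g ^^ P"
proof
  show "compact S" by (rule base.compact_S)
  show "chart_on S c" if "c \<in> A" for c using charts[OF that] .
  show "\<exists>c\<in>A. x \<in> fst c" if "x \<in> S" for x using charts_cover[OF that] .
  show "smooth_on S A id" by (rule base.smooth_id)
  show "smooth_on S A (f ^^ P)" "smooth_on S A (g ^^ P)"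
    by (rule base.smooth_funpow base.smooth_F base.smooth_Fi)+
  show "(g ^^ P) ((f ^^ P) x) = x" "(f ^^ P) ((g ^^ P) x) = x" if "x \<in> S" for x
    using that by (rule g_f_iter f_g_iter)+
qed

context morse_smale_surface
begin

lemma strict_deriv_iterate:
  assumes h: "smooth_on S A h" and c: "c \<in> A" "q \<in> fst c" "q \<in> S" "h q = q"
  shows "strict_deriv_at (local_rep c c (h ^^ m)) (snd c q) (blinfun_power (dmap c c h q) m)"
proof (induction m)
  case 0
  have id: "strict_deriv_at (\<lambda>u. u) (snd c q) id_blinfun"
    unfolding strict_deriv_at_def by (auto intro: exI[of _ 1])
  obtain r where r: "r > 0" "\<forall>u. norm (u - snd c q) \<le> r \<longrightarrow> (\<exists>y. y \<in> fst c \<and> y \<in> S \<and> u = snd c y)"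
    using chart_near[OF charts[OF c(1)] openin_subtopology_self c(2,3)] by blast
  have "strict_deriv_at (local_rep c c id) (snd c q) id_blinfun"
  proof (rule strict_deriv_cong[OF id r(1)])
    fix u assume "norm (u - snd c q) \<le> r"
    then obtain y where "y \<in> fst c" "u = snd c y" using r(2) by blast
    then show "u = local_rep c c id u" by (simp add: local_rep_apply[OF charts[OF c(1)]])
  qed
  then show ?case by (simp add: id_def)
next
  case (Suc m)
  have hm: "(h ^^ m) q = q" by (induction m) (use c(4) in auto)
  have D: "strict_deriv_at (local_rep c c h) (snd c ((h ^^ m) q)) (dmap c c h q)"
    unfolding hm using c by (intro smooth_on_strict_deriv[OF h]) auto
  have "strict_deriv_at (local_rep c c (h \<circ> h ^^ m)) (snd c q) (dmap c c h q o\<^sub>L blinfun_power (dmap c c h q) m)"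
    by (rule local_rep_compose[OF charts[OF c(1)] charts[OF c(1)] base.smooth_funpow[OF h] c(3,2) _ Suc D])
      (use hm c(2) in simp)
  then show ?case unfolding funpow.simps blinfun_power_Suc .
qed

text \<open>The eigenvalue condition concerns the Jacobian of the iterate at the period of
  \<open>q\<close>. It makes that derivative a hyperbolic map, and the derivative of
  \<open>f ^^ P\<close> is one of its powers.\<close>

lemma hyperbolic_fixed_\<Omega>:
  assumes q: "q \<in> \<Omega>"
  shows "pow.hyperbolic_fixed q"
  unfolding pow.hyperbolic_fixed_def
proof (intro conjI ballI impI)
  show "q \<in> S" "(f ^^ P) q = q" using \<Omega>_S[OF q] f_P[OF q] .
  fix c assume c: "c \<in> A" "q \<in> fst c"
  obtain m where m: "m \<ge> 1" "P = period f q * m" using P_period[OF q] .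
  define h where "h = f ^^ period f q"
  have h: "smooth_on S A h" "h q = q" unfolding h_def using base.smooth_funpow[OF base.smooth_F] period(2)[OF q] by auto
  have D: "strict_deriv_at (local_rep c c h) (snd c q) (dmap c c h q)"
    using c \<Omega>_S[OF q] h by (intro smooth_on_strict_deriv[OF h(1)]) auto
  have "frechet_derivative (local_rep c c h) (at (snd c q)) = blinfun_apply (dmap c c h q)"
    using frechet_derivative_at[OF strict_deriv_has_derivative[OF D]] by simp
  then have jac: "jacobian (local_rep c c h) (at (snd c q)) = matrix (dmap c c h q)"
    by (simp add: jacobian_def)
  have "hyperbolic A f q" using ms q unfolding morse_smale_def \<Omega>_periodic_points by blast
  then have "\<forall>\<mu>. complex_eigenvalue (jacobian (local_rep c c h) (at (snd c q))) \<mu> \<longrightarrow> cmod \<mu> \<noteq> 1"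
    using c unfolding hyperbolic_def h_def by (auto simp: split_beta)
  then have "hyperbolic_map (dmap c c h q)" unfolding jac by (intro hyperbolic_map_matrix) blast
  then have "hyperbolic_map (blinfun_power (dmap c c h q) m)" using m(1) by (rule hyperbolic_map_power)
  moreover have "f ^^ P = h ^^ m" by (simp add: h_def m(2) funpow_mult mult.commute)
  moreover have "strict_deriv_at (local_rep c c (f ^^ P)) (snd c q) (dmap c c (f ^^ P) q)"
    using c \<Omega>_S[OF q] f_P[OF q] by (intro smooth_on_strict_deriv[OF pow.smooth_F]) auto
  ultimately show "hyperbolic_map (dmap c c (f ^^ P) q)"
    using strict_deriv_unique[OF strict_deriv_iterate[OF h(1) c \<Omega>_S[OF q] h(2)]] by metis
qed

lemma pow_orb_nat: "pow.orb x (int n) = ((f ^^ P) ^^ n) x" and pow_orb_neg: "pow.orb x (- int n) = ((g ^^ P) ^^ n) x"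
  by (rule pow.orb_nat pow.orb_neg)+

text \<open>\<open>transverse_at\<close> names the point of the stable set first,
  \<open>transversal_at\<close> the limit in the past; hence the exchange of \<open>p\<close> and
  \<open>q\<close>.\<close>

lemma transversal_\<Omega>:
  assumes p: "p \<in> \<Omega>" and q: "q \<in> \<Omega>" and x: "x \<in> S"
    and lim: "(\<lambda>n. pow.orb x (int n)) \<longlonglongrightarrow> q" "(\<lambda>n. pow.orb x (- int n)) \<longlonglongrightarrow> p"
  shows "pow.transversal_at p q x"
proof -
  have "x \<in> stable_set S f q" "x \<in> unstable_set S f p"
    unfolding unstable_set_def
    using lim unfolding pow_orb_nat pow_orb_neg
    by (auto intro!: tendsto_fixed_stable_set[OF cont_f P_pos f_P[OF q] \<Omega>_S[OF q] x]
        tendsto_fixed_stable_set[OF cont_g P_pos g_P[OF p] \<Omega>_S[OF p] x])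
  then have tr: "transverse_at S A f q p x"
    using ms p q unfolding morse_smale_def \<Omega>_periodic_points by blast
  show ?thesis
    unfolding pow.transversal_at_def
  proof (intro ballI impI allI)
    fix c w assume c: "c \<in> A" "x \<in> fst c"
    obtain U \<phi> where cU: "c = (U, \<phi>)" by (cases c)
    have "{v + w | v w. v \<in> stable_tangent_space S f (U, \<phi>) q x \<and> w \<in> stable_tangent_space S g (U, \<phi>) p x} = UNIV"
      using tr[unfolded transverse_at_def, THEN bspec, OF c(1)] c(2) unfolding cU by simp
    then have "w \<in> {v + w | v w. v \<in> stable_tangent_space S f (U, \<phi>) q x \<and> w \<in> stable_tangent_space S g (U, \<phi>) p x}"
      by simp
    then obtain vs vu where w: "w = vs + vu" "vs \<in> stable_tangent_space S f (U, \<phi>) q x" "vu \<in> stable_tangent_space S g (U, \<phi>) p x"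
      by blast
    obtain cs where cs: "cs 0 = x" "\<forall>t. cs t \<in> U" "((\<phi> \<circ> cs) has_vector_derivative vs) (at 0)"
      "\<forall>\<epsilon>>0. \<exists>N. \<forall>\<^sub>F t in nhds 0. (f ^^ N) (cs t) \<in> local_stable_set S f \<epsilon> ((f ^^ N) q)"
      using w(2) unfolding stable_tangent_space_def by auto
    obtain cu where cu: "cu 0 = x" "\<forall>t. cu t \<in> U" "((\<phi> \<circ> cu) has_vector_derivative vu) (at 0)"
      "\<forall>\<epsilon>>0. \<exists>N. \<forall>\<^sub>F t in nhds 0. (g ^^ N) (cu t) \<in> local_stable_set S g \<epsilon> ((g ^^ N) p)"
      using w(3) unfolding stable_tangent_space_def by auto
    have "pow.fwd_curve cs q"
      unfolding pow.fwd_curve_def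
    proof (intro allI impI)
      fix \<epsilon> :: real assume "\<epsilon> > 0"
      from local_stable_curve[OF P_pos f_P[OF q] cs(4) this]
      obtain N where "\<forall>\<^sub>F t in nhds 0. \<forall>m\<ge>N. dist (((f ^^ P) ^^ m) (cs t)) q \<le> \<epsilon>" by blast
      then have "\<forall>\<^sub>F t in nhds 0. \<forall>n\<ge>int N. dist (pow.orb (cs t) n) q \<le> \<epsilon>"
      proof eventually_elim
        case (elim t)
        show ?case
        proof (intro allI impI)
          fix n assume "n \<ge> int N"
          then have "nat n \<ge> N" "n = int (nat n)" by linarith+
          then show "dist (pow.orb (cs t) n) q \<le> \<epsilon>" using elim pow_orb_nat[of "cs t" "nat n"] by simp
        qed
      qed
      then show "\<exists>N. \<forall>\<^sub>F t in nhds 0. \<forall>n\<ge>N. dist (pow.orb (cs t) n) q \<le> \<epsilon>" by blast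
    qed
    moreover have "pow.bwd_curve cu p"
      unfolding pow.bwd_curve_def
    proof (intro allI impI)
      fix \<epsilon> :: real assume "\<epsilon> > 0"
      from local_stable_curve[OF P_pos g_P[OF p] cu(4) this]
      obtain N where "\<forall>\<^sub>F t in nhds 0. \<forall>m\<ge>N. dist (((g ^^ P) ^^ m) (cu t)) p \<le> \<epsilon>" by blast
      then have "\<forall>\<^sub>F t in nhds 0. \<forall>n\<le>- int N. dist (pow.orb (cu t) n) p \<le> \<epsilon>"
      proof eventually_elim
        case (elim t)
        show ?case
        proof (intro allI impI)
          fix n assume "n \<le> - int N"
          then have "nat (- n) \<ge> N" "n = - int (nat (- n))" by linarith+
          then show "dist (pow.orb (cu t) n) p \<le> \<epsilon>" using elim pow_orb_neg[of "cu t" "nat (- n)"] by metis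
        qed
      qed
      then show "\<exists>N. \<forall>\<^sub>F t in nhds 0. \<forall>n\<le>N. dist (pow.orb (cu t) n) p \<le> \<epsilon>" by blast
    qed
    ultimately show "\<exists>cs cu vs vu. w = vs + vu \<and>
     cs 0 = x \<and> (\<forall>t. cs t \<in> fst c) \<and> ((snd c \<circ> cs) has_vector_derivative vs) (at 0) \<and> pow.fwd_curve cs q \<and>
     cu 0 = x \<and> (\<forall>t. cu t \<in> fst c) \<and> ((snd c \<circ> cu) has_vector_derivative vu) (at 0) \<and> pow.bwd_curve cu p"
      using w(1) cs cu unfolding cU fst_conv snd_conv by blast
  qed
qed

end

sublocale morse_smale_surface \<subseteq> pow: ms_dyn S A "f ^^ P" "g ^^ P" \<Omega>
proof
  show "finite \<Omega>" by (rule finite_\<Omega>)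
  show "pow.hyperbolic_fixed q" if "q \<in> \<Omega>" for q using hyperbolic_fixed_\<Omega>[OF that] .
  \<comment> \<open>Iterates of the power are iterates of \<open>f\<close>, so a set that wanders
    for \<open>f\<close> wanders for the power.\<close>
  show "\<exists>U. openin (top_of_set S) U \<and> x \<in> U \<and> (\<forall>n\<ge>1. ((f ^^ P) ^^ n) ` U \<inter> U = {})" if x: "x \<in> S" "x \<notin> \<Omega>" for x
  proof -
    obtain U where U: "openin (top_of_set S) U" "x \<in> U" "\<forall>n\<ge>1. (f ^^ n) ` U \<inter> U = {}"
      using x unfolding nonwandering_def by blast
    have "((f ^^ P) ^^ n) ` U \<inter> U = {}" if "n \<ge> 1" for n
    proof -
      have "P * n \<ge> 1" using P_pos that by simp
      then show ?thesis using U(3) by (simp add: funpow_mult mult.commute)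
    qed
    with U show ?thesis by blast
  qed
qed (rule transversal_\<Omega>)

section \<open>Chains of fixed points and paths of orbits\<close>

context morse_smale_surface
begin

abbreviation orbit :: "'a \<Rightarrow> 'a set" where "orbit \<equiv> orbit_of f"

lemma f_iter_\<Omega>: "p \<in> \<Omega> \<Longrightarrow> (f ^^ n) p \<in> \<Omega>"
  by (induction n) (use f_\<Omega> in auto)

lemma f_P_mult: "p \<in> \<Omega> \<Longrightarrow> (f ^^ (P * k)) p = p"
  using funpow_fixed_mult[OF f_P] .

lemma orbit_self: "p \<in> orbit p"
  unfolding orbit_of_def by (rule range_eqI[of _ _ 0]) simp

lemma orbit_back:
  assumes "p \<in> \<Omega>" "q \<in> orbit p"
  obtains k where "q \<in> \<Omega>" "(f ^^ k) q = p"
proof -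
  obtain n where n: "q = (f ^^ n) p" using assms(2) unfolding orbit_of_def by blast
  have "n \<le> P * n" using mult_le_mono1[OF P_pos, of n] by simp
  then have "(f ^^ (P * n - n)) q = (f ^^ (P * n)) p"
    unfolding n comp_apply[of "f ^^ _" "f ^^ _", symmetric] funpow_add[symmetric] by simp
  then show ?thesis using that f_P_mult[OF assms(1)] n f_iter_\<Omega>[OF assms(1)] by metis
qed

lemma orbit_eq: assumes "p \<in> \<Omega>" "q \<in> orbit p" shows "orbit q = orbit p"
proof -
  have sub: "orbit b \<subseteq> orbit a" if ab: "b \<in> orbit a" for a b
  proof -
    obtain n where n: "b = (f ^^ n) a" using ab unfolding orbit_of_def by blast
    show ?thesis
    proof
      fix c assume "c \<in> orbit b"
      then obtain m where "c = (f ^^ m) b" unfolding orbit_of_def by blast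
      then have "c = (f ^^ (m + n)) a" unfolding n by (simp add: funpow_add)
      then show "c \<in> orbit a" unfolding orbit_of_def by blast
    qed
  qed
  obtain k where "(f ^^ k) q = p" using orbit_back[OF assms] by metis
  then have "p \<in> orbit q" unfolding orbit_of_def by blast
  then show ?thesis using sub assms(2) by blast
qed

text \<open>\<open>f ^^ k\<close> commutes with \<open>f ^^ P\<close> and preserves \<Omega> and its
  complement, so it carries connections to connections.\<close>

lemma het_shift: assumes "(p, q) \<in> pow.het" shows "((f ^^ k) p, (f ^^ k) q) \<in> pow.het"
proof -
  obtain x where x: "p \<in> \<Omega>" "q \<in> \<Omega>" "x \<in> S" "x \<notin> \<Omega>" "(\<lambda>n. pow.orb x (int n)) \<longlonglongrightarrow> q" "(\<lambda>n. pow.orb x (- int n)) \<longlonglongrightarrow> p"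
    using assms unfolding pow.het_def by blast
  have cont: "continuous_on S (f ^^ k)" using base.smooth_funpow[OF base.smooth_F, of k] unfolding smooth_on_def by blast
  have base_pow: "pow.orb y i = base.orb y (int P * i)" if "y \<in> S" for y i
  proof (cases "i \<ge> 0")
    case True
    then obtain n where "i = int n" using nonneg_int_cases by blast
    then show ?thesis using base.orb_nat[of y "P * n"] by (simp add: pow.orb_nat funpow_mult mult.commute)
  next
    case False
    then obtain n where "i = - int n" by (metis int_cases2 linear nle_le of_nat_0_le_iff)
    then show ?thesis using base.orb_neg[of y "P * n"] by (simp add: pow.orb_neg funpow_mult mult.commute)
  qed
  have comm: "pow.orb ((f ^^ k) x) i = (f ^^ k) (pow.orb x i)" for i
  proof -
    have "pow.orb ((f ^^ k) x) i = base.orb (base.orb x (int k)) (int P * i)"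
      using base_pow[OF f_iter_in[OF x(3)]] by (simp add: base.orb_nat)
    also have "\<dots> = base.orb (base.orb x (int P * i)) (int k)"
      by (simp add: base.orb_add[OF x(3)] add.commute)
    finally show ?thesis using base_pow[OF x(3)] by (simp add: base.orb_nat)
  qed
  have lim: "(\<lambda>n. (f ^^ k) (pow.orb x (int n))) \<longlonglongrightarrow> (f ^^ k) q" "(\<lambda>n. (f ^^ k) (pow.orb x (- int n))) \<longlonglongrightarrow> (f ^^ k) p"
    by (rule continuous_on_tendsto_compose[OF cont]; use x pow.orb_in \<Omega>_S in auto)+
  have "(f ^^ k) x \<notin> \<Omega>"
  proof
    assume a: "(f ^^ k) x \<in> \<Omega>"
    have "k \<le> P * k" using mult_le_mono1[OF P_pos, of k] by simp
    then have "(f ^^ (P * k - k)) ((f ^^ k) x) = (f ^^ (P * k)) x"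
      unfolding comp_apply[of "f ^^ _" "f ^^ _", symmetric] funpow_add[symmetric] by simp
    then have "pow.orb x (int k) \<in> \<Omega>" using f_iter_\<Omega>[OF a, of "P * k - k"] by (simp add: pow.orb_nat funpow_mult mult.commute)
    then show False using pow.orb_notin_Q[OF x(3,4)] by blast
  qed
  then have "(f ^^ k) x \<in> S - \<Omega>" using f_iter_in[OF x(3)] by simp
  moreover have "(\<lambda>n. pow.orb ((f ^^ k) x) (int n)) \<longlonglongrightarrow> (f ^^ k) q" "(\<lambda>n. pow.orb ((f ^^ k) x) (- int n)) \<longlonglongrightarrow> (f ^^ k) p"
    unfolding comm by (rule lim)+
  ultimately show ?thesis
    unfolding pow.het_def using f_iter_\<Omega>[OF x(1)] f_iter_\<Omega>[OF x(2)] by blast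
qed

lemma het_\<Omega>: "(p, q) \<in> pow.het \<Longrightarrow> p \<in> \<Omega> \<and> q \<in> \<Omega>"
  by (auto simp: pow.het_def)

lemma het_trancl_\<Omega>: "(p, q) \<in> pow.het\<^sup>+ \<Longrightarrow> p \<in> \<Omega> \<and> q \<in> \<Omega>"
  by (induction rule: trancl_induct) (auto dest: het_\<Omega>)

lemma het_trancl_shift: "(p, q) \<in> pow.het\<^sup>+ \<Longrightarrow> ((f ^^ k) p, (f ^^ k) q) \<in> pow.het\<^sup>+"
  by (induction rule: trancl_induct) (auto intro: het_shift trancl_into_trancl)

text \<open>A chain from \<open>p\<close> to \<open>(f ^^ s) p\<close> can be shifted by
  \<open>s\<close> and appended to itself. After \<open>P\<close> copies it closes at
  \<open>p\<close>, against acyclicity.\<close>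

lemma het_trancl_orbit: assumes "(p, q) \<in> pow.het\<^sup>+" shows "q \<notin> orbit p"
proof
  assume "q \<in> orbit p"
  then obtain s where s: "q = (f ^^ s) p" unfolding orbit_of_def by blast
  have p: "p \<in> \<Omega>" using het_trancl_\<Omega>[OF assms] by blast
  have "(p, (f ^^ (s * Suc n)) p) \<in> pow.het\<^sup>+" for n
  proof (induction n)
    case 0
    then show ?case using assms s by simp
  next
    case (Suc n)
    have "((f ^^ s) p, (f ^^ s) ((f ^^ (s * Suc n)) p)) \<in> pow.het\<^sup>+" using het_trancl_shift[OF Suc] .
    moreover have "(f ^^ s) ((f ^^ (s * Suc n)) p) = (f ^^ (s * Suc (Suc n))) p"
      unfolding comp_apply[of "f ^^ _" "f ^^ _", symmetric] funpow_add[symmetric] by simp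
    ultimately show ?case using assms s by (metis trancl_trans)
  qed
  from this[of "P - 1"] have "(p, (f ^^ (P * s)) p) \<in> pow.het\<^sup>+" using P_pos by (simp add: mult.commute)
  then have "(p, p) \<in> pow.het\<^sup>+" using f_P_mult[OF p] by simp
  then show False using pow.het_acyclic unfolding acyclic_def by blast
qed

abbreviation G where "G \<equiv> orbit_graph S f"

lemma G_verts: "verts G = orbit ` \<Omega>" and G_tail: "tail G = fst" and G_head: "head G = snd"
  by (simp_all add: orbit_graph_def Let_def)

lemma G_arcs: "e \<in> arcs G \<longleftrightarrow> fst e \<in> orbit ` \<Omega> \<and> snd e \<in> orbit ` \<Omega> \<and> fst e \<noteq> snd e \<and>
    (\<Union>p\<in>fst e. unstable_set S f p) \<inter> (\<Union>q\<in>snd e. stable_set S f q) \<noteq> {}"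
  by (cases e) (simp add: orbit_graph_def Let_def)

lemma het_arc: assumes "(p, q) \<in> pow.het" shows "(orbit p, orbit q) \<in> arcs G"
proof -
  obtain x where x: "p \<in> \<Omega>" "q \<in> \<Omega>" "x \<in> S" "(\<lambda>n. pow.orb x (int n)) \<longlonglongrightarrow> q" "(\<lambda>n. pow.orb x (- int n)) \<longlonglongrightarrow> p"
    using assms unfolding pow.het_def by blast
  have "x \<in> stable_set S f q" "x \<in> unstable_set S f p"
    unfolding unstable_set_def
    using x(4,5) unfolding pow_orb_nat pow_orb_neg
    by (auto intro!: tendsto_fixed_stable_set[OF cont_f P_pos f_P[OF x(2)] \<Omega>_S[OF x(2)] x(3)]
        tendsto_fixed_stable_set[OF cont_g P_pos g_P[OF x(1)] \<Omega>_S[OF x(1)] x(3)])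
  moreover have "orbit p \<noteq> orbit q"
    using het_trancl_orbit[OF r_into_trancl[OF assms]] orbit_self by blast
  moreover have "p \<in> orbit p" "q \<in> orbit q" by (rule orbit_self)+
  ultimately show ?thesis unfolding G_arcs fst_conv snd_conv using x(1,2) by blast
qed

text \<open>An arc connects some representatives of the two orbits; shifting that connection makes
  it start at the given \<open>p\<close>. This is what allows successive arcs to be joined to a
  chain.\<close>

lemma arc_het:
  assumes e: "(\<theta>, \<eta>) \<in> arcs G" and p: "p \<in> \<Omega>" "orbit p = \<theta>"
  obtains q where "q \<in> \<Omega>" "orbit q = \<eta>" "(p, q) \<in> pow.het"
proof -
  obtain q0 where q0: "q0 \<in> \<Omega>" "\<eta> = orbit q0" using e unfolding G_arcs by auto
  obtain x p1 q1 where x: "p1 \<in> \<theta>" "q1 \<in> \<eta>" "x \<in> unstable_set S f p1" "x \<in> stable_set S f q1" and ne: "\<theta> \<noteq> \<eta>"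
    using e unfolding G_arcs by auto
  obtain k where k: "p1 \<in> \<Omega>" "(f ^^ k) p1 = p" using orbit_back[OF p(1)] x(1) p(2) by metis
  have q1: "q1 \<in> \<Omega>" using orbit_back[OF q0(1)] x(2) q0(2) by metis
  have xS: "x \<in> S" using x(4) by (simp add: stable_set_def)
  have lim: "(\<lambda>n. pow.orb x (int n)) \<longlonglongrightarrow> q1" "(\<lambda>n. pow.orb x (- int n)) \<longlonglongrightarrow> p1"
    unfolding pow_orb_nat pow_orb_neg
    using stable_set_tendsto[OF P_pos f_P[OF q1] x(4)] stable_set_tendsto[OF P_pos g_P[OF k(1)]] x(3)
    by (auto simp: unstable_set_def)
  have eqs: "orbit p1 = \<theta>" "orbit q1 = \<eta>"
    using orbit_eq[OF p(1)] x(1,2) p(2) orbit_eq[OF q0(1)] q0(2) by auto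
  have "x \<notin> \<Omega>"
  proof
    assume "x \<in> \<Omega>"
    then have "q1 = x" "p1 = x"
      using lim LIMSEQ_unique tendsto_const by (auto simp: pow.orb_Q)
    then show False using eqs ne by simp
  qed
  then have "(p1, q1) \<in> pow.het" unfolding pow.het_def using k(1) q1 xS lim by blast
  from het_shift[OF this, of k] have "(p, (f ^^ k) q1) \<in> pow.het" unfolding k(2) .
  moreover have "(f ^^ k) q1 \<in> orbit q1" unfolding orbit_of_def by blast
  ultimately show ?thesis using that orbit_eq[OF q1] eqs f_iter_\<Omega>[OF q1] by blast
qed

text \<open>\<open>apath\<close> demands distinct vertices. The last conclusion, that the vertices
  are orbits of points reachable from \<open>p\<close>, excludes a repetition in the induction
  through \<open>het_trancl_orbit\<close>.\<close>

lemma het_chain_apath: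
  "(p, q) \<in> pow.het ^^ n \<Longrightarrow> p \<in> \<Omega> \<Longrightarrow> \<exists>\<pi>. length \<pi> = n \<and> pre_digraph.apath G (orbit p) \<pi> (orbit q) \<and>
    set (pre_digraph.awalk_verts G (orbit p) \<pi>) \<subseteq> {orbit r | r. (p, r) \<in> pow.het\<^sup>*}"
proof (induction n arbitrary: p)
  case 0
  then show ?case
    by (auto simp: pre_digraph.apath_def pre_digraph.awalk_def pre_digraph.cas.simps pre_digraph.awalk_verts.simps G_verts)
next
  case (Suc n)
  obtain p1 where p1: "(p, p1) \<in> pow.het" "(p1, q) \<in> pow.het ^^ n" using relpow_Suc_D2[OF Suc.prems(1)] by blast
  have p1\<Omega>: "p1 \<in> \<Omega>" using het_\<Omega>[OF p1(1)] by blast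
  from Suc.IH[OF p1(2) p1\<Omega>] obtain \<pi> where \<pi>: "length \<pi> = n" "pre_digraph.apath G (orbit p1) \<pi> (orbit q)"
    "set (pre_digraph.awalk_verts G (orbit p1) \<pi>) \<subseteq> {orbit r | r. (p1, r) \<in> pow.het\<^sup>*}" by blast
  let ?e = "(orbit p, orbit p1)"
  have arc: "?e \<in> arcs G" using het_arc[OF p1(1)] .
  have "orbit p \<notin> {orbit r | r. (p1, r) \<in> pow.het\<^sup>*}"
  proof
    assume "orbit p \<in> {orbit r | r. (p1, r) \<in> pow.het\<^sup>*}"
    then obtain r where r: "orbit p = orbit r" "(p1, r) \<in> pow.het\<^sup>*" by blast
    then have "(p, r) \<in> pow.het\<^sup>+" using p1(1) by (meson rtrancl_into_trancl2)
    then show False using het_trancl_orbit orbit_self r(1) by blast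
  qed
  then have new: "orbit p \<notin> set (pre_digraph.awalk_verts G (orbit p1) \<pi>)" using \<pi>(3) by blast
  show ?case
  proof (intro exI[of _ "?e # \<pi>"] conjI)
    show "length (?e # \<pi>) = Suc n" using \<pi>(1) by simp
    show "pre_digraph.apath G (orbit p) (?e # \<pi>) (orbit q)"
      using \<pi>(2) new arc Suc.prems(2)
      by (auto simp: pre_digraph.apath_def pre_digraph.awalk_def pre_digraph.cas.simps pre_digraph.awalk_verts.simps
          G_verts G_tail G_head)
    have sub: "{orbit r | r. (p1, r) \<in> pow.het\<^sup>*} \<subseteq> {orbit r | r. (p, r) \<in> pow.het\<^sup>*}"
      using p1(1) by (auto intro: converse_rtrancl_into_rtrancl)
    have ins: "set (pre_digraph.awalk_verts G (orbit p) (?e # \<pi>)) = insert (orbit p) (set (pre_digraph.awalk_verts G (orbit p1) \<pi>))"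
      by (simp add: pre_digraph.awalk_verts.simps G_tail G_head)
    have self: "orbit p \<in> {orbit r | r. (p, r) \<in> pow.het\<^sup>*}" by blast
    show "set (pre_digraph.awalk_verts G (orbit p) (?e # \<pi>)) \<subseteq> {orbit r | r. (p, r) \<in> pow.het\<^sup>*}"
      unfolding ins by (rule insert_subset[THEN iffD2, OF conjI[OF self order_trans[OF \<pi>(3) sub]]])
  qed
qed

lemma cas_het:
  "set \<pi> \<subseteq> arcs G \<Longrightarrow> pre_digraph.cas G \<theta> \<pi> \<eta> \<Longrightarrow> p \<in> \<Omega> \<Longrightarrow> orbit p = \<theta> \<Longrightarrow> \<exists>q. (p, q) \<in> pow.het ^^ length \<pi>"
proof (induction \<pi> arbitrary: \<theta> p)
  case (Cons e \<pi>)
  have t: "fst e = \<theta>" "pre_digraph.cas G (snd e) \<pi> \<eta>"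
    using Cons.prems(2) by (auto simp: pre_digraph.cas.simps G_tail G_head)
  have arc: "(\<theta>, snd e) \<in> arcs G" using Cons.prems(1) t(1) by (cases e) auto
  obtain q where q: "q \<in> \<Omega>" "orbit q = snd e" "(p, q) \<in> pow.het"
    using arc_het[OF arc Cons.prems(3,4)] .
  obtain q' where "(q, q') \<in> pow.het ^^ length \<pi>"
    using Cons.IH[OF _ t(2) q(1,2)] Cons.prems(1) by auto
  then show ?case using relpow_Suc_I2[OF q(3)] by (metis length_Cons)
qed auto

text \<open>Chains of fixed points project to simple paths of orbits of the same length, and paths
  lift to chains; hence the maximal lengths agree.\<close>

lemma longest_path_het:
  shows "\<exists>p q. (p, q) \<in> pow.het ^^ longest_path S f" and "(p, q) \<in> pow.het ^^ n \<Longrightarrow> n \<le> longest_path S f"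
proof -
  interpret G: fin_digraph G
  proof
    show "tail G e \<in> verts G" "head G e \<in> verts G" if "e \<in> arcs G" for e
      using that unfolding G_arcs G_verts G_tail G_head by auto
    show "finite (verts G)" unfolding G_verts using finite_\<Omega> by simp
    show "finite (arcs G)"
      by (rule finite_subset[of _ "verts G \<times> verts G"]) (use G_arcs G_verts finite_\<Omega> in auto)
  qed
  define X where "X = {length \<pi> | \<pi> \<theta> \<eta>. G.apath \<theta> \<pi> \<eta>}"
  have L: "longest_path S f = Max X" by (simp add: longest_path_def X_def)
  have "X = (\<lambda>(u, \<pi>, v). length \<pi>) ` {(u, \<pi>, v). G.apath u \<pi> v}" unfolding X_def by force
  then have fin: "finite X" using G.apaths_finite_triple by simp
  \<comment> \<open>The surface is nonempty and every orbit converges to a point of \<Omega>, so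
    there is a vertex and the maximum is over a nonempty set.\<close>
  obtain x where "x \<in> S" using surface unfolding compact_surface_def by blast
  then obtain q0 where q0: "q0 \<in> \<Omega>" using pow.limit_exists[of x "\<lambda>n. int n"] by auto
  have "G.apath (orbit q0) [] (orbit q0)" using q0 by (simp add: G.apath_Nil_iff G_verts)
  then have "0 \<in> X" unfolding X_def by force
  then have "Max X \<in> X" using Max_in[OF fin] by blast
  then obtain \<pi> \<theta> \<eta> where \<pi>: "length \<pi> = longest_path S f" "G.apath \<theta> \<pi> \<eta>" unfolding L X_def by force
  then have aw: "\<theta> \<in> verts G" "set \<pi> \<subseteq> arcs G" "G.cas \<theta> \<pi> \<eta>" unfolding G.apath_def G.awalk_def by auto
  then obtain p where "p \<in> \<Omega>" "orbit p = \<theta>" unfolding G_verts by blast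
  from cas_het[OF aw(2,3) this] show "\<exists>p q. (p, q) \<in> pow.het ^^ longest_path S f" unfolding \<pi>(1) by blast
  show "n \<le> longest_path S f" if n: "(p, q) \<in> pow.het ^^ n" for n p q
  proof (cases n)
    case (Suc m)
    then have "p \<in> \<Omega>" using n het_\<Omega> relpow_Suc_D2[of p q m pow.het] by blast
    from het_chain_apath[OF n this] have "n \<in> X" unfolding X_def by blast
    then show ?thesis unfolding L using fin by simp
  qed simp
qed

end

section \<open>The entropies\<close>

lemma growth_class_le_iff:
  assumes "a \<in> growth_seqs" "b \<in> growth_seqs"
  shows "growth_class a \<le> growth_class b \<longleftrightarrow> growth_le a b"
  by (rule less_eq_growth.abs_eq) (use assms in \<open>simp_all add: growth_equiv_iff growth_le_refl\<close>)

lemma power_in_growth_seqs: "(\<lambda>n. real n ^ L) \<in> growth_seqs"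
  by (auto simp: growth_seqs_def mono_on_def intro: power_mono)

lemma ln_power_ratio_tendsto:
  assumes "K > 0"
  shows "(\<lambda>n. ln (K * real n ^ L) / ln (real n)) \<longlonglongrightarrow> real L"
proof -
  have inf: "filterlim (\<lambda>n. ln (real n)) at_top sequentially"
    by (rule filterlim_compose[OF ln_at_top filterlim_real_sequentially])
  have "(\<lambda>n. ln K / ln (real n) + real L) \<longlonglongrightarrow> 0 + real L"
    by (intro tendsto_add tendsto_const tendsto_divide_0[OF tendsto_const]) (rule filterlim_at_top_imp_at_infinity[OF inf])
  moreover have "\<forall>\<^sub>F n in sequentially. ln K / ln (real n) + real L = ln (K * real n ^ L) / ln (real n)"
    using eventually_gt_at_top[of 1]
  proof eventually_elim
    case (elim n)
    then have "ln (real n) > 0" by simp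
    with elim assms show ?case by (simp add: ln_mult ln_realpow field_simps)
  qed
  ultimately show ?thesis by (simp add: Lim_transform_eventually)
qed

context morse_smale_surface
begin

text \<open>By uniform continuity, closeness at multiples of \<open>P\<close> controls the iterates
  in between. The comparison uses \<open>n\<close> steps of the power for \<open>n\<close> steps of
  \<open>f\<close>, which is generous but harmless for a polynomial order of growth.\<close>

lemma cover_upper:
  assumes \<epsilon>: "\<epsilon> > 0"
  shows "\<exists>K>0. \<forall>n\<ge>1. real (cover_number S f \<epsilon> n) \<le> K * real n ^ longest_path S f"
proof -
  have "\<forall>r. \<exists>d>0. \<forall>x\<in>S. \<forall>y\<in>S. dist x y < d \<longrightarrow> dist ((f ^^ r) x) ((f ^^ r) y) < \<epsilon>"
  proof
    fix r
    have "uniformly_continuous_on S (f ^^ r)"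
      using base.smooth_funpow[OF base.smooth_F, of r] base.compact_S unfolding smooth_on_def
      by (intro compact_uniformly_continuous) auto
    then show "\<exists>d>0. \<forall>x\<in>S. \<forall>y\<in>S. dist x y < d \<longrightarrow> dist ((f ^^ r) x) ((f ^^ r) y) < \<epsilon>"
      using \<epsilon> unfolding uniformly_continuous_on_def by (metis dist_commute)
  qed
  from choice[OF this] obtain d where d: "\<And>r. d r > 0" "\<And>r x y. x \<in> S \<Longrightarrow> y \<in> S \<Longrightarrow> dist x y < d r \<Longrightarrow> dist ((f ^^ r) x) ((f ^^ r) y) < \<epsilon>"
    by blast
  define e where "e = Min (d ` {..<P})"
  have ne: "d ` {..<P} \<noteq> {}" using P_pos by (auto simp: lessThan_empty_iff)
  have e: "e > 0" unfolding e_def using d(1) ne by (subst Min_gr_iff) auto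
  have ed: "e \<le> d r" if "r < P" for r unfolding e_def using that by (intro Min_le) auto
  obtain K where K: "K > 0" "\<forall>n\<ge>1. real (cover_number S (f ^^ P) e n) \<le> K * real n ^ longest_path S f"
  proof -
    have "\<exists>K>0. \<forall>n\<ge>1. real (cover_number S (f ^^ P) e n) \<le> K * real n ^ longest_path S f"
      by (rule pow.cover_number_upper[OF _ e]) (rule longest_path_het(2))
    with that show ?thesis by blast
  qed
  have "cover_number S f \<epsilon> n \<le> cover_number S (f ^^ P) e n" if n: "n \<ge> 1" for n
  proof -
    have F: "continuous_on S (f ^^ P)" "(f ^^ P) ` S \<subseteq> S" using pow.smooth_F unfolding smooth_on_def by auto
    from cover_number_attained[OF base.compact_S F n e]
    obtain E where E: "E \<subseteq> S" "finite E" "card E = cover_number S (f ^^ P) e n" "S = (\<Union>x\<in>E. dyn_ball S (f ^^ P) x n e)" by blast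
    have sub: "dyn_ball S (f ^^ P) x n e \<subseteq> dyn_ball S f x n \<epsilon>" if x: "x \<in> E" for x
    proof
      fix y assume y: "y \<in> dyn_ball S (f ^^ P) x n e"
      then have yS: "y \<in> S" and yk: "\<And>k. k < n \<Longrightarrow> dist (((f ^^ P) ^^ k) x) (((f ^^ P) ^^ k) y) < e"
        using n by (auto simp: dyn_ball_eq)
      have "dist ((f ^^ j) x) ((f ^^ j) y) < \<epsilon>" if j: "j < n" for j
      proof -
        have "j div P < n" using j by (meson div_le_dividend le_less_trans)
        from yk[OF this] have "dist ((f ^^ (P * (j div P))) x) ((f ^^ (P * (j div P))) y) < e"
          by (simp add: funpow_mult mult.commute)
        moreover have "j mod P < P" using P_pos by simp
        ultimately have "dist ((f ^^ (P * (j div P))) x) ((f ^^ (P * (j div P))) y) < d (j mod P)"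
          using ed by fastforce
        from d(2)[OF _ _ this] show ?thesis
          unfolding funpow_div_mod[of j f _ P] using f_iter_in yS x E(1) by blast
      qed
      then show "y \<in> dyn_ball S f x n \<epsilon>" using n yS by (simp add: dyn_ball_eq)
    qed
    have "S = (\<Union>x\<in>E. dyn_ball S f x n \<epsilon>)"
    proof
      show "S \<subseteq> (\<Union>x\<in>E. dyn_ball S f x n \<epsilon>)" using sub E(4) by blast
      show "(\<Union>x\<in>E. dyn_ball S f x n \<epsilon>) \<subseteq> S" by (auto simp: dyn_ball_def)
    qed
    then show ?thesis
      unfolding cover_number_def[of S f] using E(1-3) by (intro Least_le) blast
  qed
  then have "real (cover_number S f \<epsilon> n) \<le> K * real n ^ longest_path S f" if "n \<ge> 1" for n
    using K(2) that by (meson of_nat_mono order_trans)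
  with K(1) show ?thesis by blast
qed

lemma cover_positive: "n \<ge> 1 \<Longrightarrow> \<epsilon> > 0 \<Longrightarrow> 1 \<le> cover_number S f \<epsilon> n"
proof -
  assume n: "n \<ge> 1" "\<epsilon> > 0"
  from cover_number_attained[OF base.compact_S cont_f n]
  obtain E where E: "finite E" "card E = cover_number S f \<epsilon> n" "S = (\<Union>x\<in>E. dyn_ball S f x n \<epsilon>)" by blast
  have "S \<noteq> {}" using surface by (simp add: compact_surface_def)
  then have "E \<noteq> {}" using E(3) by auto
  then have "card E > 0" using E(1) by (simp add: card_gt_0_iff)
  then show ?thesis using E(2) by linarith
qed

lemma cover_pow_le:
  assumes n: "n \<ge> 1" and \<epsilon>: "\<epsilon> > 0"
  shows "cover_number S (f ^^ P) \<epsilon> n \<le> cover_number S f \<epsilon> (P * n)"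
proof -
  have Pn: "P * n \<ge> 1" using P_pos n by simp
  from cover_number_attained[OF base.compact_S cont_f Pn \<epsilon>]
  obtain E where E: "E \<subseteq> S" "finite E" "card E = cover_number S f \<epsilon> (P * n)" "S = (\<Union>x\<in>E. dyn_ball S f x (P * n) \<epsilon>)" by blast
  have sub: "dyn_ball S f x (P * n) \<epsilon> \<subseteq> dyn_ball S (f ^^ P) x n \<epsilon>" for x
  proof
    fix y assume y: "y \<in> dyn_ball S f x (P * n) \<epsilon>"
    have "dist (((f ^^ P) ^^ k) x) (((f ^^ P) ^^ k) y) < \<epsilon>" if "k < n" for k
    proof -
      have "P * k < P * n" using that P_pos by simp
      then have "dist ((f ^^ (P * k)) x) ((f ^^ (P * k)) y) < \<epsilon>" using y Pn by (simp add: dyn_ball_eq)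
      then show ?thesis by (simp add: funpow_mult mult.commute)
    qed
    then show "y \<in> dyn_ball S (f ^^ P) x n \<epsilon>" using y n Pn by (simp add: dyn_ball_eq)
  qed
  have "S = (\<Union>x\<in>E. dyn_ball S (f ^^ P) x n \<epsilon>)"
  proof
    show "S \<subseteq> (\<Union>x\<in>E. dyn_ball S (f ^^ P) x n \<epsilon>)" using sub E(4) by blast
    show "(\<Union>x\<in>E. dyn_ball S (f ^^ P) x n \<epsilon>) \<subseteq> S" by (auto simp: dyn_ball_def)
  qed
  then show ?thesis
    unfolding cover_number_def[of S "f ^^ P"] using E(1-3) by (intro Least_le) blast
qed

lemma cover_lower:
  shows "\<exists>\<epsilon>>0. \<exists>K>0. \<forall>n\<ge>1. K * real n ^ longest_path S f \<le> real (cover_number S f \<epsilon> n)"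
proof (cases "longest_path S f = 0")
  case True
  have "\<forall>n\<ge>1. 1 * real n ^ longest_path S f \<le> real (cover_number S f 1 n)"
    using cover_positive[of _ 1] True by simp
  then show ?thesis using zero_less_one by blast
next
  case False
  let ?L = "longest_path S f"
  obtain p q where "(p, q) \<in> pow.het ^^ ?L" using longest_path_het(1) by blast
  from pow.cover_number_lower[OF this] False
  obtain \<epsilon> K where K: "\<epsilon> > 0" "K > 0" "\<forall>n\<ge>1. K * real n ^ ?L \<le> real (cover_number S (f ^^ P) \<epsilon> n)" by blast
  \<comment> \<open>The first entry is for \<open>n \<ge> P\<close>, where \<open>n div P\<close> is
    at least \<open>n / (2 * P)\<close>; the second is for \<open>n < P\<close>, where the covering
    number is at least 1.\<close>
  define K' where "K' = min (K * (1 / (2 * real P)) ^ ?L) ((1 / real P) ^ ?L)"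
  have P: "real P > 0" using P_pos by simp
  have K': "K' > 0" using K(2) P by (simp add: K'_def)
  have "K' * real n ^ ?L \<le> real (cover_number S f \<epsilon> n)" if n: "n \<ge> 1" for n
  proof (cases "n \<ge> P")
    case True
    define m where "m = n div P"
    have m: "m \<ge> 1" using True P_pos by (simp add: m_def less_eq_div_iff_mult_less_eq)
    have "n < P * (m + 1)" unfolding m_def using P_pos dividend_less_times_div[of P n] by simp
    also have "\<dots> \<le> P * (2 * m)" using m by (intro mult_le_mono2) simp
    finally have "real n \<le> real (P * (2 * m))" by (simp only: of_nat_le_iff less_imp_le)
    then have "1 / (2 * real P) * real n \<le> real m" using P by (simp add: field_simps)
    then have "(1 / (2 * real P) * real n) ^ ?L \<le> real m ^ ?L" using P by (intro power_mono) auto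
    then have "K * (1 / (2 * real P) * real n) ^ ?L \<le> K * real m ^ ?L" using K(2) by (intro mult_left_mono) auto
    moreover have "K' * real n ^ ?L \<le> K * (1 / (2 * real P)) ^ ?L * real n ^ ?L"
      by (intro mult_right_mono) (auto simp: K'_def)
    moreover have "K * real m ^ ?L \<le> real (cover_number S f \<epsilon> n)"
    proof -
      have Pm: "1 \<le> P * m" "P * m \<le> n" using m P_pos by (auto simp: m_def)
      have "cover_number S (f ^^ P) \<epsilon> m \<le> cover_number S f \<epsilon> (P * m)" by (rule cover_pow_le[OF m K(1)])
      also have "\<dots> \<le> cover_number S f \<epsilon> n"
        by (rule cover_number_mono[OF base.compact_S cont_f Pm K(1) order_refl])
      finally have "real (cover_number S (f ^^ P) \<epsilon> m) \<le> real (cover_number S f \<epsilon> n)" by simp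
      then show ?thesis using K(3) m by (meson order_trans)
    qed
    moreover have "K * (1 / (2 * real P) * real n) ^ ?L = K * (1 / (2 * real P)) ^ ?L * real n ^ ?L"
      by (simp only: power_mult_distrib mult.assoc)
    ultimately show ?thesis by linarith
  next
    case False
    have "K' * real n ^ ?L \<le> (1 / real P * real n) ^ ?L"
      unfolding power_mult_distrib by (intro mult_right_mono) (auto simp: K'_def)
    also have "\<dots> \<le> 1" using False P by (intro power_le_one) auto
    finally show ?thesis using cover_positive[OF n K(1)] by linarith
  qed
  with K(1) K' show ?thesis by blast
qed

lemma entropies:
  "gen_entropy S f = dm_embed (growth_class (\<lambda>n. real n ^ longest_path S f))"
  "pol_entropy S f = ereal (real (longest_path S f))"
proof -
  let ?L = "longest_path S f"
  have seq: "(\<lambda>n. real (cover_number S f \<epsilon> n)) \<in> growth_seqs" if "\<epsilon> > 0" for \<epsilon>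
    using cover_number_in_growth_seqs[OF base.compact_S cont_f that] .
  obtain \<epsilon>0 K0 where low: "\<epsilon>0 > 0" "K0 > 0" "\<forall>n\<ge>1. K0 * real n ^ ?L \<le> real (cover_number S f \<epsilon>0 n)"
    using cover_lower by blast
  show "gen_entropy S f = dm_embed (growth_class (\<lambda>n. real n ^ ?L))"
  proof (rule antisym)
    show "gen_entropy S f \<le> dm_embed (growth_class (\<lambda>n. real n ^ ?L))"
      unfolding gen_entropy_def
    proof (rule SUP_least)
      fix \<epsilon> :: real assume "\<epsilon> \<in> {0<..}"
      then have \<epsilon>: "\<epsilon> > 0" by simp
      show "dm_embed (growth_class (\<lambda>n. real (cover_number S f \<epsilon> n))) \<le> dm_embed (growth_class (\<lambda>n. real n ^ ?L))"
        unfolding dm_embed_le_iff growth_class_le_iff[OF seq[OF \<epsilon>] power_in_growth_seqs] growth_le_def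
        by (rule cover_upper[OF \<epsilon>])
    qed
    \<comment> \<open>The single scale \<open>\<epsilon>0\<close> already attains the
      supremum.\<close>
    have "growth_le (\<lambda>n. real n ^ ?L) (\<lambda>n. real (cover_number S f \<epsilon>0 n))"
      unfolding growth_le_def
      by (rule exI[of _ "1 / K0"]) (use low in \<open>simp add: field_simps\<close>)
    then have "dm_embed (growth_class (\<lambda>n. real n ^ ?L)) \<le> dm_embed (growth_class (\<lambda>n. real (cover_number S f \<epsilon>0 n)))"
      unfolding dm_embed_le_iff growth_class_le_iff[OF power_in_growth_seqs seq[OF low(1)]] .
    also have "\<dots> \<le> gen_entropy S f"
      unfolding gen_entropy_def by (rule SUP_upper) (use low(1) in simp)
    finally show "dm_embed (growth_class (\<lambda>n. real n ^ ?L)) \<le> gen_entropy S f" .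
  qed
  define h where "h = (\<lambda>\<epsilon>. limsup (\<lambda>n. ereal (ln (real (cover_number S f \<epsilon> n)) / ln (real n))))"
  \<comment> \<open>The upper bound holds at every scale and the lower bound persists below
    \<open>\<epsilon>0\<close>, so the upper limit is constant for small \<epsilon>.\<close>
  have h: "h \<epsilon> = ereal (real ?L)" if \<epsilon>: "0 < \<epsilon>" "\<epsilon> \<le> \<epsilon>0" for \<epsilon>
  proof -
    obtain K where K: "K > 0" "\<forall>n\<ge>1. real (cover_number S f \<epsilon> n) \<le> K * real n ^ ?L"
      using cover_upper[OF \<epsilon>(1)] by blast
    have "(\<lambda>n. ln (real (cover_number S f \<epsilon> n)) / ln (real n)) \<longlonglongrightarrow> real ?L"
    proof (rule tendsto_sandwich[OF _ _ ln_power_ratio_tendsto[OF low(2)] ln_power_ratio_tendsto[OF K(1)]])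
      show "\<forall>\<^sub>F n in sequentially. ln (K0 * real n ^ ?L) / ln (real n) \<le> ln (real (cover_number S f \<epsilon> n)) / ln (real n)"
        using eventually_gt_at_top[of 1]
      proof eventually_elim
        case (elim n)
        have "cover_number S f \<epsilon>0 n \<le> cover_number S f \<epsilon> n"
          using cover_number_mono[OF base.compact_S cont_f _ order_refl \<epsilon>] elim by simp
        then have "K0 * real n ^ ?L \<le> real (cover_number S f \<epsilon> n)" using low(3) elim by (meson less_imp_le of_nat_mono order_trans)
        moreover have "0 < K0 * real n ^ ?L" using low(2) elim by simp
        ultimately show ?case using elim by (intro divide_right_mono) auto
      qed
      show "\<forall>\<^sub>F n in sequentially. ln (real (cover_number S f \<epsilon> n)) / ln (real n) \<le> ln (K * real n ^ ?L) / ln (real n)"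
        using eventually_gt_at_top[of 1]
      proof eventually_elim
        case (elim n)
        have "0 < real (cover_number S f \<epsilon> n)" using cover_positive[of n \<epsilon>] elim \<epsilon>(1) by simp
        moreover have "real (cover_number S f \<epsilon> n) \<le> K * real n ^ ?L" using K(2) elim by simp
        ultimately show ?case using elim by (intro divide_right_mono) auto
      qed
    qed
    then have "(\<lambda>n. ereal (ln (real (cover_number S f \<epsilon> n)) / ln (real n))) \<longlonglongrightarrow> ereal (real ?L)" by simp
    from lim_imp_Limsup[OF _ this] show ?thesis unfolding h_def by simp
  qed
  have "\<forall>\<^sub>F \<epsilon> in at_right 0. h \<epsilon> = ereal (real ?L)"
    unfolding eventually_at_right_field using h low(1) by (intro exI[of _ \<epsilon>0]) auto
  then have "(h \<longlongrightarrow> ereal (real ?L)) (at_right 0)" by (rule tendsto_eventually)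
  moreover have "(h \<longlongrightarrow> pol_entropy S f) (at_right 0)"
    using tendsto_pol_entropy[OF base.compact_S cont_f] unfolding h_def .
  ultimately show "pol_entropy S f = ereal (real ?L)"
    using tendsto_unique trivial_limit_at_right_real by blast
qed

end

theorem theorem1:
  fixes S :: "'a::metric_space set" and A :: "'a chart set" and f :: "'a \<Rightarrow> 'a"
  assumes "compact_surface S A"
    and "morse_smale S A f"
  shows "gen_entropy S f = dm_embed (growth_class (\<lambda>n. real n ^ longest_path S f)) \<and>
         pol_entropy S f = ereal (real (longest_path S f))"
proof -
  interpret morse_smale_surface S A f using assms by unfold_locales
  show ?thesis using entropies by blast
qed

end
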